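(* Let $d\ge 2$, let $\widehat X$ be a non-degenerate stationary Poisson hyperplane process in $\mathbb{R}^d$ with intensity $\widehat\gamma>0$ and spherical directional distribution $\varphi$, and suppose that $\varphi$ is subspace-free. Let $X$ be the tessellation of $\mathbb{R}^d$ induced by $\widehat X$, and let $k\in\{1,\dots,d\}$. With respect to the incenter as center function, the distribution $\mathbb{Q}^{(k)}$ of the typical $k$-face $Z^{(k)}$ of $X$ is given by $$\mathbb{Q}^{(k)}(A)=\frac{2^{k+1}}{(k+1)!\,(d-k)!}\,\frac{\widehat\gamma^{\,d+1}}{\gamma^{(k)}}\int_{\mathsf{P}_k}\int_0^\infty e^{-2\widehat\gamma r\Phi(B(L_{\mathbf u}))}\;\mathbb{P}\left(\bigcap_{H\in\widehat X\setminus[B^o(L_{\mathbf u},o,r)]_{\mathcal H}}H_o^-\cap rT_k(\mathbf u)\in A\right)\mathrm{d}r\;D_k(\mathbf u)\,\varphi^{d+1}(\mathrm{d}\mathbf u)$$ for every Borel set $A\in\mathcal{B}(\mathcal{K})$.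
   Context: Notation. $\mathbb{R}^d$ ($d\ge2$) has origin $o$, scalar product $\langle\cdot,\cdot\rangle$, norm $\|\cdot\|$; $S^{d-1}$ is the unit sphere and $\lambda_d$ is Lebesgue measure. $\mathcal H$ is the space of hyperplanes in $\mathbb{R}^d$ with its usual topology. Write $H(u,\tau)=\{x:\langle x,u\rangle=\tau\}$ and $H^-(u,\tau)=\{x:\langle x,u\rangle\le\tau\}$ for $u\in S^{d-1}$, $\tau\in\mathbb{R}$. For a hyperplane $H$ and a point $x\notin H$, $H_x^-$ is the closed halfspace bounded by $H$ that contains $x$. For $K\subset\mathbb{R}^d$, $[K]_{\mathcal H}=\{H\in\mathcal H:H\cap K\ne\emptyset\}$. $\mathcal K$ is the space of convex bodies (nonempty compact convex subsets of $\mathbb{R}^d$) with the Hausdorff metric, $\mathcal B(T)$ is the Borel $\sigma$-algebra of a topological space $T$, and $\mathcal P_k\subset\mathcal K$ is the set of $k$-dimensional polytopes. Hyperplane process. $\widehat X$ is a stationary Poisson hyperplane process on a probability space with probability $\mathbb P$ and expectation $\mathbb E$. Its intensity measure $\widehat\Theta=\mathbb{E}\widehat X$ satisfies $$\int_{\mathcal H}f\,\mathrm d\widehat\Theta=\widehat\gamma\int_{S^{d-1}}\int_{-\infty}^\infty f(H(u,\tau))\,\mathrm d\tau\,\varphi(\mathrm du)$$ for all nonnegative measurable $f$, with intensity $\widehat\gamma\in(0,\infty)$ and an even Borel probability measure $\varphi$ on $S^{d-1}$, the spherical directional distribution. Non-degenerate means that $\varphi$ is not concentrated on a great subsphere. A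 measure on $S^{d-1}$ is subspace-free if it is zero on each great subsphere (intersection of $S^{d-1}$ with a $(d-1)$-dimensional linear subspace). A simple counting measure is identified with its support, so $\widehat X$ is also treated as a (random, locally finite) set of hyperplanes. The hitting functional is $\Phi(K)=\int_{S^{d-1}}h(K,u)\,\varphi(\mathrm du)$ for $K\in\mathcal K$, where $h(K,u)=\max\{\langle x,u\rangle:x\in K\}$. Typical $k$-face. $\widehat X$ induces a tessellation $X$ of $\mathbb{R}^d$ into convex polytopes (cells); $X^{(k)}$ is the stationary particle process of the $k$-dimensional faces of the cells (each face counted once). The incenter $c(K)$ of a $k$-dimensional convex body $K$ with a unique largest inscribed $k$-dimensional ball (inball) is the center of that ball; if $\varphi$ is subspace-free, almost surely all $k$-faces of $X$ have a unique inball. The intensity $\gamma^{(k)}\in(0,\infty)$ of $X^{(k)}$ and the probability distribution $\mathbb{Q}^{(k)}$ of the typical $k$-face $Z^{(k)}$ (with respect to the incenter) are determined by $$\gamma^{(k)}\mathbb{Q}^{(k)}(A)=\mathbb{E}\sum_{K\in X^{(k)}}\mathbf 1_A(K-c(K))\,\mathbf 1_B(c(K)),$$ for Borel sets $A$ of convex bodies and any $B\in\mathcal B(\mathbb{R}^d)$ with $\lambda_d(B)=1$. Quantities depending on $\mathbf u$. A $(d+1)$-tuple $\mathbf u=(u_1,\dots,u_{d+1})$ of unit vectors is in general position if any $d$ of them are linearly independent. For such $\mathbf u$ let $L_{\mathbf u}=(\mathrm{lin}\{u_{k+2},\dots,u_{d+1}\})^\perp$, a $k$-dimensional linear subspace ($L_{\mathbf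 u}=\mathbb{R}^d$ if $k=d$), and let $v_j=u_j|L_{\mathbf u}$ be the orthogonal projection of $u_j$ to $L_{\mathbf u}$, $j=1,\dots,k+1$ ($v_j=u_j$ if $k=d$). $\mathsf P_k\subset(S^{d-1})^{d+1}$ is the set of all $\mathbf u$ in general position such that $v_1,\dots,v_{k+1}$ positively span $L_{\mathbf u}$ (i.e. every vector of $L_{\mathbf u}$ is a nonnegative linear combination of them). $D_k(\mathbf u)$ is the absolute value of the determinant of the $(d+1)\times(d+1)$ matrix whose $j$-th row is $(\langle u_j,e_1\rangle,\dots,\langle u_j,e_d\rangle,\|u_j|L_{\mathbf u}\|)$ for $j=1,\dots,k+1$ and $(\langle u_j,e_1\rangle,\dots,\langle u_j,e_d\rangle,0)$ for $j=k+2,\dots,d+1$, where $(e_1,\dots,e_d)$ is an orthonormal basis of $\mathbb{R}^d$. $T_k(\mathbf u)=L_{\mathbf u}\cap\bigcap_{i=1}^{k+1}H^-(u_i,\|u_i|L_{\mathbf u}\|)$, a $k$-simplex in $L_{\mathbf u}$ with incenter $o$ and inradius $1$. $B(L_{\mathbf u})$ is the closed $k$-dimensional unit ball in $L_{\mathbf u}$ with center $o$, and $B^o(L_{\mathbf u},o,r)$ is the relative interior of the $k$-dimensional ball in $L_{\mathbf u}$ with center $o$ and radius $r$. *)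

theory Defs
  imports "HOL-Probability.Probability" "Jordan_Normal_Form.Determinant"
begin

definition borel_algebra :: "'a topology \<Rightarrow> 'a measure" where
  "borel_algebra T = sigma (topspace T) {U. openin T U}"

definition hyperplane :: "'a::euclidean_space \<Rightarrow> real \<Rightarrow> 'a set" where
  "hyperplane u t = {x. inner x u = t}"

definition halfspace :: "'a::euclidean_space \<Rightarrow> real \<Rightarrow> 'a set" where
  "halfspace u t = {x. inner x u \<le> t}"

definition hyperplanes :: "'a::euclidean_space set set" where
  "hyperplanes = {hyperplane u t |u t. norm u = 1}"

definition halfspace_at :: "'a::euclidean_space set \<Rightarrow> 'a \<Rightarrow> 'a set" where
  "halfspace_at H x =
     (THE S. x \<in> S \<and> (\<exists>u t. norm u = 1 \<and> H = hyperplane u t \<and> S = halfspace u t))"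

definition hitting :: "'a::euclidean_space set \<Rightarrow> 'a set set" where
  "hitting K = {H \<in> hyperplanes. H \<inter> K \<noteq> {}}"

text \<open>The usual topology on hyperplanes is the final topology with respect to the
  parametrization \<^term>\<open>\<lambda>(u, t). hyperplane u t\<close> on (unit sphere) \<open>\<times>\<close> (real line).\<close>

definition openin_hyperplanes :: "'a::euclidean_space set set \<Rightarrow> bool" where
  "openin_hyperplanes U \<longleftrightarrow> U \<subseteq> hyperplanes \<and>
     openin (top_of_set (sphere 0 1 \<times> UNIV)) {(u, t). norm u = 1 \<and> hyperplane u t \<in> U}"

definition hyperplane_topology :: "'a::euclidean_space set topology" where
  "hyperplane_topology = topology openin_hyperplanes"

definition hyperplane_borel :: "'a::euclidean_space set measure" where
  "hyperplane_borel = borel_algebra hyperplane_topology"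

lemma istopology_openin_hyperplanes: "istopology openin_hyperplanes"
  unfolding istopology_def
proof (intro conjI allI impI)
  fix S T :: "'a set set"
  assume S: "openin_hyperplanes S" and T: "openin_hyperplanes T"
  have "{(u, t). norm u = 1 \<and> hyperplane u t \<in> S \<inter> T} =
      {(u, t). norm u = 1 \<and> hyperplane u t \<in> S} \<inter> {(u, t). norm u = 1 \<and> hyperplane u t \<in> T}"
    by auto
  with S T show "openin_hyperplanes (S \<inter> T)"
    unfolding openin_hyperplanes_def by (auto intro!: openin_Int)
next
  fix \<K> :: "'a set set set"
  assume K: "\<forall>K\<in>\<K>. openin_hyperplanes K"
  have "{(u, t). norm u = 1 \<and> hyperplane u t \<in> \<Union>\<K>} =
      \<Union> ((\<lambda>S. {(u, t). norm u = 1 \<and> hyperplane u t \<in> S}) ` \<K>)"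
    by auto
  with K show "openin_hyperplanes (\<Union>\<K>)"
    unfolding openin_hyperplanes_def by (auto intro!: openin_Union)
qed

lemma openin_hyperplane_topology: "openin hyperplane_topology U \<longleftrightarrow> openin_hyperplanes U"
  by (simp add: hyperplane_topology_def topology_inverse' istopology_openin_hyperplanes)

lemma topspace_hyperplane_topology: "topspace hyperplane_topology = hyperplanes"
proof
  show "topspace hyperplane_topology \<subseteq> (hyperplanes :: 'a set set)"
    unfolding topspace_def openin_hyperplane_topology openin_hyperplanes_def by auto
  have "{(u::'a, t). norm u = 1 \<and> hyperplane u t \<in> hyperplanes} = sphere 0 1 \<times> UNIV"
    by (auto simp: hyperplanes_def)
  then have "openin_hyperplanes (hyperplanes :: 'a set set)"
    unfolding openin_hyperplanes_def by (metis openin_subtopology_self order_refl)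
  then show "(hyperplanes :: 'a set set) \<subseteq> topspace hyperplane_topology"
    using openin_hyperplane_topology openin_subset by blast
qed

lemma space_hyperplane_borel: "space hyperplane_borel = hyperplanes"
  by (simp add: hyperplane_borel_def borel_algebra_def topspace_hyperplane_topology space_measure_of_conv)

definition convex_bodies :: "'a::euclidean_space set set" where
  "convex_bodies = {K. K \<noteq> {} \<and> compact K \<and> convex K}"

text \<open>The value outside \<^const>\<open>convex_bodies\<close> is only chosen so that the locale
  \<^locale>\<open>Metric_space\<close> applies, which requires nonnegativity everywhere.\<close>

definition hausdorff_dist :: "'a::euclidean_space set \<Rightarrow> 'a set \<Rightarrow> real" where
  "hausdorff_dist K L =
     (if K \<in> convex_bodies \<and> L \<in> convex_bodies
      then max (SUP x\<in>K. infdist x L) (SUP y\<in>L. infdist y K) else 0)"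

definition body_borel :: "'a::euclidean_space set measure" where
  "body_borel = borel_algebra (Metric_space.mtopology convex_bodies hausdorff_dist)"

lemma hausdorff_dist_commute: "hausdorff_dist K L = hausdorff_dist L K"
  by (auto simp: hausdorff_dist_def max.commute)

lemma infdist_le_hausdorff_dist:
  fixes K L :: "'a::euclidean_space set"
  assumes "K \<in> convex_bodies" "L \<in> convex_bodies" "x \<in> K"
  shows "infdist x L \<le> hausdorff_dist K L"
proof -
  have "bdd_above ((\<lambda>x. infdist x L) ` K)"
    using assms by (intro bounded_imp_bdd_above compact_imp_bounded compact_continuous_image
        continuous_intros) (auto simp: convex_bodies_def)
  then have "infdist x L \<le> (SUP x\<in>K. infdist x L)"
    using assms by (intro cSUP_upper)
  then show ?thesis
    using assms unfolding hausdorff_dist_def by auto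
qed

lemma hausdorff_dist_le:
  fixes K L :: "'a::euclidean_space set"
  assumes "K \<in> convex_bodies" "L \<in> convex_bodies"
    and "\<And>x. x \<in> K \<Longrightarrow> infdist x L \<le> b" "\<And>y. y \<in> L \<Longrightarrow> infdist y K \<le> b"
  shows "hausdorff_dist K L \<le> b"
proof -
  have "(SUP x\<in>K. infdist x L) \<le> b" "(SUP y\<in>L. infdist y K) \<le> b"
    using assms by (auto intro!: cSUP_least simp: convex_bodies_def)
  then show ?thesis
    using assms unfolding hausdorff_dist_def by auto
qed

lemma Metric_space_hausdorff_dist:
  "Metric_space (convex_bodies :: 'a::euclidean_space set set) hausdorff_dist"
proof
  fix K L :: "'a set"
  show "hausdorff_dist K L = hausdorff_dist L K"
    by (rule hausdorff_dist_commute)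
  show "0 \<le> hausdorff_dist K L"
  proof (cases "K \<in> convex_bodies \<and> L \<in> convex_bodies")
    case True
    then obtain x where "x \<in> K" by (auto simp: convex_bodies_def)
    then show ?thesis
      using True infdist_le_hausdorff_dist[of K L x] infdist_nonneg[of x L] by simp
  qed (auto simp: hausdorff_dist_def)
next
  fix K L :: "'a set"
  assume KL: "K \<in> convex_bodies" "L \<in> convex_bodies"
  show "hausdorff_dist K L = 0 \<longleftrightarrow> K = L"
  proof
    assume 0: "hausdorff_dist K L = 0"
    have sub: "A \<subseteq> B" if AB: "A \<in> convex_bodies" "B \<in> convex_bodies" "hausdorff_dist A B = 0"
      for A B :: "'a set"
    proof
      fix x assume "x \<in> A"
      then have "infdist x B = 0"
        using infdist_le_hausdorff_dist[of A B x] AB infdist_nonneg[of x B] by simp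
      moreover have "closed B" "B \<noteq> {}"
        using AB by (auto simp: convex_bodies_def compact_imp_closed)
      ultimately show "x \<in> B"
        by (simp add: in_closed_iff_infdist_zero)
    qed
    show "K = L"
      using sub[OF KL 0] sub[OF KL(2,1)] 0 by (simp add: hausdorff_dist_commute subset_antisym)
  next
    assume "K = L"
    moreover obtain x where "x \<in> K" using KL by (auto simp: convex_bodies_def)
    ultimately show "hausdorff_dist K L = 0"
      using hausdorff_dist_le[OF KL, of 0] infdist_le_hausdorff_dist[OF KL \<open>x \<in> K\<close>]
        infdist_nonneg[of x L] by simp
  qed
next
  fix K L N :: "'a set"
  assume KLN: "K \<in> convex_bodies" "L \<in> convex_bodies" "N \<in> convex_bodies"
  have tri: "infdist x C \<le> hausdorff_dist A B + hausdorff_dist B C"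
    if ABC: "A \<in> convex_bodies" "B \<in> convex_bodies" "C \<in> convex_bodies" and "x \<in> A"
    for A B C :: "'a set" and x
  proof -
    obtain y where y: "y \<in> B" "infdist x B = dist x y"
      using infdist_attains_inf[of B x] ABC by (auto simp: convex_bodies_def compact_imp_closed)
    have "infdist x C \<le> infdist y C + dist x y" by (rule infdist_triangle)
    also have "\<dots> \<le> hausdorff_dist B C + hausdorff_dist A B"
      using infdist_le_hausdorff_dist[of B C y] infdist_le_hausdorff_dist[of A B x] ABC y \<open>x \<in> A\<close>
      by simp
    finally show ?thesis by simp
  qed
  show "hausdorff_dist K N \<le> hausdorff_dist K L + hausdorff_dist L N"
    using tri[OF KLN] tri[OF KLN(3,2,1)]
    by (intro hausdorff_dist_le KLN) (auto simp: hausdorff_dist_commute add.commute)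
qed

lemma space_body_borel: "space body_borel = convex_bodies"
  by (simp add: body_borel_def borel_algebra_def space_measure_of_conv
      Metric_space.topspace_mtopology[OF Metric_space_hausdorff_dist])

text \<open>A simple counting measure is identified with its support \<open>S\<close>; then
  \<open>num_in S B\<close> is the mass of \<open>B\<close>.\<close>

definition num_in :: "'b set \<Rightarrow> 'b set \<Rightarrow> ennreal" where
  "num_in S B = emeasure (count_space UNIV) (S \<inter> B)"

definition hyperplane_configs :: "'a::euclidean_space set set set" where
  "hyperplane_configs =
     {S. S \<subseteq> hyperplanes \<and> (\<forall>C. compact C \<longrightarrow> finite (S \<inter> hitting C))}"

text \<open>The smallest \<open>\<sigma>\<close>-algebra making all counting maps measurable.\<close>

definition config_space :: "'a::euclidean_space set set measure" where
  "config_space = sigma hyperplane_configs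
     {{S \<in> hyperplane_configs. num_in S B \<in> C} |B C. B \<in> sets hyperplane_borel \<and> C \<in> sets borel}"

definition intensity_measure ::
    "'w measure \<Rightarrow> ('w \<Rightarrow> 'a::euclidean_space set set) \<Rightarrow> 'a set measure" where
  "intensity_measure M X = measure_of hyperplanes (sets hyperplane_borel)
     (\<lambda>B. \<integral>\<^sup>+\<omega>. num_in (X \<omega>) B \<partial>M)"

lemma measurable_num_in:
  assumes "X \<in> M \<rightarrow>\<^sub>M config_space" "B \<in> sets hyperplane_borel"
  shows "(\<lambda>\<omega>. num_in (X \<omega>) B) \<in> borel_measurable M"
proof -
  have "(\<lambda>S. num_in S B) \<in> borel_measurable config_space"
  proof (rule measurableI)
    fix C :: "ennreal set" assume "C \<in> sets borel"
    then have "{S \<in> hyperplane_configs. num_in S B \<in> C} \<in> sets config_space"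
      unfolding config_space_def using assms(2) by (subst sets_measure_of) (auto intro!: sigma_sets.Basic)
    also have "{S \<in> hyperplane_configs. num_in S B \<in> C} = (\<lambda>S. num_in S B) -` C \<inter> space config_space"
      by (auto simp: config_space_def space_measure_of_conv)
    finally show "(\<lambda>S. num_in S B) -` C \<inter> space config_space \<in> sets config_space" .
  qed simp
  then show ?thesis using assms(1) by (rule measurable_compose[rotated])
qed

lemma emeasure_intensity_measure:
  fixes X :: "'w \<Rightarrow> 'a::euclidean_space set set"
  assumes X: "X \<in> M \<rightarrow>\<^sub>M config_space" and B: "B \<in> sets hyperplane_borel"
  shows "emeasure (intensity_measure M X) B = (\<integral>\<^sup>+\<omega>. num_in (X \<omega>) B \<partial>M)"
proof -
  have "countably_additive (sets (hyperplane_borel :: 'a set measure))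
      (\<lambda>B. \<integral>\<^sup>+\<omega>. num_in (X \<omega>) B \<partial>M)"
  proof (rule countably_additiveI)
    fix A :: "nat \<Rightarrow> 'a set set"
    assume A: "range A \<subseteq> sets hyperplane_borel" "disjoint_family A"
    have "(\<Sum>i. num_in (X \<omega>) (A i)) = num_in (X \<omega>) (\<Union>i. A i)" for \<omega>
      unfolding num_in_def using A(2)
      by (subst suminf_emeasure) (auto simp: disjoint_family_on_def intro!: arg_cong2[where f=emeasure])
    then show "(\<Sum>i. \<integral>\<^sup>+\<omega>. num_in (X \<omega>) (A i) \<partial>M) = (\<integral>\<^sup>+\<omega>. num_in (X \<omega>) (\<Union>i. A i) \<partial>M)"
      using A(1) by (subst nn_integral_suminf[symmetric]) (auto intro!: measurable_num_in[OF X])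
  qed
  moreover have "positive (sets (hyperplane_borel :: 'a set measure))
      (\<lambda>B. \<integral>\<^sup>+\<omega>. num_in (X \<omega>) B \<partial>M)"
    by (simp add: positive_def num_in_def)
  moreover have "sigma_algebra hyperplanes (sets (hyperplane_borel :: 'a set measure))"
    using sets.sigma_algebra_axioms[of "hyperplane_borel :: 'a set measure"]
    by (simp add: space_hyperplane_borel)
  ultimately show ?thesis
    unfolding intensity_measure_def using B by (intro emeasure_measure_of_sigma)
qed

definition poisson_hyperplane_process ::
    "'w measure \<Rightarrow> ('w \<Rightarrow> 'a::euclidean_space set set) \<Rightarrow> bool" where
  "poisson_hyperplane_process M X \<longleftrightarrow>
     X \<in> M \<rightarrow>\<^sub>M config_space \<and>
     (\<forall>C. compact C \<longrightarrow> emeasure (intensity_measure M X) (hitting C) < \<infinity>) \<and>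
     (\<forall>B\<in>sets hyperplane_borel. emeasure (intensity_measure M X) B < \<infinity> \<longrightarrow>
        (\<forall>n::nat. \<P>(\<omega> in M. num_in (X \<omega>) B = of_nat n) =
           measure (intensity_measure M X) B ^ n / fact n * exp (- measure (intensity_measure M X) B))) \<and>
     (\<forall>I::nat set. \<forall>B. finite I \<longrightarrow> B ` I \<subseteq> sets hyperplane_borel \<longrightarrow> disjoint_family_on B I \<longrightarrow>
        prob_space.indep_vars M (\<lambda>_. borel) (\<lambda>i \<omega>. num_in (X \<omega>) (B i)) I)"

definition stationary_process ::
    "'w measure \<Rightarrow> ('w \<Rightarrow> 'a::euclidean_space set set) \<Rightarrow> bool" where
  "stationary_process M X \<longleftrightarrow>
     (\<forall>t. distr M config_space (\<lambda>\<omega>. (\<lambda>H. (+) t ` H) ` X \<omega>) = distr M config_space X)"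

definition even_prob_on_sphere :: "'a::euclidean_space measure \<Rightarrow> bool" where
  "even_prob_on_sphere \<phi> \<longleftrightarrow>
     prob_space \<phi> \<and> sets \<phi> = sets (restrict_space borel (sphere 0 1)) \<and>
     (\<forall>A\<in>sets \<phi>. emeasure \<phi> (uminus ` A) = emeasure \<phi> A)"

definition has_intensity_and_directional_distribution ::
    "'w measure \<Rightarrow> ('w \<Rightarrow> 'a::euclidean_space set set) \<Rightarrow> real \<Rightarrow> 'a measure \<Rightarrow> bool" where
  "has_intensity_and_directional_distribution M X \<gamma> \<phi> \<longleftrightarrow>
     0 < \<gamma> \<and> even_prob_on_sphere \<phi> \<and>
     (\<forall>f \<in> borel_measurable hyperplane_borel.
        (\<integral>\<^sup>+H. f H \<partial>intensity_measure M X) =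
        ennreal \<gamma> * (\<integral>\<^sup>+u. (\<integral>\<^sup>+t. f (hyperplane u t) \<partial>lborel) \<partial>\<phi>))"

definition great_subspheres :: "'a::euclidean_space set set" where
  "great_subspheres = {sphere 0 1 \<inter> L |L. subspace L \<and> dim L = DIM('a) - 1}"

definition non_degenerate :: "'a::euclidean_space measure \<Rightarrow> bool" where
  "non_degenerate \<phi> \<longleftrightarrow> (\<forall>G\<in>great_subspheres. emeasure \<phi> (sphere 0 1 - G) \<noteq> 0)"

definition subspace_free :: "'a::euclidean_space measure \<Rightarrow> bool" where
  "subspace_free \<phi> \<longleftrightarrow> (\<forall>G\<in>great_subspheres. emeasure \<phi> G = 0)"

definition support_function :: "'a::euclidean_space set \<Rightarrow> 'a \<Rightarrow> real" where
  "support_function K u = (SUP x\<in>K. inner x u)"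

definition hitting_functional :: "'a::euclidean_space measure \<Rightarrow> 'a set \<Rightarrow> real" where
  "hitting_functional \<phi> K = (\<integral>u. support_function K u \<partial>\<phi>)"

definition cells :: "'a::euclidean_space set set \<Rightarrow> 'a set set" where
  "cells S = closure ` components (- \<Union>S)"

definition faces :: "nat \<Rightarrow> 'a::euclidean_space set set \<Rightarrow> 'a set set" where
  "faces k S = {F. \<exists>C\<in>cells S. F face_of C \<and> aff_dim F = int k}"

definition inscribed_ball :: "'a::euclidean_space set \<Rightarrow> 'a \<Rightarrow> real \<Rightarrow> bool" where
  "inscribed_ball K x r \<longleftrightarrow> x \<in> affine hull K \<and> 0 \<le> r \<and> cball x r \<inter> affine hull K \<subseteq> K"

text \<open>Unspecified if there is no unique largest inscribed ball.\<close>

definition incenter :: "'a::euclidean_space set \<Rightarrow> 'a" where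
  "incenter K =
     (THE x. \<exists>r. inscribed_ball K x r \<and> (\<forall>y s. inscribed_ball K y s \<longrightarrow> s \<le> r))"

text \<open>The intensity \<open>\<gamma>k\<close> of the faces and the distribution \<open>Q\<close> of the typical face are
  jointly characterized: with \<open>A\<close> the whole space the equation gives \<open>\<gamma>k\<close>, and then \<open>Q\<close>.\<close>

definition is_typical_face_distribution ::
    "'w measure \<Rightarrow> ('w \<Rightarrow> 'a::euclidean_space set set) \<Rightarrow> nat \<Rightarrow> real \<Rightarrow> 'a set measure \<Rightarrow> bool" where
  "is_typical_face_distribution M X k \<gamma>k Q \<longleftrightarrow>
     0 < \<gamma>k \<and> prob_space Q \<and> sets Q = sets body_borel \<and>
     (\<forall>A\<in>sets body_borel. \<forall>B\<in>sets lborel. emeasure lborel B = 1 \<longrightarrow>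
        ennreal \<gamma>k * emeasure Q A =
        (\<integral>\<^sup>+\<omega>. (\<integral>\<^sup>+K. indicator A ((\<lambda>x. x - incenter K) ` K) * indicator B (incenter K)
            \<partial>count_space (faces k (X \<omega>))) \<partial>M))"

definition orth_proj :: "'a::euclidean_space set \<Rightarrow> 'a \<Rightarrow> 'a" where
  "orth_proj L x = (THE y. y \<in> L \<and> (\<forall>z\<in>L. inner (x - y) z = 0))"

definition general_position :: "(nat \<Rightarrow> 'a::euclidean_space) \<Rightarrow> bool" where
  "general_position u \<longleftrightarrow>
     (\<forall>I \<subseteq> {1..DIM('a) + 1}. card I = DIM('a) \<longrightarrow> inj_on u I \<and> independent (u ` I))"

definition L_space :: "nat \<Rightarrow> (nat \<Rightarrow> 'a::euclidean_space) \<Rightarrow> 'a set" where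
  "L_space k u = orthogonal_comp (span (u ` {k + 2..DIM('a) + 1}))"

definition P_set :: "nat \<Rightarrow> (nat \<Rightarrow> 'a::euclidean_space) set" where
  "P_set k = {u \<in> {1..DIM('a) + 1} \<rightarrow>\<^sub>E sphere 0 1. general_position u \<and>
     (\<forall>x\<in>L_space k u. \<exists>c. (\<forall>j\<in>{1..k + 1}. 0 \<le> c j) \<and>
        x = (\<Sum>j = 1..k + 1. c j *\<^sub>R orth_proj (L_space k u) (u j)))}"

text \<open>Matrix indices start at 0, so row \<open>i\<close> belongs to \<open>u (i + 1)\<close>. The orthonormal basis is an
  enumeration of \<^const>\<open>Basis\<close>; the choice does not affect the absolute value.\<close>

definition D_fun :: "nat \<Rightarrow> (nat \<Rightarrow> 'a::euclidean_space) \<Rightarrow> real" where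
  "D_fun k u = \<bar>Determinant.det (Matrix.mat (DIM('a) + 1) (DIM('a) + 1) (\<lambda>(i, j).
     if j < DIM('a) then inner (u (i + 1)) (from_nat_into Basis j)
     else if i < k + 1 then norm (orth_proj (L_space k u) (u (i + 1))) else 0))\<bar>"

definition T_simplex :: "nat \<Rightarrow> (nat \<Rightarrow> 'a::euclidean_space) \<Rightarrow> 'a set" where
  "T_simplex k u =
     L_space k u \<inter> (\<Inter>i\<in>{1..k + 1}. halfspace (u i) (norm (orth_proj (L_space k u) (u i))))"

definition rel_open_ball :: "'a::euclidean_space set \<Rightarrow> real \<Rightarrow> 'a set" where
  "rel_open_ball L r = rel_interior (cball 0 r \<inter> L)"

end

theory Submission
  imports Defs
begin

text \<open>A bounded \<open>k\<close>-face lies, almost surely, in exactly \<open>d - k\<close> of the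
  hyperplanes, and exactly \<open>k + 1\<close> further hyperplanes touch its inball. The multivariate Mecke
  formula turns the sum over all \<open>(d + 1)\<close>-tuples of hyperplanes, each given by one of its two
  unit normals \<open>u\<close> and a level \<open>t\<close>, into an integral over \<open>(u\<^sub>1,
  t\<^sub>1), \<dots>, (u\<^sub>d\<^sub>+\<^sub>1, t\<^sub>d\<^sub>+\<^sub>1)\<close>. For fixed normals the
  linear substitution from the levels to the incenter \<open>z\<close> and the inradius \<open>r\<close> has
  Jacobian \<open>D_fun k u\<close>, and stationarity moves \<open>z\<close> to the origin. The hyperplanes
  hitting the open ball are independent of the others: that there are none has the exponential probability,
  and the others cut the translated face out of \<open>r\<close> times the simplex. Each such face arises from
  \<open>(k + 1)! (d - k)! 2\<^sup>d\<^sup>-\<^sup>k\<close> tuples, which accounts for the constant.\<close>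

section \<open>Hyperplanes and their parametrization\<close>

text \<open>Hyperplanes enter as signed pairs (u, t), so each is counted twice and (d + 1)-tuples
  carry the factor (2 \<gamma>)^(d+1). A touching hyperplane must have its normal pointing away from
  the ball, which leaves one of its two pairs; a hyperplane through the face keeps both. Hence
  2^(d+1) is divided by 2^(d-k) only, and 2^(k+1) survives. The process is given through Poisson
  counts and their independence on disjoint sets. Statements about whole configurations, namely the
  Mecke formula and the independence of the hyperplanes missing the ball, are therefore compared on
  void events, which generate the sigma-algebra because configurations are simple. The number of
  tuples per face is exact once only k + 1 hyperplanes touch the inball and the normals are in
  general position; both hold almost surely by the Mecke formula itself, the latter because \<phi>
  is subspace-free. Unbounded faces drop out because the sets A contain only convex bodies, so such
  faces have weight zero.\<close>

lemma measurable_fst_borel[measurable]: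
  "(fst :: 'a::second_countable_topology \<times> 'b::second_countable_topology \<Rightarrow> 'a) \<in> borel_measurable borel"
  by (intro borel_measurable_continuous_onI continuous_intros)

lemma measurable_snd_borel[measurable]:
  "(snd :: 'a::second_countable_topology \<times> 'b::second_countable_topology \<Rightarrow> 'b) \<in> borel_measurable borel"
  by (intro borel_measurable_continuous_onI continuous_intros)

lemma hyperplane_uminus: "hyperplane (- u) (- t) = hyperplane u t"
  by (auto simp: hyperplane_def)

lemma hyperplane_eq_iff:
  fixes u v :: "'a::euclidean_space"
  assumes "norm u = 1" "norm v = 1"
  shows "hyperplane u s = hyperplane v t \<longleftrightarrow> v = u \<and> t = s \<or> v = - u \<and> t = - s"
proof
  assume eq: "hyperplane u s = hyperplane v t"
  have uu: "inner u u = 1" "inner v v = 1"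
    using assms by (simp_all add: dot_square_norm)
  have in1: "inner (s *\<^sub>R u + y) v = t" if "inner y u = 0" for y
  proof -
    have "s *\<^sub>R u + y \<in> hyperplane u s"
      using that uu by (simp add: hyperplane_def inner_add_left)
    then show ?thesis unfolding eq by (simp add: hyperplane_def)
  qed
  have t: "t = s * inner u v"
    using in1[of 0] by simp
  \<comment> \<open>The part of v orthogonal to u. Testing the foot point
    \<open>s *\<^sub>R u\<close> and its translate by w shows that w is also orthogonal to v, hence
    zero.\<close>
  define w where "w = v - inner u v *\<^sub>R u"
  have "inner w u = 0"
    using uu by (simp add: w_def inner_diff_left inner_commute[of v u])
  then have "inner w v = 0"
    using in1[of w] t by (simp add: inner_add_left)
  then have "inner w w = 0"
    using \<open>inner w u = 0\<close> by (metis diff_0_right inner_diff_right inner_scaleR_right mult_zero_right w_def)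
  then have "w = 0" by simp
  then have v: "v = inner u v *\<^sub>R u"
    unfolding w_def by (rule eq_iff_diff_eq_0[THEN iffD2])
  then have "\<bar>inner u v\<bar> = 1"
    using assms by (metis mult.right_neutral norm_scaleR)
  then consider "inner u v = 1" | "inner u v = - 1" by linarith
  then show "v = u \<and> t = s \<or> v = - u \<and> t = - s"
  proof cases
    case 1
    then show ?thesis using v t unfolding 1 by simp
  next
    case 2
    then show ?thesis using v t unfolding 2 by simp
  qed
qed (auto simp: hyperplane_uminus)

text \<open>Totalised so that it is measurable on the whole of \<open>'a \<times> real\<close>.\<close>

definition hyp :: "'a::euclidean_space \<times> real \<Rightarrow> 'a set" where
  "hyp p = (if norm (fst p) = 1 then hyperplane (fst p) (snd p)
            else hyperplane (SOME b. b \<in> Basis) 0)"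

lemma hyp_in_hyperplanes: "hyp p \<in> hyperplanes"
  by (auto simp: hyp_def hyperplanes_def)

lemma hyp_uminus: "hyp (- p) = hyp p"
  by (simp add: hyp_def hyperplane_uminus)

lemma hyp_eq_iff:
  assumes "norm (fst p) = 1" "norm (fst q) = 1"
  shows "hyp p = hyp q \<longleftrightarrow> q = p \<or> q = - p"
  using hyperplane_eq_iff[OF assms] assms
  by (auto simp: hyp_def prod_eq_iff)

text \<open>An arbitrary choice with no measurability of its own. Even functions of it are
  measurable by \<open>measurable_even_rep\<close>, and this is enough to build the measurable
  choice \<open>sec\<close>.\<close>

definition rep :: "'a::euclidean_space set \<Rightarrow> 'a \<times> real" where
  "rep H = (SOME p. norm (fst p) = 1 \<and> hyp p = H)"

lemma rep:
  assumes "H \<in> hyperplanes"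
  shows "norm (fst (rep H)) = 1" "hyp (rep H) = H"
proof -
  obtain u t where "norm u = 1" "H = hyperplane u t"
    using assms by (auto simp: hyperplanes_def)
  then have "\<exists>p. norm (fst p) = 1 \<and> hyp p = H"
    by (intro exI[of _ "(u, t)"]) (simp add: hyp_def)
  from someI_ex[OF this] show "norm (fst (rep H)) = 1" "hyp (rep H) = H"
    unfolding rep_def by auto
qed

lemma openin_imp_sets_hyperplane_borel: "openin_hyperplanes U \<Longrightarrow> U \<in> sets hyperplane_borel"
  unfolding hyperplane_borel_def borel_algebra_def
  by (subst sets_measure_of) (auto simp: openin_hyperplane_topology topspace_hyperplane_topology
      openin_hyperplanes_def intro!: sigma_sets.Basic)

text \<open>An even function does not see which of the two representatives was chosen, so on a
  hyperplane with parameters (u, t) it takes the value f (u, t). Preimages of open sets are then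
  open in the final topology.\<close>

lemma measurable_even_rep:
  fixes f :: "'a::euclidean_space \<times> real \<Rightarrow> 'b::topological_space"
  assumes f: "continuous_on UNIV f" and even: "\<And>p. f (- p) = f p"
  shows "(\<lambda>H. f (rep H)) \<in> borel_measurable hyperplane_borel"
proof (rule borel_measurableI)
  fix U :: "'b set" assume U: "open U"
  let ?V = "(\<lambda>H. f (rep H)) -` U \<inter> space hyperplane_borel"
  have rep_hyp: "f (rep (hyperplane u t)) = f (u, t)" if "norm u = 1" for u t
  proof -
    have H: "hyperplane u t \<in> hyperplanes" using that by (auto simp: hyperplanes_def)
    have "hyp (rep (hyperplane u t)) = hyp (u, t)"
      using rep[OF H] that by (simp add: hyp_def)
    then have "rep (hyperplane u t) = (u, t) \<or> rep (hyperplane u t) = - (u, t)"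
      using rep(1)[OF H] that by (metis fst_conv hyp_eq_iff)
    then show ?thesis using even by metis
  qed
  have "{(u, t). norm u = 1 \<and> hyperplane u t \<in> ?V} = (sphere 0 1 \<times> UNIV) \<inter> f -` U"
    using rep_hyp by (auto simp: space_hyperplane_borel hyperplanes_def)
  then have "openin_hyperplanes ?V"
    unfolding openin_hyperplanes_def
    using open_vimage[OF U f] by (auto simp: space_hyperplane_borel openin_open)
  then show "?V \<in> sets hyperplane_borel"
    by (rule openin_imp_sets_hyperplane_borel)
qed

text \<open>The absolute values keep the predicate unchanged under a change of sign of u, as
  \<open>measurable_even_rep\<close> demands.\<close>

definition first_coord :: "'a::euclidean_space \<Rightarrow> nat \<Rightarrow> bool" where
  "first_coord u i \<longleftrightarrow> \<bar>inner u (from_nat_into Basis i)\<bar> \<noteq> 0 \<and>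
     (\<forall>j<i. \<bar>inner u (from_nat_into Basis j)\<bar> = 0)"

text \<open>The representative whose first nonzero coordinate is positive.\<close>

definition sec :: "'a::euclidean_space set \<Rightarrow> 'a \<times> real" where
  "sec H = (\<Sum>i<DIM('a). if first_coord (fst (rep H)) i
     then (1 / \<bar>inner (fst (rep H)) (from_nat_into Basis i)\<bar>) *\<^sub>R
       (inner (fst (rep H)) (from_nat_into Basis i) *\<^sub>R rep H) else 0)"

lemma ex_first_coord:
  fixes u :: "'a::euclidean_space"
  assumes "u \<noteq> 0"
  shows "\<exists>i<DIM('a). first_coord u i"
proof -
  have "\<exists>b\<in>Basis. inner u b \<noteq> 0"
    using assms by (metis euclidean_all_zero_iff)
  then obtain j where j: "j < DIM('a)" "inner u (from_nat_into Basis j) \<noteq> 0"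
    using bij_betw_from_nat_into_finite[OF finite_Basis]
    unfolding bij_betw_def by (metis (no_types, lifting) imageE lessThan_iff)
  define i where "i = (LEAST j. inner u (from_nat_into Basis j) \<noteq> 0)"
  have "inner u (from_nat_into Basis i) \<noteq> 0" "i \<le> j"
    unfolding i_def using j LeastI[of "\<lambda>j. inner u (from_nat_into Basis j) \<noteq> 0" j]
    by (auto intro: Least_le)
  moreover have "inner u (from_nat_into Basis l) = 0" if "l < i" for l
    using not_less_Least[of l "\<lambda>j. inner u (from_nat_into Basis j) \<noteq> 0"] that i_def by auto
  ultimately show ?thesis using j by (auto simp: first_coord_def intro!: exI[of _ i])
qed

lemma first_coord_unique: "first_coord u i \<Longrightarrow> first_coord u j \<Longrightarrow> i = j"
  unfolding first_coord_def by (metis linorder_neqE_nat)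

lemma sec_eq_rep:
  assumes "H \<in> hyperplanes"
  shows "sec H = rep H \<or> sec H = - rep H"
proof -
  let ?p = "rep H"
  have "fst ?p \<noteq> 0" using rep[OF assms] by auto
  from ex_first_coord[OF this] obtain i where i: "i < DIM('a)" "first_coord (fst ?p) i"
    by (elim exE conjE)
  define c where "c = inner (fst ?p) (from_nat_into Basis i)"
  have "sec H = (\<Sum>j<DIM('a). if i = j then (1 / \<bar>c\<bar>) *\<^sub>R (c *\<^sub>R rep H) else 0)"
    unfolding sec_def
  by (smt (verit) sum.cong first_coord_unique i c_def)
  also have "\<dots> = (1 / \<bar>c\<bar> * c) *\<^sub>R rep H"
    using i(1) by simp
  finally have s: "sec H = (1 / \<bar>c\<bar> * c) *\<^sub>R rep H" .
  have "c \<noteq> 0" using i(2) by (simp add: first_coord_def c_def)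
  then have "1 / \<bar>c\<bar> * c = 1 \<or> 1 / \<bar>c\<bar> * c = - 1"
    by (auto simp: abs_if)
  then show ?thesis unfolding s by (metis scaleR_minus1_left scaleR_one)
qed

lemma sec:
  assumes "H \<in> hyperplanes"
  shows "norm (fst (sec H)) = 1" "hyp (sec H) = H"
  using sec_eq_rep[OF assms] rep[OF assms] hyp_uminus[of "rep H"]
  by (metis fst_uminus norm_minus_cancel)+

lemma sec_inj: "H \<in> hyperplanes \<Longrightarrow> H' \<in> hyperplanes \<Longrightarrow> sec H = sec H' \<longleftrightarrow> H = H'"
  by (metis sec(2))

text \<open>\<open>sec\<close> is assembled from even functions of the representative only: a
  coordinate of the normal times the representative itself keeps its value when both change
  sign.\<close>

lemma measurable_sec[measurable]: "sec \<in> borel_measurable hyperplane_borel"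
proof -
  have [measurable]: "(\<lambda>H. inner (fst (rep H)) b *\<^sub>R rep H) \<in> borel_measurable hyperplane_borel" for b :: 'a
    by (intro measurable_even_rep[where f="\<lambda>p. inner (fst p) b *\<^sub>R p"] continuous_intros) simp
  have [measurable]: "(\<lambda>H. \<bar>inner (fst (rep H)) b\<bar>) \<in> borel_measurable hyperplane_borel" for b :: 'a
    by (intro measurable_even_rep[where f="\<lambda>p. \<bar>inner (fst p) b\<bar>"] continuous_intros) simp
  show ?thesis
    unfolding sec_def first_coord_def by measurable
qed

lemma measurable_hyp[measurable]: "hyp \<in> borel \<rightarrow>\<^sub>M hyperplane_borel"
  unfolding hyperplane_borel_def borel_algebra_def
proof (rule measurable_measure_of)
  show "{U. openin hyperplane_topology U} \<subseteq> Pow (topspace (hyperplane_topology :: 'a set topology))"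
    using openin_subset by auto
  show "hyp \<in> space borel \<rightarrow> topspace hyperplane_topology"
    by (simp add: hyp_in_hyperplanes topspace_hyperplane_topology)
  fix U :: "'a set set" assume "U \<in> {U. openin hyperplane_topology U}"
  then have "openin (top_of_set (sphere 0 1 \<times> UNIV)) {(u, t). norm u = 1 \<and> hyperplane u t \<in> U}"
    by (simp add: openin_hyperplane_topology openin_hyperplanes_def)
  then obtain T where T: "open T" "{(u, t). norm u = 1 \<and> hyperplane u t \<in> U} = (sphere 0 1 \<times> UNIV) \<inter> T"
    by (auto simp: openin_open)
  have cl: "sphere 0 1 \<times> UNIV \<in> sets (borel :: ('a \<times> real) measure)"
    by (intro borel_closed closed_Times) auto
  let ?H = "hyperplane (SOME b. b \<in> (Basis::'a set)) 0"
  have "hyp -` U \<inter> space borel = (sphere 0 1 \<times> UNIV) \<inter> T \<union> (if ?H \<in> U then - (sphere 0 1 \<times> UNIV) else {})"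
    unfolding T(2)[symmetric] by (auto simp: hyp_def split: if_splits)
  also have "\<dots> \<in> sets borel"
  proof -
    have "(sphere 0 1 \<times> UNIV) \<inter> T \<in> sets borel" "- (sphere 0 1 \<times> UNIV) \<in> sets (borel :: ('a \<times> real) measure)"
      using T(1) cl by (auto simp del: Compl_Times_UNIV2)
    then show ?thesis by (simp del: Compl_Times_UNIV2 add: sets.Un)
  qed
  finally show "hyp -` U \<inter> space borel \<in> sets borel" .
qed

text \<open>B is the preimage of its set of unit representatives under the measurable section
  \<open>sec\<close>. Measurability of sets of hyperplanes thereby becomes a question about normals
  and levels.\<close>

lemma sets_hyperplane_borelI:
  assumes "B \<subseteq> hyperplanes" "{p. norm (fst p) = 1 \<and> hyp p \<in> B} \<in> sets borel"
  shows "B \<in> sets hyperplane_borel"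
proof -
  have "B = sec -` {p. norm (fst p) = 1 \<and> hyp p \<in> B} \<inter> space hyperplane_borel"
    using assms(1) by (auto simp: space_hyperplane_borel sec subset_eq)
  also have "\<dots> \<in> sets hyperplane_borel"
    using assms(2) by (rule measurable_sets[OF measurable_sec])
  finally show ?thesis .
qed

text \<open>Every hyperplane is \<open>hyp\<close> of its section, so a map may be examined in the
  parameters and then composed with the measurable map \<open>sec\<close>.\<close>

lemma measurable_via_sec:
  assumes "(\<lambda>(x, p). f x (hyp p)) \<in> N \<Otimes>\<^sub>M borel \<rightarrow>\<^sub>M L"
  shows "(\<lambda>(x, H). f x H) \<in> N \<Otimes>\<^sub>M hyperplane_borel \<rightarrow>\<^sub>M L"
proof -
  have "(\<lambda>(x, H). f x (hyp (sec H))) \<in> N \<Otimes>\<^sub>M hyperplane_borel \<rightarrow>\<^sub>M L"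
    using measurable_compose[OF _ assms, of "\<lambda>(x, H). (x, sec H)"] by (simp add: split_beta')
  then show ?thesis
    by (rule measurable_cong[THEN iffD1, rotated])
       (auto simp: space_pair_measure space_hyperplane_borel sec)
qed

text \<open>An exhaustion of the space of hyperplanes by sets that meet every configuration finitely
  often and have finite intensity. It carries all truncation and sigma-finiteness arguments.\<close>

definition rad_hit :: "nat \<Rightarrow> 'a::euclidean_space set set" where
  "rad_hit n = hitting (cball 0 (real n))"

lemma hyperplane_meets_cball:
  assumes "norm u = 1" "0 \<le> r"
  shows "hyperplane u t \<inter> cball 0 r \<noteq> {} \<longleftrightarrow> \<bar>t\<bar> \<le> r"
proof
  assume "hyperplane u t \<inter> cball 0 r \<noteq> {}"
  then obtain x where "x \<in> hyperplane u t" "x \<in> cball 0 r" by blast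
  then have "inner x u = t" "norm x \<le> r" by (auto simp: hyperplane_def)
  then show "\<bar>t\<bar> \<le> r"
    using Cauchy_Schwarz_ineq2[of x u] assms by simp
next
  assume "\<bar>t\<bar> \<le> r"
  then have "t *\<^sub>R u \<in> hyperplane u t \<inter> cball 0 r"
    using assms by (simp add: hyperplane_def dot_square_norm)
  then show "hyperplane u t \<inter> cball 0 r \<noteq> {}" by blast
qed

lemma sets_rad_hit[measurable]: "rad_hit n \<in> sets hyperplane_borel"
proof (rule sets_hyperplane_borelI)
  have "norm (fst p) = 1 \<and> hyp p \<in> rad_hit n \<longleftrightarrow> norm (fst p) = 1 \<and> \<bar>snd p\<bar> \<le> real n" for p :: "'a \<times> real"
    using hyperplane_meets_cball[of "fst p" "real n" "snd p"] hyp_in_hyperplanes[of p]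
    unfolding rad_hit_def hitting_def by (cases "norm (fst p) = 1") (simp_all add: hyp_def)
  then have "{p. norm (fst p) = 1 \<and> hyp p \<in> rad_hit n} = {p::'a\<times>real. norm (fst p) = 1 \<and> \<bar>snd p\<bar> \<le> real n}"
    by blast
  also have "\<dots> \<in> sets borel"
    by measurable
  finally show "{p::'a\<times>real. norm (fst p) = 1 \<and> hyp p \<in> rad_hit n} \<in> sets borel" .
qed (auto simp: rad_hit_def hitting_def)

lemma UN_rad_hit: "(\<Union>n. rad_hit n) = hyperplanes"
proof
  show "hyperplanes \<subseteq> (\<Union>n. rad_hit n :: 'a set set)"
  by (force simp: hyperplanes_def real_arch_simple hyperplane_meets_cball rad_hit_def hitting_def)
  show "(\<Union>n. rad_hit n :: 'a set set) \<subseteq> hyperplanes"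
    by (auto simp: rad_hit_def hitting_def)
qed

lemma rad_hit_mono: "m \<le> n \<Longrightarrow> rad_hit m \<subseteq> rad_hit n"
  by (auto simp: rad_hit_def hitting_def)

section \<open>Measurability on the space of configurations\<close>

lemma space_config_space: "space config_space = hyperplane_configs"
  by (simp add: config_space_def space_measure_of_conv)

lemma hyperplane_configs_subset: "S \<in> hyperplane_configs \<Longrightarrow> S \<subseteq> hyperplanes"
  by (simp add: hyperplane_configs_def)

lemma finite_config_rad_hit: "S \<in> hyperplane_configs \<Longrightarrow> finite (S \<inter> rad_hit n)"
  by (simp add: hyperplane_configs_def rad_hit_def)

lemma hyperplane_configs_mono: "S \<in> hyperplane_configs \<Longrightarrow> T \<subseteq> S \<Longrightarrow> T \<in> hyperplane_configs"
  unfolding hyperplane_configs_def by (auto intro: rev_finite_subset)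

lemma config_space_spaceD: "S \<in> N \<rightarrow>\<^sub>M config_space \<Longrightarrow> x \<in> space N \<Longrightarrow> S x \<in> hyperplane_configs"
  by (metis measurable_space space_config_space)

lemma measurable_configI:
  assumes "\<And>x. x \<in> space N \<Longrightarrow> S x \<in> hyperplane_configs"
    and "\<And>B. B \<in> sets hyperplane_borel \<Longrightarrow> (\<lambda>x. num_in (S x) B) \<in> borel_measurable N"
  shows "S \<in> N \<rightarrow>\<^sub>M config_space"
  unfolding config_space_def
proof (rule measurable_measure_of)
  fix Y :: "'b set set set"
  assume "Y \<in> {{S \<in> hyperplane_configs. num_in S B \<in> C} |B C. B \<in> sets hyperplane_borel \<and> C \<in> sets borel}"
  then obtain B C where Y: "Y = {S \<in> hyperplane_configs. num_in S B \<in> C}" "B \<in> sets hyperplane_borel" "C \<in> sets borel"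
    by blast
  then have "S -` Y \<inter> space N = (\<lambda>x. num_in (S x) B) -` C \<inter> space N"
    using assms(1) by auto
  then show "S -` Y \<inter> space N \<in> sets N"
    using measurable_sets[OF assms(2)[OF Y(2)] Y(3)] by simp
qed (use assms(1) in auto)

lemma num_in_UN_disjoint:
  "disjoint_family A \<Longrightarrow> num_in S (\<Union>i. A i) = (\<Sum>i. num_in S (A i))" for A :: "nat \<Rightarrow> 'b set"
  unfolding num_in_def
  by (subst suminf_emeasure) (auto simp: disjoint_family_on_def intro!: arg_cong2[where f=emeasure])

lemma num_in_SUP:
  "incseq A \<Longrightarrow> num_in S (\<Union>i. A i) = (SUP i. num_in S (A i))" for A :: "nat \<Rightarrow> 'b set"
  unfolding num_in_def
  by (subst SUP_emeasure_incseq) (auto simp: incseq_def intro!: arg_cong2[where f=emeasure])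

lemma num_in_finite: "finite (S \<inter> B) \<Longrightarrow> num_in S B = of_nat (card (S \<inter> B))"
  by (simp add: num_in_def emeasure_count_space)

lemma num_in_Diff:
  assumes "finite (S \<inter> B)" "C \<subseteq> B"
  shows "num_in S (B - C) = num_in S B - num_in S C"
proof -
  have "finite (S \<inter> C)" using assms by (meson Int_mono finite_subset order_refl)
  have "S \<inter> (B - C) = (S \<inter> B) - (S \<inter> C)" by auto
  then show ?thesis
    unfolding num_in_def using assms \<open>finite (S \<inter> C)\<close>
    by (simp only: ) (subst emeasure_Diff, auto simp: emeasure_count_space)
qed

lemma num_in_eq_0_iff: "num_in S B = 0 \<longleftrightarrow> S \<inter> B = {}"
  by (simp add: num_in_def emeasure_count_space_eq_0)

lemma nn_integral_count_space_eq_num_in: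
  "(\<integral>\<^sup>+H. indicator A H \<partial>count_space S) = num_in S A"
proof -
  have "(\<integral>\<^sup>+H. indicator A H \<partial>count_space S) = (\<integral>\<^sup>+H. indicator (S \<inter> A) H \<partial>count_space UNIV)"
    by (simp add: nn_integral_count_space_indicator[of S] indicator_inter_arith mult.commute)
  then show ?thesis by (simp add: num_in_def)
qed

text \<open>The complement step of the Dynkin argument subtracts counts, which requires them to be
  finite. The counts are therefore first restricted to \<open>rad_hit n\<close>, and the restriction
  is removed by a monotone limit.\<close>

lemma measurable_num_in_section:
  assumes S: "S \<in> N \<rightarrow>\<^sub>M config_space" and A: "A \<in> sets (N \<Otimes>\<^sub>M hyperplane_borel)"
  shows "(\<lambda>x. num_in (S x) {H. (x, H) \<in> A}) \<in> borel_measurable N"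
proof -
  have *: "(\<lambda>x. num_in (S x) ({H. (x, H) \<in> A} \<inter> rad_hit n)) \<in> borel_measurable N" for n
    using Int_stable_pair_measure_generator pair_measure_closed A unfolding sets_pair_measure
  proof (induction A rule: sigma_sets_induct_disjoint)
    case (basic A)
    then obtain a b where ab: "A = a \<times> b" "a \<in> sets N" "b \<in> sets hyperplane_borel" by blast
    have "num_in (S x) ({H. (x, H) \<in> A} \<inter> rad_hit n) = indicator a x * num_in (S x) (b \<inter> rad_hit n)" for x
      by (auto simp: ab(1) indicator_def num_in_def)
    then show ?case using ab(2,3) measurable_num_in[OF S] by simp
  next
    case empty
    then show ?case by (simp add: num_in_def)
  next
    case (compl A)
    have "num_in (S x) ({H. (x, H) \<in> space N \<times> space hyperplane_borel - A} \<inter> rad_hit n) =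
        num_in (S x) (rad_hit n) - num_in (S x) ({H. (x, H) \<in> A} \<inter> rad_hit n)" if x: "x \<in> space N" for x
    proof -
      have "{H. (x, H) \<in> space N \<times> space hyperplane_borel - A} \<inter> rad_hit n =
          rad_hit n - ({H. (x, H) \<in> A} \<inter> rad_hit n)"
        using x by (auto simp: space_hyperplane_borel rad_hit_def hitting_def)
      then show ?thesis
        using finite_config_rad_hit[OF config_space_spaceD[OF S x]] by (simp add: num_in_Diff)
    qed
    moreover have "(\<lambda>x. num_in (S x) (rad_hit n) - num_in (S x) ({H. (x, H) \<in> A} \<inter> rad_hit n)) \<in> borel_measurable N"
      using compl measurable_num_in[OF S sets_rad_hit] by (intro borel_measurable_minus_ennreal) auto
    ultimately show ?case by (simp cong: measurable_cong)
  next
    case (union A)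
    have "num_in (S x) ({H. (x, H) \<in> (\<Union>i. A i)} \<inter> rad_hit n) =
      (\<Sum>i. num_in (S x) ({H. (x, H) \<in> A i} \<inter> rad_hit n))" for x
    proof -
      have "{H. (x, H) \<in> (\<Union>i. A i)} \<inter> rad_hit n = (\<Union>i. {H. (x, H) \<in> A i} \<inter> rad_hit n)" by auto
      then show ?thesis using union(1)
        by (simp only:) (intro num_in_UN_disjoint, auto simp: disjoint_family_on_def)
    qed
    then show ?case using union(3) by (simp add: borel_measurable_suminf)
  qed
  have "num_in (S x) {H. (x, H) \<in> A} = (SUP n. num_in (S x) ({H. (x, H) \<in> A} \<inter> rad_hit n))" if x: "x \<in> space N" for x
  proof -
    have sub: "S x \<subseteq> hyperplanes"
      using config_space_spaceD[OF S x] by (rule hyperplane_configs_subset)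
    have "num_in (S x) {H. (x, H) \<in> A} = num_in (S x) (\<Union>n. {H. (x, H) \<in> A} \<inter> rad_hit n)"
      unfolding num_in_def using sub UN_rad_hit by (intro arg_cong2[where f=emeasure]) auto
    also have "\<dots> = (SUP n. num_in (S x) ({H. (x, H) \<in> A} \<inter> rad_hit n))"
      by (intro num_in_SUP) (auto simp: incseq_def dest: rad_hit_mono)
    finally show ?thesis .
  qed
  then show ?thesis using * by (simp cong: measurable_cong)
qed

lemma measurable_config_sum:
  assumes S: "S \<in> N \<rightarrow>\<^sub>M config_space" and f: "f \<in> borel_measurable (N \<Otimes>\<^sub>M hyperplane_borel)"
  shows "(\<lambda>x. \<integral>\<^sup>+H. f (x, H) \<partial>count_space (S x)) \<in> borel_measurable N"
  using f
proof (induction rule: borel_measurable_induct)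
  case (cong f g)
  have "(\<integral>\<^sup>+H. f (x, H) \<partial>count_space (S x)) = (\<integral>\<^sup>+H. g (x, H) \<partial>count_space (S x))" if x: "x \<in> space N" for x
    using hyperplane_configs_subset[OF config_space_spaceD[OF S x]] x cong(3)
    by (intro nn_integral_cong) (auto simp: space_pair_measure space_hyperplane_borel)
  then show ?case using cong(4) by (simp cong: measurable_cong)
next
  case (set A)
  have "(\<integral>\<^sup>+H. indicator A (x, H) \<partial>count_space (S x)) = num_in (S x) {H. (x, H) \<in> A}" for x
    by (subst nn_integral_count_space_eq_num_in[symmetric]) (auto intro!: nn_integral_cong simp: indicator_def)
  then show ?case using measurable_num_in_section[OF S set] by simp
next
  case (mult u c)
  then show ?case by (simp add: nn_integral_cmult)
next
  case (add u v)
  then show ?case by (simp add: nn_integral_add)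
next
  case (seq U)
  have "(\<integral>\<^sup>+H. (SUP i. U i) (x, H) \<partial>count_space (S x)) = (SUP i. \<integral>\<^sup>+H. U i (x, H) \<partial>count_space (S x))" for x
    using seq(3) unfolding SUP_apply
    by (intro nn_integral_monotone_convergence_SUP) (auto simp: incseq_def le_fun_def)
  then show ?case using seq by simp
qed

lemma measurable_config_Int:
  assumes S: "S \<in> N \<rightarrow>\<^sub>M config_space" and A: "A \<in> sets (N \<Otimes>\<^sub>M hyperplane_borel)"
  shows "(\<lambda>x. S x \<inter> {H. (x, H) \<in> A}) \<in> N \<rightarrow>\<^sub>M config_space"
proof (rule measurable_configI)
  fix x assume "x \<in> space N"
  then show "S x \<inter> {H. (x, H) \<in> A} \<in> hyperplane_configs"
    by (intro hyperplane_configs_mono[OF config_space_spaceD[OF S]]) auto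
next
  fix B :: "'b set set" assume B: "B \<in> sets hyperplane_borel"
  have "num_in (S x \<inter> {H. (x, H) \<in> A}) B = num_in (S x) {H. (x, H) \<in> A \<inter> (space N \<times> B)}" if "x \<in> space N" for x
    unfolding num_in_def using that by (intro arg_cong2[where f=emeasure]) auto
  then show "(\<lambda>x. num_in (S x \<inter> {H. (x, H) \<in> A}) B) \<in> borel_measurable N"
    using measurable_num_in_section[OF S, of "A \<inter> (space N \<times> B)"] A B by (simp cong: measurable_cong)
qed

lemma measurable_config_remove:
  assumes S: "S \<in> N \<rightarrow>\<^sub>M config_space" and h[measurable]: "h \<in> N \<rightarrow>\<^sub>M hyperplane_borel"
  shows "(\<lambda>x. S x - {h x}) \<in> N \<rightarrow>\<^sub>M config_space"
proof -
  \<comment> \<open>Distinctness of hyperplanes is tested on their sections: \<open>sec\<close> is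
    injective with values in a Euclidean space, where inequality is a measurable relation.\<close>
  let ?A = "{y \<in> space (N \<Otimes>\<^sub>M hyperplane_borel). sec (snd y) \<noteq> sec (h (fst y))}"
  have A: "?A \<in> sets (N \<Otimes>\<^sub>M hyperplane_borel)" by measurable
  have "S x - {h x} = S x \<inter> {H. (x, H) \<in> ?A}" if x: "x \<in> space N" for x
    using hyperplane_configs_subset[OF config_space_spaceD[OF S x]] x measurable_space[OF h x]
    by (auto simp: space_pair_measure space_hyperplane_borel sec_inj)
  then show ?thesis
    using measurable_config_Int[OF S A] by (simp cong: measurable_cong)
qed

section \<open>Void events generate the sigma-algebra of configurations\<close>

definition void_event :: "'a::euclidean_space set set \<Rightarrow> 'a set set set" where
  "void_event C = {S \<in> hyperplane_configs. S \<inter> C = {}}"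

text \<open>Confining C to some \<open>rad_hit n\<close> gives it finite intensity, so that its void
  probability is supplied by the Poisson law.\<close>

definition void_events :: "'a::euclidean_space set set set set" where
  "void_events = {void_event C |C. C \<in> sets hyperplane_borel \<and> (\<exists>n. C \<subseteq> rad_hit n)}"

lemma Int_stable_void_events: "Int_stable void_events"
proof (rule Int_stableI)
  fix a b :: "'a set set set" assume "a \<in> void_events" "b \<in> void_events"
  then obtain C D m n where *: "a = void_event C" "b = void_event D" "C \<in> sets hyperplane_borel" "D \<in> sets hyperplane_borel"
     "C \<subseteq> rad_hit m" "D \<subseteq> rad_hit n"
    unfolding void_events_def by blast
  have "a \<inter> b = void_event (C \<union> D)" by (auto simp: * void_event_def)
  moreover have "C \<union> D \<subseteq> rad_hit (max m n)"
    using * rad_hit_mono[of m "max m n"] rad_hit_mono[of n "max m n"] by auto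
  ultimately show "a \<inter> b \<in> void_events"
    using * unfolding void_events_def by blast
qed

lemma void_event_empty: "void_event {} = hyperplane_configs"
  by (auto simp: void_event_def)

lemma space_in_void_events: "hyperplane_configs \<in> void_events"
  unfolding void_events_def using void_event_empty by blast

lemma sets_void_event: "C \<in> sets hyperplane_borel \<Longrightarrow> void_event C \<in> sets config_space"
proof -
  assume C: "C \<in> sets hyperplane_borel"
  have "void_event C = (\<lambda>S. num_in S C) -` {0} \<inter> space config_space"
    by (auto simp: void_event_def space_config_space num_in_eq_0_iff)
  also have "\<dots> \<in> sets config_space"
    by (intro measurable_sets[OF measurable_num_in[OF measurable_ident C, unfolded id_def]]) auto
  finally show ?thesis .
qed

text \<open>A countable basis separates points. Membership in its first n sets will serve as a
  finite code that tells hyperplanes apart for large n.\<close>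

lemma ex_separating_sets:
  "\<exists>U::nat \<Rightarrow> ('a::euclidean_space \<times> real) set. (\<forall>i. open (U i)) \<and> (\<forall>x y. x \<noteq> y \<longrightarrow> (\<exists>i. x \<in> U i \<and> y \<notin> U i))"
proof -
  obtain B :: "('a \<times> real) set set" where B: "countable B" "topological_basis B"
    using ex_countable_basis by blast
  have ne: "B \<noteq> {}"
  proof
    assume "B = {}"
    then have "\<not> open (UNIV :: ('a \<times> real) set)"
      using B(2) unfolding topological_basis_def by (metis Union_empty empty_not_UNIV empty_subsetI subset_empty)
    then show False by simp
  qed
  show ?thesis
  proof (intro exI[of _ "from_nat_into B"] conjI allI impI)
    show "open (from_nat_into B i)" for i
      using from_nat_into[OF ne] B(2) by (metis topological_basis_open)
    fix x y :: "'a \<times> real" assume "x \<noteq> y"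
    then obtain b where b: "b \<in> B" "x \<in> b" "b \<subseteq> - {y}"
      using topological_basisE[OF B(2), of "- {y}" x] by auto
    then show "\<exists>i. x \<in> from_nat_into B i \<and> y \<notin> from_nat_into B i"
      using from_nat_into_surj[OF B(1) b(1)] by auto
  qed
qed

text \<open>A simple configuration is determined by the sets that it avoids. Partition a bounded set
  of hyperplanes by the code of length n: the number of occupied cells is a function of void events,
  and it reaches the number of points as soon as the code separates the finitely many points
  present. So counts, and with them all configuration events, are generated by void events.\<close>

lemma sets_config_space_void:
  "sets (config_space :: 'a::euclidean_space set set measure) = sigma_sets hyperplane_configs void_events"
proof
  have sub: "void_events \<subseteq> Pow (hyperplane_configs :: 'a set set set)"
    by (auto simp: void_events_def void_event_def)
  let ?V = "sigma hyperplane_configs void_events :: 'a set set measure"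
  have spV: "space ?V = hyperplane_configs" and setsV: "sets ?V = sigma_sets hyperplane_configs void_events"
    using sub by auto
  show "sigma_sets hyperplane_configs void_events \<subseteq> sets (config_space :: 'a set set measure)"
  proof -
    have "void_events \<subseteq> sets (config_space :: 'a set set measure)"
      by (auto simp: void_events_def sets_void_event)
    then show ?thesis
      using sets.sigma_sets_subset[of void_events "config_space :: 'a set set measure"] by (simp add: space_config_space)
  qed
  obtain U :: "nat \<Rightarrow> ('a \<times> real) set" where U: "\<And>i. open (U i)" "\<And>x y. x \<noteq> y \<Longrightarrow> \<exists>i. x \<in> U i \<and> y \<notin> U i"
    using ex_separating_sets by metis
  define code where "code n H = {i. i < n \<and> sec H \<in> U i}" for n :: nat and H :: "'a set"
  have code_Pow: "code n H \<in> Pow {..<n}" for n H by (auto simp: code_def)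
  have code_sets: "{H \<in> hyperplanes. code n H = s} \<in> sets hyperplane_borel" for n s
  proof (cases "s \<subseteq> {..<n}")
    case True
    then have "{H \<in> hyperplanes. code n H = s} = {H \<in> space hyperplane_borel. \<forall>i<n. (sec H \<in> U i) = (i \<in> s)}"
      by (auto simp: code_def space_hyperplane_borel)
    also have "\<dots> \<in> sets hyperplane_borel"
    proof -
      have [measurable]: "U i \<in> sets borel" for i using U(1) by auto
      show ?thesis by measurable
    qed
    finally show ?thesis .
  next
    case False
    then have "{H \<in> hyperplanes. code n H = s} = {}"
      using code_Pow by auto
    then show ?thesis by (simp only: sets.empty_sets)
  qed
  have fin: "(\<lambda>S. num_in S (B \<inter> rad_hit m)) \<in> borel_measurable ?V" if B: "B \<in> sets hyperplane_borel" for B m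
  proof -
    let ?D = "\<lambda>n s. B \<inter> rad_hit m \<inter> {H \<in> hyperplanes. code n H = s}"
    have eq: "num_in S (B \<inter> rad_hit m) = (SUP n. \<Sum>s\<in>Pow {..<n}. if S \<in> void_event (?D n s) then 0 else 1)"
      if S: "S \<in> space ?V" for S
    proof -
      have S': "S \<in> hyperplane_configs" using S by (simp only: spV)
      define T where "T = S \<inter> (B \<inter> rad_hit m)"
      have finT: "finite T"
        unfolding T_def using finite_config_rad_hit[OF S', of m] by (auto intro: rev_finite_subset)
      have T_sub: "T \<subseteq> hyperplanes" using hyperplane_configs_subset[OF S'] by (auto simp: T_def)
      have card_eq: "(\<Sum>s\<in>Pow {..<n}. if S \<in> void_event (?D n s) then 0 else 1 :: ennreal) = of_nat (card (code n ` T))" for n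
      proof -
        have "S \<in> void_event (?D n s) \<longleftrightarrow> s \<notin> code n ` T" for s
          using S' T_sub unfolding void_event_def T_def by auto
        then have "(\<Sum>s\<in>Pow {..<n}. if S \<in> void_event (?D n s) then 0 else 1 :: ennreal) =
            (\<Sum>s\<in>Pow {..<n}. if s \<in> code n ` T then 1 else 0)"
          by (intro sum.cong) auto
        also have "\<dots> = of_nat (card (Pow {..<n} \<inter> code n ` T))"
          by (subst sum.inter_restrict[symmetric]) auto
        also have "Pow {..<n} \<inter> code n ` T = code n ` T" using code_Pow by auto
        finally show ?thesis .
      qed
      have "\<forall>x\<in>T. \<forall>y\<in>T. \<exists>i. x \<noteq> y \<longrightarrow> sec x \<in> U i \<and> sec y \<notin> U i"
        using T_sub sec_inj U(2) by (metis subsetD)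
      then obtain sep where sep: "\<And>x y. x \<in> T \<Longrightarrow> y \<in> T \<Longrightarrow> x \<noteq> y \<Longrightarrow> sec x \<in> U (sep x y) \<and> sec y \<notin> U (sep x y)"
        by metis
      \<comment> \<open>A code length beyond every separating index needed for pairs from T. The
        inserted 0 keeps the maximum meaningful when T is empty.\<close>
      define n where "n = Suc (Max (insert 0 ((\<lambda>(x,y). sep x y) ` (T \<times> T))))"
      have sep_less: "sep x y < n" if "x \<in> T" "y \<in> T" for x y
      proof -
        have "sep x y \<le> Max (insert 0 ((\<lambda>(x,y). sep x y) ` (T \<times> T)))"
          using finT that by (intro Max_ge) auto
        then show ?thesis by (simp add: n_def)
      qed
      have "inj_on (code n) T"
      proof (rule inj_onI, rule ccontr)
        fix x y assume xy: "x \<in> T" "y \<in> T" "code n x = code n y" "x \<noteq> y"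
        have "sep x y \<in> code n x" "sep x y \<notin> code n y"
          using sep[OF xy(1,2,4)] sep_less[OF xy(1,2)] by (auto simp: code_def)
        then show False using xy by simp
      qed
      then have 1: "card (code n ` T) = card T" by (rule card_image)
      have "num_in S (B \<inter> rad_hit m) = of_nat (card T)"
        using finT by (simp add: T_def num_in_finite)
      also have "\<dots> = (SUP n. of_nat (card (code n ` T)) :: ennreal)"
      proof (rule antisym)
        show "of_nat (card T) \<le> (SUP n. of_nat (card (code n ` T)) :: ennreal)"
          using 1 by (metis SUP_upper UNIV_I)
        show "(SUP n. of_nat (card (code n ` T)) :: ennreal) \<le> of_nat (card T)"
          by (intro SUP_least) (simp add: card_image_le finT)
      qed
      finally show ?thesis by (simp only: card_eq)
    qed
    have [measurable]: "void_event (?D n s) \<in> sets ?V" for n s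
    proof -
      have "?D n s \<in> sets hyperplane_borel" using B code_sets by auto
      then have "void_event (?D n s) \<in> void_events" unfolding void_events_def by blast
      then show ?thesis unfolding setsV by (rule sigma_sets.Basic)
    qed
    have "(\<lambda>S. SUP n. \<Sum>s\<in>Pow {..<n}. if S \<in> void_event (?D n s) then 0 else 1 :: ennreal) \<in> borel_measurable ?V"
      by measurable
    then show ?thesis using eq by (simp only: cong: measurable_cong)
  qed
  have num: "(\<lambda>S. num_in S B) \<in> borel_measurable ?V" if B: "B \<in> sets hyperplane_borel" for B
  proof -
    have "num_in S B = (SUP m. num_in S (B \<inter> rad_hit m))" for S
    proof -
      have "num_in S B = num_in S (\<Union>m. B \<inter> rad_hit m)"
        using UN_rad_hit sets.sets_into_space[OF B]
        by (intro arg_cong2[where f=num_in]) (auto simp: space_hyperplane_borel)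
      also have "\<dots> = (SUP m. num_in S (B \<inter> rad_hit m))"
        by (intro num_in_SUP) (auto simp: incseq_def dest: rad_hit_mono)
      finally show ?thesis .
    qed
    then show ?thesis using fin[OF B] by simp
  qed
  have "(\<lambda>x. x) \<in> ?V \<rightarrow>\<^sub>M config_space"
    by (rule measurable_configI) (use num spV in auto)
  show "sets (config_space :: 'a set set measure) \<subseteq> sigma_sets hyperplane_configs void_events"
  proof
    fix Y :: "'a set set set" assume "Y \<in> sets config_space"
    from measurable_sets[OF \<open>(\<lambda>x. x) \<in> ?V \<rightarrow>\<^sub>M config_space\<close> this]
    have "Y \<inter> hyperplane_configs \<in> sigma_sets hyperplane_configs void_events"
      by (simp add: setsV spV)
    moreover have "Y \<subseteq> hyperplane_configs"
      using sets.sets_into_space[OF \<open>Y \<in> sets config_space\<close>] by (simp add: space_config_space)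
    ultimately show "Y \<in> sigma_sets hyperplane_configs void_events"
      by (simp add: Int_absorb2)
  qed
qed

section \<open>Poisson hyperplane processes and the Mecke formula\<close>

text \<open>For a fixed B, the sets V for which the rectangle is generated form a sigma-algebra.
  Complements are taken inside \<open>B \<times> hyperplane_configs\<close>, which is itself a
  generator because the void event of the empty set is everything.\<close>

lemma sets_pair_void_events:
  "sets (hyperplane_borel \<Otimes>\<^sub>M config_space :: ('a::euclidean_space set \<times> 'a set set) measure) =
    sigma_sets (hyperplanes \<times> hyperplane_configs) {B \<times> V |B V. B \<in> sets hyperplane_borel \<and> V \<in> void_events}"
  (is "?L = sigma_sets ?\<Omega> ?G")
proof
  have Gsub: "?G \<subseteq> Pow ?\<Omega>"
    using sets.sets_into_space by (fastforce simp: void_events_def void_event_def space_hyperplane_borel)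
  have VE: "V \<in> sets config_space" if "V \<in> void_events" for V :: "'a set set set"
    unfolding sets_config_space_void using that by (rule sigma_sets.Basic)
  show "sigma_sets ?\<Omega> ?G \<subseteq> ?L"
  proof -
    have "?G \<subseteq> ?L" using VE by auto
    from sets.sigma_sets_subset[OF this] show ?thesis
      by (simp add: space_pair_measure space_hyperplane_borel space_config_space)
  qed
  have rect: "B \<times> V \<in> sigma_sets ?\<Omega> ?G" if B: "B \<in> sets hyperplane_borel" and V: "V \<in> sets config_space" for B :: "'a set set" and V
    using V unfolding sets_config_space_void
  proof (induction rule: sigma_sets.induct)
    case (Basic a)
    then show ?case using B by (intro sigma_sets.Basic) auto
  next
    case Empty
    then show ?case by (simp add: sigma_sets.Empty)
  next
    case (Compl a)
    interpret sigma_algebra ?\<Omega> "sigma_sets ?\<Omega> ?G"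
      using Gsub by (rule sigma_algebra_sigma_sets)
    have "B \<times> hyperplane_configs \<in> sigma_sets ?\<Omega> ?G"
      using B space_in_void_events by (intro sigma_sets.Basic) auto
    then have "B \<times> hyperplane_configs - B \<times> a \<in> sigma_sets ?\<Omega> ?G"
      using Compl(2) by (rule Diff)
    then show ?case by (simp add: Times_Diff_distrib1 Sigma_Diff_distrib2)
  next
    case (Union a)
    have "B \<times> (\<Union>i. a i) = (\<Union>i. B \<times> a i)" by auto
    with Union(2) show ?case by (simp only:) (rule sigma_sets.Union)
  qed
  show "?L \<subseteq> sigma_sets ?\<Omega> ?G"
    unfolding sets_pair_measure space_hyperplane_borel space_config_space
    by (rule sigma_sets_mono) (use rect in auto)
qed

locale hyperplane_process = prob_space M for M :: "'w measure" +
  fixes X :: "'w \<Rightarrow> 'a::euclidean_space set set" and \<gamma> :: real and \<phi> :: "'a measure"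
  assumes poisson: "poisson_hyperplane_process M X"
    and stationary: "stationary_process M X"
    and intensity: "has_intensity_and_directional_distribution M X \<gamma> \<phi>"
begin

abbreviation \<Theta> :: "'a set measure" where "\<Theta> \<equiv> intensity_measure M X"

lemma measurable_X[measurable]: "X \<in> M \<rightarrow>\<^sub>M config_space"
  using poisson by (simp add: poisson_hyperplane_process_def)

lemma sets_intensity[measurable_cong, simp]: "sets \<Theta> = sets hyperplane_borel"
  unfolding intensity_measure_def
  by (metis sets.sets_measure_of_eq space_hyperplane_borel)

lemma space_intensity: "space \<Theta> = hyperplanes"
  using sets_eq_imp_space_eq[OF sets_intensity] by (simp add: space_hyperplane_borel)

lemma intensity_rad_hit: "emeasure \<Theta> (rad_hit n) < \<infinity>"
  using poisson by (simp add: poisson_hyperplane_process_def rad_hit_def)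

lemma sigma_finite_intensity: "sigma_finite_measure \<Theta>"
proof
  show "\<exists>A. countable A \<and> A \<subseteq> sets \<Theta> \<and> \<Union> A = space \<Theta> \<and> (\<forall>a\<in>A. emeasure \<Theta> a \<noteq> \<infinity>)"
  proof (intro exI[of _ "range rad_hit"] conjI ballI)
    fix a :: "'a set set" assume "a \<in> range rad_hit"
    then show "emeasure \<Theta> a \<noteq> \<infinity>" using intensity_rad_hit by (auto simp: less_top)
  qed (auto simp: UN_rad_hit space_intensity)
qed

lemma nn_integral_num_in: "B \<in> sets hyperplane_borel \<Longrightarrow> (\<integral>\<^sup>+\<omega>. num_in (X \<omega>) B \<partial>M) = emeasure \<Theta> B"
  by (simp add: emeasure_intensity_measure[OF measurable_X])

lemma measurable_num[measurable]: "B \<in> sets hyperplane_borel \<Longrightarrow> (\<lambda>\<omega>. num_in (X \<omega>) B) \<in> borel_measurable M"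
  by (rule measurable_num_in[OF measurable_X])

lemma prob_num_in:
  assumes "B \<in> sets hyperplane_borel" "emeasure \<Theta> B < \<infinity>"
  shows "(\<integral>\<^sup>+\<omega>. indicator {of_nat n} (num_in (X \<omega>) B) \<partial>M) =
    ennreal (measure \<Theta> B ^ n / fact n * exp (- measure \<Theta> B))"
proof -
  have "(\<integral>\<^sup>+\<omega>. indicator {of_nat n} (num_in (X \<omega>) B) \<partial>M) =
     (\<integral>\<^sup>+\<omega>. indicator {\<omega> \<in> space M. num_in (X \<omega>) B = of_nat n} \<omega> \<partial>M)"
    by (intro nn_integral_cong) (auto simp: indicator_def)
  also have "\<dots> = emeasure M {\<omega> \<in> space M. num_in (X \<omega>) B = of_nat n}"
    using assms(1) by (intro nn_integral_indicator) measurable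
  also have "\<dots> = ennreal (\<P>(\<omega> in M. num_in (X \<omega>) B = of_nat n))"
    by (rule emeasure_eq_measure)
  also have "\<dots> = ennreal (measure \<Theta> B ^ n / fact n * exp (- measure \<Theta> B))"
  using poisson poisson_hyperplane_process_def assms by auto
  finally show ?thesis .
qed

lemma nn_integral_num_in_indep:
  fixes f g :: "ennreal \<Rightarrow> ennreal"
  assumes B: "B \<in> sets hyperplane_borel" and C: "C \<in> sets hyperplane_borel" and disj: "B \<inter> C = {}"
    and f: "f \<in> borel_measurable borel" and g: "g \<in> borel_measurable borel"
  shows "(\<integral>\<^sup>+\<omega>. f (num_in (X \<omega>) B) * g (num_in (X \<omega>) C) \<partial>M) =
    (\<integral>\<^sup>+\<omega>. f (num_in (X \<omega>) B) \<partial>M) * (\<integral>\<^sup>+\<omega>. g (num_in (X \<omega>) C) \<partial>M)"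
proof -
  let ?B = "\<lambda>i::nat. if i = 0 then B else C"
  let ?f = "\<lambda>i::nat. if i = 0 then f else g"
  have "?B ` {0, 1} \<subseteq> sets hyperplane_borel" "disjoint_family_on ?B {0, 1}"
    using B C disj by (auto simp: disjoint_family_on_def)
  then have "indep_vars (\<lambda>_. borel) (\<lambda>i \<omega>. num_in (X \<omega>) (?B i)) {0, 1}"
    using poisson unfolding poisson_hyperplane_process_def by simp
  then have "indep_vars (\<lambda>_. borel) (\<lambda>i \<omega>. ?f i (num_in (X \<omega>) (?B i))) {0, 1}"
    by (rule indep_vars_compose2) (use f g in auto)
  from indep_vars_nn_integral[OF _ this]
  have "(\<integral>\<^sup>+\<omega>. (\<Prod>i\<in>{0, 1}. ?f i (num_in (X \<omega>) (?B i))) \<partial>M) = (\<Prod>i\<in>{0, 1}. \<integral>\<^sup>+\<omega>. ?f i (num_in (X \<omega>) (?B i)) \<partial>M)"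
    by simp
  then show ?thesis by simp
qed

definition config_law :: "'a set set measure" where
  "config_law = distr M config_space X"

text \<open>Removing H from S empties C exactly when S has no point in C or only the point H. In the
  first case the admissible H are the points in \<open>B - C\<close>; in the second the single point
  of S in C must lie in B. The Mecke sum thus splits into counts over disjoint sets.\<close>

lemma sum_void_event:
  assumes S: "S \<in> hyperplane_configs"
  shows "(\<integral>\<^sup>+H. indicator (B \<times> void_event C) (H, S - {H}) \<partial>count_space S) =
    num_in S (B - C) * indicator {0} (num_in S C) +
    indicator {1} (num_in S (C \<inter> B)) * indicator {0} (num_in S (C - B))"
proof -
  have ve: "S - {H} \<in> void_event C \<longleftrightarrow> S \<inter> C \<subseteq> {H}" for H
    using hyperplane_configs_mono[OF S, of "S - {H}"] by (auto simp: void_event_def)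
  have sum: "(\<integral>\<^sup>+H. indicator (B \<times> void_event C) (H, S - {H}) \<partial>count_space S) = num_in S {H \<in> B. S \<inter> C \<subseteq> {H}}"
    unfolding nn_integral_count_space_eq_num_in[symmetric] using ve
    by (intro nn_integral_cong) (auto simp: indicator_def)
  show ?thesis
  proof (cases "S \<inter> C = {}")
    case True
    then have "num_in S {H \<in> B. S \<inter> C \<subseteq> {H}} = num_in S (B - C)"
      unfolding num_in_def by (intro arg_cong2[where f=emeasure]) auto
    moreover have "num_in S C = 0" "num_in S (C \<inter> B) = 0"
      using True by (auto simp: num_in_eq_0_iff)
    ultimately show ?thesis using sum by simp
  next
    case False
    then have nC: "num_in S C \<noteq> 0" by (simp add: num_in_eq_0_iff)
    show ?thesis
    proof (cases "\<exists>H0. S \<inter> C = {H0}")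
      case True
      then obtain H0 where H0: "S \<inter> C = {H0}" by blast
      show ?thesis
      proof (cases "H0 \<in> B")
        case True
        have "S \<inter> {H \<in> B. S \<inter> C \<subseteq> {H}} = {H0}" "S \<inter> (C \<inter> B) = {H0}" "S \<inter> (C - B) = {}"
          using True H0 by auto
        then show ?thesis unfolding sum using nC by (simp add: num_in_def)
      next
        case False
        have "S \<inter> {H \<in> B. S \<inter> C \<subseteq> {H}} = {}" "S \<inter> (C \<inter> B) = {}"
          using False H0 by auto
        then show ?thesis unfolding sum using nC by (simp add: num_in_def)
      qed
    next
      case False2: False
      have 1: "S \<inter> {H \<in> B. S \<inter> C \<subseteq> {H}} = {}"
        using False False2 by blast
      have "\<not> (num_in S (C \<inter> B) = 1 \<and> num_in S (C - B) = 0)"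
      proof
        assume a: "num_in S (C \<inter> B) = 1 \<and> num_in S (C - B) = 0"
        then have "S \<inter> C = S \<inter> (C \<inter> B)" by (auto simp: num_in_eq_0_iff)
        then have "emeasure (count_space UNIV) (S \<inter> C) = 1" using a by (simp add: num_in_def)
        then have "card (S \<inter> C) = 1"
          by (cases "finite (S \<inter> C)") (simp_all add: emeasure_count_space)
        then show False using False2 by (auto simp: card_1_singleton_iff)
      qed
      then show ?thesis unfolding sum using nC 1 by (auto simp: num_in_def indicator_def)
    qed
  qed
qed

lemma measurable_mecke_summand:
  assumes f: "f \<in> borel_measurable (hyperplane_borel \<Otimes>\<^sub>M config_space)"
  shows "(\<lambda>S. \<integral>\<^sup>+H. f (H, S - {H}) \<partial>count_space S) \<in> borel_measurable config_space"
proof (rule measurable_config_sum[where f="\<lambda>(S, H). f (H, S - {H})" and S="\<lambda>S. S", simplified split_conv])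
  show "(\<lambda>S. S) \<in> config_space \<rightarrow>\<^sub>M config_space" by measurable
next
  have "(\<lambda>x. fst x - {snd x}) \<in> config_space \<Otimes>\<^sub>M hyperplane_borel \<rightarrow>\<^sub>M config_space"
    by (intro measurable_config_remove) measurable
  then have "(\<lambda>x. (snd x, fst x - {snd x})) \<in> config_space \<Otimes>\<^sub>M hyperplane_borel \<rightarrow>\<^sub>M hyperplane_borel \<Otimes>\<^sub>M config_space"
    by measurable
  from measurable_compose[OF this f]
  show "(\<lambda>(S, H). f (H, S - {H})) \<in> borel_measurable (config_space \<Otimes>\<^sub>M hyperplane_borel)"
    by (simp add: split_beta')
qed

text \<open>Both terms of \<open>sum_void_event\<close> factor by independence over disjoint sets.
  The first gives \<Theta>(B - C) exp(-\<Theta>(C)). The second gives \<Theta>(C \<inter> B)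
  exp(-\<Theta>(C \<inter> B)) exp(-\<Theta>(C - B)), in which the exponentials combine to the same
  void probability; the masses add up to \<Theta>(B).\<close>

lemma mecke_void:
  assumes B: "B \<in> sets hyperplane_borel" and C: "C \<in> sets hyperplane_borel" "C \<subseteq> rad_hit n"
  shows "(\<integral>\<^sup>+\<omega>. \<integral>\<^sup>+H. indicator (B \<times> void_event C) (H, X \<omega> - {H}) \<partial>count_space (X \<omega>) \<partial>M) =
    emeasure \<Theta> B * (\<integral>\<^sup>+\<omega>. indicator (void_event C) (X \<omega>) \<partial>M)"
proof -
  have fin: "emeasure \<Theta> D < \<infinity>" if "D \<subseteq> C" "D \<in> sets hyperplane_borel" for D
  proof -
    have "emeasure \<Theta> D \<le> emeasure \<Theta> (rad_hit n)"
      using that C by (intro emeasure_mono) auto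
    then show ?thesis using intensity_rad_hit[of n] by (rule le_less_trans)
  qed
  have void: "(\<integral>\<^sup>+\<omega>. indicator {0} (num_in (X \<omega>) D) \<partial>M) = ennreal (exp (- measure \<Theta> D))"
    if "D \<subseteq> C" "D \<in> sets hyperplane_borel" for D
    using prob_num_in[OF that(2) fin[OF that], of 0] by simp
  have [measurable]: "B - C \<in> sets hyperplane_borel" "C \<inter> B \<in> sets hyperplane_borel" "C - B \<in> sets hyperplane_borel"
    "C \<in> sets hyperplane_borel"
    using B C by auto
  have "(\<integral>\<^sup>+\<omega>. \<integral>\<^sup>+H. indicator (B \<times> void_event C) (H, X \<omega> - {H}) \<partial>count_space (X \<omega>) \<partial>M) =
    (\<integral>\<^sup>+\<omega>. num_in (X \<omega>) (B - C) * indicator {0} (num_in (X \<omega>) C) +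
      indicator {1} (num_in (X \<omega>) (C \<inter> B)) * indicator {0} (num_in (X \<omega>) (C - B)) \<partial>M)"
    by (intro nn_integral_cong sum_void_event config_space_spaceD[OF measurable_X])
  also have "\<dots> = (\<integral>\<^sup>+\<omega>. num_in (X \<omega>) (B - C) * indicator {0} (num_in (X \<omega>) C) \<partial>M) +
     (\<integral>\<^sup>+\<omega>. indicator {1} (num_in (X \<omega>) (C \<inter> B)) * indicator {0} (num_in (X \<omega>) (C - B)) \<partial>M)"
    by (rule nn_integral_add) measurable
  also have "(\<integral>\<^sup>+\<omega>. num_in (X \<omega>) (B - C) * indicator {0} (num_in (X \<omega>) C) \<partial>M) =
     emeasure \<Theta> (B - C) * ennreal (exp (- measure \<Theta> C))"
    using B C by (subst nn_integral_num_in_indep[where f="\<lambda>x. x"]) (auto simp: nn_integral_num_in void)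
  also have "(\<integral>\<^sup>+\<omega>. indicator {1} (num_in (X \<omega>) (C \<inter> B)) * indicator {0} (num_in (X \<omega>) (C - B)) \<partial>M) =
     ennreal (measure \<Theta> (C \<inter> B) * exp (- measure \<Theta> (C \<inter> B))) * ennreal (exp (- measure \<Theta> (C - B)))"
    using B C prob_num_in[OF _ fin, of "C \<inter> B" 1]
    by (subst nn_integral_num_in_indep[where f="indicator {1}"]) (auto simp: void)
  also have "\<dots> = emeasure \<Theta> (C \<inter> B) * ennreal (exp (- measure \<Theta> C))"
  proof -
    have CB: "emeasure \<Theta> (C \<inter> B) = ennreal (measure \<Theta> (C \<inter> B))"
      using fin[of "C \<inter> B"] B C by (intro emeasure_eq_ennreal_measure) auto
    have "measure \<Theta> C = measure \<Theta> ((C \<inter> B) \<union> (C - B))"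
      by (intro arg_cong[where f="measure \<Theta>"]) auto
    also have "\<dots> = measure \<Theta> (C \<inter> B) + measure \<Theta> (C - B)"
      using fin[of "C \<inter> B"] fin[of "C - B"] B C by (intro measure_Union) auto
    finally show ?thesis
      by (simp add: CB ennreal_mult'[symmetric] exp_add[symmetric] mult.assoc)
  qed
  also have "emeasure \<Theta> (B - C) * ennreal (exp (- measure \<Theta> C)) + emeasure \<Theta> (C \<inter> B) * ennreal (exp (- measure \<Theta> C)) =
     emeasure \<Theta> B * ennreal (exp (- measure \<Theta> C))"
  proof -
    have "emeasure \<Theta> B = emeasure \<Theta> ((B - C) \<union> (C \<inter> B))"
      by (intro arg_cong[where f="emeasure \<Theta>"]) auto
    also have "\<dots> = emeasure \<Theta> (B - C) + emeasure \<Theta> (C \<inter> B)"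
      using B C by (intro plus_emeasure[symmetric]) auto
    finally show ?thesis by (simp add: distrib_right)
  qed
  also have "ennreal (exp (- measure \<Theta> C)) = (\<integral>\<^sup>+\<omega>. indicator (void_event C) (X \<omega>) \<partial>M)"
  proof -
    have "indicator {0} (num_in (X \<omega>) C) = (indicator (void_event C) (X \<omega>) :: ennreal)" if "\<omega> \<in> space M" for \<omega>
      using config_space_spaceD[OF measurable_X that] by (auto simp: indicator_def void_event_def num_in_eq_0_iff)
    then show ?thesis
      unfolding void[OF order_refl C(1), symmetric] by (intro nn_integral_cong)
  qed
  finally show ?thesis .
qed

text \<open>For indicators the left side is a measure on pairs of a hyperplane and the remaining
  configuration. By \<open>mecke_void\<close> it agrees with the product of \<Theta> and the law of
  the process on an intersection-stable generator, hence everywhere; monotone approximation passes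
  to functions.\<close>

theorem mecke:
  assumes f: "f \<in> borel_measurable (hyperplane_borel \<Otimes>\<^sub>M config_space)"
  shows "(\<integral>\<^sup>+\<omega>. \<integral>\<^sup>+H. f (H, X \<omega> - {H}) \<partial>count_space (X \<omega>) \<partial>M) = (\<integral>\<^sup>+H. \<integral>\<^sup>+\<omega>. f (H, X \<omega>) \<partial>M \<partial>\<Theta>)"
proof -
  let ?P = "hyperplane_borel \<Otimes>\<^sub>M config_space :: ('a set \<times> 'a set set) measure"
  let ?m = "\<lambda>A. \<integral>\<^sup>+\<omega>. \<integral>\<^sup>+H. indicator A (H, X \<omega> - {H}) \<partial>count_space (X \<omega>) \<partial>M"
  interpret \<Theta>: sigma_finite_measure \<Theta> by (rule sigma_finite_intensity)
  interpret L: prob_space config_law unfolding config_law_def by (rule prob_space_distr) measurable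
  have sets_law[measurable_cong, simp]: "sets config_law = sets config_space" by (simp add: config_law_def)
  interpret PL: pair_sigma_finite \<Theta> config_law ..
  define \<mu> where "\<mu> = measure_of (space ?P) (sets ?P) ?m"
  have meas[measurable]: "(\<lambda>\<omega>. \<integral>\<^sup>+H. f (H, X \<omega> - {H}) \<partial>count_space (X \<omega>)) \<in> borel_measurable M"
    if "f \<in> borel_measurable ?P" for f
    using measurable_compose[OF measurable_X measurable_mecke_summand[OF that]] .
  have sets_mu[measurable_cong, simp]: "sets \<mu> = sets ?P" unfolding \<mu>_def by (rule sets.sets_measure_of_eq)
  have em: "emeasure \<mu> A = ?m A" if A: "A \<in> sets ?P" for A
    unfolding \<mu>_def
  proof (rule emeasure_measure_of_sigma)
    show "sigma_algebra (space ?P) (sets ?P)" by (rule sets.sigma_algebra_axioms)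
    show "positive (sets ?P) ?m" by (simp add: positive_def)
    show "countably_additive (sets ?P) ?m"
    proof (rule countably_additiveI)
      fix A :: "nat \<Rightarrow> ('a set \<times> 'a set set) set"
      assume A: "range A \<subseteq> sets ?P" "disjoint_family A"
      have [measurable]: "A i \<in> sets ?P" for i using A by auto
      have "(\<Sum>i. ?m (A i)) = (\<integral>\<^sup>+\<omega>. (\<Sum>i. \<integral>\<^sup>+H. indicator (A i) (H, X \<omega> - {H}) \<partial>count_space (X \<omega>)) \<partial>M)"
        by (subst nn_integral_suminf) (auto intro!: meas)
      also have "\<dots> = (\<integral>\<^sup>+\<omega>. \<integral>\<^sup>+H. (\<Sum>i. indicator (A i) (H, X \<omega> - {H})) \<partial>count_space (X \<omega>) \<partial>M)"
        by (intro nn_integral_cong nn_integral_suminf[symmetric]) auto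
      also have "\<dots> = ?m (\<Union>i. A i)"
        using A(2) by (simp add: suminf_indicator)
      finally show "(\<Sum>i. ?m (A i)) = ?m (\<Union>i. A i)" .
    qed
  qed (use A in auto)
  have "\<mu> = \<Theta> \<Otimes>\<^sub>M config_law"
  proof (rule measure_eqI_generator_eq[where A="\<lambda>i. rad_hit i \<times> hyperplane_configs"])
    let ?G = "{B \<times> V |B V. B \<in> sets (hyperplane_borel :: 'a set measure) \<and> V \<in> (void_events :: 'a set set set set)}"
    show "Int_stable ?G"
    proof (rule Int_stableI)
      fix a b assume "a \<in> ?G" "b \<in> ?G"
      then obtain B V B' V' where *: "a = B \<times> V" "b = B' \<times> V'" "B \<in> sets hyperplane_borel" "B' \<in> sets hyperplane_borel"
        "V \<in> void_events" "V' \<in> void_events" by blast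
      have "a \<inter> b = (B \<inter> B') \<times> (V \<inter> V')" by (auto simp: *)
      moreover have "V \<inter> V' \<in> void_events"
        using Int_stable_void_events * unfolding Int_stable_def by blast
      ultimately show "a \<inter> b \<in> ?G" using * by blast
    qed
    show "?G \<subseteq> Pow (hyperplanes \<times> hyperplane_configs)"
      using sets.sets_into_space by (fastforce simp: void_events_def void_event_def space_hyperplane_borel)
    show "sets \<mu> = sigma_sets (hyperplanes \<times> hyperplane_configs) ?G"
      by (simp add: sets_pair_void_events)
    have "sets (\<Theta> \<Otimes>\<^sub>M config_law) = sets ?P" by (intro sets_pair_measure_cong) simp_all
    then show "sets (\<Theta> \<Otimes>\<^sub>M config_law) = sigma_sets (hyperplanes \<times> hyperplane_configs) ?G"
      by (simp add: sets_pair_void_events)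
    have eq: "emeasure \<mu> (B \<times> void_event C) = emeasure \<Theta> B * emeasure config_law (void_event C)"
      if "B \<in> sets hyperplane_borel" "C \<in> sets hyperplane_borel" "C \<subseteq> rad_hit n" for B C n
    proof -
      have V: "void_event C \<in> sets config_space" using that by (intro sets_void_event)
      have "(\<integral>\<^sup>+\<omega>. indicator (void_event C) (X \<omega>) \<partial>M) = (\<integral>\<^sup>+S. indicator (void_event C) S \<partial>config_law)"
        unfolding config_law_def using V by (subst nn_integral_distr) auto
      then have "emeasure config_law (void_event C) = (\<integral>\<^sup>+\<omega>. indicator (void_event C) (X \<omega>) \<partial>M)"
        using V by simp
      then show ?thesis using mecke_void[OF that] V that by (simp add: em)
    qed
    show "emeasure \<mu> Y = emeasure (\<Theta> \<Otimes>\<^sub>M config_law) Y" if Y: "Y \<in> ?G" for Y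
    proof -
      obtain B C n where *: "Y = B \<times> void_event C" "B \<in> sets hyperplane_borel" "C \<in> sets hyperplane_borel" "C \<subseteq> rad_hit n"
        using Y unfolding void_events_def by blast
      then show ?thesis
        using eq[OF *(2-4)] sets_void_event[OF *(3)] by (simp add: L.emeasure_pair_measure_Times)
    qed
    show "range (\<lambda>i. rad_hit i \<times> hyperplane_configs) \<subseteq> ?G"
      using space_in_void_events sets_rad_hit by blast
    show "(\<Union>i. rad_hit i \<times> hyperplane_configs) = hyperplanes \<times> hyperplane_configs"
      unfolding UN_rad_hit[symmetric] by auto
    fix i
    have "emeasure \<mu> (rad_hit i \<times> hyperplane_configs) = emeasure \<Theta> (rad_hit i) * emeasure config_law hyperplane_configs"
      using eq[of "rad_hit i" "{}" 0] by (simp add: void_event_empty)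
    also have "emeasure config_law hyperplane_configs = 1"
      using L.emeasure_space_1 sets_eq_imp_space_eq[OF sets_law] by (simp add: space_config_space)
    finally show "emeasure \<mu> (rad_hit i \<times> hyperplane_configs) \<noteq> \<infinity>"
      using intensity_rad_hit[of i] by (simp add: less_top)
  qed
  have "(\<integral>\<^sup>+\<omega>. \<integral>\<^sup>+H. f (H, X \<omega> - {H}) \<partial>count_space (X \<omega>) \<partial>M) = (\<integral>\<^sup>+y. f y \<partial>\<mu>)"
    using f
  proof (induction rule: borel_measurable_induct)
    case (cong f g)
    have "(\<integral>\<^sup>+H. f (H, X \<omega> - {H}) \<partial>count_space (X \<omega>)) = (\<integral>\<^sup>+H. g (H, X \<omega> - {H}) \<partial>count_space (X \<omega>))"
      if "\<omega> \<in> space M" for \<omega>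
    proof (rule nn_integral_cong)
      fix H assume "H \<in> space (count_space (X \<omega>))"
      then have "(H, X \<omega> - {H}) \<in> space ?P"
        using config_space_spaceD[OF measurable_X that] hyperplane_configs_subset
          hyperplane_configs_mono[OF config_space_spaceD[OF measurable_X that], of "X \<omega> - {H}"]
        by (auto simp: space_pair_measure space_hyperplane_borel space_config_space)
      then show "f (H, X \<omega> - {H}) = g (H, X \<omega> - {H})" using cong by simp
    qed
    moreover have "(\<integral>\<^sup>+y. f y \<partial>\<mu>) = (\<integral>\<^sup>+y. g y \<partial>\<mu>)"
      using cong(3) by (intro nn_integral_cong) (simp add: sets_eq_imp_space_eq[OF sets_mu])
    ultimately show ?case using cong(4) by (simp cong: nn_integral_cong)
  next
    case (set A)
    then show ?case by (simp add: em)
  next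
    case (mult u c)
    then show ?case by (simp add: nn_integral_cmult meas)
  next
    case (add u v)
    then show ?case by (simp add: nn_integral_add meas)
  next
    case (seq U)
    have "(\<integral>\<^sup>+\<omega>. \<integral>\<^sup>+H. (SUP i. U i) (H, X \<omega> - {H}) \<partial>count_space (X \<omega>) \<partial>M) =
      (\<integral>\<^sup>+\<omega>. (SUP i. \<integral>\<^sup>+H. U i (H, X \<omega> - {H}) \<partial>count_space (X \<omega>)) \<partial>M)"
      using seq(3) unfolding SUP_apply
      by (intro nn_integral_cong nn_integral_monotone_convergence_SUP) (auto simp: incseq_def le_fun_def)
    also have "\<dots> = (SUP i. \<integral>\<^sup>+\<omega>. \<integral>\<^sup>+H. U i (H, X \<omega> - {H}) \<partial>count_space (X \<omega>) \<partial>M)"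
      using seq(3) by (intro nn_integral_monotone_convergence_SUP meas seq(1))
        (auto simp: incseq_def le_fun_def intro!: nn_integral_mono)
    also have "\<dots> = (SUP i. \<integral>\<^sup>+y. U i y \<partial>\<mu>)" using seq by simp
    also have "\<dots> = (\<integral>\<^sup>+y. (SUP i. U i) y \<partial>\<mu>)"
      unfolding SUP_apply using seq by (intro nn_integral_monotone_convergence_SUP[symmetric]) auto
    finally show ?case .
  qed
  also have "\<dots> = (\<integral>\<^sup>+y. f y \<partial>(\<Theta> \<Otimes>\<^sub>M config_law))"
    by (simp add: \<open>\<mu> = \<Theta> \<Otimes>\<^sub>M config_law\<close>)
  also have "\<dots> = (\<integral>\<^sup>+H. \<integral>\<^sup>+S. f (H, S) \<partial>config_law \<partial>\<Theta>)"
  proof -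
    have "sets (\<Theta> \<Otimes>\<^sub>M config_law) = sets ?P" by (intro sets_pair_measure_cong) simp_all
    then have "f \<in> borel_measurable (\<Theta> \<Otimes>\<^sub>M config_law)" using f by (simp cong: measurable_cong_sets)
    then show ?thesis by (rule L.nn_integral_fst[symmetric])
  qed
  also have "\<dots> = (\<integral>\<^sup>+H. \<integral>\<^sup>+\<omega>. f (H, X \<omega>) \<partial>M \<partial>\<Theta>)"
    unfolding config_law_def
  proof (intro nn_integral_cong nn_integral_distr measurable_X)
    fix H assume "H \<in> space \<Theta>"
    then show "(\<lambda>S. f (H, S)) \<in> borel_measurable (distr M config_space X)"
      using measurable_Pair2[OF f, of H] by (simp add: space_intensity space_hyperplane_borel)
  qed
  finally show ?thesis .
qed

end

section \<open>The multivariate Mecke formula in parametrized form\<close>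

definition reps :: "'a::euclidean_space set set \<Rightarrow> ('a \<times> real) set" where
  "reps S = {p. norm (fst p) = 1 \<and> hyp p \<in> S}"

text \<open>Injectivity is asked of the hyperplanes and not of the pairs, so a tuple cannot contain
  both representatives of one hyperplane.\<close>

definition tuples :: "nat \<Rightarrow> 'a::euclidean_space set set \<Rightarrow> (nat \<Rightarrow> 'a \<times> real) set" where
  "tuples n S = {q \<in> {1..n} \<rightarrow>\<^sub>E reps S. inj_on (\<lambda>i. hyp (q i)) {1..n}}"

definition hyps :: "nat \<Rightarrow> (nat \<Rightarrow> 'a::euclidean_space \<times> real) \<Rightarrow> 'a set set" where
  "hyps n q = (\<lambda>i. hyp (q i)) ` {1..n}"

lemma nn_integral_count_space_Sigma:
  "(\<integral>\<^sup>+z. f z \<partial>count_space (Sigma A B)) = (\<integral>\<^sup>+x. \<integral>\<^sup>+y. f (x, y) \<partial>count_space (B x) \<partial>count_space A)"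
proof -
  have "(\<integral>\<^sup>+z. f z \<partial>count_space (Sigma A B)) = (\<integral>\<^sup>+z. f z * indicator (Sigma A B) z \<partial>count_space UNIV)"
    by (simp add: nn_integral_count_space_indicator)
  also have "\<dots> = (\<integral>\<^sup>+x. \<integral>\<^sup>+y. f (x, y) * indicator (Sigma A B) (x, y) \<partial>count_space UNIV \<partial>count_space UNIV)"
    by (rule nn_integral_fst_count_space[symmetric])
  also have "\<dots> = (\<integral>\<^sup>+x. (\<integral>\<^sup>+y. f (x, y) * indicator (B x) y \<partial>count_space UNIV) * indicator A x \<partial>count_space UNIV)"
    by (subst nn_integral_multc[symmetric]) (auto intro!: nn_integral_cong simp: indicator_def)
  finally show ?thesis
    by (simp add: nn_integral_count_space_indicator)
qed

lemma nn_integral_count_space_Un: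
  assumes "A \<inter> B = {}"
  shows "(\<integral>\<^sup>+x. f x \<partial>count_space (A \<union> B)) = (\<integral>\<^sup>+x. f x \<partial>count_space A) + (\<integral>\<^sup>+x. f x \<partial>count_space B)"
proof -
  have "(\<integral>\<^sup>+x. f x \<partial>count_space (A \<union> B)) = (\<integral>\<^sup>+x. f x * indicator A x + f x * indicator B x \<partial>count_space UNIV)"
    using assms by (subst nn_integral_count_space_indicator) (auto intro!: nn_integral_cong simp: indicator_def)
  then show ?thesis
    by (simp add: nn_integral_add nn_integral_count_space_indicator)
qed

text \<open>Equality would force H = H' and then a zero section, against the unit normal. This makes
  the two sheets of representatives disjoint, so the sum over them is a sum of two sums.\<close>

lemma sec_neq_uminus_sec:
  assumes "H \<in> hyperplanes" "H' \<in> hyperplanes"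
  shows "sec H \<noteq> - sec H'"
proof
  assume e: "sec H = - sec H'"
  then have "hyp (sec H) = hyp (sec H')" by (simp add: hyp_uminus)
  then have "H = H'" using sec assms by metis
  have "sec H + sec H' = 0" by (simp add: e)
  with \<open>H = H'\<close> have "sec H + sec H = 0" by simp
  then have "2 *\<^sub>R sec H = 0" by (simp only: scaleR_2)
  then have "sec H = 0" by simp
  then show False using sec(1)[OF assms(1)] by simp
qed

lemma reps_eq:
  assumes "S \<subseteq> hyperplanes"
  shows "reps S = sec ` S \<union> (\<lambda>H. - sec H) ` S"
proof
  show "reps S \<subseteq> sec ` S \<union> (\<lambda>H. - sec H) ` S"
  proof
    fix p assume p: "p \<in> reps S"
    then have H: "hyp p \<in> S" "norm (fst p) = 1" by (auto simp: reps_def)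
    then have "sec (hyp p) = p \<or> sec (hyp p) = - p"
      using sec[of "hyp p"] assms hyp_eq_iff[of p "sec (hyp p)"] by auto
    then show "p \<in> sec ` S \<union> (\<lambda>H. - sec H) ` S"
    proof
      assume "sec (hyp p) = p"
      then have "p \<in> sec ` S" using H(1) by (metis imageI)
      then show ?thesis by simp
    next
      assume "sec (hyp p) = - p"
      then have "p = - sec (hyp p)" by simp
      then have "p \<in> (\<lambda>H. - sec H) ` S" using H(1) by (metis imageI)
      then show ?thesis by simp
    qed
  qed
  show "sec ` S \<union> (\<lambda>H. - sec H) ` S \<subseteq> reps S"
    using sec[OF subsetD[OF assms]] by (auto simp: reps_def hyp_uminus simp del: split_paired_All)
qed

lemma nn_integral_reps:
  assumes "S \<subseteq> hyperplanes"
  shows "(\<integral>\<^sup>+p. f p \<partial>count_space (reps S)) = (\<integral>\<^sup>+H. f (sec H) + f (- sec H) \<partial>count_space S)"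
proof -
  have disj: "sec ` S \<inter> (\<lambda>H. - sec H) ` S = {}"
    using sec_neq_uminus_sec assms by blast
  have 1: "bij_betw sec S (sec ` S)"
    using sec_inj assms by (auto simp: bij_betw_def inj_on_def subset_eq)
  have 2: "bij_betw (\<lambda>H. - sec H) S ((\<lambda>H. - sec H) ` S)"
    using sec_inj assms by (auto simp: bij_betw_def inj_on_def subset_eq)
  show ?thesis
    unfolding reps_eq[OF assms] nn_integral_count_space_Un[OF disj]
    by (simp add: nn_integral_bij_count_space[OF 1, symmetric] nn_integral_bij_count_space[OF 2, symmetric] nn_integral_add)
qed

lemma tuples_0: "tuples 0 S = {\<lambda>_. undefined}"
  by (simp add: tuples_def)

lemma bij_betw_tuples_Suc:
  "bij_betw (\<lambda>(q, p). q(Suc n := p)) (SIGMA q:tuples n S. reps (S - hyps n q)) (tuples (Suc n) S)"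
proof (rule bij_betwI)
  have insert: "{1..Suc n} = insert (Suc n) {1..n}" by auto
  show "(\<lambda>(q, p). q(Suc n := p)) \<in> (SIGMA q:tuples n S. reps (S - hyps n q)) \<rightarrow> tuples (Suc n) S"
  proof (rule funcsetI, clarify)
    fix q p assume q: "q \<in> tuples n S" and p: "p \<in> reps (S - hyps n q)"
    have "q(Suc n := p) \<in> insert (Suc n) {1..n} \<rightarrow>\<^sub>E reps S"
      using q p by (intro PiE_fun_upd) (auto simp: tuples_def reps_def)
    moreover have "inj_on (\<lambda>i. hyp ((q(Suc n := p)) i)) (insert (Suc n) {1..n})"
    proof (subst inj_on_insert, intro conjI)
      have "inj_on (\<lambda>i. hyp (q i)) {1..n}" using q by (simp add: tuples_def)
      then show "inj_on (\<lambda>i. hyp ((q(Suc n := p)) i)) {1..n}"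
        by (rule inj_on_cong[THEN iffD1, rotated]) auto
      show "hyp ((q(Suc n := p)) (Suc n)) \<notin> (\<lambda>i. hyp ((q(Suc n := p)) i)) ` ({1..n} - {Suc n})"
        using p by (auto simp: reps_def hyps_def)
    qed
    ultimately show "q(Suc n := p) \<in> tuples (Suc n) S"
      unfolding tuples_def insert by blast
  qed
  show "(\<lambda>q. (restrict q {1..n}, q (Suc n))) \<in> tuples (Suc n) S \<rightarrow> (SIGMA q:tuples n S. reps (S - hyps n q))"
  proof (rule funcsetI)
    fix q assume q: "q \<in> tuples (Suc n) S"
    have "restrict q {1..n} \<in> tuples n S"
    proof -
      have "inj_on (\<lambda>i. hyp (q i)) {1..n}"
        using q by (auto simp: tuples_def insert intro: inj_on_subset)
      then have "inj_on (\<lambda>i. hyp (restrict q {1..n} i)) {1..n}"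
        by (rule inj_on_cong[THEN iffD1, rotated]) auto
      then show ?thesis using q by (auto simp: tuples_def PiE_iff)
    qed
    moreover have "q (Suc n) \<in> reps (S - hyps n (restrict q {1..n}))"
    proof -
      have "q (Suc n) \<in> reps S" using q by (auto simp: tuples_def PiE_iff)
      have "hyp (q (Suc n)) \<noteq> hyp (q i)" if "i \<in> {1..n}" for i
      proof
        assume e: "hyp (q (Suc n)) = hyp (q i)"
        have "inj_on (\<lambda>i. hyp (q i)) {1..Suc n}" using q by (simp add: tuples_def)
        from inj_onD[OF this e] show False using that by simp
      qed
      then have "hyp (q (Suc n)) \<notin> hyps n (restrict q {1..n})"
        unfolding hyps_def by force
      with \<open>q (Suc n) \<in> reps S\<close> show ?thesis by (simp add: reps_def)
    qed
    ultimately show "(restrict q {1..n}, q (Suc n)) \<in> (SIGMA q:tuples n S. reps (S - hyps n q))" by simp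
  qed
  show "(\<lambda>q. (restrict q {1..n}, q (Suc n))) ((\<lambda>(q, p). q(Suc n := p)) x) = x"
    if "x \<in> (SIGMA q:tuples n S. reps (S - hyps n q))" for x
    using that by (auto simp: tuples_def fun_eq_iff PiE_iff extensional_def restrict_def)
  show "(\<lambda>(q, p). q(Suc n := p)) ((\<lambda>q. (restrict q {1..n}, q (Suc n))) q) = q" if "q \<in> tuples (Suc n) S" for q
    using that by (auto simp: tuples_def fun_eq_iff PiE_iff extensional_def restrict_def le_Suc_eq)
qed

lemma nn_integral_tuples_Suc:
  "(\<integral>\<^sup>+q. f q \<partial>count_space (tuples (Suc n) S)) =
    (\<integral>\<^sup>+q. \<integral>\<^sup>+p. f (q(Suc n := p)) \<partial>count_space (reps (S - hyps n q)) \<partial>count_space (tuples n S))"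
proof -
  have "(\<integral>\<^sup>+q. f q \<partial>count_space (tuples (Suc n) S)) =
    (\<integral>\<^sup>+z. f ((\<lambda>(q, p). q(Suc n := p)) z) \<partial>count_space (SIGMA q:tuples n S. reps (S - hyps n q)))"
    by (rule nn_integral_bij_count_space[OF bij_betw_tuples_Suc, symmetric])
  also have "\<dots> = (\<integral>\<^sup>+q. \<integral>\<^sup>+p. f (q(Suc n := p)) \<partial>count_space (reps (S - hyps n q)) \<partial>count_space (tuples n S))"
    by (subst nn_integral_count_space_Sigma) simp
  finally show ?thesis .
qed

lemma hyps_Suc: "hyps (Suc n) (q(Suc n := p)) = insert (hyp p) (hyps n q)"
proof -
  have "{1..Suc n} = insert (Suc n) {1..n}" by auto
  then show ?thesis by (auto simp: hyps_def image_iff)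
qed

text \<open>Summing out the last entry of a tuple leaves a function of the shorter tuple and its
  residual configuration, of the same type as before. This is the recursion behind both the
  measurability and the value of sums over tuples.\<close>

definition extend_sum :: "nat \<Rightarrow> ((nat \<Rightarrow> 'a::euclidean_space \<times> real) \<times> 'a set set \<Rightarrow> ennreal) \<Rightarrow>
    (nat \<Rightarrow> 'a \<times> real) \<times> 'a set set \<Rightarrow> ennreal" where
  "extend_sum n F = (\<lambda>(q, S). \<integral>\<^sup>+p. F (q(Suc n := p), S - {hyp p}) \<partial>count_space (reps S))"

lemma nn_integral_tuples_extend_sum:
  "(\<integral>\<^sup>+q. F (q, S - hyps (Suc n) q) \<partial>count_space (tuples (Suc n) S)) =
    (\<integral>\<^sup>+q. extend_sum n F (q, S - hyps n q) \<partial>count_space (tuples n S))"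
  by (simp add: nn_integral_tuples_Suc extend_sum_def hyps_Suc Diff_insert[symmetric])

lemma measurable_tuple_upd:
  "(\<lambda>x. (fst x)(Suc n := snd x)) \<in> PiM {1..n} (\<lambda>_. borel) \<Otimes>\<^sub>M borel \<rightarrow>\<^sub>M PiM {1..Suc n} (\<lambda>_. borel)"
proof -
  have "{1..Suc n} = insert (Suc n) {1..n}" by auto
  then show ?thesis
    using measurable_add_dim[of "Suc n" "{1..n}" "\<lambda>_. borel"] by (simp add: split_beta')
qed

lemma measurable_extend_sum:
  fixes F :: "(nat \<Rightarrow> 'a::euclidean_space \<times> real) \<times> 'a set set \<Rightarrow> ennreal"
  assumes F: "F \<in> borel_measurable (PiM {1..Suc n} (\<lambda>_. borel) \<Otimes>\<^sub>M config_space)"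
  shows "extend_sum n F \<in> borel_measurable (PiM {1..n} (\<lambda>_. borel) \<Otimes>\<^sub>M config_space)"
proof -
  let ?N = "PiM {1..n} (\<lambda>_. borel) \<Otimes>\<^sub>M config_space :: ((nat \<Rightarrow> 'a \<times> real) \<times> 'a set set) measure"
  have rem: "(\<lambda>y. snd (fst y) - {snd y}) \<in> ?N \<Otimes>\<^sub>M hyperplane_borel \<rightarrow>\<^sub>M config_space"
    by (intro measurable_config_remove) measurable
  have G: "(\<lambda>y. F ((fst (fst y))(Suc n := s *\<^sub>R sec (snd y)), snd (fst y) - {snd y})) \<in> borel_measurable (?N \<Otimes>\<^sub>M hyperplane_borel)" for s :: real
  proof -
    have "(\<lambda>y. (fst (fst y), s *\<^sub>R sec (snd y))) \<in> ?N \<Otimes>\<^sub>M hyperplane_borel \<rightarrow>\<^sub>M PiM {1..n} (\<lambda>_. borel) \<Otimes>\<^sub>M borel"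
      by measurable
    from measurable_compose[OF this measurable_tuple_upd]
    have "(\<lambda>y. ((fst (fst y))(Suc n := s *\<^sub>R sec (snd y)), snd (fst y) - {snd y})) \<in>
        ?N \<Otimes>\<^sub>M hyperplane_borel \<rightarrow>\<^sub>M PiM {1..Suc n} (\<lambda>_. borel) \<Otimes>\<^sub>M config_space"
      by (intro measurable_Pair rem) simp
    from measurable_compose[OF this F] show ?thesis .
  qed
  have "(\<lambda>x. \<integral>\<^sup>+H. F ((fst x)(Suc n := 1 *\<^sub>R sec H), snd x - {H}) + F ((fst x)(Suc n := (-1) *\<^sub>R sec H), snd x - {H}) \<partial>count_space (snd x))
      \<in> borel_measurable ?N"
    using measurable_config_sum[of snd ?N "\<lambda>y. F ((fst (fst y))(Suc n := 1 *\<^sub>R sec (snd y)), snd (fst y) - {snd y}) +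
       F ((fst (fst y))(Suc n := (-1) *\<^sub>R sec (snd y)), snd (fst y) - {snd y})"] G[of 1] G[of "-1"] by simp
  moreover have "extend_sum n F x =
      (\<integral>\<^sup>+H. F ((fst x)(Suc n := 1 *\<^sub>R sec H), snd x - {H}) + F ((fst x)(Suc n := (-1) *\<^sub>R sec H), snd x - {H}) \<partial>count_space (snd x))"
    if "x \<in> space ?N" for x
  proof -
    have "snd x \<in> hyperplane_configs"
      using that by (auto simp: space_pair_measure space_config_space)
    then have sub: "snd x \<subseteq> hyperplanes"
      by (rule hyperplane_configs_subset)
    show ?thesis
      unfolding extend_sum_def using sec(2)[OF subsetD[OF sub]]
      by (auto simp: split_beta' nn_integral_reps[OF sub] hyp_uminus intro!: nn_integral_cong)
  qed
  ultimately show ?thesis by (subst measurable_cong)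
qed

lemma measurable_sum_tuples:
  fixes F :: "(nat \<Rightarrow> 'a::euclidean_space \<times> real) \<times> 'a set set \<Rightarrow> ennreal"
  assumes "F \<in> borel_measurable (PiM {1..n} (\<lambda>_. borel) \<Otimes>\<^sub>M config_space)"
  shows "(\<lambda>S. \<integral>\<^sup>+q. F (q, S - hyps n q) \<partial>count_space (tuples n S)) \<in> borel_measurable config_space"
  using assms
proof (induction n arbitrary: F)
  case 0
  have "(\<lambda>S. F (\<lambda>_. undefined, S)) \<in> borel_measurable config_space"
    by (rule measurable_Pair2[OF 0]) (simp add: space_PiM)
  then show ?case
    by (simp add: tuples_0 hyps_def nn_integral_count_space_finite)
next
  case (Suc n)
  show ?case
    using Suc.IH[OF measurable_extend_sum[OF Suc.prems]] by (simp add: nn_integral_tuples_extend_sum)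
qed

section \<open>The Mecke formula in normals and levels\<close>

context hyperplane_process
begin

lemma gamma_pos: "0 < \<gamma>"
  using intensity by (simp add: has_intensity_and_directional_distribution_def)

lemma prob_space_phi: "prob_space \<phi>"
  using intensity by (simp add: has_intensity_and_directional_distribution_def even_prob_on_sphere_def)

lemma sets_phi: "sets \<phi> = sets (restrict_space borel (sphere 0 1))"
  using intensity by (simp add: has_intensity_and_directional_distribution_def even_prob_on_sphere_def)

lemma space_phi: "space \<phi> = sphere 0 1"
  using sets_eq_imp_space_eq[OF sets_phi] by simp

lemma measurable_id_phi[measurable]: "(\<lambda>u. u) \<in> borel_measurable \<phi>"
proof -
  have "(\<lambda>u. u) \<in> restrict_space borel (sphere 0 1) \<rightarrow>\<^sub>M borel"
    by (intro measurable_restrict_space1) auto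
  then show ?thesis by (simp cong: measurable_cong_sets add: sets_phi)
qed

definition \<Psi> :: "('a \<times> real) measure" where
  "\<Psi> = \<phi> \<Otimes>\<^sub>M lborel"

lemma sigma_finite_Psi: "sigma_finite_measure \<Psi>"
proof -
  interpret \<phi>: prob_space \<phi> by (rule prob_space_phi)
  interpret pair_sigma_finite \<phi> lborel ..
  show ?thesis unfolding \<Psi>_def by unfold_locales
qed

lemma measurable_id_Psi[measurable]: "(\<lambda>p. p) \<in> borel_measurable \<Psi>"
proof -
  have "(\<lambda>p. (fst p, snd p)) \<in> \<Psi> \<rightarrow>\<^sub>M borel \<Otimes>\<^sub>M borel"
    unfolding \<Psi>_def by (intro measurable_Pair) measurable
  then show ?thesis by (simp add: borel_prod)
qed

lemma measurable_Psi: "f \<in> borel \<rightarrow>\<^sub>M N \<Longrightarrow> f \<in> \<Psi> \<rightarrow>\<^sub>M N"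
  using measurable_compose[OF measurable_id_Psi] .

lemma nn_integral_Psi:
  assumes "f \<in> borel_measurable borel"
  shows "(\<integral>\<^sup>+p. f p \<partial>\<Psi>) = (\<integral>\<^sup>+u. \<integral>\<^sup>+t. f (u, t) \<partial>lborel \<partial>\<phi>)"
  unfolding \<Psi>_def
  using measurable_Psi[OF assms] by (subst lborel.nn_integral_fst) (auto simp: \<Psi>_def)

lemma nn_integral_phi_uminus:
  assumes "f \<in> borel_measurable borel"
  shows "(\<integral>\<^sup>+u. f (- u) \<partial>\<phi>) = (\<integral>\<^sup>+u. f u \<partial>\<phi>)"
proof -
  have um: "uminus \<in> \<phi> \<rightarrow>\<^sub>M \<phi>"
  proof -
    have "uminus \<in> \<phi> \<rightarrow>\<^sub>M restrict_space borel (sphere 0 1)"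
      by (rule measurable_restrict_space2) (auto simp: space_phi)
    then show ?thesis by (simp cong: measurable_cong_sets add: sets_phi)
  qed
  have ev: "emeasure \<phi> (uminus ` A) = emeasure \<phi> A" if "A \<in> sets \<phi>" for A
    using intensity that by (simp add: has_intensity_and_directional_distribution_def even_prob_on_sphere_def)
  have "distr \<phi> \<phi> uminus = \<phi>"
  proof (rule measure_eqI)
    fix A assume A: "A \<in> sets (distr \<phi> \<phi> uminus)"
    then have "A \<subseteq> sphere 0 1" using sets.sets_into_space space_phi by auto
    then have "uminus -` A \<inter> space \<phi> = uminus ` A"
      by (force simp: space_phi image_iff)
    then show "emeasure (distr \<phi> \<phi> uminus) A = emeasure \<phi> A"
      using A um ev by (simp add: emeasure_distr)
  qed simp
  then have "(\<integral>\<^sup>+u. f u \<partial>\<phi>) = (\<integral>\<^sup>+u. f u \<partial>distr \<phi> \<phi> uminus)" by simp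
  also have "\<dots> = (\<integral>\<^sup>+u. f (- u) \<partial>\<phi>)"
    using measurable_compose[OF measurable_id_phi assms] um by (intro nn_integral_distr) simp_all
  finally show ?thesis ..
qed

lemma nn_integral_Psi_uminus:
  assumes f: "f \<in> borel_measurable borel"
  shows "(\<integral>\<^sup>+p. f (- p) \<partial>\<Psi>) = (\<integral>\<^sup>+p. f p \<partial>\<Psi>)"
proof -
  have [measurable]: "f \<in> borel_measurable (borel \<Otimes>\<^sub>M borel)" using f by (simp add: borel_prod)
  have "(\<integral>\<^sup>+p. f (- p) \<partial>\<Psi>) = (\<integral>\<^sup>+u. \<integral>\<^sup>+t. f (- u, - t) \<partial>lborel \<partial>\<phi>)"
    using f by (subst nn_integral_Psi) auto
  also have "\<dots> = (\<integral>\<^sup>+u. \<integral>\<^sup>+t. f (- u, t) \<partial>lborel \<partial>\<phi>)"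
  proof (rule nn_integral_cong)
    fix u
    have "(\<lambda>t. f (- u, t)) \<in> borel_measurable borel" by measurable
    from nn_integral_real_affine[OF this, of "-1" 0]
    show "(\<integral>\<^sup>+t. f (- u, - t) \<partial>lborel) = (\<integral>\<^sup>+t. f (- u, t) \<partial>lborel)" by simp
  qed
  also have "\<dots> = (\<integral>\<^sup>+u. \<integral>\<^sup>+t. f (u, t) \<partial>lborel \<partial>\<phi>)"
    by (rule nn_integral_phi_uminus[where f="\<lambda>u. \<integral>\<^sup>+t. f (u, t) \<partial>lborel"]) measurable
  also have "\<dots> = (\<integral>\<^sup>+p. f p \<partial>\<Psi>)" using f by (subst nn_integral_Psi) auto
  finally show ?thesis .
qed

text \<open>The two representatives contribute f(p) and f(-p). Evenness of \<phi> and reflection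
  invariance of Lebesgue measure make their integrals equal, which is the origin of the factor
  2.\<close>

lemma nn_integral_intensity_signed:
  assumes f: "f \<in> borel_measurable borel"
  shows "(\<integral>\<^sup>+H. f (sec H) + f (- sec H) \<partial>\<Theta>) = ennreal (2 * \<gamma>) * (\<integral>\<^sup>+p. f p \<partial>\<Psi>)"
proof -
  have [measurable]: "f \<in> borel_measurable (borel \<Otimes>\<^sub>M borel)" "f \<in> borel_measurable borel"
    using f by (simp_all add: borel_prod)
  have meas: "(\<lambda>H. f (sec H) + f (- sec H)) \<in> borel_measurable hyperplane_borel" by measurable
  have eq: "f (sec (hyperplane u t)) + f (- sec (hyperplane u t)) = f (u, t) + f (- (u, t))" if "u \<in> space \<phi>" for u t
  proof -
    have n: "norm u = 1" using that by (simp add: space_phi)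
    then have H: "hyperplane u t \<in> hyperplanes" by (auto simp: hyperplanes_def)
    have "hyp (u, t) = hyp (sec (hyperplane u t))"
      using sec[OF H] n by (simp add: hyp_def)
    then have "sec (hyperplane u t) = (u, t) \<or> sec (hyperplane u t) = - (u, t)"
      using hyp_eq_iff[of "(u, t)" "sec (hyperplane u t)"] n sec(1)[OF H] by simp
    then show ?thesis
    proof
      assume "sec (hyperplane u t) = - (u, t)"
      then show ?thesis by (simp add: add.commute)
    qed simp
  qed
  have "(\<integral>\<^sup>+H. f (sec H) + f (- sec H) \<partial>\<Theta>) =
     ennreal \<gamma> * (\<integral>\<^sup>+u. \<integral>\<^sup>+t. f (sec (hyperplane u t)) + f (- sec (hyperplane u t)) \<partial>lborel \<partial>\<phi>)"
    using intensity meas unfolding has_intensity_and_directional_distribution_def by blast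
  also have "\<dots> = ennreal \<gamma> * (\<integral>\<^sup>+u. \<integral>\<^sup>+t. f (u, t) + f (- (u, t)) \<partial>lborel \<partial>\<phi>)"
    by (intro arg_cong2[where f=times] refl nn_integral_cong eq)
  also have "\<dots> = ennreal \<gamma> * (\<integral>\<^sup>+p. f p + f (- p) \<partial>\<Psi>)"
    using f by (subst nn_integral_Psi) auto
  also have "(\<integral>\<^sup>+p. f p + f (- p) \<partial>\<Psi>) = 2 * (\<integral>\<^sup>+p. f p \<partial>\<Psi>)"
    using f by (subst nn_integral_add) (auto simp: nn_integral_Psi_uminus mult_2 intro!: measurable_Psi)
  also have "ennreal \<gamma> * (2 * (\<integral>\<^sup>+p. f p \<partial>\<Psi>)) = ennreal (2 * \<gamma>) * (\<integral>\<^sup>+p. f p \<partial>\<Psi>)"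
    using gamma_pos by (simp add: ennreal_mult mult_ac)
  finally show ?thesis .
qed

lemma measurable_expectation:
  assumes "F \<in> borel_measurable (N \<Otimes>\<^sub>M config_space)"
  shows "(\<lambda>x. \<integral>\<^sup>+\<omega>. F (x, X \<omega>) \<partial>M) \<in> borel_measurable N"
  using assms by simp

lemma mecke_signed:
  assumes f: "f \<in> borel_measurable (borel \<Otimes>\<^sub>M config_space)"
  shows "(\<integral>\<^sup>+\<omega>. \<integral>\<^sup>+p. f (p, X \<omega> - {hyp p}) \<partial>count_space (reps (X \<omega>)) \<partial>M) =
    ennreal (2 * \<gamma>) * (\<integral>\<^sup>+p. \<integral>\<^sup>+\<omega>. f (p, X \<omega>) \<partial>M \<partial>\<Psi>)"
proof -
  let ?g = "\<lambda>(H, S). f (sec H, S) + f (- sec H, S)"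
  have g: "?g \<in> borel_measurable (hyperplane_borel \<Otimes>\<^sub>M config_space)"
  using f by simp
  have "(\<integral>\<^sup>+\<omega>. \<integral>\<^sup>+p. f (p, X \<omega> - {hyp p}) \<partial>count_space (reps (X \<omega>)) \<partial>M) =
    (\<integral>\<^sup>+\<omega>. \<integral>\<^sup>+H. ?g (H, X \<omega> - {H}) \<partial>count_space (X \<omega>) \<partial>M)"
  proof (rule nn_integral_cong)
    fix \<omega> assume "\<omega> \<in> space M"
    then have sub: "X \<omega> \<subseteq> hyperplanes" using config_space_spaceD[OF measurable_X] hyperplane_configs_subset by blast
    show "(\<integral>\<^sup>+p. f (p, X \<omega> - {hyp p}) \<partial>count_space (reps (X \<omega>))) = (\<integral>\<^sup>+H. ?g (H, X \<omega> - {H}) \<partial>count_space (X \<omega>))"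
      using sec(2)[OF subsetD[OF sub]] by (auto simp: nn_integral_reps[OF sub] hyp_uminus intro!: nn_integral_cong)
  qed
  also have "\<dots> = (\<integral>\<^sup>+H. \<integral>\<^sup>+\<omega>. ?g (H, X \<omega>) \<partial>M \<partial>\<Theta>)"
    by (rule mecke[OF g])
  also have "\<dots> = (\<integral>\<^sup>+H. (\<integral>\<^sup>+\<omega>. f (sec H, X \<omega>) \<partial>M) + (\<integral>\<^sup>+\<omega>. f (- sec H, X \<omega>) \<partial>M) \<partial>\<Theta>)"
  proof (rule nn_integral_cong)
    fix H
    have "(\<lambda>\<omega>. f (p, X \<omega>)) \<in> borel_measurable M" for p
      by (rule measurable_compose[OF measurable_X measurable_Pair2[OF f]]) simp
    then show "(\<integral>\<^sup>+\<omega>. ?g (H, X \<omega>) \<partial>M) = (\<integral>\<^sup>+\<omega>. f (sec H, X \<omega>) \<partial>M) + (\<integral>\<^sup>+\<omega>. f (- sec H, X \<omega>) \<partial>M)"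
      by (simp add: nn_integral_add)
  qed
  also have "\<dots> = ennreal (2 * \<gamma>) * (\<integral>\<^sup>+p. \<integral>\<^sup>+\<omega>. f (p, X \<omega>) \<partial>M \<partial>\<Psi>)"
    by (rule nn_integral_intensity_signed[OF measurable_expectation[OF f]])
  finally show ?thesis .
qed

lemma measurable_id_PiM_Psi: "(\<lambda>q. q) \<in> PiM I (\<lambda>_. \<Psi>) \<rightarrow>\<^sub>M PiM I (\<lambda>_. borel)"
  by (simp add: measurable_PiM_single' space_PiM PiE_def)

text \<open>The induction hypothesis is applied to the function with the last entry summed out; for
  each fixed shorter tuple the one-point formula then replaces this sum by an integral and
  contributes another factor 2 \<gamma>.\<close>

theorem mecke_tuples:
  assumes "F \<in> borel_measurable (PiM {1..n} (\<lambda>_. borel) \<Otimes>\<^sub>M config_space)"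
  shows "(\<integral>\<^sup>+\<omega>. \<integral>\<^sup>+q. F (q, X \<omega> - hyps n q) \<partial>count_space (tuples n (X \<omega>)) \<partial>M) =
    ennreal ((2 * \<gamma>) ^ n) * (\<integral>\<^sup>+q. \<integral>\<^sup>+\<omega>. F (q, X \<omega>) \<partial>M \<partial>PiM {1..n} (\<lambda>_. \<Psi>))"
  using assms
proof (induction n arbitrary: F)
  case 0
  then show ?case
    by (simp add: tuples_0 hyps_def nn_integral_count_space_finite PiM_empty)
next
  case (Suc n)
  interpret \<Psi>: sigma_finite_measure \<Psi> by (rule sigma_finite_Psi)
  interpret product_sigma_finite "\<lambda>_::nat. \<Psi>" ..
  note F = Suc.prems
  have sec_meas: "(\<lambda>(p, S). F (q(Suc n := p), S)) \<in> borel_measurable (borel \<Otimes>\<^sub>M config_space)"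
    if q: "q \<in> space (PiM {1..n} (\<lambda>_. \<Psi>))" for q
  proof -
    have "q \<in> space (PiM {1..n} (\<lambda>_. borel))"
      using q by (simp add: space_PiM PiE_def)
    then have "(\<lambda>x. (q, fst x)) \<in> borel \<Otimes>\<^sub>M config_space \<rightarrow>\<^sub>M PiM {1..n} (\<lambda>_. borel) \<Otimes>\<^sub>M borel"
      by (intro measurable_Pair) auto
    from measurable_compose[OF this measurable_tuple_upd]
    have "(\<lambda>x. (q(Suc n := fst x), snd x)) \<in> borel \<Otimes>\<^sub>M config_space \<rightarrow>\<^sub>M PiM {1..Suc n} (\<lambda>_. borel) \<Otimes>\<^sub>M config_space"
      by (intro measurable_Pair) auto
    from measurable_compose[OF this F] show ?thesis by (simp add: split_beta')
  qed
  have "(\<integral>\<^sup>+\<omega>. \<integral>\<^sup>+q. F (q, X \<omega> - hyps (Suc n) q) \<partial>count_space (tuples (Suc n) (X \<omega>)) \<partial>M) =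
    ennreal ((2 * \<gamma>) ^ n) * (\<integral>\<^sup>+q. \<integral>\<^sup>+\<omega>. extend_sum n F (q, X \<omega>) \<partial>M \<partial>PiM {1..n} (\<lambda>_. \<Psi>))"
    unfolding nn_integral_tuples_extend_sum by (rule Suc.IH[OF measurable_extend_sum[OF F]])
  also have "(\<integral>\<^sup>+q. \<integral>\<^sup>+\<omega>. extend_sum n F (q, X \<omega>) \<partial>M \<partial>PiM {1..n} (\<lambda>_. \<Psi>)) =
     (\<integral>\<^sup>+q. ennreal (2 * \<gamma>) * (\<integral>\<^sup>+p. \<integral>\<^sup>+\<omega>. F (q(Suc n := p), X \<omega>) \<partial>M \<partial>\<Psi>) \<partial>PiM {1..n} (\<lambda>_. \<Psi>))"
    using mecke_signed[OF sec_meas] by (intro nn_integral_cong) (simp add: extend_sum_def)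
  also have "\<dots> = ennreal (2 * \<gamma>) * (\<integral>\<^sup>+q. \<integral>\<^sup>+p. \<integral>\<^sup>+\<omega>. F (q(Suc n := p), X \<omega>) \<partial>M \<partial>\<Psi> \<partial>PiM {1..n} (\<lambda>_. \<Psi>))"
  proof (rule nn_integral_cmult)
    have "(\<lambda>x. (fst x)(Suc n := snd x)) \<in> PiM {1..n} (\<lambda>_. \<Psi>) \<Otimes>\<^sub>M \<Psi> \<rightarrow>\<^sub>M PiM {1..Suc n} (\<lambda>_. borel)"
    proof (rule measurable_compose[OF _ measurable_tuple_upd])
      have "fst \<in> PiM {1..n} (\<lambda>_. \<Psi>) \<Otimes>\<^sub>M \<Psi> \<rightarrow>\<^sub>M PiM {1..n} (\<lambda>_. borel)"
        using measurable_compose[OF measurable_fst measurable_id_PiM_Psi] .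
      moreover have "snd \<in> PiM {1..n} (\<lambda>_. \<Psi>) \<Otimes>\<^sub>M \<Psi> \<rightarrow>\<^sub>M borel"
        using measurable_compose[OF measurable_snd measurable_id_Psi] .
      ultimately show "(\<lambda>x. x) \<in> PiM {1..n} (\<lambda>_. \<Psi>) \<Otimes>\<^sub>M \<Psi> \<rightarrow>\<^sub>M PiM {1..n} (\<lambda>_. borel) \<Otimes>\<^sub>M borel"
        by (simp add: measurable_pair_iff comp_def)
    qed
    from measurable_compose[OF this measurable_expectation[OF F]]
    show "(\<lambda>q. \<integral>\<^sup>+p. \<integral>\<^sup>+\<omega>. F (q(Suc n := p), X \<omega>) \<partial>M \<partial>\<Psi>) \<in> borel_measurable (PiM {1..n} (\<lambda>_. \<Psi>))"
      by (intro \<Psi>.borel_measurable_nn_integral) (simp add: split_beta')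
  qed
  also have "(\<integral>\<^sup>+q. \<integral>\<^sup>+p. \<integral>\<^sup>+\<omega>. F (q(Suc n := p), X \<omega>) \<partial>M \<partial>\<Psi> \<partial>PiM {1..n} (\<lambda>_. \<Psi>)) =
     (\<integral>\<^sup>+q. \<integral>\<^sup>+\<omega>. F (q, X \<omega>) \<partial>M \<partial>PiM {1..Suc n} (\<lambda>_. \<Psi>))"
  proof -
    have ins: "{1..Suc n} = insert (Suc n) {1..n}" by auto
    show ?thesis
      unfolding ins
      using measurable_compose[OF measurable_id_PiM_Psi measurable_expectation[OF F], unfolded ins]
      by (intro product_nn_integral_insert[symmetric]) auto
  qed
  moreover have "ennreal ((2 * \<gamma>) ^ Suc n) = ennreal ((2 * \<gamma>) ^ n) * ennreal (2 * \<gamma>)"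
    using gamma_pos by (subst ennreal_mult[symmetric]) (auto simp: mult.commute)
  ultimately show ?case by (simp only: mult.assoc)
qed

end

section \<open>Linear substitutions in product Lebesgue measure\<close>

abbreviation lebesgue_PiM :: "nat \<Rightarrow> (nat \<Rightarrow> real) measure" where
  "lebesgue_PiM n \<equiv> PiM {0..<n} (\<lambda>_. lborel)"

interpretation lborel_product: product_sigma_finite "\<lambda>_::nat. lborel :: real measure"
  by standard

lemma measurable_fun_upd_borel:
  fixes g :: "'x \<Rightarrow> real"
  assumes "f \<in> N \<rightarrow>\<^sub>M PiM {0..<n} (\<lambda>_. lborel)" "g \<in> borel_measurable N"
  shows "(\<lambda>x. (f x)(n := g x)) \<in> N \<rightarrow>\<^sub>M PiM {0..<Suc n} (\<lambda>_. lborel)"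
  using assms atLeast0_lessThan_Suc by simp

lemma nn_integral_lebesgue_PiM_Suc:
  assumes "f \<in> borel_measurable (lebesgue_PiM (Suc n))"
  shows "(\<integral>\<^sup>+x. f x \<partial>lebesgue_PiM (Suc n)) = (\<integral>\<^sup>+x. \<integral>\<^sup>+s. f (x(n := s)) \<partial>lborel \<partial>lebesgue_PiM n)"
  using lborel_product.product_nn_integral_insert[of "{0..<n}" n f] assms
  by (simp add: atLeast0_lessThan_Suc)

lemma measurable_lebesgue_PiM_upd:
  assumes "f \<in> borel_measurable (lebesgue_PiM (Suc n))"
  shows "(\<lambda>(x, s). f (x(n := s))) \<in> borel_measurable (lebesgue_PiM n \<Otimes>\<^sub>M lborel)"
  using measurable_compose[OF measurable_add_dim[of n "{0..<n}" "\<lambda>_. lborel"], of f] assms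
  by (simp add: atLeast0_lessThan_Suc split_beta')

lemma nn_integral_lebesgue_PiM_swap:
  assumes "(\<lambda>(x, s). g x s) \<in> borel_measurable (lebesgue_PiM n \<Otimes>\<^sub>M (lborel :: real measure))"
  shows "(\<integral>\<^sup>+x. \<integral>\<^sup>+s. g x s \<partial>lborel \<partial>lebesgue_PiM n) = (\<integral>\<^sup>+s. \<integral>\<^sup>+x. g x s \<partial>lebesgue_PiM n \<partial>lborel)"
proof -
  interpret pair_sigma_finite "lebesgue_PiM n" "lborel :: real measure"
    by (intro pair_sigma_finite.intro lborel_product.sigma_finite sigma_finite_lborel) simp
  show ?thesis using Fubini'[OF assms] by simp
qed

lemma nn_integral_lborel_shift:
  fixes f :: "real \<Rightarrow> ennreal"
  assumes "f \<in> borel_measurable borel"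
  shows "(\<integral>\<^sup>+s. f (s + a) \<partial>lborel) = (\<integral>\<^sup>+s. f s \<partial>lborel)"
  using nn_integral_real_affine[OF assms, of 1 a] by (simp add: add.commute)

lemma measurable_restrict_lborel:
  assumes "\<And>i. i \<in> I \<Longrightarrow> (\<lambda>x. f x i) \<in> borel_measurable N"
  shows "(\<lambda>x. \<lambda>i\<in>I. f x i :: real) \<in> N \<rightarrow>\<^sub>M PiM I (\<lambda>_. lborel)"
  using assms by (intro measurable_restrict) simp

lemma measurable_component_lborel:
  "i \<in> I \<Longrightarrow> (\<lambda>x. x i :: real) \<in> borel_measurable (PiM I (\<lambda>_. lborel))"
  using measurable_component_singleton[of i I "\<lambda>_. lborel :: real measure"] by simp

lemma nn_integral_lebesgue_PiM_shift:
  assumes "f \<in> borel_measurable (lebesgue_PiM n)"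
  shows "(\<integral>\<^sup>+x. f (\<lambda>i\<in>{0..<n}. x i + v i) \<partial>lebesgue_PiM n) = (\<integral>\<^sup>+x. f x \<partial>lebesgue_PiM n)"
  using assms
proof (induction n arbitrary: f)
  case 0
  then show ?case by (simp add: PiM_empty nn_integral_count_space_finite)
next
  case (Suc n)
  note f = Suc.prems
  note fu = measurable_lebesgue_PiM_upd[OF f]
  have upd: "(\<lambda>i\<in>{0..<Suc n}. (x(n := s)) i + v i) = (\<lambda>i\<in>{0..<n}. x i + v i)(n := s + v n)" for x s
    by (auto simp: fun_eq_iff)
  have meas: "(\<lambda>x. \<lambda>i\<in>{0..<Suc n}. x i + v i) \<in> lebesgue_PiM (Suc n) \<rightarrow>\<^sub>M lebesgue_PiM (Suc n)"
    by (intro measurable_restrict_lborel borel_measurable_add measurable_component_lborel) auto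
  have meas': "(\<lambda>x. \<lambda>i\<in>{0..<n}. x i + v i) \<in> lebesgue_PiM n \<rightarrow>\<^sub>M lebesgue_PiM n"
    by (intro measurable_restrict_lborel borel_measurable_add measurable_component_lborel) auto
  have fx: "(\<lambda>s. f (x(n := s))) \<in> borel_measurable borel" if "x \<in> space (lebesgue_PiM n)" for x
    using measurable_Pair2[OF fu that] by (simp add: fun_upd_def)
  have "(\<integral>\<^sup>+x. f (\<lambda>i\<in>{0..<Suc n}. x i + v i) \<partial>lebesgue_PiM (Suc n)) =
    (\<integral>\<^sup>+x. \<integral>\<^sup>+s. f ((\<lambda>i\<in>{0..<n}. x i + v i)(n := s + v n)) \<partial>lborel \<partial>lebesgue_PiM n)"
    by (subst nn_integral_lebesgue_PiM_Suc[OF measurable_compose[OF meas f]]) (simp only: upd)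
  also have "\<dots> = (\<integral>\<^sup>+x. \<integral>\<^sup>+s. f ((\<lambda>i\<in>{0..<n}. x i + v i)(n := s)) \<partial>lborel \<partial>lebesgue_PiM n)"
  proof (rule nn_integral_cong)
    fix x assume "x \<in> space (lebesgue_PiM n)"
    then have "(\<lambda>i\<in>{0..<n}. x i + v i) \<in> space (lebesgue_PiM n)" using measurable_space[OF meas'] by auto
    from nn_integral_lborel_shift[OF fx[OF this]]
    show "(\<integral>\<^sup>+s. f ((\<lambda>i\<in>{0..<n}. x i + v i)(n := s + v n)) \<partial>lborel) = (\<integral>\<^sup>+s. f ((\<lambda>i\<in>{0..<n}. x i + v i)(n := s)) \<partial>lborel)"
      by simp
  qed
  also have "\<dots> = (\<integral>\<^sup>+x. \<integral>\<^sup>+s. f (x(n := s)) \<partial>lborel \<partial>lebesgue_PiM n)"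
    using lborel.borel_measurable_nn_integral[OF fu] by (intro Suc.IH)
  also have "\<dots> = (\<integral>\<^sup>+x. f x \<partial>lebesgue_PiM (Suc n))"
    by (rule nn_integral_lebesgue_PiM_Suc[OF f, symmetric])
  finally show ?case .
qed

definition lin :: "nat \<Rightarrow> real mat \<Rightarrow> (nat \<Rightarrow> real) \<Rightarrow> nat \<Rightarrow> real" where
  "lin n A x = (\<lambda>i\<in>{0..<n}. \<Sum>j<n. A $$ (i, j) * x j)"

lemma measurable_lin: "lin n A \<in> lebesgue_PiM n \<rightarrow>\<^sub>M lebesgue_PiM n"
  unfolding lin_def
  by (intro measurable_restrict_lborel borel_measurable_sum borel_measurable_times
      borel_measurable_const measurable_component_lborel) auto

definition schur_last :: "nat \<Rightarrow> real mat \<Rightarrow> real mat" where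
  "schur_last n A = mat n n (\<lambda>(i, j). A $$ (i, j) - A $$ (i, n) * A $$ (n, j) / A $$ (n, n))"

text \<open>Multiplication by a unit lower triangular matrix clears the last row to the left of the
  pivot. What remains is block upper triangular, with the Schur complement and the pivot as diagonal
  blocks.\<close>

lemma det_schur_last:
  assumes A: "A \<in> carrier_mat (Suc n) (Suc n)" and c: "A $$ (n, n) \<noteq> 0"
  shows "Determinant.det A = A $$ (n, n) * Determinant.det (schur_last n A)"
proof -
  define B where "B = mat n n (\<lambda>(i, j). A $$ (i, j))"
  define b where "b = mat n 1 (\<lambda>(i, j). A $$ (i, n))"
  define r where "r = mat 1 n (\<lambda>(i, j). A $$ (n, j))"
  define c' where "c' = mat 1 1 (\<lambda>(i, j). A $$ (n, n))"
  define r' where "r' = mat 1 n (\<lambda>(i, j). - A $$ (n, j) / A $$ (n, n))"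
  note defs = B_def b_def r_def c'_def r'_def
  have A_eq: "A = four_block_mat B b r c'"
    using A by (intro eq_matI) (auto simp: defs less_Suc_eq)
  define U where "U = four_block_mat (1\<^sub>m n) (0\<^sub>m n 1) r' (1\<^sub>m 1)"
  have car: "B \<in> carrier_mat n n" "b \<in> carrier_mat n 1" "r \<in> carrier_mat 1 n" "c' \<in> carrier_mat 1 1"
    "r' \<in> carrier_mat 1 n" by (auto simp: defs)
  have detU: "Determinant.det U = 1"
    unfolding U_def using car by (subst det_four_block_mat_upper_right_zero[of _ n _ 1]) auto
  have Ucar: "U \<in> carrier_mat (Suc n) (Suc n)"
  using U_def by auto
  have "A * U = four_block_mat (B * 1\<^sub>m n + b * r') (B * 0\<^sub>m n 1 + b * 1\<^sub>m 1) (r * 1\<^sub>m n + c' * r') (r * 0\<^sub>m n 1 + c' * 1\<^sub>m 1)"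
    unfolding A_eq U_def using car by (intro mult_four_block_mat) auto
  also have "B * 1\<^sub>m n + b * r' = schur_last n A"
    using c by (intro eq_matI) (auto simp: defs schur_last_def scalar_prod_def)
  also have "r * 1\<^sub>m n + c' * r' = 0\<^sub>m 1 n"
    using c by (intro eq_matI) (auto simp: defs scalar_prod_def)
  also have "B * 0\<^sub>m n 1 + b * 1\<^sub>m 1 = b" using car by simp
  also have "r * 0\<^sub>m n 1 + c' * 1\<^sub>m 1 = c'" using car by simp
  finally have AU: "A * U = four_block_mat (schur_last n A) b (0\<^sub>m 1 n) c'" .
  have "Determinant.det A * Determinant.det U = Determinant.det (A * U)"
    using A Ucar by (simp add: det_mult)
  also have "\<dots> = Determinant.det (schur_last n A) * Determinant.det c'"
    unfolding AU using car by (intro det_four_block_mat_lower_left_zero[of _ n _ 1]) (auto simp: schur_last_def)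
  also have "Determinant.det c' = A $$ (n, n)"
    by (simp add: c'_def det_def)
  finally show ?thesis by (simp add: detU)
qed

text \<open>Take the last coordinate w of the image as new variable in place of the last variable,
  at the cost of a factor 1/|pivot|. The other coordinates of the image are then the Schur
  complement applied to x plus a shift proportional to w, so the induction hypothesis and
  translation invariance finish the substitution.\<close>

lemma nn_integral_lin_pivot:
  assumes IH: "\<And>A f. A \<in> carrier_mat n n \<Longrightarrow> Determinant.det A \<noteq> 0 \<Longrightarrow> f \<in> borel_measurable (lebesgue_PiM n) \<Longrightarrow>
      ennreal \<bar>Determinant.det A\<bar> * (\<integral>\<^sup>+x. f (lin n A x) \<partial>lebesgue_PiM n) = (\<integral>\<^sup>+x. f x \<partial>lebesgue_PiM n)"
    and A: "A \<in> carrier_mat (Suc n) (Suc n)" and c0: "A $$ (n, n) \<noteq> 0" and d: "Determinant.det A \<noteq> 0"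
    and f: "f \<in> borel_measurable (lebesgue_PiM (Suc n))"
  shows "ennreal \<bar>Determinant.det A\<bar> * (\<integral>\<^sup>+x. f (lin (Suc n) A x) \<partial>lebesgue_PiM (Suc n)) = (\<integral>\<^sup>+x. f x \<partial>lebesgue_PiM (Suc n))"
proof -
  let ?c = "A $$ (n, n)" and ?S = "schur_last n A"
  let ?b = "\<lambda>i. A $$ (i, n) / ?c"
  have detA: "Determinant.det A = ?c * Determinant.det ?S" by (rule det_schur_last[OF A c0])
  then have dS: "Determinant.det ?S \<noteq> 0" using d by auto
  have Scar: "?S \<in> carrier_mat n n" by (simp add: schur_last_def)
  note fu = measurable_lebesgue_PiM_upd[OF f]
  let ?g = "\<lambda>x w. f ((\<lambda>i\<in>{0..<n}. lin n ?S x i + ?b i * w)(n := w))"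
  let ?h = "\<lambda>x w. f ((\<lambda>i\<in>{0..<n}. x i + ?b i * w)(n := w))"
  have meas_h: "(\<lambda>(x, w). ?h x w) \<in> borel_measurable (lebesgue_PiM n \<Otimes>\<^sub>M lborel)"
  proof -
    have "(\<lambda>p. \<lambda>i\<in>{0..<n}. fst p i + ?b i * snd p) \<in> lebesgue_PiM n \<Otimes>\<^sub>M lborel \<rightarrow>\<^sub>M lebesgue_PiM n"
    by simp
    then have "(\<lambda>p. (\<lambda>i\<in>{0..<n}. fst p i + ?b i * snd p)(n := snd p)) \<in> lebesgue_PiM n \<Otimes>\<^sub>M lborel \<rightarrow>\<^sub>M lebesgue_PiM (Suc n)"
      by (rule measurable_fun_upd_borel) measurable
    from measurable_compose[OF this f] show ?thesis by (simp add: split_beta')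
  qed
  have meas_g: "(\<lambda>(x, w). ?g x w) \<in> borel_measurable (lebesgue_PiM n \<Otimes>\<^sub>M lborel)"
  using measurable_lin meas_h by simp
  have inner: "(\<integral>\<^sup>+s. f (lin (Suc n) A (x(n := s))) \<partial>lborel) = ennreal (1 / \<bar>?c\<bar>) * (\<integral>\<^sup>+w. ?g x w \<partial>lborel)"
    if x: "x \<in> space (lebesgue_PiM n)" for x
  proof -
    let ?L = "\<Sum>j<n. A $$ (n, j) * x j"
    have eq: "lin (Suc n) A (x(n := s)) = (\<lambda>i\<in>{0..<n}. lin n ?S x i + ?b i * (?L + ?c * s))(n := ?L + ?c * s)" for s
    proof
      fix i
      consider "i < n" | "i = n" | "i > n" by linarith
      then show "lin (Suc n) A (x(n := s)) i = ((\<lambda>i\<in>{0..<n}. lin n ?S x i + ?b i * (?L + ?c * s))(n := ?L + ?c * s)) i"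
      proof cases
        case 1
        have "lin n ?S x i = (\<Sum>j<n. A $$ (i, j) * x j - A $$ (i, n) / ?c * (A $$ (n, j) * x j))"
          unfolding lin_def using 1 by (auto simp: schur_last_def algebra_simps intro!: sum.cong)
        also have "\<dots> = (\<Sum>j<n. A $$ (i, j) * x j) - ?b i * ?L"
          by (simp add: sum_subtractf sum_distrib_left)
        finally show ?thesis using 1 c0 by (simp add: lin_def algebra_simps)
      qed (auto simp: lin_def)
    qed
    have gx: "(\<lambda>w. ?g x w) \<in> borel_measurable borel"
      using measurable_Pair2[OF meas_g x] by simp
    have "(\<integral>\<^sup>+w. ?g x w \<partial>lborel) = ennreal \<bar>?c\<bar> * (\<integral>\<^sup>+s. ?g x (?L + ?c * s) \<partial>lborel)"
      using nn_integral_real_affine[OF gx c0, of ?L] by simp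
    then have "ennreal (1 / \<bar>?c\<bar>) * (\<integral>\<^sup>+w. ?g x w \<partial>lborel) = (ennreal (1 / \<bar>?c\<bar>) * ennreal \<bar>?c\<bar>) * (\<integral>\<^sup>+s. ?g x (?L + ?c * s) \<partial>lborel)"
      by (simp only: mult.assoc)
    also have "ennreal (1 / \<bar>?c\<bar>) * ennreal \<bar>?c\<bar> = 1"
      using c0 by (subst ennreal_mult'[symmetric]) auto
    finally show ?thesis by (simp only: eq mult_1_left)
  qed
  have meas_lin: "(\<lambda>x. f (lin (Suc n) A x)) \<in> borel_measurable (lebesgue_PiM (Suc n))"
    by (rule measurable_compose[OF measurable_lin f])
  have hw: "(\<lambda>x. ?h x w) \<in> borel_measurable (lebesgue_PiM n)" for w
    using measurable_Pair1[OF meas_h, of w] by simp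
  have "(\<integral>\<^sup>+x. f (lin (Suc n) A x) \<partial>lebesgue_PiM (Suc n)) =
     (\<integral>\<^sup>+x. ennreal (1 / \<bar>?c\<bar>) * (\<integral>\<^sup>+w. ?g x w \<partial>lborel) \<partial>lebesgue_PiM n)"
    unfolding nn_integral_lebesgue_PiM_Suc[OF meas_lin] by (intro nn_integral_cong inner)
  also have "\<dots> = ennreal (1 / \<bar>?c\<bar>) * (\<integral>\<^sup>+x. \<integral>\<^sup>+w. ?g x w \<partial>lborel \<partial>lebesgue_PiM n)"
    by (intro nn_integral_cmult lborel.borel_measurable_nn_integral meas_g)
  also have "(\<integral>\<^sup>+x. \<integral>\<^sup>+w. ?g x w \<partial>lborel \<partial>lebesgue_PiM n) = (\<integral>\<^sup>+w. \<integral>\<^sup>+x. ?g x w \<partial>lebesgue_PiM n \<partial>lborel)"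
    by (rule nn_integral_lebesgue_PiM_swap[OF meas_g])
  finally have "ennreal \<bar>Determinant.det A\<bar> * (\<integral>\<^sup>+x. f (lin (Suc n) A x) \<partial>lebesgue_PiM (Suc n)) =
     ennreal \<bar>Determinant.det A\<bar> * ennreal (1 / \<bar>?c\<bar>) * (\<integral>\<^sup>+w. \<integral>\<^sup>+x. ?g x w \<partial>lebesgue_PiM n \<partial>lborel)"
    by (simp add: mult.assoc)
  also have "ennreal \<bar>Determinant.det A\<bar> * ennreal (1 / \<bar>?c\<bar>) = ennreal \<bar>Determinant.det ?S\<bar>"
    using c0 by (subst ennreal_mult'[symmetric]) (auto simp: detA abs_mult)
  also have "ennreal \<bar>Determinant.det ?S\<bar> * (\<integral>\<^sup>+w. \<integral>\<^sup>+x. ?g x w \<partial>lebesgue_PiM n \<partial>lborel) =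
     (\<integral>\<^sup>+w. ennreal \<bar>Determinant.det ?S\<bar> * (\<integral>\<^sup>+x. ?g x w \<partial>lebesgue_PiM n) \<partial>lborel)"
  proof (rule nn_integral_cmult[symmetric])
    interpret pair_sigma_finite "lborel :: real measure" "lebesgue_PiM n"
      by (intro pair_sigma_finite.intro lborel_product.sigma_finite sigma_finite_lborel) simp
    show "(\<lambda>w. \<integral>\<^sup>+x. ?g x w \<partial>lebesgue_PiM n) \<in> borel_measurable lborel"
      using measurable_pair_swap[OF meas_g] by (intro M2.borel_measurable_nn_integral) (simp add: split_beta')
  qed
  also have "\<dots> = (\<integral>\<^sup>+w. \<integral>\<^sup>+x. ?h x w \<partial>lebesgue_PiM n \<partial>lborel)"
    using IH[OF Scar dS hw] by (intro nn_integral_cong) simp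
  also have "\<dots> = (\<integral>\<^sup>+w. \<integral>\<^sup>+x. f (x(n := w)) \<partial>lebesgue_PiM n \<partial>lborel)"
  proof (rule nn_integral_cong)
    fix w
    have "(\<lambda>x. f (x(n := w))) \<in> borel_measurable (lebesgue_PiM n)"
      using measurable_Pair1[OF fu, of w] by simp
    from nn_integral_lebesgue_PiM_shift[OF this, of "\<lambda>i. ?b i * w"]
    show "(\<integral>\<^sup>+x. ?h x w \<partial>lebesgue_PiM n) = (\<integral>\<^sup>+x. f (x(n := w)) \<partial>lebesgue_PiM n)" .
  qed
  also have "\<dots> = (\<integral>\<^sup>+x. \<integral>\<^sup>+w. f (x(n := w)) \<partial>lborel \<partial>lebesgue_PiM n)"
    by (rule nn_integral_lebesgue_PiM_swap[OF fu, symmetric])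
  also have "\<dots> = (\<integral>\<^sup>+x. f x \<partial>lebesgue_PiM (Suc n))"
    by (rule nn_integral_lebesgue_PiM_Suc[OF f, symmetric])
  finally show ?thesis .
qed

lemma measurable_shear:
  assumes f: "f \<in> borel_measurable (lebesgue_PiM (Suc n))" and i: "i < n"
  shows "(\<lambda>x. f (x(n := x n - x i))) \<in> borel_measurable (lebesgue_PiM (Suc n))"
proof -
  have "(\<lambda>x. \<lambda>j\<in>{0..<Suc n}. if j = n then x n - x i else x j) \<in> lebesgue_PiM (Suc n) \<rightarrow>\<^sub>M lebesgue_PiM (Suc n)"
  using i by simp
  from measurable_compose[OF this f] show ?thesis
  proof (rule measurable_cong[THEN iffD1, rotated])
    fix x assume "x \<in> space (lebesgue_PiM (Suc n))"
    then have "(\<lambda>j\<in>{0..<Suc n}. if j = n then x n - x i else x j) = x(n := x n - x i)"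
      using i by (auto simp: space_PiM fun_eq_iff PiE_iff extensional_def)
    then show "f (\<lambda>j\<in>{0..<Suc n}. if j = n then x n - x i else x j) = f (x(n := x n - x i))" by simp
  qed
qed

lemma nn_integral_shear:
  assumes f: "f \<in> borel_measurable (lebesgue_PiM (Suc n))" and i: "i < n"
  shows "(\<integral>\<^sup>+x. f (x(n := x n - x i)) \<partial>lebesgue_PiM (Suc n)) = (\<integral>\<^sup>+x. f x \<partial>lebesgue_PiM (Suc n))"
proof -
  note fu = measurable_lebesgue_PiM_upd[OF f]
  note meas = measurable_shear[OF assms]
  have "(\<integral>\<^sup>+x. f (x(n := x n - x i)) \<partial>lebesgue_PiM (Suc n)) =
    (\<integral>\<^sup>+x. \<integral>\<^sup>+s. f (x(n := s + (- x i))) \<partial>lborel \<partial>lebesgue_PiM n)"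
    unfolding nn_integral_lebesgue_PiM_Suc[OF meas] using i by simp
  also have "\<dots> = (\<integral>\<^sup>+x. \<integral>\<^sup>+s. f (x(n := s)) \<partial>lborel \<partial>lebesgue_PiM n)"
  proof (rule nn_integral_cong)
    fix x assume "x \<in> space (lebesgue_PiM n)"
    then have "(\<lambda>s. f (x(n := s))) \<in> borel_measurable borel" using measurable_Pair2[OF fu, of x] by simp
    from nn_integral_lborel_shift[OF this]
    show "(\<integral>\<^sup>+s. f (x(n := s + (- x i))) \<partial>lborel) = (\<integral>\<^sup>+s. f (x(n := s)) \<partial>lborel)" .
  qed
  finally show ?thesis unfolding nn_integral_lebesgue_PiM_Suc[OF f] .
qed

theorem nn_integral_lin:
  assumes "A \<in> carrier_mat n n" "Determinant.det A \<noteq> 0" "f \<in> borel_measurable (lebesgue_PiM n)"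
  shows "ennreal \<bar>Determinant.det A\<bar> * (\<integral>\<^sup>+x. f (lin n A x) \<partial>lebesgue_PiM n) = (\<integral>\<^sup>+x. f x \<partial>lebesgue_PiM n)"
  using assms
proof (induction n arbitrary: A f)
  case 0
  then show ?case by (simp add: PiM_empty lin_def nn_integral_count_space_finite)
next
  case (Suc n)
  note A = Suc.prems(1) and d = Suc.prems(2) and f = Suc.prems(3)
  show ?case
  proof (cases "A $$ (n, n) = 0")
    case False
    then show ?thesis by (intro nn_integral_lin_pivot[OF Suc.IH A _ d f]) auto
  next
    case True
    \<comment> \<open>Otherwise the last column vanishes and A annihilates the last unit
      vector.\<close>
    have "\<exists>i<n. A $$ (i, n) \<noteq> 0"
    proof (rule ccontr)
      assume "\<not> ?thesis"
      then have z: "A $$ (i, n) = 0" if "i < Suc n" for i using that True by (auto simp: less_Suc_eq)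
      have "A *\<^sub>v unit_vec (Suc n) n = 0\<^sub>v (Suc n)"
        using A z by (intro eq_vecI) (auto simp: scalar_prod_def unit_vec_def if_distrib cong: if_cong)
      then have "Determinant.det A = 0"
        unfolding det_0_iff_vec_prod_zero[OF A]
        by (intro exI[of _ "unit_vec (Suc n) n"]) (auto simp: unit_vec_def vec_eq_iff)
      then show False using d by simp
    qed
    then obtain i where i: "i < n" "A $$ (i, n) \<noteq> 0" by blast
    \<comment> \<open>Adding row i to the last row produces a nonzero pivot without changing the
      determinant. Precomposing f with the shear \<open>x n - x i\<close> undoes the row operation
      in the image.\<close>
    let ?A = "addrow 1 n i A"
    have A': "?A \<in> carrier_mat (Suc n) (Suc n)" using A by simp
    have det': "Determinant.det ?A = Determinant.det A" using i A by (intro det_addrow) auto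
    have nz: "?A $$ (n, n) \<noteq> 0" using A i True by simp
    let ?f = "\<lambda>x. f (x(n := x n - x i))"
    have eq: "?f (lin (Suc n) ?A x) = f (lin (Suc n) A x)" for x
    proof (rule arg_cong[where f=f], rule ext)
      fix j
      show "((lin (Suc n) ?A x)(n := lin (Suc n) ?A x n - lin (Suc n) ?A x i)) j = lin (Suc n) A x j"
        using i A by (cases "j = n")
          (auto simp: lin_def sum.distrib algebra_simps intro!: sum.cong)
    qed
    have meas: "?f \<in> borel_measurable (lebesgue_PiM (Suc n))"
      by (rule measurable_shear[OF f i(1)])
    have "ennreal \<bar>Determinant.det ?A\<bar> * (\<integral>\<^sup>+x. ?f (lin (Suc n) ?A x) \<partial>lebesgue_PiM (Suc n)) = (\<integral>\<^sup>+x. ?f x \<partial>lebesgue_PiM (Suc n))"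
      using d det' by (intro nn_integral_lin_pivot[OF Suc.IH A' nz _ meas]) auto
    then show ?thesis
      unfolding eq det' nn_integral_shear[OF f i(1)] .
  qed
qed

section \<open>Changing from levels to center and radius\<close>

lemma nn_integral_lborel_coordinates:
  fixes g :: "'a::euclidean_space \<Rightarrow> ennreal"
  assumes g: "g \<in> borel_measurable borel"
  shows "(\<integral>\<^sup>+z. g z \<partial>lborel) =
    (\<integral>\<^sup>+x. g (\<Sum>j<DIM('a). x j *\<^sub>R from_nat_into Basis j) \<partial>lebesgue_PiM DIM('a))"
proof -
  let ?b = "from_nat_into (Basis :: 'a set)"
  let ?h = "\<lambda>x. \<Sum>j<DIM('a). x j *\<^sub>R ?b j"
  have bij: "bij_betw ?b {..<DIM('a)} Basis"
    using bij_betw_from_nat_into_finite[OF finite_Basis] .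
  have inner_h: "inner (?h x) (?b i) = x i" if "i < DIM('a)" for x i
  proof -
    have "inner (?h x) (?b i) = (\<Sum>j<DIM('a). x j * inner (?b j) (?b i))"
      by (simp add: inner_sum_left)
    also have "\<dots> = (\<Sum>j<DIM('a). if j = i then x j else 0)"
    proof (intro sum.cong refl)
      fix j assume j: "j \<in> {..<DIM('a)}"
      have "?b j \<in> Basis" "?b i \<in> Basis"
        using bij j that by (auto simp: bij_betw_def)
      moreover have "?b j = ?b i \<longleftrightarrow> j = i"
        using bij j that by (auto simp: bij_betw_def inj_on_def)
      ultimately show "x j * inner (?b j) (?b i) = (if j = i then x j else 0)"
        by (auto simp: inner_Basis)
    qed
    finally show ?thesis using that by simp
  qed
  have h[measurable]: "?h \<in> lebesgue_PiM DIM('a) \<rightarrow>\<^sub>M borel"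
    by (intro borel_measurable_sum borel_measurable_scaleR borel_measurable_const measurable_component_lborel) auto
  have "lborel = distr (lebesgue_PiM DIM('a)) borel ?h"
  proof (rule lborel_eqI)
    fix l u :: 'a assume le: "\<And>b. b \<in> Basis \<Longrightarrow> inner l b \<le> inner u b"
    have pre: "?h -` box l u \<inter> space (lebesgue_PiM DIM('a)) =
        (\<Pi>\<^sub>E i\<in>{0..<DIM('a)}. {inner l (?b i)<..<inner u (?b i)})"
    proof -
      have "?h x \<in> box l u \<longleftrightarrow> (\<forall>i<DIM('a). inner l (?b i) < x i \<and> x i < inner u (?b i))" for x
      proof -
        have "?h x \<in> box l u \<longleftrightarrow> (\<forall>b\<in>?b ` {..<DIM('a)}. inner l b < inner (?h x) b \<and> inner (?h x) b < inner u b)"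
          using bij by (simp add: mem_box bij_betw_def)
        then show ?thesis using inner_h by auto
      qed
      then show ?thesis by (auto simp: space_PiM PiE_def Pi_iff)
    qed
    have "emeasure (distr (lebesgue_PiM DIM('a)) borel ?h) (box l u) =
      (\<Prod>i\<in>{0..<DIM('a)}. emeasure lborel {inner l (?b i)<..<inner u (?b i)})"
      unfolding pre[symmetric]
      by (subst emeasure_distr) (simp_all add: pre lborel_product.emeasure_PiM)
    also have "\<dots> = (\<Prod>i\<in>{0..<DIM('a)}. ennreal (inner (u - l) (?b i)))"
    proof (intro prod.cong refl)
      fix i assume "i \<in> {0..<DIM('a)}"
      then have "?b i \<in> Basis" using bij by (auto simp: bij_betw_def)
      then show "emeasure lborel {inner l (?b i)<..<inner u (?b i)} = ennreal (inner (u - l) (?b i))"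
        using le[of "?b i"] by (simp add: inner_diff_left)
    qed
    also have "\<dots> = ennreal (\<Prod>i<DIM('a). inner (u - l) (?b i))"
    proof -
      have "0 \<le> inner (u - l) (?b i)" if "i < DIM('a)" for i
        using le[of "?b i"] bij that by (auto simp: bij_betw_def inner_diff_left)
      then show ?thesis by (subst prod_ennreal) (auto simp: atLeast0LessThan)
    qed
    also have "(\<Prod>i<DIM('a). inner (u - l) (?b i)) = (\<Prod>b\<in>Basis. inner (u - l) b)"
      by (rule prod.reindex_bij_betw[OF bij])
    finally show "emeasure (distr (lebesgue_PiM DIM('a)) borel ?h) (box l u) = ennreal (\<Prod>b\<in>Basis. inner (u - l) b)" .
  qed simp
  then have "(\<integral>\<^sup>+z. g z \<partial>lborel) = (\<integral>\<^sup>+z. g z \<partial>distr (lebesgue_PiM DIM('a)) borel ?h)" by simp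
  also have "\<dots> = (\<integral>\<^sup>+x. g (?h x) \<partial>lebesgue_PiM DIM('a))"
    using g by (intro nn_integral_distr h) simp
  finally show ?thesis .
qed

text \<open>Tuples are numbered from 1, matrix rows and coordinates from 0; the shift by one is
  measure preserving.\<close>

lemma nn_integral_PiM_shift_index:
  assumes f: "f \<in> borel_measurable (PiM {1..n} (\<lambda>_. lborel :: real measure))"
  shows "(\<integral>\<^sup>+y. f (\<lambda>i\<in>{1..n}. y (i - 1)) \<partial>lebesgue_PiM n) = (\<integral>\<^sup>+t. f t \<partial>PiM {1..n} (\<lambda>_. lborel))"
proof -
  let ?h = "\<lambda>y. \<lambda>i\<in>{1..n}. y (i - 1) :: real"
  have h: "?h \<in> lebesgue_PiM n \<rightarrow>\<^sub>M PiM {1..n} (\<lambda>_. lborel)"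
    by (intro measurable_restrict_lborel measurable_component_lborel) auto
  have "distr (lebesgue_PiM n) (PiM {1..n} (\<lambda>_. lborel)) ?h = PiM {1..n} (\<lambda>_. lborel)"
  proof (rule lborel_product.PiM_eqI)
    fix A :: "nat \<Rightarrow> real set" assume A: "\<And>i. i \<in> {1..n} \<Longrightarrow> A i \<in> sets lborel"
    have "?h -` Pi\<^sub>E {1..n} A \<inter> space (lebesgue_PiM n) = (\<Pi>\<^sub>E i\<in>{0..<n}. A (Suc i))"
    proof (intro Set.set_eqI iffI)
      fix y assume y: "y \<in> ?h -` Pi\<^sub>E {1..n} A \<inter> space (lebesgue_PiM n)"
      have "y i \<in> A (Suc i)" if "i < n" for i
      proof -
        have "?h y (Suc i) \<in> A (Suc i)" using y that by (intro PiE_mem[of "?h y" "{1..n}"]) auto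
        then show ?thesis using that by simp
      qed
      then show "y \<in> (\<Pi>\<^sub>E i\<in>{0..<n}. A (Suc i))" using y by (auto simp: space_PiM PiE_def)
    next
      fix y assume y: "y \<in> (\<Pi>\<^sub>E i\<in>{0..<n}. A (Suc i))"
      have "y (i - 1) \<in> A i" if "i \<in> {1..n}" for i
      proof -
        have "y (i - 1) \<in> A (Suc (i - 1))" using y that by (intro PiE_mem[OF y]) auto
        then show ?thesis using that by simp
      qed
      then show "y \<in> ?h -` Pi\<^sub>E {1..n} A \<inter> space (lebesgue_PiM n)"
        using y by (auto simp: space_PiM PiE_def)
    qed
    then have "emeasure (distr (lebesgue_PiM n) (PiM {1..n} (\<lambda>_. lborel)) ?h) (Pi\<^sub>E {1..n} A) =
      emeasure (lebesgue_PiM n) (\<Pi>\<^sub>E i\<in>{0..<n}. A (Suc i))"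
      using A by (subst emeasure_distr[OF h]) (auto intro!: sets_PiM_I_finite)
    also have "\<dots> = (\<Prod>i\<in>{0..<n}. emeasure lborel (A (Suc i)))"
      using A by (intro lborel_product.emeasure_PiM) auto
    also have "\<dots> = (\<Prod>i\<in>{1..n}. emeasure lborel (A i))"
      by (rule prod.reindex_bij_witness[of _ "\<lambda>i. i - 1" Suc]) auto
    finally show "emeasure (distr (lebesgue_PiM n) (PiM {1..n} (\<lambda>_. lborel)) ?h) (Pi\<^sub>E {1..n} A) =
      (\<Prod>i\<in>{1..n}. emeasure lborel (A i))" .
  qed simp_all
  then have "(\<integral>\<^sup>+t. f t \<partial>PiM {1..n} (\<lambda>_. lborel)) = (\<integral>\<^sup>+t. f t \<partial>distr (lebesgue_PiM n) (PiM {1..n} (\<lambda>_. lborel)) ?h)"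
    by simp
  also have "\<dots> = (\<integral>\<^sup>+y. f (?h y) \<partial>lebesgue_PiM n)"
    using f h by (intro nn_integral_distr) simp_all
  finally show ?thesis ..
qed

text \<open>Applied to the coordinates of z followed by r, this matrix yields the levels
  \<open>inner (u i) z + r * m i\<close> of the hyperplanes.\<close>

definition center_radius_mat :: "(nat \<Rightarrow> 'a::euclidean_space) \<Rightarrow> (nat \<Rightarrow> real) \<Rightarrow> real mat" where
  "center_radius_mat u m = mat (DIM('a) + 1) (DIM('a) + 1) (\<lambda>(i, j).
     if j < DIM('a) then inner (u (i + 1)) (from_nat_into Basis j) else m (i + 1))"

lemma center_radius_mat_carrier:
  "center_radius_mat u m \<in> carrier_mat (DIM('a) + 1) (DIM('a) + 1)" for u :: "nat \<Rightarrow> 'a::euclidean_space"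
  by (simp add: center_radius_mat_def)

theorem nn_integral_center_radius:
  fixes u :: "nat \<Rightarrow> 'a::euclidean_space"
  assumes d: "Determinant.det (center_radius_mat u m) \<noteq> 0"
    and f: "f \<in> borel_measurable (PiM {1..DIM('a) + 1} (\<lambda>_. lborel :: real measure))"
  shows "(\<integral>\<^sup>+t. f t \<partial>PiM {1..DIM('a) + 1} (\<lambda>_. lborel)) =
    ennreal \<bar>Determinant.det (center_radius_mat u m)\<bar> *
    (\<integral>\<^sup>+z. \<integral>\<^sup>+r. f (\<lambda>i\<in>{1..DIM('a) + 1}. inner (u i) z + r * m i) \<partial>lborel \<partial>lborel)"
proof -
  let ?n = "DIM('a) + 1" and ?A = "center_radius_mat u m"
  let ?b = "from_nat_into (Basis :: 'a set)"
  let ?h = "\<lambda>x. \<Sum>j<DIM('a). x j *\<^sub>R ?b j"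
  let ?G = "\<lambda>z r. f (\<lambda>i\<in>{1..?n}. inner (u i) z + r * m i)"
  let ?f = "\<lambda>y. f (\<lambda>i\<in>{1..?n}. y (i - 1))"
  have G: "(\<lambda>(z, r). ?G z r) \<in> borel_measurable (borel \<Otimes>\<^sub>M lborel)"
  using f by simp
  have f': "?f \<in> borel_measurable (lebesgue_PiM ?n)"
  proof -
    have "(\<lambda>y. \<lambda>i\<in>{1..?n}. y (i - 1) :: real) \<in> lebesgue_PiM ?n \<rightarrow>\<^sub>M PiM {1..?n} (\<lambda>_. lborel)"
      by (intro measurable_restrict_lborel measurable_component_lborel) auto
    from measurable_compose[OF this f] show ?thesis .
  qed
  have lin_eq: "?f (lin ?n ?A (x(DIM('a) := r))) = ?G (?h x) r" for x r
  proof (rule arg_cong[where f=f], rule ext)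
    fix i
    show "(\<lambda>i\<in>{1..?n}. lin ?n ?A (x(DIM('a) := r)) (i - 1)) i = (\<lambda>i\<in>{1..?n}. inner (u i) (?h x) + r * m i) i"
    proof (cases "i \<in> {1..?n}")
      case True
      then have "lin ?n ?A (x(DIM('a) := r)) (i - 1) = (\<Sum>j<?n. ?A $$ (i - 1, j) * (x(DIM('a) := r)) j)"
        by (auto simp: lin_def)
      also have "\<dots> = (\<Sum>j<DIM('a). inner (u i) (?b j) * x j) + m i * r"
        using True by (auto simp: center_radius_mat_def intro!: sum.cong)
      also have "\<dots> = inner (u i) (?h x) + r * m i"
        by (simp add: inner_sum_right mult.commute)
      finally show ?thesis using True by (simp only: restrict_apply if_True)
    next
      case False
      then show ?thesis by (simp only: restrict_apply if_False)
    qed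
  qed
  have fl: "(\<lambda>x. ?f (lin ?n ?A x)) \<in> borel_measurable (lebesgue_PiM (Suc DIM('a)))"
    using measurable_compose[OF measurable_lin f'] by simp
  have "(\<integral>\<^sup>+t. f t \<partial>PiM {1..?n} (\<lambda>_. lborel)) = (\<integral>\<^sup>+y. ?f y \<partial>lebesgue_PiM ?n)"
    by (rule nn_integral_PiM_shift_index[OF f, symmetric])
  also have "\<dots> = ennreal \<bar>Determinant.det ?A\<bar> * (\<integral>\<^sup>+x. ?f (lin ?n ?A x) \<partial>lebesgue_PiM ?n)"
    by (rule nn_integral_lin[OF center_radius_mat_carrier d f', symmetric])
  also have "(\<integral>\<^sup>+x. ?f (lin ?n ?A x) \<partial>lebesgue_PiM ?n) =
     (\<integral>\<^sup>+x. \<integral>\<^sup>+r. ?G (?h x) r \<partial>lborel \<partial>lebesgue_PiM DIM('a))"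
    using nn_integral_lebesgue_PiM_Suc[OF fl] by (simp only: lin_eq Suc_eq_plus1)
  also have "\<dots> = (\<integral>\<^sup>+z. \<integral>\<^sup>+r. ?G z r \<partial>lborel \<partial>lborel)"
    by (rule nn_integral_lborel_coordinates[symmetric])
      (rule lborel.borel_measurable_nn_integral[OF G])
  finally show ?thesis .
qed

section \<open>Measurable determinants and Cramer's rule\<close>

lemma measurable_det:
  assumes "\<And>i j. i < n \<Longrightarrow> j < n \<Longrightarrow> (\<lambda>x. a x i j :: real) \<in> borel_measurable N"
  shows "(\<lambda>x. Determinant.det (mat n n (\<lambda>(i, j). a x i j))) \<in> borel_measurable N"
proof -
  have "(\<lambda>x. \<Sum>p\<in>{p. p permutes {0..<n}}. signof p * (\<Prod>i = 0..<n. a x i (p i))) \<in> borel_measurable N"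
  using assms by simp
  moreover have "Determinant.det (mat n n (\<lambda>(i, j). a x i j)) =
      (\<Sum>p\<in>{p. p permutes {0..<n}}. signof p * (\<Prod>i = 0..<n. a x i (p i)))" for x
    unfolding det_def by (auto intro!: sum.cong prod.cong simp: permutes_in_image less_imp_le)
  ultimately show ?thesis by simp
qed

text \<open>Cramer's rule; division by zero makes this \<open>0\<close> for a singular matrix.\<close>

definition cramer_solve :: "nat \<Rightarrow> real mat \<Rightarrow> (nat \<Rightarrow> real) \<Rightarrow> nat \<Rightarrow> real" where
  "cramer_solve n A t k = (\<Sum>i<n. cofactor A i k * t i) / Determinant.det A"

lemma cramer_solve:
  assumes A: "A \<in> carrier_mat n n" and d: "Determinant.det A \<noteq> 0" and k: "k < n"
  shows "cramer_solve n A (\<lambda>i. \<Sum>j<n. A $$ (i, j) * x j) k = x k"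
proof -
  have "(\<Sum>i<n. cofactor A i k * (\<Sum>j<n. A $$ (i, j) * x j)) = (\<Sum>j<n. (\<Sum>i<n. cofactor A i k * A $$ (i, j)) * x j)"
    unfolding sum_distrib_left sum_distrib_right by (subst sum.swap) (simp add: mult.assoc)
  also have "\<dots> = (\<Sum>j<n. (if k = j then Determinant.det A else 0) * x j)"
  proof (intro sum.cong refl arg_cong2[where f=times])
    fix j assume j: "j \<in> {..<n}"
    have *: "(adj_mat A * A) $$ (k, j) = (\<Sum>i<n. cofactor A i k * A $$ (i, j))"
      using A k j by (auto simp: adj_mat_def scalar_prod_def atLeast0LessThan intro!: sum.cong)
    show "(\<Sum>i<n. cofactor A i k * A $$ (i, j)) = (if k = j then Determinant.det A else 0)"
      unfolding *[symmetric] adj_mat(3)[OF A] using k j by simp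
  qed
  also have "\<dots> = Determinant.det A * x k" using k by (simp add: if_distrib[where f="\<lambda>y. y * _"] cong: if_cong)
  finally show ?thesis using d by (simp add: cramer_solve_def)
qed

text \<open>The explicit formula is what makes the center and radius of a tuple measurable functions
  of the tuple: only determinants, sums and a quotient occur.\<close>

lemma measurable_cramer_solve:
  assumes a: "\<And>i j. i < n \<Longrightarrow> j < n \<Longrightarrow> (\<lambda>x. a x i j :: real) \<in> borel_measurable N"
    and t: "\<And>i. i < n \<Longrightarrow> (\<lambda>x. t x i) \<in> borel_measurable N" and k: "k < n"
  shows "(\<lambda>x. cramer_solve n (mat n n (\<lambda>(i, j). a x i j)) (t x) k) \<in> borel_measurable N"
  unfolding cramer_solve_def
proof (intro borel_measurable_divide borel_measurable_sum borel_measurable_times measurable_det a t)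
  fix i assume i: "i \<in> {..<n}"
  \<comment> \<open>A minor is again a matrix with measurable entries, row i and column k being
    skipped by the index shift.\<close>
  have "mat_delete (mat n n (\<lambda>(i, j). a x i j)) i k = mat (n - 1) (n - 1) (\<lambda>(i', j').
      a x (if i' < i then i' else Suc i') (if j' < k then j' else Suc j'))" for x
    unfolding mat_delete_def by (rule eq_matI) auto
  then show "(\<lambda>x. cofactor (mat n n (\<lambda>(i, j). a x i j)) i k) \<in> borel_measurable N"
    unfolding cofactor_def
    by (auto intro!: borel_measurable_times measurable_det a)
qed auto

text \<open>Collecting all first components before all second ones lets the linear substitution act
  on the levels while the normals stay fixed. The induction exchanges one pair of integrals by
  Fubini at each step.\<close>

lemma nn_integral_PiM_pair:
  fixes f :: "(nat \<Rightarrow> 'b \<times> 'c) \<Rightarrow> ennreal"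
  assumes "finite I" and sf: "sigma_finite_measure N" "sigma_finite_measure L"
    and "f \<in> borel_measurable (PiM I (\<lambda>_. N \<Otimes>\<^sub>M L))"
  shows "(\<integral>\<^sup>+q. f q \<partial>PiM I (\<lambda>_. N \<Otimes>\<^sub>M L)) =
    (\<integral>\<^sup>+u. \<integral>\<^sup>+t. f (\<lambda>i\<in>I. (u i, t i)) \<partial>PiM I (\<lambda>_. L) \<partial>PiM I (\<lambda>_. N))"
  using assms(1,4)
proof (induction I arbitrary: f)
  case empty
  then show ?case by (simp add: PiM_empty nn_integral_count_space_finite)
next
  case (insert i I)
  interpret N: sigma_finite_measure N by fact
  interpret L: sigma_finite_measure L by fact
  interpret NL: pair_sigma_finite N L ..
  interpret pN: product_sigma_finite "\<lambda>_::nat. N" ..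
  interpret pL: product_sigma_finite "\<lambda>_::nat. L" ..
  interpret pNL: product_sigma_finite "\<lambda>_::nat. N \<Otimes>\<^sub>M L" ..
  interpret IN: finite_product_sigma_finite "\<lambda>_::nat. N" I by standard (rule insert)
  interpret IL: finite_product_sigma_finite "\<lambda>_::nat. L" I by standard (rule insert)
  interpret sw: pair_sigma_finite "PiM I (\<lambda>_. L)" N ..
  note f = insert.prems
  have fu: "(\<lambda>(q, p). f (q(i := p))) \<in> borel_measurable (PiM I (\<lambda>_. N \<Otimes>\<^sub>M L) \<Otimes>\<^sub>M (N \<Otimes>\<^sub>M L))"
    using measurable_compose[OF measurable_add_dim f] by (simp add: split_beta' fun_upd_def)
  let ?j = "\<lambda>u t. \<lambda>i\<in>I. (u i, t i)"
  let ?J = "\<lambda>u t. \<lambda>j\<in>insert i I. (u j, t j)"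
  have j: "(\<lambda>y. ?j (fst y) (snd y)) \<in> PiM I (\<lambda>_. N) \<Otimes>\<^sub>M PiM I (\<lambda>_. L) \<rightarrow>\<^sub>M PiM I (\<lambda>_. N \<Otimes>\<^sub>M L)"
    by (rule measurable_restrict) measurable
  have J: "(\<lambda>y. ?J (fst y) (snd y)) \<in> PiM (insert i I) (\<lambda>_. N) \<Otimes>\<^sub>M PiM (insert i I) (\<lambda>_. L) \<rightarrow>\<^sub>M PiM (insert i I) (\<lambda>_. N \<Otimes>\<^sub>M L)"
    by (rule measurable_restrict) measurable
  note fJ = measurable_compose[OF J f]
  have upd: "(?j u t)(i := (v, s)) = ?J (u(i := v)) (t(i := s))" for u t v s
    using insert.hyps by (auto simp: fun_eq_iff)
  have q4: "(\<lambda>(((u, v), t), s). f (?J (u(i := v)) (t(i := s)))) \<in>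
      borel_measurable (((PiM I (\<lambda>_. N) \<Otimes>\<^sub>M N) \<Otimes>\<^sub>M PiM I (\<lambda>_. L)) \<Otimes>\<^sub>M L)"
  proof -
    have a: "(\<lambda>z. (fst (fst (fst z)))(i := snd (fst (fst z)))) \<in> ((PiM I (\<lambda>_. N) \<Otimes>\<^sub>M N) \<Otimes>\<^sub>M PiM I (\<lambda>_. L)) \<Otimes>\<^sub>M L \<rightarrow>\<^sub>M PiM (insert i I) (\<lambda>_. N)"
      by measurable
    have b: "(\<lambda>z. (snd (fst z))(i := snd z)) \<in> ((PiM I (\<lambda>_. N) \<Otimes>\<^sub>M N) \<Otimes>\<^sub>M PiM I (\<lambda>_. L)) \<Otimes>\<^sub>M L \<rightarrow>\<^sub>M PiM (insert i I) (\<lambda>_. L)"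
      by measurable
    from measurable_compose[OF measurable_Pair[OF a b] fJ] show ?thesis
      by (simp only: split_beta' fst_conv snd_conv)
  qed
  have q3: "(\<lambda>((u, v), t). \<integral>\<^sup>+s. f (?J (u(i := v)) (t(i := s))) \<partial>L) \<in>
      borel_measurable ((PiM I (\<lambda>_. N) \<Otimes>\<^sub>M N) \<Otimes>\<^sub>M PiM I (\<lambda>_. L))"
    using L.borel_measurable_nn_integral[OF q4[unfolded split_beta', THEN measurable_cong[THEN iffD1, rotated], of "\<lambda>(x, s). f (?J ((fst (fst x))(i := snd (fst x))) ((snd x)(i := s)))"]]
    by (simp add: split_beta')
  have "(\<integral>\<^sup>+q. f q \<partial>PiM (insert i I) (\<lambda>_. N \<Otimes>\<^sub>M L)) =
    (\<integral>\<^sup>+q. \<integral>\<^sup>+p. f (q(i := p)) \<partial>(N \<Otimes>\<^sub>M L) \<partial>PiM I (\<lambda>_. N \<Otimes>\<^sub>M L))"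
    using insert.hyps f by (intro pNL.product_nn_integral_insert) auto
  also have "\<dots> = (\<integral>\<^sup>+u. \<integral>\<^sup>+t. \<integral>\<^sup>+p. f ((?j u t)(i := p)) \<partial>(N \<Otimes>\<^sub>M L) \<partial>PiM I (\<lambda>_. L) \<partial>PiM I (\<lambda>_. N))"
    by (rule insert.IH) (rule NL.borel_measurable_nn_integral[OF fu])
  also have "\<dots> = (\<integral>\<^sup>+u. \<integral>\<^sup>+t. \<integral>\<^sup>+v. \<integral>\<^sup>+s. f (?J (u(i := v)) (t(i := s))) \<partial>L \<partial>N \<partial>PiM I (\<lambda>_. L) \<partial>PiM I (\<lambda>_. N))"
  proof (intro nn_integral_cong)
    fix u t assume ut: "u \<in> space (PiM I (\<lambda>_. N))" "t \<in> space (PiM I (\<lambda>_. L))"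
    have "?j u t \<in> space (PiM I (\<lambda>_. N \<Otimes>\<^sub>M L))"
      using measurable_space[OF j, of "(u, t)"] ut by (simp add: space_pair_measure)
    from measurable_Pair2[OF fu this]
    have "(\<lambda>p. f ((?j u t)(i := p))) \<in> borel_measurable (N \<Otimes>\<^sub>M L)" by simp
    from L.nn_integral_fst[OF this, symmetric]
    show "(\<integral>\<^sup>+p. f ((?j u t)(i := p)) \<partial>(N \<Otimes>\<^sub>M L)) = (\<integral>\<^sup>+v. \<integral>\<^sup>+s. f (?J (u(i := v)) (t(i := s))) \<partial>L \<partial>N)"
      by (simp only: upd)
  qed
  also have "\<dots> = (\<integral>\<^sup>+u. \<integral>\<^sup>+v. \<integral>\<^sup>+t. \<integral>\<^sup>+s. f (?J (u(i := v)) (t(i := s))) \<partial>L \<partial>PiM I (\<lambda>_. L) \<partial>N \<partial>PiM I (\<lambda>_. N))"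
  proof (intro nn_integral_cong)
    fix u assume u: "u \<in> space (PiM I (\<lambda>_. N))"
    have "(\<lambda>y. ((u, snd y), fst y)) \<in> PiM I (\<lambda>_. L) \<Otimes>\<^sub>M N \<rightarrow>\<^sub>M (PiM I (\<lambda>_. N) \<Otimes>\<^sub>M N) \<Otimes>\<^sub>M PiM I (\<lambda>_. L)"
      using u by measurable
    from measurable_compose[OF this q3]
    have "(\<lambda>(t, v). \<integral>\<^sup>+s. f (?J (u(i := v)) (t(i := s))) \<partial>L) \<in> borel_measurable (PiM I (\<lambda>_. L) \<Otimes>\<^sub>M N)"
      by (simp only: split_beta' fst_conv snd_conv)
    from sw.Fubini'[OF this, symmetric]
    show "(\<integral>\<^sup>+t. \<integral>\<^sup>+v. \<integral>\<^sup>+s. f (?J (u(i := v)) (t(i := s))) \<partial>L \<partial>N \<partial>PiM I (\<lambda>_. L)) =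
      (\<integral>\<^sup>+v. \<integral>\<^sup>+t. \<integral>\<^sup>+s. f (?J (u(i := v)) (t(i := s))) \<partial>L \<partial>PiM I (\<lambda>_. L) \<partial>N)" .
  qed
  also have "\<dots> = (\<integral>\<^sup>+u. \<integral>\<^sup>+v. \<integral>\<^sup>+t. f (?J (u(i := v)) t) \<partial>PiM (insert i I) (\<lambda>_. L) \<partial>N \<partial>PiM I (\<lambda>_. N))"
  proof (intro nn_integral_cong)
    fix u v assume uv: "u \<in> space (PiM I (\<lambda>_. N))" "v \<in> space N"
    have "u(i := v) \<in> space (PiM (insert i I) (\<lambda>_. N))"
      using measurable_space[OF measurable_add_dim, of "(u, v)" I "\<lambda>_. N" i] uv by (simp add: space_pair_measure)
    from measurable_Pair2[OF fJ this]
    have "(\<lambda>t. f (?J (u(i := v)) t)) \<in> borel_measurable (PiM (insert i I) (\<lambda>_. L))"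
      by (simp only: split_beta' fst_conv snd_conv)
    from pL.product_nn_integral_insert[OF insert.hyps this, symmetric]
    show "(\<integral>\<^sup>+t. \<integral>\<^sup>+s. f (?J (u(i := v)) (t(i := s))) \<partial>L \<partial>PiM I (\<lambda>_. L)) =
      (\<integral>\<^sup>+t. f (?J (u(i := v)) t) \<partial>PiM (insert i I) (\<lambda>_. L))" .
  qed
  also have "\<dots> = (\<integral>\<^sup>+u. \<integral>\<^sup>+t. f (?J u t) \<partial>PiM (insert i I) (\<lambda>_. L) \<partial>PiM (insert i I) (\<lambda>_. N))"
  proof (rule pN.product_nn_integral_insert[symmetric])
    interpret IL': finite_product_sigma_finite "\<lambda>_::nat. L" "insert i I" by standard (use insert in simp)
    show "(\<lambda>u. \<integral>\<^sup>+t. f (?J u t) \<partial>PiM (insert i I) (\<lambda>_. L)) \<in> borel_measurable (PiM (insert i I) (\<lambda>_. N))"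
      by (rule IL'.borel_measurable_nn_integral) (use fJ in \<open>simp only: split_beta' fst_conv snd_conv\<close>)
  qed (use insert in auto)
  finally show ?case .
qed

section \<open>Faces of a hyperplane tessellation\<close>

definition nrm :: "'a::euclidean_space set \<Rightarrow> 'a" where "nrm H = fst (sec H)"

text \<open>The signed distance of y from H. Its sign depends on the orientation given by
  \<open>sec\<close>, so sides of H are compared through products of two values.\<close>

definition lev :: "'a::euclidean_space set \<Rightarrow> 'a \<Rightarrow> real" where
  "lev H y = inner y (nrm H) - snd (sec H)"

lemma norm_nrm: "H \<in> hyperplanes \<Longrightarrow> norm (nrm H) = 1"
  by (simp add: nrm_def sec)

lemma lev_eq_0_iff: "H \<in> hyperplanes \<Longrightarrow> lev H y = 0 \<longleftrightarrow> y \<in> H"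
  using sec[of H] by (auto simp: lev_def nrm_def hyp_def hyperplane_def)

lemma lev_diff: "lev H y - lev H x = inner (y - x) (nrm H)"
  by (simp add: lev_def inner_diff_left)

lemma lev_add: "lev H (x + w) = lev H x + inner w (nrm H)"
  by (simp add: lev_def inner_add_left)

lemma lev_convex: "a + b = 1 \<Longrightarrow> lev H (a *\<^sub>R x + b *\<^sub>R y) = a * lev H x + b * lev H y"
proof -
  assume "a + b = 1"
  then have "snd (sec H) = a * snd (sec H) + b * snd (sec H)" by (simp add: distrib_right[symmetric])
  then show ?thesis by (simp add: lev_def inner_add_left algebra_simps)
qed

lemma continuous_lev: "continuous_on A (lev H)"
  unfolding lev_def[abs_def] by (intro continuous_intros)

lemma abs_lev_diff_le: "H \<in> hyperplanes \<Longrightarrow> \<bar>lev H y - lev H x\<bar> \<le> dist x y"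
  unfolding lev_diff using Cauchy_Schwarz_ineq2[of "y - x" "nrm H"]
  by (simp add: norm_nrm dist_norm norm_minus_commute)

text \<open>A hyperplane has two unit normals, and a point off the hyperplane satisfies the
  halfspace inequality for just one of them. This makes the definite description in
  \<open>halfspace_at\<close> unique.\<close>

lemma halfspace_at_hyperplane:
  fixes u x :: "'a::euclidean_space"
  assumes u: "norm u = 1" and x: "inner x u \<noteq> t"
  shows "halfspace_at (hyperplane u t) x = {y. 0 \<le> (inner x u - t) * (inner y u - t)}"
proof -
  have uniq: "S = halfspace v s" if "x \<in> S" "norm v = 1" "hyperplane u t = hyperplane v s" "inner x v < s"
    "\<exists>w r. norm w = 1 \<and> hyperplane u t = hyperplane w r \<and> S = halfspace w r" for S v s
  proof -
    have S: "\<exists>w r. norm w = 1 \<and> hyperplane v s = hyperplane w r \<and> S = halfspace w r"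
      using that by simp
    obtain w r where w: "norm w = 1" "hyperplane v s = hyperplane w r" "S = halfspace w r"
      using S by auto
    have "w = v \<and> r = s \<or> w = - v \<and> r = - s"
      using hyperplane_eq_iff[OF that(2) w(1)] w(2) by simp
    moreover have "\<not> (w = - v \<and> r = - s)"
      using that(1,4) w(3) by (auto simp: halfspace_def)
    ultimately show ?thesis using w(3) by simp
  qed
  have the: "halfspace_at (hyperplane u t) x = halfspace v s"
    if "norm v = 1" "hyperplane u t = hyperplane v s" "inner x v < s" for v s
    unfolding halfspace_at_def
  proof (rule the_equality)
    show "x \<in> halfspace v s \<and> (\<exists>u' t'. norm u' = 1 \<and> hyperplane u t = hyperplane u' t' \<and> halfspace v s = halfspace u' t')"
      using that by (auto simp: halfspace_def)
    show "S = halfspace v s" if "x \<in> S \<and> (\<exists>u' t'. norm u' = 1 \<and> hyperplane u t = hyperplane u' t' \<and> S = halfspace u' t')" for S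
      using uniq[of S v s] that \<open>norm v = 1\<close> \<open>hyperplane u t = hyperplane v s\<close> \<open>inner x v < s\<close> by blast
  qed
  show ?thesis
  proof (cases "inner x u < t")
    case True
    have "halfspace u t = {y. 0 \<le> (inner x u - t) * (inner y u - t)}"
      using True by (auto simp: halfspace_def zero_le_mult_iff)
    then show ?thesis using the[OF u refl True] by simp
  next
    case False
    then have gt: "inner x u > t" using x by simp
    have "halfspace_at (hyperplane u t) x = halfspace (- u) (- t)"
      using gt u by (intro the) (auto simp: hyperplane_uminus)
    also have "\<dots> = {y. 0 \<le> (inner x u - t) * (inner y u - t)}"
      using gt by (auto simp: halfspace_def zero_le_mult_iff)
    finally show ?thesis .
  qed
qed

lemma halfspace_at_eq:
  assumes "H \<in> hyperplanes" "x \<notin> H"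
  shows "halfspace_at H x = {y. 0 \<le> lev H x * lev H y}"
proof -
  have H: "H = hyperplane (nrm H) (snd (sec H))"
    using sec[OF assms(1)] by (simp add: hyp_def nrm_def)
  have "inner x (nrm H) \<noteq> snd (sec H)"
    using assms lev_eq_0_iff[of H x] by (simp add: lev_def)
  from halfspace_at_hyperplane[OF norm_nrm[OF assms(1)] this] show ?thesis
    unfolding H[symmetric] by (simp add: lev_def)
qed

text \<open>The sign pattern of x against all hyperplanes, closed up. For x on no hyperplane this is
  the closed cell of x; in general it is the face that has x in its relative interior.\<close>

definition cellat :: "'a::euclidean_space set set \<Rightarrow> 'a \<Rightarrow> 'a set" where
  "cellat S x = {y. \<forall>H\<in>S. (lev H x = 0 \<longrightarrow> lev H y = 0) \<and> 0 \<le> lev H x * lev H y}"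

definition flat_at :: "'a::euclidean_space set set \<Rightarrow> 'a \<Rightarrow> 'a set" where
  "flat_at S x = \<Inter>{H \<in> S. x \<in> H}"

lemma in_cellat_self: "x \<in> cellat S x"
  by (simp add: cellat_def)

lemma in_flat_at_iff: "S \<subseteq> hyperplanes \<Longrightarrow> y \<in> flat_at S x \<longleftrightarrow> (\<forall>H\<in>S. lev H x = 0 \<longrightarrow> lev H y = 0)"
  using lev_eq_0_iff by (fastforce simp: flat_at_def)

lemma cellat_subset_flat_at: "S \<subseteq> hyperplanes \<Longrightarrow> cellat S x \<subseteq> flat_at S x"
  by (auto simp: in_flat_at_iff cellat_def)

lemma convex_cellat: "convex (cellat S x)"
  unfolding convex_def
proof (intro ballI allI impI)
  fix y z a b assume y: "y \<in> cellat S x" and z: "z \<in> cellat S x" and ab: "0 \<le> a" "0 \<le> b" "a + b = (1::real)"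
  show "a *\<^sub>R y + b *\<^sub>R z \<in> cellat S x"
    unfolding cellat_def
  proof (intro CollectI ballI conjI impI)
    fix H assume H: "H \<in> S"
    have e: "lev H (a *\<^sub>R y + b *\<^sub>R z) = a * lev H y + b * lev H z" by (rule lev_convex[OF ab(3)])
    show "lev H (a *\<^sub>R y + b *\<^sub>R z) = 0" if "lev H x = 0" using y z H that by (simp add: e cellat_def)
    have "0 \<le> a * (lev H x * lev H y) + b * (lev H x * lev H z)"
      using y z H ab by (intro add_nonneg_nonneg mult_nonneg_nonneg[of a] mult_nonneg_nonneg[of b]) (auto simp: cellat_def)
    then show "0 \<le> lev H x * lev H (a *\<^sub>R y + b *\<^sub>R z)" by (simp add: e algebra_simps)
  qed
qed

lemma closed_cellat: "closed (cellat S x)"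
proof -
  have "cellat S x = (\<Inter>H\<in>S. (if lev H x = 0 then {y. lev H y = 0} else UNIV) \<inter> {y. 0 \<le> lev H x * lev H y})"
    by (auto simp: cellat_def split: if_splits)
  then show ?thesis
    by (auto intro!: closed_INT closed_Int closed_Collect_eq closed_Collect_le continuous_intros continuous_lev)
qed

lemma affine_flat_at:
  assumes "S \<subseteq> hyperplanes" shows "affine (flat_at S x)"
  unfolding affine_def
proof (intro ballI allI impI)
  fix y z and a b :: real assume "y \<in> flat_at S x" "z \<in> flat_at S x" "a + b = 1"
  then show "a *\<^sub>R y + b *\<^sub>R z \<in> flat_at S x"
    using assms by (simp add: in_flat_at_iff lev_convex)
qed

text \<open>The points strictly on the side of y0 for every hyperplane form a convex, hence
  connected, set. Conversely a connected set avoiding all hyperplanes cannot change the sign of any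
  \<open>lev H\<close>, by the intermediate value property.\<close>

lemma cell_eq_cellat:
  assumes S: "S \<subseteq> hyperplanes" and y0: "y0 \<notin> \<Union>S"
  shows "closure (connected_component_set (- \<Union>S) y0) = cellat S y0"
proof -
  have nz: "lev H y0 \<noteq> 0" if "H \<in> S" for H using that y0 S lev_eq_0_iff[of H y0] by auto
  let ?O = "{y. \<forall>H\<in>S. 0 < lev H y0 * lev H y}"
  have conv: "convex ?O"
    unfolding convex_def
  proof (intro ballI allI impI)
    fix y z a b assume y: "y \<in> ?O" and z: "z \<in> ?O" and ab: "0 \<le> a" "0 \<le> b" "a + b = (1::real)"
    show "a *\<^sub>R y + b *\<^sub>R z \<in> ?O"
    proof (intro CollectI ballI)
      fix H assume H: "H \<in> S"
      have "a > 0 \<or> b > 0" using ab by linarith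
      moreover have p: "0 < lev H y0 * lev H y" "0 < lev H y0 * lev H z" using y z H by auto
      moreover have "0 \<le> a * (lev H y0 * lev H y)" "0 \<le> b * (lev H y0 * lev H z)"
        using ab p by auto
      ultimately have "0 < a * (lev H y0 * lev H y) + b * (lev H y0 * lev H z)"
        by (metis add_nonneg_pos add_pos_nonneg mult_pos_pos)
      then show "0 < lev H y0 * lev H (a *\<^sub>R y + b *\<^sub>R z)" by (simp add: lev_convex[OF ab(3)] algebra_simps)
    qed
  qed
  have O_eq: "connected_component_set (- \<Union>S) y0 = ?O"
  proof
    have "y0 \<in> ?O"
    by (smt (verit) CollectI nz zero_less_mult_iff)
    moreover have "?O \<subseteq> - \<Union>S"
    proof (rule subsetI, rule ComplI)
      fix y assume "y \<in> ?O" "y \<in> \<Union>S"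
      then obtain H where "H \<in> S" "y \<in> H" "0 < lev H y0 * lev H y" by auto
      then show False using S lev_eq_0_iff[of H y] by auto
    qed
    ultimately show "?O \<subseteq> connected_component_set (- \<Union>S) y0"
      using convex_connected[OF conv] by (intro connected_component_maximal)
    show "connected_component_set (- \<Union>S) y0 \<subseteq> ?O"
    proof (intro subsetI CollectI ballI)
      fix y H assume y: "y \<in> connected_component_set (- \<Union>S) y0" and H: "H \<in> S"
      let ?C = "connected_component_set (- \<Union>S) y0"
      have C: "connected ?C" "y0 \<in> ?C" "?C \<subseteq> - \<Union>S"
        using y0 by (auto simp: connected_connected_component connected_component_refl_eq connected_component_subset)
      have "connected (lev H ` ?C)"
        using continuous_lev C(1) by (rule connected_continuous_image)
      moreover have n0: "0 \<notin> lev H ` ?C"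
      proof
        assume "0 \<in> lev H ` ?C"
        then obtain x where "x \<in> ?C" "lev H x = 0" by (metis imageE)
        moreover have "H \<in> hyperplanes" using H S by blast
        ultimately have "x \<in> \<Union>S" using H lev_eq_0_iff by blast
        then show False using \<open>x \<in> ?C\<close> C(3) by blast
      qed
      ultimately have no: "\<not> (a < 0 \<and> 0 < b)" if "a \<in> lev H ` ?C" "b \<in> lev H ` ?C" for a b
        using connectedD_interval[of "lev H ` ?C" a b 0] that by (metis less_imp_le)
      have "lev H y \<in> lev H ` ?C" "lev H y0 \<in> lev H ` ?C" using y C(2) by blast+
      then have "lev H y \<noteq> 0" "lev H y0 \<noteq> 0" "\<not> (lev H y < 0 \<and> 0 < lev H y0)" "\<not> (lev H y0 < 0 \<and> 0 < lev H y)"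
        using no n0 by auto
      then show "0 < lev H y0 * lev H y"
        by (auto simp: zero_less_mult_iff)
    qed
  qed
  show ?thesis unfolding O_eq
  proof
    have "?O \<subseteq> cellat S y0" using nz by (auto simp: cellat_def intro: less_imp_le)
    then show "closure ?O \<subseteq> cellat S y0"
      by (rule closure_minimal) (rule closed_cellat)
    show "cellat S y0 \<subseteq> closure ?O"
    proof
      fix y assume y: "y \<in> cellat S y0"
      \<comment> \<open>Giving y0 a small positive weight moves a point of the closed cell strictly
        inside; the weight 1 / (n + 1) then tends to zero.\<close>
      let ?s = "\<lambda>n::nat. (1 / (real n + 1)) *\<^sub>R y0 + (1 - 1 / (real n + 1)) *\<^sub>R y"
      have "?s n \<in> ?O" for n
      proof (intro CollectI ballI)
        fix H assume H: "H \<in> S"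
        have "0 < 1 / (real n + 1) * (lev H y0 * lev H y0) + (1 - 1 / (real n + 1)) * (lev H y0 * lev H y)"
        proof (rule add_pos_nonneg)
          have "0 < lev H y0 * lev H y0" using nz[OF H] by (auto simp: zero_less_mult_iff)
          then show "0 < 1 / (real n + 1) * (lev H y0 * lev H y0)" by simp
          have "0 \<le> lev H y0 * lev H y" using y H by (simp add: cellat_def)
          then show "0 \<le> (1 - 1 / (real n + 1)) * (lev H y0 * lev H y)" by simp
        qed
        then show "0 < lev H y0 * lev H (?s n)"
          by (subst lev_convex) (auto simp: algebra_simps)
      qed
      moreover have "?s \<longlonglongrightarrow> 0 *\<^sub>R y0 + (1 - 0) *\<^sub>R y"
        by (intro tendsto_intros) (use LIMSEQ_inverse_real_of_nat in \<open>simp add: inverse_eq_divide add.commute\<close>)+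
      ultimately show "y \<in> closure ?O"
        unfolding closure_sequential by (intro exI[of _ ?s]) auto
    qed
  qed
qed

lemma cells_eq:
  assumes "S \<subseteq> hyperplanes"
  shows "cells S = {cellat S y0 |y0. y0 \<notin> \<Union>S}"
proof -
  have "cells S = (\<lambda>y0. closure (connected_component_set (- \<Union>S) y0)) ` {y0. y0 \<notin> \<Union>S}"
    unfolding cells_def components_def image_image by (intro image_cong) auto
  also have "\<dots> = cellat S ` {y0. y0 \<notin> \<Union>S}"
    by (intro image_cong refl cell_eq_cellat[OF assms]) simp
  finally show ?thesis by blast
qed

lemma cball_meets_hyperplane:
  assumes H: "H \<in> hyperplanes" and le: "\<bar>lev H x\<bar> \<le> e"
  shows "H \<in> hitting (cball x e)"
proof -
  let ?y = "x - lev H x *\<^sub>R nrm H"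
  have "lev H ?y = 0"
    using norm_nrm[OF H] by (simp add: lev_def inner_diff_left dot_square_norm)
  then have "?y \<in> H" using H lev_eq_0_iff by blast
  moreover have "?y \<in> cball x e" using le norm_nrm[OF H] by (simp add: dist_norm)
  ultimately show ?thesis using H by (auto simp: hitting_def)
qed

text \<open>Only finitely many hyperplanes meet the unit ball around x, and all others stay at
  distance more than 1. So the positive distances from x to hyperplanes are bounded below by a
  positive number, within which no side can change.\<close>

lemma config_local:
  assumes S: "S \<in> hyperplane_configs"
  obtains e where "0 < e" "\<And>H y. H \<in> S \<Longrightarrow> lev H x \<noteq> 0 \<Longrightarrow> dist x y < e \<Longrightarrow> 0 < lev H x * lev H y"
proof -
  have Sh: "S \<subseteq> hyperplanes" using S by (rule hyperplane_configs_subset)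
  have fin: "finite (S \<inter> hitting (cball x 1))" using S by (simp add: hyperplane_configs_def)
  define e where "e = Min (insert 1 ((\<lambda>H. \<bar>lev H x\<bar>) ` {H \<in> S \<inter> hitting (cball x 1). lev H x \<noteq> 0}))"
  have fin': "finite (insert 1 ((\<lambda>H. \<bar>lev H x\<bar>) ` {H \<in> S \<inter> hitting (cball x 1). lev H x \<noteq> 0}))"
    using finite_subset[of "{H \<in> S \<inter> hitting (cball x 1). lev H x \<noteq> 0}" "S \<inter> hitting (cball x 1)"] fin by blast
  have e0: "0 < e"
    unfolding e_def by (subst Min_gr_iff[OF fin']) auto
  have le: "e \<le> \<bar>lev H x\<bar>" if "H \<in> S" "lev H x \<noteq> 0" for H
  proof (cases "\<bar>lev H x\<bar> \<le> 1")
    case True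
    then have "H \<in> hitting (cball x 1)" using cball_meets_hyperplane that Sh by blast
    then show ?thesis unfolding e_def using that by (intro Min_le[OF fin']) auto
  next
    case False
    moreover have "e \<le> 1" unfolding e_def by (intro Min_le[OF fin']) auto
    ultimately show ?thesis by linarith
  qed
  have "0 < lev H x * lev H y" if "H \<in> S" "lev H x \<noteq> 0" "dist x y < e" for H y
  proof -
    have "\<bar>lev H y - lev H x\<bar> < \<bar>lev H x\<bar>"
      using abs_lev_diff_le[of H y x] le[OF that(1,2)] that Sh by force
    then show ?thesis by (auto simp: zero_less_mult_iff abs_if split: if_splits)
  qed
  with e0 show ?thesis using that by blast
qed

lemma flat_at_ball_subset_cellat:
  assumes S: "S \<in> hyperplane_configs"
  obtains e where "0 < e" "flat_at S x \<inter> ball x e \<subseteq> cellat S x"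
proof -
  have Sh: "S \<subseteq> hyperplanes" using S by (rule hyperplane_configs_subset)
  obtain e where e: "0 < e" "\<And>H y. H \<in> S \<Longrightarrow> lev H x \<noteq> 0 \<Longrightarrow> dist x y < e \<Longrightarrow> 0 < lev H x * lev H y"
    using config_local[OF S] by blast
  have "flat_at S x \<inter> ball x e \<subseteq> cellat S x"
    using e(2) Sh by (fastforce simp: cellat_def in_flat_at_iff intro: less_imp_le)
  with e(1) show ?thesis using that by blast
qed

text \<open>Near x the set \<open>cellat S x\<close> contains the whole flat, and a nonempty
  relatively open part of an affine set spans it.\<close>

lemma affine_hull_cellat:
  assumes S: "S \<in> hyperplane_configs"
  shows "affine hull (cellat S x) = flat_at S x"
proof
  have Sh: "S \<subseteq> hyperplanes" using S by (rule hyperplane_configs_subset)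
  show "affine hull (cellat S x) \<subseteq> flat_at S x"
    by (intro hull_minimal cellat_subset_flat_at affine_flat_at Sh)
  obtain e where e: "0 < e" "flat_at S x \<inter> ball x e \<subseteq> cellat S x"
    using flat_at_ball_subset_cellat[OF S] by blast
  have "x \<in> flat_at S x" by (simp add: flat_at_def)
  then have "flat_at S x \<inter> ball x e \<noteq> {}" using e(1) by auto
  then have "affine hull (flat_at S x \<inter> ball x e) = affine hull (flat_at S x)"
    by (intro affine_hull_affine_Int_open[OF affine_flat_at[OF Sh]]) auto
  also have "\<dots> = flat_at S x"
    using affine_flat_at[OF Sh] by (simp add: affine_hull_eq)
  finally have "affine hull (flat_at S x \<inter> ball x e) = flat_at S x" .
  then show "flat_at S x \<subseteq> affine hull (cellat S x)"
    using hull_mono[OF e(2), of affine] by simp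
qed

lemma rel_interior_cellat:
  assumes S: "S \<in> hyperplane_configs"
  shows "x \<in> rel_interior (cellat S x)"
proof -
  obtain e where e: "0 < e" "flat_at S x \<inter> ball x e \<subseteq> cellat S x"
    using flat_at_ball_subset_cellat[OF S] by blast
  then show ?thesis
    unfolding mem_rel_interior affine_hull_cellat[OF S]
    by (intro exI[of _ "ball x e"]) (auto simp: in_cellat_self)
qed

lemma aff_dim_cellat:
  assumes S: "S \<in> hyperplane_configs"
  shows "aff_dim (cellat S x) = aff_dim (flat_at S x)"
  by (metis affine_hull_cellat[OF S] aff_dim_affine_hull)

text \<open>The smaller set is the cell cut with the hyperplanes through x. If an inner point of a
  segment in the cell lies on such a hyperplane, then a positive combination of two nonnegative
  values is zero, so both endpoints lie on it.\<close>

lemma cellat_face: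
  assumes S: "S \<in> hyperplane_configs" and y0: "y0 \<notin> \<Union>S" and x: "x \<in> cellat S y0"
  shows "cellat S x face_of cellat S y0"
proof -
  have Sh: "S \<subseteq> hyperplanes" using S by (rule hyperplane_configs_subset)
  have nz: "lev H y0 \<noteq> 0" if "H \<in> S" for H using that y0 Sh lev_eq_0_iff[of H y0] by auto
  have eq: "cellat S x = cellat S y0 \<inter> flat_at S x"
  proof (rule Set.set_eqI)
    fix y
    have "(lev H x = 0 \<longrightarrow> lev H y = 0) \<and> 0 \<le> lev H x * lev H y \<longleftrightarrow>
       ((lev H y0 = 0 \<longrightarrow> lev H y = 0) \<and> 0 \<le> lev H y0 * lev H y) \<and> (lev H x = 0 \<longrightarrow> lev H y = 0)" if H: "H \<in> S" for H
    proof -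
      have "0 \<le> lev H y0 * lev H x" using x H by (simp add: cellat_def)
      then show ?thesis using nz[OF H] by (auto simp: zero_le_mult_iff)
    qed
    then show "y \<in> cellat S x \<longleftrightarrow> y \<in> cellat S y0 \<inter> flat_at S x"
      using Sh by (auto simp: cellat_def in_flat_at_iff)
  qed
  show ?thesis
    unfolding face_of_def
  proof (intro conjI ballI impI)
    show "cellat S x \<subseteq> cellat S y0" using eq by auto
    show "convex (cellat S x)" by (rule convex_cellat)
    fix a b y assume a: "a \<in> cellat S y0" and b: "b \<in> cellat S y0" and y: "y \<in> cellat S x" "y \<in> open_segment a b"
    obtain s where s: "0 < s" "s < 1" "y = (1 - s) *\<^sub>R a + s *\<^sub>R b"
      using y(2) by (auto simp: in_segment)
    have "lev H a = 0 \<and> lev H b = 0" if H: "H \<in> S" and 0: "lev H x = 0" for H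
    proof -
      have "0 = (1 - s) * (lev H y0 * lev H a) + s * (lev H y0 * lev H b)"
      proof -
        have "lev H y = 0" using y(1) H 0 by (simp add: cellat_def)
        moreover have "lev H y = (1 - s) * lev H a + s * lev H b" unfolding s(3) by (rule lev_convex) simp
        ultimately have "lev H y0 * ((1 - s) * lev H a + s * lev H b) = 0" by simp
        then show ?thesis by (simp add: algebra_simps)
      qed
      moreover have "0 \<le> lev H y0 * lev H a" "0 \<le> lev H y0 * lev H b"
        using a b H by (auto simp: cellat_def)
      ultimately have "(1 - s) * (lev H y0 * lev H a) = 0" "s * (lev H y0 * lev H b) = 0"
        using s by (smt (verit) mult_nonneg_nonneg)+
      then show ?thesis using s nz[OF H] by simp
    qed
    then show "a \<in> cellat S x" "b \<in> cellat S x"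
      using a b Sh by (auto simp: eq in_flat_at_iff)
  qed
qed

text \<open>A face is determined by any point of its relative interior, since faces with
  intersecting relative interiors coincide. For the converse, x lies in the cell of some nearby
  point that is on no hyperplane.\<close>

lemma faces_eq:
  assumes S: "S \<in> hyperplane_configs"
  shows "faces k S = {cellat S x |x. aff_dim (flat_at S x) = int k}"
proof
  have Sh: "S \<subseteq> hyperplanes" using S by (rule hyperplane_configs_subset)
  show "faces k S \<subseteq> {cellat S x |x. aff_dim (flat_at S x) = int k}"
  proof
    fix F assume "F \<in> faces k S"
    then obtain y0 where F: "y0 \<notin> \<Union>S" "F face_of cellat S y0" "aff_dim F = int k"
      by (auto simp: faces_def cells_eq[OF Sh])
    have "F \<noteq> {}" using F(3) by auto
    moreover have cF: "convex F" using F(2) by (rule face_of_imp_convex)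
    ultimately obtain x where x: "x \<in> rel_interior F" using rel_interior_eq_empty by blast
    then have xC: "x \<in> cellat S y0"
      using face_of_imp_subset[OF F(2)] rel_interior_subset by blast
    have "F = cellat S x"
      using F(2) cellat_face[OF S F(1) xC] x rel_interior_cellat[OF S, of x] by (intro face_of_eq) auto
    then show "F \<in> {cellat S x |x. aff_dim (flat_at S x) = int k}"
      using F(3) aff_dim_cellat[OF S] by auto
  qed
  show "{cellat S x |x. aff_dim (flat_at S x) = int k} \<subseteq> faces k S"
  proof clarify
    fix x assume d: "aff_dim (flat_at S x) = int k"
    obtain e where e: "0 < e" "\<And>H y. H \<in> S \<Longrightarrow> lev H x \<noteq> 0 \<Longrightarrow> dist x y < e \<Longrightarrow> 0 < lev H x * lev H y"
      using config_local[OF S] by blast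
    let ?I = "{H \<in> S. x \<in> H}"
    have "?I \<subseteq> S \<inter> hitting {x}" using Sh by (auto simp: hitting_def)
    then have "finite ?I" using S by (auto simp: hyperplane_configs_def intro: finite_subset[of ?I "S \<inter> hitting {x}"])
    moreover have "negligible H" if "H \<in> ?I" for H
    proof -
      have "H \<in> hyperplanes" using that Sh by auto
      then obtain u t where u: "norm u = 1" "H = hyperplane u t" by (auto simp: hyperplanes_def)
      then have "u \<noteq> 0" by auto
      then show ?thesis
        using negligible_hyperplane[of u t] u by (simp add: hyperplane_def inner_commute)
    qed
    \<comment> \<open>Finitely many null sets cannot cover a ball, so some y0 near x avoids all
      hyperplanes through x; the choice of e keeps it off the others.\<close>
    ultimately have "negligible (\<Union>?I)" by (intro negligible_Union) auto
    moreover have "\<not> negligible (ball x e)"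
      using e(1) by (intro open_not_negligible) auto
    ultimately have "\<not> ball x e \<subseteq> \<Union>?I"
      by (meson negligible_subset)
    then obtain y0 where "y0 \<in> ball x e" and y0': "y0 \<notin> \<Union>?I" by blast
    then have y0: "dist x y0 < e" "y0 \<notin> \<Union>?I" by (simp_all only: mem_ball not_False_eq_True)
    have y0S: "y0 \<notin> \<Union>S"
    using y0 e Sh lev_eq_0_iff by force
    have "x \<in> cellat S y0"
      unfolding cellat_def
    proof (intro CollectI ballI conjI impI)
      fix H assume H: "H \<in> S"
      show "lev H x = 0" if "lev H y0 = 0" using that H y0S Sh lev_eq_0_iff[of H y0] by auto
      show "0 \<le> lev H y0 * lev H x"
        using e(2)[OF H, of y0] y0 by (cases "lev H x = 0") (auto simp: mult.commute intro: less_imp_le)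
    qed
    from cellat_face[OF S y0S this] show "cellat S x \<in> faces k S"
      unfolding faces_def cells_eq[OF Sh] using y0S d aff_dim_cellat[OF S] by auto
  qed
qed

section \<open>Projections and general position\<close>

lemma orth_proj:
  fixes L :: "'a::euclidean_space set"
  assumes "subspace L"
  shows orth_proj_in: "orth_proj L x \<in> L" and orth_proj_orth: "z \<in> L \<Longrightarrow> inner (x - orth_proj L x) z = 0"
proof -
  obtain y w where yw: "y \<in> span L" "\<And>v. v \<in> span L \<Longrightarrow> real_inner_class.orthogonal w v" "x = y + w"
    using orthogonal_subspace_decomp_exists[of L x] by metis
  have sp: "span L = L" using assms by (rule span_eq_iff[THEN iffD2])
  have "\<exists>!y. y \<in> L \<and> (\<forall>z\<in>L. inner (x - y) z = 0)"
  proof (rule ex1I[of _ y])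
    show "y \<in> L \<and> (\<forall>z\<in>L. inner (x - y) z = 0)" using yw sp by (auto simp: real_inner_class.orthogonal_def)
    fix y' assume y': "y' \<in> L \<and> (\<forall>z\<in>L. inner (x - y') z = 0)"
    have "y' - y \<in> L" using y' yw sp assms by (auto intro: subspace_diff)
    then have "inner (x - y') (y' - y) = 0" "inner (x - y) (y' - y) = 0"
      using y' yw sp by (auto simp: real_inner_class.orthogonal_def)
    then have "inner (y' - y) (y' - y) = 0"
      by (simp add: inner_diff_left)
    then show "y' = y" by simp
  qed
  from theI'[OF this] show "orth_proj L x \<in> L" "z \<in> L \<Longrightarrow> inner (x - orth_proj L x) z = 0"
    unfolding orth_proj_def by auto
qed

lemma orth_proj_eqI:
  assumes L: "subspace L" and y: "y \<in> L" "\<And>z. z \<in> L \<Longrightarrow> inner (x - y) z = 0"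
  shows "orth_proj L x = y"
proof -
  have "orth_proj L x - y \<in> L" using L y orth_proj_in by (auto intro: subspace_diff)
  then have "inner (x - y) (orth_proj L x - y) = 0" "inner (x - orth_proj L x) (orth_proj L x - y) = 0"
    using y orth_proj_orth[OF L] by auto
  then have "inner (orth_proj L x - y) (orth_proj L x - y) = 0" by (simp add: inner_diff_left)
  then show ?thesis by simp
qed

lemma inner_orth_proj: "subspace L \<Longrightarrow> z \<in> L \<Longrightarrow> inner (orth_proj L x) z = inner x z"
  using orth_proj_orth[of L z x] by (simp add: inner_diff_left)

lemma orth_proj_self: "subspace L \<Longrightarrow> x \<in> L \<Longrightarrow> orth_proj L x = x"
  by (intro orth_proj_eqI) auto

lemma orth_proj_add: "subspace L \<Longrightarrow> orth_proj L (x + y) = orth_proj L x + orth_proj L y"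
  by (intro orth_proj_eqI) (auto simp: orth_proj_in subspace_add inner_add_left inner_diff_left inner_orth_proj)

lemma orth_proj_scaleR: "subspace L \<Longrightarrow> orth_proj L (c *\<^sub>R x) = c *\<^sub>R orth_proj L x"
  by (intro orth_proj_eqI) (auto simp: orth_proj_in subspace_scale inner_diff_left inner_orth_proj)

lemma orth_proj_uminus: "subspace L \<Longrightarrow> orth_proj L (- x) = - orth_proj L x"
  using orth_proj_scaleR[of L "-1" x] by simp

lemma orth_proj_diff: "subspace L \<Longrightarrow> orth_proj L (x - y) = orth_proj L x - orth_proj L y"
  using orth_proj_add[of L x "- y"] by (simp add: orth_proj_uminus)

lemma orth_proj_0: "subspace L \<Longrightarrow> orth_proj L 0 = 0"
  by (simp add: orth_proj_self subspace_0)

lemma orth_proj_sum: "subspace L \<Longrightarrow> orth_proj L (\<Sum>i\<in>I. f i) = (\<Sum>i\<in>I. orth_proj L (f i))"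
  by (induction I rule: infinite_finite_induct) (auto simp: orth_proj_0 orth_proj_add)

lemma norm_orth_proj_le: "subspace L \<Longrightarrow> norm (orth_proj L x) \<le> norm x"
proof -
  assume L: "subspace L"
  have "norm (orth_proj L x) ^ 2 = inner x (orth_proj L x)"
    using inner_orth_proj[OF L orth_proj_in[OF L], of x x] by (simp add: power2_norm_eq_inner)
  also have "\<dots> \<le> norm x * norm (orth_proj L x)" by (rule norm_cauchy_schwarz)
  finally show ?thesis
    by (cases "norm (orth_proj L x) = 0") (auto simp: power2_eq_square)
qed

lemma inner_orth_proj_self: "subspace L \<Longrightarrow> inner x (orth_proj L x) = norm (orth_proj L x) ^ 2"
  using inner_orth_proj[of L "orth_proj L x" x] by (simp add: orth_proj_in power2_norm_eq_inner)

text \<open>Independence of an indexed family, which unlike independence of its image also excludes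
  repeated vectors.\<close>

definition indep_fam :: "'i set \<Rightarrow> ('i \<Rightarrow> 'a::euclidean_space) \<Rightarrow> bool" where
  "indep_fam I u \<longleftrightarrow> (\<forall>c. (\<Sum>i\<in>I. c i *\<^sub>R u i) = 0 \<longrightarrow> (\<forall>i\<in>I. c i = 0))"

lemma indep_fam_iff:
  assumes "finite I"
  shows "indep_fam I u \<longleftrightarrow> inj_on u I \<and> independent (u ` I)"
proof
  assume i: "indep_fam I u"
  have inj: "inj_on u I"
  proof (rule inj_onI, rule ccontr)
    fix x y assume xy: "x \<in> I" "y \<in> I" "u x = u y" "x \<noteq> y"
    let ?c = "\<lambda>i. if i = x then 1 else if i = y then -1 else (0::real)"
    have "(\<Sum>i\<in>I. ?c i *\<^sub>R u i) = (\<Sum>i\<in>{x, y}. ?c i *\<^sub>R u i)"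
      using assms xy by (intro sum.mono_neutral_right) auto
    also have "\<dots> = 0" using xy by simp
    finally have "\<forall>i\<in>I. ?c i = 0" using i unfolding indep_fam_def by (elim allE[of _ ?c]) simp
    then have "?c x = 0" using xy(1) by (rule bspec)
    then show False by simp
  qed
  moreover have "independent (u ` I)"
  proof
    assume "dependent (u ` I)"
    then obtain c where c: "(\<exists>v\<in>u ` I. c v \<noteq> 0)" "(\<Sum>v\<in>u ` I. c v *\<^sub>R v) = 0"
      using dependent_finite[of "u ` I"] assms by auto
    then have "(\<Sum>i\<in>I. c (u i) *\<^sub>R u i) = 0" using inj by (simp add: sum.reindex)
    then have "\<forall>i\<in>I. c (u i) = 0" using i unfolding indep_fam_def by (elim allE[of _ "\<lambda>i. c (u i)"]) simp
    then show False using c(1) by auto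
  qed
  ultimately show "inj_on u I \<and> independent (u ` I)" by simp
next
  assume a: "inj_on u I \<and> independent (u ` I)"
  show "indep_fam I u"
    unfolding indep_fam_def
  proof (intro allI impI ballI)
    fix c i assume c: "(\<Sum>i\<in>I. c i *\<^sub>R u i) = 0" and i: "i \<in> I"
    have "(\<Sum>v\<in>u ` I. c (the_inv_into I u v) *\<^sub>R v) = (\<Sum>i\<in>I. c i *\<^sub>R u i)"
      using a by (subst sum.reindex) (auto simp: the_inv_into_f_f intro!: sum.cong)
    then have s0: "(\<Sum>v\<in>u ` I. c (the_inv_into I u v) *\<^sub>R v) = 0" using c by simp
    have "\<forall>v\<in>u ` I. c (the_inv_into I u v) = 0"
    proof (rule ccontr)
      assume "\<not> ?thesis"
      then have "dependent (u ` I)"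
        unfolding dependent_finite[OF finite_imageI[OF assms]] using s0
        by (intro exI[of _ "\<lambda>v. c (the_inv_into I u v)"]) simp
      then show False using a by simp
    qed
    then show "c i = 0" using a i by (auto simp: the_inv_into_f_f)
  qed
qed

lemma indep_fam_mono:
  assumes "finite I" "indep_fam I u" "J \<subseteq> I" shows "indep_fam J u"
  by (metis assms finite_subset indep_fam_iff independent_mono image_mono inj_on_subset)

text \<open>Transfers independence from the normals \<open>nrm\<close> of a set of hyperplanes to
  the normals in a tuple, which are signed and differently indexed.\<close>

lemma indep_fam_reindex:
  assumes "finite J" "inj_on f J" "indep_fam (f ` J) w"
    and u: "\<And>j. j \<in> J \<Longrightarrow> u j = s j *\<^sub>R w (f j)" "\<And>j. j \<in> J \<Longrightarrow> s j \<noteq> 0"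
  shows "indep_fam J u"
  unfolding indep_fam_def
proof (intro allI impI ballI)
  fix c j assume c: "(\<Sum>i\<in>J. c i *\<^sub>R u i) = 0" and j: "j \<in> J"
  let ?g = "the_inv_into J f"
  have "(\<Sum>h\<in>f ` J. (c (?g h) * s (?g h)) *\<^sub>R w h) = (\<Sum>i\<in>J. c i *\<^sub>R u i)"
    using assms(2) u(1) by (subst sum.reindex) (auto simp: the_inv_into_f_f intro!: sum.cong)
  then have s0: "(\<Sum>h\<in>f ` J. (c (?g h) * s (?g h)) *\<^sub>R w h) = 0" using c by simp
  have "\<forall>h\<in>f ` J. c (?g h) * s (?g h) = 0"
    using assms(3) s0 unfolding indep_fam_def by (elim allE[of _ "\<lambda>h. c (?g h) * s (?g h)"]) simp
  then have "c j * s j = 0" using j assms(2) by (auto simp: the_inv_into_f_f)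
  then show "c j = 0" using u(2)[OF j] by simp
qed

lemma dim_span_indep_fam:
  assumes "finite I" "indep_fam I u" shows "dim (span (u ` I)) = card I"
  using assms indep_fam_iff[OF assms(1), of u] by (simp add: dim_eq_card_independent card_image)

definition orth_fam :: "'i set \<Rightarrow> ('i \<Rightarrow> 'a::euclidean_space) \<Rightarrow> 'a set" where
  "orth_fam I u = {w. \<forall>i\<in>I. inner (u i) w = 0}"

lemma orth_fam_eq: "orthogonal_comp (span (u ` I)) = orth_fam I u"
proof
  show "orthogonal_comp (span (u ` I)) \<subseteq> orth_fam I u"
    by (fastforce simp: orthogonal_comp_def orth_fam_def real_inner_class.orthogonal_def intro: span_base)
  show "orth_fam I u \<subseteq> orthogonal_comp (span (u ` I))"
  proof
    fix w assume w: "w \<in> orth_fam I u"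
    have "real_inner_class.orthogonal w v" if "v \<in> span (u ` I)" for v
      using that w by (intro orthogonal_to_span[of v "u ` I"]) (auto simp: orth_fam_def real_inner_class.orthogonal_def inner_commute)
    then show "w \<in> orthogonal_comp (span (u ` I))" by (auto simp: orthogonal_comp_def real_inner_class.orthogonal_def inner_commute)
  qed
qed

lemma L_space_eq: "L_space k u = orth_fam {k + 2..DIM('a) + 1} u" for u :: "nat \<Rightarrow> 'a::euclidean_space"
  by (simp add: L_space_def orth_fam_eq)

lemma subspace_orth_fam: "subspace (orth_fam I u)"
  unfolding orth_fam_eq[symmetric] by (rule subspace_orthogonal_comp)

lemma dim_orth_fam:
  fixes u :: "'i \<Rightarrow> 'a::euclidean_space"
  assumes "finite I" "indep_fam I u" shows "dim (orth_fam I u) + card I = DIM('a)"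
proof -
  have "dim {y \<in> UNIV. \<forall>x\<in>span (u ` I). real_inner_class.orthogonal x y} + dim (span (u ` I)) = dim (UNIV :: 'a set)"
    by (intro dim_subspace_orthogonal_to_vectors) auto
  moreover have "{y \<in> UNIV. \<forall>x\<in>span (u ` I). real_inner_class.orthogonal x y} = orth_fam I u"
    unfolding orth_fam_eq[symmetric] by (auto simp: orthogonal_comp_def)
  ultimately show ?thesis using dim_span_indep_fam[OF assms] by simp
qed

text \<open>A vector orthogonal to the orthogonal complement lies in the span. Span conditions
  thereby become the vanishing of the norm of a projection, which is a measurable quantity.\<close>

lemma orth_proj_orth_fam_eq_0_iff: "orth_proj (orth_fam I u) x = 0 \<longleftrightarrow> x \<in> span (u ` I)"
proof
  let ?L = "orth_fam I u"
  assume "orth_proj ?L x = 0"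
  then have "inner x z = 0" if "z \<in> ?L" for z
    using inner_orth_proj[OF subspace_orth_fam that, of x] by simp
  then have "x \<in> orthogonal_comp ?L" by (auto simp: orthogonal_comp_def real_inner_class.orthogonal_def inner_commute)
  then show "x \<in> span (u ` I)"
    unfolding orth_fam_eq[symmetric] by (simp add: orthogonal_comp_self)
next
  assume x: "x \<in> span (u ` I)"
  have "inner x z = 0" if "z \<in> orth_fam I u" for z
    using that x unfolding orth_fam_eq[symmetric] by (auto simp: orthogonal_comp_def real_inner_class.orthogonal_def)
  then show "orth_proj (orth_fam I u) x = 0"
    by (intro orth_proj_eqI subspace_orth_fam) (auto simp: subspace_0 subspace_orth_fam)
qed

lemma span_image_sum:
  assumes "finite I" "x \<in> span (u ` I)"
  obtains b where "x = (\<Sum>i\<in>I. b i *\<^sub>R u i)"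
proof -
  have "\<exists>b. x = (\<Sum>i\<in>I. b i *\<^sub>R u i)"
    using assms(2)
  proof (induction rule: span_induct_alt)
    case base
    then show ?case by (intro exI[of _ "\<lambda>_. 0"]) simp
  next
    case (step c y z)
    then obtain i b where i: "i \<in> I" "y = u i" "z = (\<Sum>i\<in>I. b i *\<^sub>R u i)" by auto
    have "(\<Sum>j\<in>I. (b j + (if j = i then c else 0)) *\<^sub>R u j) = (\<Sum>j\<in>I. b j *\<^sub>R u j) + (\<Sum>j\<in>I. (if j = i then c else 0) *\<^sub>R u j)"
      by (simp add: scaleR_add_left sum.distrib)
    also have "(\<Sum>j\<in>I. (if j = i then c else 0) *\<^sub>R u j) = (\<Sum>j\<in>I. if j = i then c *\<^sub>R u j else 0)"
      by (intro sum.cong) auto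
    also have "\<dots> = c *\<^sub>R u i" using assms(1) i(1) by simp
    finally have "c *\<^sub>R y + z = (\<Sum>j\<in>I. (b j + (if j = i then c else 0)) *\<^sub>R u j)"
      using i by (simp add: add.commute)
    then show ?case by (intro exI)
  qed
  then show ?thesis using that by blast
qed

text \<open>A relation between the projections says that a combination of the vectors with index in
  J lies in the span of those with index in I. Joint independence forces all coefficients to
  vanish.\<close>

lemma indep_fam_orth_proj:
  assumes "finite J" "finite I" "I \<inter> J = {}" "indep_fam (I \<union> J) u"
  shows "indep_fam J (\<lambda>j. orth_proj (orth_fam I u) (u j))"
  unfolding indep_fam_def
proof (intro allI impI)
  fix c assume "(\<Sum>j\<in>J. c j *\<^sub>R orth_proj (orth_fam I u) (u j)) = 0"
  then have "orth_proj (orth_fam I u) (\<Sum>j\<in>J. c j *\<^sub>R u j) = 0"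
    by (simp add: orth_proj_sum orth_proj_scaleR subspace_orth_fam)
  then have "(\<Sum>j\<in>J. c j *\<^sub>R u j) \<in> span (u ` I)"
    by (simp only: orth_proj_orth_fam_eq_0_iff)
  then obtain b where b: "(\<Sum>j\<in>J. c j *\<^sub>R u j) = (\<Sum>i\<in>I. b i *\<^sub>R u i)"
    using span_image_sum[OF assms(2)] by blast
  let ?c = "\<lambda>i. if i \<in> J then c i else - b i"
  have "(\<Sum>i\<in>I \<union> J. ?c i *\<^sub>R u i) = (\<Sum>i\<in>I. ?c i *\<^sub>R u i) + (\<Sum>i\<in>J. ?c i *\<^sub>R u i)"
    using assms by (intro sum.union_disjoint) auto
  also have "(\<Sum>i\<in>I. ?c i *\<^sub>R u i) = (\<Sum>i\<in>I. - (b i *\<^sub>R u i))"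
    using assms(3) by (intro sum.cong) auto
  also have "(\<Sum>i\<in>J. ?c i *\<^sub>R u i) = (\<Sum>i\<in>J. c i *\<^sub>R u i)" by (intro sum.cong) auto
  finally have "(\<Sum>i\<in>I \<union> J. ?c i *\<^sub>R u i) = 0" using b by (simp add: sum_negf)
  then have "\<forall>i\<in>I \<union> J. ?c i = 0" using assms(4) unfolding indep_fam_def by (elim allE[of _ ?c]) simp
  then have "?c j = 0" if "j \<in> J" for j by (rule bspec) (use that in simp)
  then show "\<forall>j\<in>J. c j = 0" by auto
qed

section \<open>Counting injective tuples of representatives\<close>

text \<open>Such a tuple takes one element from every fibre: there are n! assignments of fibres to
  indices and c choices in each fibre. The induction fixes one entry and deletes its whole
  fibre.\<close>

lemma card_tuples_of_fibres:
  fixes h :: "'b \<Rightarrow> 'c"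
  assumes "finite N" "finite R" "finite I" "card N = card I"
    and "\<And>x. x \<in> R \<Longrightarrow> h x \<in> I" and "\<And>i. i \<in> I \<Longrightarrow> card {x \<in> R. h x = i} = c"
  shows "card {p \<in> N \<rightarrow>\<^sub>E R. inj_on (\<lambda>i. h (p i)) N} = c ^ card N * fact (card N)"
  using assms
proof (induction N arbitrary: R I rule: finite_induct)
  case empty
  then show ?case by simp
next
  case (insert a N)
  let ?R = "\<lambda>x. {y \<in> R. h y \<noteq> h x}"
  let ?T = "\<lambda>N R. {p \<in> N \<rightarrow>\<^sub>E R. inj_on (\<lambda>i. h (p i)) N}"
  have cardR: "card R = card I * c"
  proof -
    have "R = (\<Union>i\<in>I. {x \<in> R. h x = i})" using insert.prems by auto
    then have "card R = card (\<Union>i\<in>I. {x \<in> R. h x = i})" by simp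
    also have "\<dots> = (\<Sum>i\<in>I. card {x \<in> R. h x = i})"
      using insert.prems by (intro card_UN_disjoint) auto
    also have "\<dots> = card I * c" using insert.prems(5) by simp
    finally show ?thesis .
  qed
  have IH: "card (?T N (?R x)) = c ^ card N * fact (card N)" if x: "x \<in> R" for x
  proof (rule insert.IH[of _ "I - {h x}"])
    show "finite (?R x)" "finite (I - {h x})" using insert.prems by auto
    show "card N = card (I - {h x})" using insert.prems insert.hyps x by simp
    show "h y \<in> I - {h x}" if "y \<in> ?R x" for y using that insert.prems by auto
    show "card {y \<in> ?R x. h y = i} = c" if i: "i \<in> I - {h x}" for i
    proof -
      have "{y \<in> ?R x. h y = i} = {y \<in> R. h y = i}" using i by auto
      then show ?thesis using insert.prems i by simp
    qed
  qed
  have fin: "finite (?T N (?R x))" for x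
    using insert.hyps insert.prems by (intro finite_subset[OF _ finite_PiE[of N "\<lambda>_. ?R x"]]) auto
  have bij: "bij_betw (\<lambda>(x, p). p(a := x)) (SIGMA x:R. ?T N (?R x)) (?T (insert a N) R)"
  proof (rule bij_betwI)
    show "(\<lambda>(x, p). p(a := x)) \<in> (SIGMA x:R. ?T N (?R x)) \<rightarrow> ?T (insert a N) R"
    proof (rule funcsetI)
      fix y assume "y \<in> (SIGMA x:R. ?T N (?R x))"
      then obtain x p where y: "y = (x, p)" and x: "x \<in> R" and p: "p \<in> N \<rightarrow>\<^sub>E ?R x" "inj_on (\<lambda>i. h (p i)) N"
        by blast
      have "p \<in> N \<rightarrow>\<^sub>E R" using p(1) by (auto simp: PiE_iff)
      then have "p(a := x) \<in> insert a N \<rightarrow>\<^sub>E R" by (intro PiE_fun_upd x)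
      moreover have "inj_on (\<lambda>i. h ((p(a := x)) i)) (insert a N)"
      proof (subst inj_on_insert, intro conjI)
        show "inj_on (\<lambda>i. h ((p(a := x)) i)) N"
          using p(2) by (rule inj_on_cong[THEN iffD1, rotated]) (use insert.hyps in auto)
        have "h x \<noteq> h (p i)" if "i \<in> N" for i using p(1) that by (force simp: PiE_iff)
        then show "h ((p(a := x)) a) \<notin> (\<lambda>i. h ((p(a := x)) i)) ` (N - {a})"
          by auto
      qed
      ultimately show "(\<lambda>(x, p). p(a := x)) y \<in> ?T (insert a N) R" by (simp add: y)
    qed
    show "(\<lambda>p. (p a, restrict p N)) \<in> ?T (insert a N) R \<rightarrow> (SIGMA x:R. ?T N (?R x))"
    by (auto simp: insert.hyps inj_on_def)
    show "(\<lambda>p. (p a, restrict p N)) ((\<lambda>(x, p). p(a := x)) z) = z" if "z \<in> (SIGMA x:R. ?T N (?R x))" for z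
      using that insert.hyps by (auto simp: fun_eq_iff PiE_iff extensional_def restrict_def)
    show "(\<lambda>(x, p). p(a := x)) ((\<lambda>p. (p a, restrict p N)) p) = p" if "p \<in> ?T (insert a N) R" for p
      using that by (auto simp: fun_eq_iff PiE_iff extensional_def restrict_def)
  qed
  have "card (?T (insert a N) R) = card (SIGMA x:R. ?T N (?R x))"
    using bij_betw_same_card[OF bij] by simp
  also have "\<dots> = (\<Sum>x\<in>R. card (?T N (?R x)))"
    using insert.prems fin by (intro card_SigmaI) auto
  also have "\<dots> = card R * (c ^ card N * fact (card N))" using IH by simp
  also have "\<dots> = c ^ card (insert a N) * fact (card (insert a N))"
    unfolding cardR insert.prems(3)[symmetric] using insert.hyps by (simp add: algebra_simps)
  finally show ?case .
qed

lemma bounded_componentwise_inner: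
  fixes W :: "'a::euclidean_space set"
  assumes "\<And>b. bounded ((\<lambda>w. inner w b) ` W)"
  shows "bounded W"
proof -
  have "\<forall>b. \<exists>B. \<forall>w\<in>W. \<bar>inner w b\<bar> \<le> B"
    using assms unfolding bounded_iff by auto
  then obtain B where B: "\<And>b w. w \<in> W \<Longrightarrow> \<bar>inner w b\<bar> \<le> B b" by metis
  have "norm w \<le> (\<Sum>b\<in>Basis. B b)" if "w \<in> W" for w
    using norm_le_l1[of w] B[OF that] by (meson order_trans sum_mono)
  then show ?thesis unfolding bounded_iff by blast
qed

section \<open>Tuples of hyperplanes determining a simplex\<close>

definition normals :: "(nat \<Rightarrow> 'a::euclidean_space \<times> real) \<Rightarrow> nat \<Rightarrow> 'a" where
  "normals p = (\<lambda>i\<in>{1..DIM('a) + 1}. fst (p i))"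

text \<open>The change of level per unit of radius: a hyperplane with normal \<open>u i\<close> that
  touches an r-ball in the flat around z lies at r times this amount beyond z, while hyperplanes
  through the flat stay at the level of z.\<close>

definition mrad :: "nat \<Rightarrow> (nat \<Rightarrow> 'a::euclidean_space) \<Rightarrow> nat \<Rightarrow> real" where
  "mrad k u i = (if i \<le> k + 1 then norm (orth_proj (L_space k u) (u i)) else 0)"

definition tuple_ball :: "nat \<Rightarrow> (nat \<Rightarrow> 'a::euclidean_space) \<Rightarrow> (nat \<Rightarrow> real) \<Rightarrow> 'a \<Rightarrow> real \<Rightarrow> bool" where
  "tuple_ball k u t z r \<longleftrightarrow> (\<forall>i\<in>{1..DIM('a) + 1}. inner (u i) z + r * mrad k u i = t i)"

lemma subspace_L_space: "subspace (L_space k u)" for u :: "nat \<Rightarrow> 'a::euclidean_space"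
  by (simp add: L_space_eq subspace_orth_fam)

lemma in_L_space_iff: "w \<in> L_space k u \<longleftrightarrow> (\<forall>i\<in>{k + 2..DIM('a) + 1}. inner (u i) w = 0)"
  for u :: "nat \<Rightarrow> 'a::euclidean_space"
  by (auto simp: L_space_eq orth_fam_def)

lemma general_position_iff:
  "general_position u \<longleftrightarrow> (\<forall>I\<subseteq>{1..DIM('a) + 1}. card I = DIM('a) \<longrightarrow> indep_fam I u)"
  for u :: "nat \<Rightarrow> 'a::euclidean_space"
  by (simp add: finite_subset general_position_def indep_fam_iff)

lemma general_position_indep_fam:
  fixes u :: "nat \<Rightarrow> 'a::euclidean_space"
  assumes gp: "general_position u" and I: "I \<subseteq> {1..DIM('a) + 1}" "card I \<le> DIM('a)"
  shows "indep_fam I u"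
proof -
  have "\<exists>J. I \<subseteq> J \<and> J \<subseteq> {1..DIM('a) + 1} \<and> card J = DIM('a)"
    using I by (intro exists_subset_between) auto
  then obtain J where J: "I \<subseteq> J" "J \<subseteq> {1..DIM('a) + 1}" "card J = DIM('a)" by blast
  then have "indep_fam J u" using gp by (simp add: general_position_iff)
  moreover have "finite J" using J(2) by (rule finite_subset) simp
  ultimately show ?thesis using J(1) indep_fam_mono by blast
qed

text \<open>In general position the first k projections form a basis of \<open>L_space k u\<close>.
  Positive spanning yields a strictly positive relation by representing the negated sum of all
  projections; conversely a multiple of such a relation can be added to any representation to make
  its coefficients nonnegative.\<close>

lemma P_set_iff:
  fixes u :: "nat \<Rightarrow> 'a::euclidean_space"
  assumes k: "k \<in> {1..DIM('a)}"
  shows "u \<in> P_set k \<longleftrightarrow> u \<in> {1..DIM('a) + 1} \<rightarrow>\<^sub>E sphere 0 1 \<and> general_position u \<and>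
    (\<exists>a. (\<forall>j\<in>{1..k + 1}. 0 < a j) \<and> (\<Sum>j = 1..k + 1. a j *\<^sub>R orth_proj (L_space k u) (u j)) = 0)"
proof -
  let ?L = "L_space k u"
  let ?v = "\<lambda>j. orth_proj ?L (u j)"
  have "(\<forall>x\<in>?L. \<exists>c. (\<forall>j\<in>{1..k + 1}. 0 \<le> c j) \<and> x = (\<Sum>j = 1..k + 1. c j *\<^sub>R ?v j)) \<longleftrightarrow>
     (\<exists>a. (\<forall>j\<in>{1..k + 1}. 0 < a j) \<and> (\<Sum>j = 1..k + 1. a j *\<^sub>R ?v j) = 0)"
    if gp: "general_position u"
  proof
    assume *: "\<forall>x\<in>?L. \<exists>c. (\<forall>j\<in>{1..k + 1}. 0 \<le> c j) \<and> x = (\<Sum>j = 1..k + 1. c j *\<^sub>R ?v j)"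
    have "- (\<Sum>j = 1..k + 1. ?v j) \<in> ?L"
      by (intro subspace_neg subspace_sum subspace_L_space orth_proj_in)
    then obtain c where c: "\<forall>j\<in>{1..k + 1}. 0 \<le> c j" "- (\<Sum>j = 1..k + 1. ?v j) = (\<Sum>j = 1..k + 1. c j *\<^sub>R ?v j)"
      using * by blast
    have "(\<Sum>j = 1..k + 1. (1 + c j) *\<^sub>R ?v j) = (\<Sum>j = 1..k + 1. ?v j) + (\<Sum>j = 1..k + 1. c j *\<^sub>R ?v j)"
      by (simp only: scaleR_add_left scaleR_one sum.distrib)
    also have "\<dots> = 0" unfolding c(2)[symmetric] by simp
    finally show "\<exists>a. (\<forall>j\<in>{1..k + 1}. 0 < a j) \<and> (\<Sum>j = 1..k + 1. a j *\<^sub>R ?v j) = 0"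
      using c(1) by (intro exI[of _ "\<lambda>j. 1 + c j"]) (auto intro: add_pos_nonneg)
  next
    assume "\<exists>a. (\<forall>j\<in>{1..k + 1}. 0 < a j) \<and> (\<Sum>j = 1..k + 1. a j *\<^sub>R ?v j) = 0"
    then obtain a where a: "\<forall>j\<in>{1..k + 1}. 0 < a j" "(\<Sum>j = 1..k + 1. a j *\<^sub>R ?v j) = 0" by blast
    let ?I = "{k + 2..DIM('a) + 1}"
    have card_I: "card ?I = DIM('a) - k" by simp
    have "indep_fam (?I \<union> {1..k}) u"
      using k by (intro general_position_indep_fam[OF gp]) (auto simp: card_Un_disjoint)
    then have ind: "indep_fam {1..k} ?v"
      unfolding L_space_eq by (intro indep_fam_orth_proj) auto
    have "indep_fam ?I u" using k by (intro general_position_indep_fam[OF gp]) auto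
    then have dimL: "dim ?L = k"
      using dim_orth_fam[of ?I u] k by (auto simp: L_space_eq)
    have "?v ` {1..k} \<subseteq> ?L" using orth_proj_in[OF subspace_L_space] by auto
    moreover have "independent (?v ` {1..k})" "card (?v ` {1..k}) = k"
      using ind indep_fam_iff[of "{1..k}" ?v] by (auto simp: card_image)
    ultimately have Lspan: "?L \<subseteq> span (?v ` {1..k})"
      using dimL by (intro card_ge_dim_independent) auto
    show "\<forall>x\<in>?L. \<exists>c. (\<forall>j\<in>{1..k + 1}. 0 \<le> c j) \<and> x = (\<Sum>j = 1..k + 1. c j *\<^sub>R ?v j)"
    proof
      fix x assume "x \<in> ?L"
      then obtain b where b: "x = (\<Sum>j\<in>{1..k}. b j *\<^sub>R ?v j)"
        using Lspan span_image_sum[of "{1..k}" x ?v] by blast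
      let ?b = "\<lambda>j. if j \<le> k then b j else 0"
      \<comment> \<open>A multiple of the positive relation that dominates every |b j| at
        once.\<close>
      define l where "l = (\<Sum>j = 1..k + 1. \<bar>?b j\<bar> / a j)"
      have nonneg: "0 \<le> ?b j + l * a j" if j: "j \<in> {1..k + 1}" for j
      proof -
        have aj: "0 < a j" using a(1) j by blast
        have "\<bar>?b j\<bar> / a j \<le> l"
          unfolding l_def using a(1) j by (intro member_le_sum) (auto intro!: divide_nonneg_pos)
        then have "\<bar>?b j\<bar> \<le> l * a j" using aj by (simp add: pos_divide_le_eq)
        then show ?thesis by linarith
      qed
      have x_eq: "x = (\<Sum>j = 1..k + 1. (?b j + l * a j) *\<^sub>R ?v j)"
      proof -
        have "(\<Sum>j = 1..k + 1. (?b j + l * a j) *\<^sub>R ?v j) = (\<Sum>j = 1..k + 1. ?b j *\<^sub>R ?v j) + l *\<^sub>R (\<Sum>j = 1..k + 1. a j *\<^sub>R ?v j)"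
          by (simp only: scaleR_add_left sum.distrib scaleR_sum_right scaleR_scaleR)
        also have "(\<Sum>j = 1..k + 1. ?b j *\<^sub>R ?v j) = (\<Sum>j = 1..k. ?b j *\<^sub>R ?v j)" by simp
        also have "\<dots> = x" unfolding b by (intro sum.cong) auto
        also have "x + l *\<^sub>R (\<Sum>j = 1..k + 1. a j *\<^sub>R ?v j) = x" by (simp only: a(2) scaleR_zero_right add_0_right)
        finally show ?thesis ..
      qed
      show "\<exists>c. (\<forall>j\<in>{1..k + 1}. 0 \<le> c j) \<and> x = (\<Sum>j = 1..k + 1. c j *\<^sub>R ?v j)"
        by (intro exI[of _ "\<lambda>j. ?b j + l * a j"] conjI ballI nonneg x_eq)
    qed
  qed
  then show ?thesis unfolding P_set_def by blast
qed

section \<open>Consequences of positive spanning\<close>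

context
  fixes u :: "nat \<Rightarrow> 'a::euclidean_space" and k :: nat
  assumes k: "k \<in> {1..DIM('a)}" and u: "u \<in> P_set k"
begin

lemma P_set_general_position: "general_position u" using u by (simp add: P_set_def)

lemma P_set_zero:
  assumes w: "w \<in> L_space k u" and le: "\<And>j. j \<in> {1..k + 1} \<Longrightarrow> inner (u j) w \<le> 0"
  shows "w = 0"
proof -
  let ?v = "\<lambda>j. orth_proj (L_space k u) (u j)"
  obtain c where c: "\<forall>j\<in>{1..k + 1}. 0 \<le> c j" "w = (\<Sum>j = 1..k + 1. c j *\<^sub>R ?v j)"
    using u w unfolding P_set_def by blast
  have "inner w w = (\<Sum>j = 1..k + 1. c j * inner (?v j) w)"
    by (subst (1) c(2)) (simp only: inner_sum_left inner_scaleR_left)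
  also have "\<dots> = (\<Sum>j = 1..k + 1. c j * inner (u j) w)"
    by (simp only: inner_orth_proj[OF subspace_L_space w])
  also have "\<dots> \<le> 0"
    using c(1) le by (intro sum_nonpos) (auto intro!: mult_nonneg_nonpos)
  finally show ?thesis using inner_ge_zero[of w] by simp
qed

lemma P_set_mrad_pos:
  assumes j: "j \<in> {1..k + 1}" shows "0 < mrad k u j"
proof -
  let ?I = "{k + 2..DIM('a) + 1}"
  have "indep_fam (?I \<union> {j}) u"
    using k j by (intro general_position_indep_fam[OF P_set_general_position]) (auto simp: card_insert_if)
  then have "indep_fam {j} (\<lambda>j. orth_proj (L_space k u) (u j))"
    unfolding L_space_eq using j by (intro indep_fam_orth_proj) auto
  then have "orth_proj (L_space k u) (u j) \<noteq> 0"
    unfolding indep_fam_def by (auto dest: spec[of _ "\<lambda>_. 1"])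
  then show ?thesis using j by (simp add: mrad_def)
qed

text \<open>Weighting the inequalities with the strictly positive relation cancels the terms in w
  and leaves s times a positive sum. Geometrically, no ball in the simplex exceeds the
  inball.\<close>

lemma P_set_radius_le:
  assumes w: "w \<in> L_space k u" and le: "\<And>j. j \<in> {1..k + 1} \<Longrightarrow> inner (u j) w + s * mrad k u j \<le> 0"
  shows "s \<le> 0"
proof -
  let ?v = "\<lambda>j. orth_proj (L_space k u) (u j)"
  obtain a where a: "\<forall>j\<in>{1..k + 1}. 0 < a j" "(\<Sum>j = 1..k + 1. a j *\<^sub>R ?v j) = 0"
    using u unfolding P_set_iff[OF k] by blast
  have "(\<Sum>j = 1..k + 1. a j * inner (u j) w) = inner (\<Sum>j = 1..k + 1. a j *\<^sub>R ?v j) w"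
    by (simp only: inner_sum_left inner_scaleR_left inner_orth_proj[OF subspace_L_space w])
  then have 0: "(\<Sum>j = 1..k + 1. a j * inner (u j) w) = 0" unfolding a(2) by simp
  have "(\<Sum>j = 1..k + 1. a j * (inner (u j) w + s * mrad k u j)) \<le> 0"
  by (smt (verit) sum_nonpos a le mult_le_0_iff)
  also have "(\<Sum>j = 1..k + 1. a j * (inner (u j) w + s * mrad k u j)) =
      (\<Sum>j = 1..k + 1. a j * inner (u j) w) + s * (\<Sum>j = 1..k + 1. a j * mrad k u j)"
    unfolding sum_distrib_left sum.distrib[symmetric] by (intro sum.cong) (auto simp: algebra_simps)
  finally have "s * (\<Sum>j = 1..k + 1. a j * mrad k u j) \<le> 0" using 0 by simp
  moreover have "0 < (\<Sum>j = 1..k + 1. a j * mrad k u j)"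
    using a(1) P_set_mrad_pos by (intro sum_pos) auto
  ultimately show ?thesis by (simp add: mult_le_0_iff)
qed

lemma P_set_kernel:
  assumes "\<And>i. i \<in> {1..DIM('a) + 1} \<Longrightarrow> inner (u i) w + s * mrad k u i = 0"
  shows "w = 0 \<and> s = 0"
proof -
  have w: "w \<in> L_space k u"
    unfolding in_L_space_iff
  proof
    fix i assume "i \<in> {k + 2..DIM('a) + 1}"
    then show "inner (u i) w = 0" using assms[of i] by (simp add: mrad_def)
  qed
  have e: "inner (u j) w + s * mrad k u j = 0" if "j \<in> {1..k + 1}" for j
    using that k by (intro assms) auto
  have "s \<le> 0"
  using P_set_radius_le w e by simp
  moreover have "- s \<le> 0"
  proof (rule P_set_radius_le[of "- w"])
    show "- w \<in> L_space k u" using w subspace_neg[OF subspace_L_space] by blast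
    fix j assume "j \<in> {1..k + 1}"
    from e[OF this] show "inner (u j) (- w) + - s * mrad k u j \<le> 0" by simp
  qed
  ultimately have s: "s = 0" by simp
  have "w = 0"
  proof (rule P_set_zero[OF w])
    fix j assume "j \<in> {1..k + 1}"
    from e[OF this] s show "inner (u j) w \<le> 0" by simp
  qed
  with s show ?thesis by simp
qed

text \<open>A kernel vector of the matrix is a displacement w together with a change of radius s
  that alters no level, and \<open>P_set_kernel\<close> admits only the trivial one.\<close>

lemma det_center_radius_neq_0: "Determinant.det (center_radius_mat u (mrad k u)) \<noteq> 0"
proof
  let ?A = "center_radius_mat u (mrad k u)" and ?n = "DIM('a) + 1"
  assume "Determinant.det ?A = 0"
  then obtain v where v: "v \<in> carrier_vec ?n" "v \<noteq> 0\<^sub>v ?n" "?A *\<^sub>v v = 0\<^sub>v ?n"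
    unfolding det_0_iff_vec_prod_zero[OF center_radius_mat_carrier] by blast
  let ?b = "from_nat_into (Basis :: 'a set)"
  let ?w = "\<Sum>j<DIM('a). (vec_index v j) *\<^sub>R ?b j" and ?s = "vec_index v DIM('a)"
  have bij: "bij_betw ?b {..<DIM('a)} Basis"
    using bij_betw_from_nat_into_finite[OF finite_Basis] .
  have "inner (u i) ?w + ?s * mrad k u i = 0" if i: "i \<in> {1..?n}" for i
  proof -
    have "i - 1 < ?n" using i by auto
    then have "0 = vec_index (?A *\<^sub>v v) (i - 1)" unfolding v(3) by (rule index_zero_vec(1)[symmetric])
    also have "\<dots> = (\<Sum>j<?n. ?A $$ (i - 1, j) * vec_index v j)"
      using i v(1) by (auto simp: center_radius_mat_def scalar_prod_def atLeast0LessThan intro!: sum.cong)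
    also have "\<dots> = (\<Sum>j<DIM('a). inner (u i) (?b j) * vec_index v j) + mrad k u i * ?s"
      using i by (auto simp: center_radius_mat_def intro!: sum.cong)
    also have "\<dots> = inner (u i) ?w + ?s * mrad k u i"
      by (simp add: inner_sum_right mult.commute)
    finally show ?thesis by simp
  qed
  from P_set_kernel[OF this] have w: "?w = 0" "?s = 0" by auto
  have "vec_index v j = 0" if j: "j < ?n" for j
  proof (cases "j = DIM('a)")
    case False
    then have j': "j < DIM('a)" using j by simp
    have "inner ?w (?b j) = (\<Sum>i<DIM('a). if i = j then vec_index v i else 0)"
      unfolding inner_sum_left
    proof (intro sum.cong refl)
      fix i assume i: "i \<in> {..<DIM('a)}"
      have "?b j \<in> Basis" "?b i \<in> Basis" using bij j' i by (auto simp: bij_betw_def)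
      moreover have "?b i = ?b j \<longleftrightarrow> i = j" using bij j' i by (auto simp: bij_betw_def inj_on_def)
      ultimately show "inner ((vec_index v i) *\<^sub>R ?b i) (?b j) = (if i = j then vec_index v i else 0)"
        by (auto simp: inner_Basis)
    qed
    then show ?thesis using w(1) j' by simp
  qed (use w in simp)
  then have "v = 0\<^sub>v ?n" using v(1) by (intro eq_vecI) auto
  then show False using v(2) by simp
qed

text \<open>On \<open>L_space k u\<close> every linear functional is a nonnegative combination of
  the functionals \<open>inner (u j)\<close>, hence bounded above on the set. Applied to a vector
  and its negative, this bounds the functional on both sides.\<close>

lemma P_set_simplex_bounded:
  "bounded {y. y - z \<in> L_space k u \<and> (\<forall>j\<in>{1..k + 1}. inner (u j) y \<le> t j)}"
proof -
  let ?W = "{w \<in> L_space k u. \<forall>j\<in>{1..k + 1}. inner (u j) w \<le> t j - inner (u j) z}"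
  let ?C = "\<lambda>j. t j - inner (u j) z"
  let ?v = "\<lambda>j. orth_proj (L_space k u) (u j)"
  have upper: "\<exists>B. \<forall>w\<in>?W. inner w b \<le> B" for b
  proof -
    have "orth_proj (L_space k u) b \<in> L_space k u" by (rule orth_proj_in[OF subspace_L_space])
    then obtain c where c: "\<forall>j\<in>{1..k + 1}. 0 \<le> c j" "orth_proj (L_space k u) b = (\<Sum>j = 1..k + 1. c j *\<^sub>R ?v j)"
      using u unfolding P_set_def by blast
    have "inner w b \<le> (\<Sum>j = 1..k + 1. c j * ?C j)" if w: "w \<in> ?W" for w
    proof -
      have wL: "w \<in> L_space k u" using w by simp
      have "inner w b = inner (orth_proj (L_space k u) b) w"
        by (subst inner_orth_proj[OF subspace_L_space wL]) (rule inner_commute)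
      also have "\<dots> = (\<Sum>j = 1..k + 1. c j * inner (u j) w)"
        unfolding c(2) by (simp only: inner_sum_left inner_scaleR_left inner_orth_proj[OF subspace_L_space wL])
      also have "\<dots> \<le> (\<Sum>j = 1..k + 1. c j * ?C j)"
        using c(1) w by (intro sum_mono mult_left_mono) auto
      finally show ?thesis .
    qed
    then show ?thesis by blast
  qed
  have "bounded ((\<lambda>w. inner w b) ` ?W)" for b
  proof -
    obtain B B' where "\<forall>w\<in>?W. inner w b \<le> B" "\<forall>w\<in>?W. inner w (- b) \<le> B'"
      using upper[of b] upper[of "- b"] by blast
    then have "(\<lambda>w. inner w b) ` ?W \<subseteq> {- B'..B}" by force
    then show ?thesis using bounded_closed_interval bounded_subset by blast
  qed
  then have "bounded ?W" by (rule bounded_componentwise_inner)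
  then have "bounded ((+) z ` ?W)" by (rule bounded_translation)
  moreover have "{y. y - z \<in> L_space k u \<and> (\<forall>j\<in>{1..k + 1}. inner (u j) y \<le> t j)} \<subseteq> (+) z ` ?W"
  by (force simp: inner_diff_right)
  ultimately show ?thesis using bounded_subset by blast
qed

end

lemma rep_lev:
  assumes "norm (fst q) = 1"
  shows "\<exists>s. (s = 1 \<or> s = -1) \<and> (\<forall>y. inner (fst q) y - snd q = s * lev (hyp q) y) \<and> fst q = s *\<^sub>R nrm (hyp q)"
proof -
  have H: "hyp q \<in> hyperplanes" by (rule hyp_in_hyperplanes)
  have "hyp (sec (hyp q)) = hyp q" using sec[OF H] by simp
  then have "sec (hyp q) = q \<or> sec (hyp q) = - q"
    using hyp_eq_iff[OF assms sec(1)[OF H]] by simp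
  then show ?thesis
  by (force simp: lev_def nrm_def inner_commute)
qed

lemma normals_apply: "i \<in> {1..DIM('a) + 1} \<Longrightarrow> normals p i = fst (p i)" for p :: "nat \<Rightarrow> 'a::euclidean_space \<times> real"
  by (simp add: normals_def)

lemma rel_open_ball_eq:
  assumes L: "subspace L" and r: "0 < r"
  shows "rel_open_ball L r = {w \<in> L. norm w < r}"
proof -
  have "0 \<in> interior (cball 0 r) \<inter> L" using r subspace_0[OF L] by simp
  then have "interior (cball 0 r) \<inter> L \<noteq> {}" by blast
  then have "rel_interior (cball 0 r \<inter> L) = interior (cball 0 r) \<inter> L"
    by (rule rel_interior_convex_Int_affine[OF convex_cball subspace_imp_affine[OF L]])
  then show ?thesis unfolding rel_open_ball_def by auto
qed

text \<open>The tuple data \<open>(p, z, r)\<close> describes a face with incenter \<open>z\<close> and inradius \<open>r\<close>.\<close>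

definition good_tuple :: "nat \<Rightarrow> 'a::euclidean_space set set \<Rightarrow> (nat \<Rightarrow> 'a \<times> real) \<Rightarrow> 'a \<Rightarrow> real \<Rightarrow> bool" where
  "good_tuple k S p z r \<longleftrightarrow> p \<in> tuples (DIM('a) + 1) S \<and> normals p \<in> P_set k \<and> 0 < r \<and>
     tuple_ball k (normals p) (\<lambda>i. snd (p i)) z r \<and>
     (\<forall>H\<in>S - hyps (DIM('a) + 1) p. \<forall>w\<in>L_space k (normals p). norm w < r \<longrightarrow> z + w \<notin> H)"

lemma tuplesD:
  assumes "p \<in> tuples n S" "i \<in> {1..n}"
  shows "norm (fst (p i)) = 1" "hyp (p i) \<in> S"
  using assms by (auto simp: tuples_def reps_def PiE_iff)

section \<open>The face described by a good tuple\<close>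

locale good_tuple_face =
  fixes k :: nat and S :: "'a::euclidean_space set set" and p z r
  assumes k: "k \<in> {1..DIM('a)}" and S: "S \<in> hyperplane_configs" and good: "good_tuple k S p z r"
begin

abbreviation "u \<equiv> normals p"
abbreviation "L \<equiv> L_space k u"

lemma p: "p \<in> tuples (DIM('a) + 1) S" and uP: "u \<in> P_set k" and r: "0 < r"
  and tb: "tuple_ball k u (\<lambda>i. snd (p i)) z r"
  and nohit: "H \<in> S \<Longrightarrow> H \<notin> hyps (DIM('a) + 1) p \<Longrightarrow> w \<in> L \<Longrightarrow> norm w < r \<Longrightarrow> z + w \<notin> H"
  using good by (auto simp: good_tuple_def)

lemma Sh: "S \<subseteq> hyperplanes" using S by (rule hyperplane_configs_subset)

lemma p_norm: "i \<in> {1..DIM('a) + 1} \<Longrightarrow> norm (fst (p i)) = 1" and p_hyp: "i \<in> {1..DIM('a) + 1} \<Longrightarrow> hyp (p i) \<in> S"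
  using tuplesD[OF p] by auto

lemma ball_eq: "i \<in> {1..DIM('a) + 1} \<Longrightarrow> inner (u i) z + r * mrad k u i = snd (p i)"
  using tb by (auto simp: tuple_ball_def)

lemma p_level: "i \<in> {1..DIM('a) + 1} \<Longrightarrow> inner (u i) z - snd (p i) = - (r * mrad k u i)"
  using ball_eq[of i] by simp

lemma mrad_pos: "j \<in> {1..k + 1} \<Longrightarrow> 0 < mrad k u j" by (rule P_set_mrad_pos[OF k uP])

lemma mrad_0: "i \<in> {k + 2..DIM('a) + 1} \<Longrightarrow> mrad k u i = 0"
  unfolding mrad_def by (rule if_not_P) auto

lemma lev_iff:
  assumes "i \<in> {1..DIM('a) + 1}"
  shows "lev (hyp (p i)) y = 0 \<longleftrightarrow> inner (u i) y = snd (p i)"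
    and "lev (hyp (p i)) y * lev (hyp (p i)) y' = (inner (u i) y - snd (p i)) * (inner (u i) y' - snd (p i))"
proof -
  obtain s where s: "(s = 1 \<or> s = -1) \<and> (\<forall>y. inner (fst (p i)) y - snd (p i) = s * lev (hyp (p i)) y)
      \<and> fst (p i) = s *\<^sub>R nrm (hyp (p i))"
    using rep_lev[OF p_norm[OF assms]] by (rule exE)
  have e: "inner (u i) y - snd (p i) = s * lev (hyp (p i)) y" for y
    unfolding normals_apply[OF assms] using s by blast
  show "lev (hyp (p i)) y = 0 \<longleftrightarrow> inner (u i) y = snd (p i)"
    using e[of y] s by auto
  show "lev (hyp (p i)) y * lev (hyp (p i)) y' = (inner (u i) y - snd (p i)) * (inner (u i) y' - snd (p i))"
    unfolding e using conjunct1[OF s] by auto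
qed

lemma other_lev: "H \<in> S \<Longrightarrow> H \<notin> hyps (DIM('a) + 1) p \<Longrightarrow> lev H z \<noteq> 0"
  using nohit[of H 0] r lev_eq_0_iff[of H z] Sh subspace_0[OF subspace_L_space, of k u] by auto

lemma S_cases:
  assumes "H \<in> S"
  obtains (outer) j where "j \<in> {1..k + 1}" "H = hyp (p j)"
  | (through) i where "i \<in> {k + 2..DIM('a) + 1}" "H = hyp (p i)"
  | (other) "H \<notin> hyps (DIM('a) + 1) p"
proof (cases "H \<in> hyps (DIM('a) + 1) p")
  case True
  then obtain i where i: "i \<in> {1..DIM('a) + 1}" "H = hyp (p i)" by (auto simp: hyps_def)
  show ?thesis
  proof (cases "i \<le> k + 1")
    case True
    then show ?thesis using i outer[of i] by auto
  next
    case False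
    then show ?thesis using i through[of i] by auto
  qed
qed (rule other)

lemma index_split: "j \<in> {1..k + 1} \<Longrightarrow> j \<in> {1..DIM('a) + 1}" "i \<in> {k + 2..DIM('a) + 1} \<Longrightarrow> i \<in> {1..DIM('a) + 1}"
  using k by auto

lemma outer_level: "j \<in> {1..k + 1} \<Longrightarrow> inner (u j) z < snd (p j)"
  using ball_eq[OF index_split(1), of j] mrad_pos[of j] mult_pos_pos[OF r, of "mrad k u j"] by linarith

lemma through_level: "i \<in> {k + 2..DIM('a) + 1} \<Longrightarrow> inner (u i) z = snd (p i)"
  using ball_eq[OF index_split(2), of i] mrad_0[of i] by (simp del: atLeastAtMost_iff)

lemma through_eq: "{H \<in> S. lev H z = 0} = (\<lambda>i. hyp (p i)) ` {k + 2..DIM('a) + 1}"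
proof
  show "{H \<in> S. lev H z = 0} \<subseteq> (\<lambda>i. hyp (p i)) ` {k + 2..DIM('a) + 1}"
  proof
    fix H assume H: "H \<in> {H \<in> S. lev H z = 0}"
    then have "H \<in> S" by simp
    then show "H \<in> (\<lambda>i. hyp (p i)) ` {k + 2..DIM('a) + 1}"
    proof (cases rule: S_cases)
      case (outer j)
      then show ?thesis using H lev_iff(1)[OF index_split(1)[OF outer(1)], of z] outer_level[OF outer(1)] by simp
    next
      case (through i)
      then show ?thesis by blast
    next
      case other
      then show ?thesis using H other_lev[of H] by blast
    qed
  qed
  show "(\<lambda>i. hyp (p i)) ` {k + 2..DIM('a) + 1} \<subseteq> {H \<in> S. lev H z = 0}"
  using p_hyp lev_iff through_level by auto
qed

lemma in_flat_iff: "y \<in> flat_at S z \<longleftrightarrow> y - z \<in> L"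
proof -
  have "y \<in> flat_at S z \<longleftrightarrow> (\<forall>H\<in>{H \<in> S. lev H z = 0}. lev H y = 0)"
    using in_flat_at_iff[OF Sh] by auto
  also have "\<dots> \<longleftrightarrow> (\<forall>i\<in>{k + 2..DIM('a) + 1}. inner (u i) y = inner (u i) z)"
    unfolding through_eq using lev_iff(1)[OF index_split(2)] through_level by auto
  also have "\<dots> \<longleftrightarrow> y - z \<in> L"
    by (simp add: in_L_space_iff inner_diff_right)
  finally show ?thesis .
qed

lemma dim_L: "dim L = k"
proof -
  have "indep_fam {k + 2..DIM('a) + 1} u"
    using k by (intro general_position_indep_fam[OF P_set_general_position[OF k uP]]) auto
  from dim_orth_fam[OF _ this] have "dim L + (DIM('a) - k) = DIM('a)" by (simp add: L_space_eq)
  then show ?thesis using k by auto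
qed

lemma aff_dim_flat: "aff_dim (flat_at S z) = int k"
proof -
  have "flat_at S z = (+) z ` L"
  proof
    show "flat_at S z \<subseteq> (+) z ` L"
    by (force simp: in_flat_iff)
    show "(+) z ` L \<subseteq> flat_at S z"
      by (rule image_subsetI) (simp add: in_flat_iff)
  qed
  then have "aff_dim (flat_at S z) = aff_dim L" by (simp only: aff_dim_translation_eq)
  also have "\<dots> = int (dim L)" by (rule aff_dim_subspace[OF subspace_L_space])
  finally show ?thesis by (simp only: dim_L)
qed

lemma in_cellat_iff:
  "y \<in> cellat S z \<longleftrightarrow> y - z \<in> L \<and> (\<forall>j\<in>{1..k + 1}. inner (u j) y \<le> snd (p j)) \<and>
    (\<forall>H\<in>S - hyps (DIM('a) + 1) p. 0 \<le> lev H z * lev H y)"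
proof
  assume y: "y \<in> cellat S z"
  then have "y - z \<in> L" using cellat_subset_flat_at[OF Sh] in_flat_iff by blast
  moreover have "inner (u j) y \<le> snd (p j)" if j: "j \<in> {1..k + 1}" for j
  proof -
    have "0 \<le> lev (hyp (p j)) z * lev (hyp (p j)) y"
      using y p_hyp[OF index_split(1)[OF j]] by (simp add: cellat_def)
    then have "0 \<le> (inner (u j) z - snd (p j)) * (inner (u j) y - snd (p j))"
      by (simp only: lev_iff(2)[OF index_split(1)[OF j]])
    then show ?thesis using outer_level[OF j] by (simp add: zero_le_mult_iff)
  qed
  moreover have "\<forall>H\<in>S - hyps (DIM('a) + 1) p. 0 \<le> lev H z * lev H y"
    using y by (simp add: cellat_def)
  ultimately show "y - z \<in> L \<and> (\<forall>j\<in>{1..k + 1}. inner (u j) y \<le> snd (p j)) \<and>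
    (\<forall>H\<in>S - hyps (DIM('a) + 1) p. 0 \<le> lev H z * lev H y)" by blast
next
  assume y: "y - z \<in> L \<and> (\<forall>j\<in>{1..k + 1}. inner (u j) y \<le> snd (p j)) \<and>
    (\<forall>H\<in>S - hyps (DIM('a) + 1) p. 0 \<le> lev H z * lev H y)"
  then have fl: "y \<in> flat_at S z" using in_flat_iff by blast
  show "y \<in> cellat S z"
    unfolding cellat_def
  proof (intro CollectI ballI conjI impI)
    fix H assume H: "H \<in> S"
    show "lev H y = 0" if "lev H z = 0" using fl in_flat_at_iff[OF Sh] H that by blast
    show "0 \<le> lev H z * lev H y"
      using H
    proof (cases rule: S_cases)
      case (outer j)
      have "0 \<le> (inner (u j) z - snd (p j)) * (inner (u j) y - snd (p j))"
        using y outer(1) outer_level[OF outer(1)] by (intro mult_nonpos_nonpos) auto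
      then show ?thesis unfolding outer(2) lev_iff(2)[OF index_split(1)[OF outer(1)]] .
    next
      case (through i)
      then have "lev H z = 0" using through_eq by blast
      then show ?thesis by simp
    next
      case other
      then show ?thesis using y H by blast
    qed
  qed
qed

lemma inscribed_center: "inscribed_ball (cellat S z) z r"
  unfolding inscribed_ball_def affine_hull_cellat[OF S]
proof (intro conjI subsetI)
  show "z \<in> flat_at S z" by (simp add: flat_at_def)
  show "0 \<le> r" using r by simp
  fix y assume y: "y \<in> cball z r \<inter> flat_at S z"
  then have w: "y - z \<in> L" "norm (y - z) \<le> r"
    using in_flat_iff by (auto simp: dist_norm norm_minus_commute)
  show "y \<in> cellat S z"
    unfolding in_cellat_iff
  proof (intro conjI ballI)
    show "y - z \<in> L" by (rule w)
    show "inner (u j) y \<le> snd (p j)" if j: "j \<in> {1..k + 1}" for j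
    proof -
      have "inner (u j) (y - z) = inner (orth_proj L (u j)) (y - z)"
        by (simp add: inner_orth_proj[OF subspace_L_space w(1)])
      also have "\<dots> \<le> norm (orth_proj L (u j)) * norm (y - z)" by (rule norm_cauchy_schwarz)
      also have "\<dots> \<le> norm (orth_proj L (u j)) * r" using w(2) by (intro mult_left_mono) auto
      also have "\<dots> = r * mrad k u j" using j by (simp add: mrad_def)
      finally show ?thesis using ball_eq[OF index_split(1)[OF j]] by (simp add: inner_diff_right)
    qed
    fix H assume H: "H \<in> S - hyps (DIM('a) + 1) p"
    show "0 \<le> lev H z * lev H y"
    proof (rule ccontr)
      assume neg: "\<not> 0 \<le> lev H z * lev H y"
      \<comment> \<open>If H separated z from y, the segment between them would cross H at this
        parameter. Since a < 1, the crossing point lies in the open ball, which H does not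
        meet.\<close>
      define a where "a = lev H z / (lev H z - lev H y)"
      have a: "0 < a" "a < 1" "(1 - a) * lev H z + a * lev H y = 0"
      proof -
        have "0 < lev H z \<and> lev H y < 0 \<or> lev H z < 0 \<and> 0 < lev H y"
          using neg by (simp add: not_le mult_less_0_iff)
        then show "0 < a" "a < 1" by (auto simp: a_def divide_simps)
        have "lev H z - lev H y \<noteq> 0" using \<open>0 < lev H z \<and> lev H y < 0 \<or> lev H z < 0 \<and> 0 < lev H y\<close> by linarith
        then show "(1 - a) * lev H z + a * lev H y = 0" by (simp add: a_def field_simps)
      qed
      have "lev H ((1 - a) *\<^sub>R z + a *\<^sub>R y) = 0" using a(3) by (subst lev_convex) auto
      moreover have "(1 - a) *\<^sub>R z + a *\<^sub>R y = z + a *\<^sub>R (y - z)" by (simp add: algebra_simps)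
      ultimately have "z + a *\<^sub>R (y - z) \<in> H" using H Sh lev_eq_0_iff by auto
      moreover have "a *\<^sub>R (y - z) \<in> L" using w(1) by (rule subspace_scale[OF subspace_L_space])
      moreover have "norm (a *\<^sub>R (y - z)) < r"
      proof -
        have "norm (a *\<^sub>R (y - z)) \<le> a * r" using a(1) w(2) by simp
        also have "\<dots> < r" using a(2) r by simp
        finally show ?thesis .
      qed
      ultimately show False using nohit H by blast
    qed
  qed
qed

text \<open>The inequalities of the simplex are tested at the point of the competing ball that is
  farthest in the direction of each projected normal. \<open>P_set_radius_le\<close> then bounds the
  radius, and for equal radii \<open>P_set_zero\<close> forces equal centers.\<close>

lemma inscribed_le:
  assumes "inscribed_ball (cellat S z) c s"
  shows "s \<le> r" and "s = r \<Longrightarrow> c = z"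
proof -
  have c: "c - z \<in> L" and s: "0 \<le> s" and sub: "cball c s \<inter> flat_at S z \<subseteq> cellat S z"
    using assms in_flat_iff by (auto simp: inscribed_ball_def affine_hull_cellat[OF S])
  have le: "inner (u j) (c - z) + (s - r) * mrad k u j \<le> 0" if j: "j \<in> {1..k + 1}" for j
  proof -
    let ?v = "orth_proj L (u j)"
    have v0: "norm ?v \<noteq> 0" using mrad_pos[OF j] j by (auto simp: mrad_def)
    have vL: "?v \<in> L" by (rule orth_proj_in[OF subspace_L_space])
    \<comment> \<open>The point of the competing ball, within the flat, that comes closest to the
      j-th outer hyperplane or goes farthest beyond it.\<close>
    let ?y = "c + (s / norm ?v) *\<^sub>R ?v"
    have "?y - z = (c - z) + (s / norm ?v) *\<^sub>R ?v" by simp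
    also have "\<dots> \<in> L" using c vL by (intro subspace_add subspace_scale subspace_L_space)
    finally have "?y \<in> flat_at S z" using in_flat_iff by blast
    moreover have "?y \<in> cball c s" using v0 s by (simp add: dist_norm)
    ultimately have "?y \<in> cellat S z" using sub by blast
    then have "inner (u j) ?y \<le> snd (p j)" using j in_cellat_iff by blast
    moreover have "inner (u j) ?v = norm ?v ^ 2"
      by (rule inner_orth_proj_self[OF subspace_L_space])
    ultimately have "inner (u j) c + s * norm ?v \<le> snd (p j)"
      using v0 by (simp add: inner_add_right power2_eq_square)
    then show ?thesis using ball_eq[OF index_split(1)[OF j]] j by (simp add: mrad_def inner_diff_right algebra_simps)
  qed
  have "s - r \<le> 0" using le by (rule P_set_radius_le[OF k uP c])
  then show "s \<le> r" by simp
  show "c = z" if "s = r"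
  proof -
    have "c - z = 0"
    proof (rule P_set_zero[OF k uP c])
      fix j assume "j \<in> {1..k + 1}"
      from le[OF this] that show "inner (u j) (c - z) \<le> 0" by simp
    qed
    then show ?thesis by simp
  qed
qed

lemma incenter_cellat: "incenter (cellat S z) = z"
  unfolding incenter_def
  by (smt (verit) the_equality inscribed_center inscribed_le)

lemma cellat_in_faces: "cellat S z \<in> faces k S"
  unfolding faces_eq[OF S] using aff_dim_flat by blast

lemma translate_cellat:
  "(\<lambda>x. x - z) ` cellat S z =
    {w \<in> L. \<forall>j\<in>{1..k + 1}. inner (u j) w \<le> r * mrad k u j} \<inter>
    {w. \<forall>H\<in>S - hyps (DIM('a) + 1) p. 0 \<le> lev H z * lev H (z + w)}"
proof -
  have "z + w \<in> cellat S z \<longleftrightarrow> w \<in> {w \<in> L. \<forall>j\<in>{1..k + 1}. inner (u j) w \<le> r * mrad k u j} \<inter>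
    {w. \<forall>H\<in>S - hyps (DIM('a) + 1) p. 0 \<le> lev H z * lev H (z + w)}" for w
  proof -
    have "inner (u j) (z + w) \<le> snd (p j) \<longleftrightarrow> inner (u j) w \<le> r * mrad k u j" if "j \<in> {1..k + 1}" for j
      using ball_eq[OF index_split(1)[OF that]] by (auto simp: inner_add_right)
    then show ?thesis unfolding in_cellat_iff by auto
  qed
  note mem = this
  show ?thesis (is "_ = ?R")
  proof
    show "(\<lambda>x. x - z) ` cellat S z \<subseteq> ?R"
    proof (rule image_subsetI)
      fix x assume "x \<in> cellat S z"
      then show "x - z \<in> ?R" using mem[of "x - z"] by simp
    qed
    show "?R \<subseteq> (\<lambda>x. x - z) ` cellat S z"
    proof
      fix w assume "w \<in> ?R"
      then have "z + w \<in> cellat S z" using mem by blast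
      then show "w \<in> (\<lambda>x. x - z) ` cellat S z" by (intro image_eqI[of _ _ "z + w"]) simp_all
    qed
  qed
qed

end

section \<open>Every bounded face comes from a tuple\<close>

definition gen_pos :: "'a::euclidean_space set set \<Rightarrow> bool" where
  "gen_pos S \<longleftrightarrow> (\<forall>J\<subseteq>S. finite J \<longrightarrow> card J \<le> DIM('a) \<longrightarrow> indep_fam J nrm)"

lemma gen_posD: "gen_pos S \<Longrightarrow> J \<subseteq> S \<Longrightarrow> finite J \<Longrightarrow> card J \<le> DIM('a) \<Longrightarrow> indep_fam J nrm"
  for S :: "'a::euclidean_space set set"
  unfolding gen_pos_def by simp

lemma indep_fam_cong: "(\<And>i. i \<in> I \<Longrightarrow> u i = v i) \<Longrightarrow> indep_fam I u = indep_fam I v"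
  by (smt (verit) sum.cong indep_fam_def)

lemma indep_fam_normals:
  fixes S :: "'a::euclidean_space set set"
  assumes gp: "gen_pos S" and A: "finite A" "card A \<le> DIM('a)" "inj_on (\<lambda>i. hyp (p i)) A"
    and p: "\<And>i. i \<in> A \<Longrightarrow> norm (fst (p i)) = 1 \<and> hyp (p i) \<in> S"
  shows "indep_fam A (\<lambda>i. fst (p i))"
proof -
  have "\<forall>i\<in>A. \<exists>s. s \<noteq> 0 \<and> fst (p i) = s *\<^sub>R nrm (hyp (p i))"
  by (smt (verit) rep_lev p)
  then obtain s where s: "\<And>i. i \<in> A \<Longrightarrow> s i \<noteq> 0 \<and> fst (p i) = s i *\<^sub>R nrm (hyp (p i))"
    using bchoice[of A "\<lambda>i s. s \<noteq> 0 \<and> fst (p i) = s *\<^sub>R nrm (hyp (p i))"] by blast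
  have "indep_fam ((\<lambda>i. hyp (p i)) ` A) nrm"
    using A p by (intro gen_posD[OF gp]) (auto simp: card_image)
  from indep_fam_reindex[OF A(1,3) this, of "\<lambda>i. fst (p i)" s] show ?thesis using s by simp
qed

lemma general_position_normals:
  fixes S :: "'a::euclidean_space set set"
  assumes gp: "gen_pos S" and p: "p \<in> tuples (DIM('a) + 1) S"
  shows "general_position (normals p)"
  unfolding general_position_iff
proof (intro allI impI)
  fix I assume I: "I \<subseteq> {1..DIM('a) + 1}" "card I = DIM('a)"
  have "indep_fam I (\<lambda>i. fst (p i))"
  proof (rule indep_fam_normals[OF gp])
    show "finite I" using I(1) by (rule finite_subset) simp
    show "card I \<le> DIM('a)" using I(2) by simp
    show "inj_on (\<lambda>i. hyp (p i)) I" using p I(1) by (auto simp: tuples_def intro: inj_on_subset)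
    show "norm (fst (p i)) = 1 \<and> hyp (p i) \<in> S" if "i \<in> I" for i
      using tuplesD[OF p] I(1) that by auto
  qed
  then show "indep_fam I (normals p)"
    by (rule indep_fam_cong[THEN iffD1, rotated]) (use I(1) in \<open>auto simp: normals_def\<close>)
qed

lemma cellat_cong_sgn:
  assumes "\<And>H. H \<in> S \<Longrightarrow> sgn (lev H x) = sgn (lev H y)"
  shows "cellat S x = cellat S y"
  by (smt (verit) assms sgn_if zero_le_mult_iff cellat_def Collect_cong)

section \<open>The largest ball in a bounded face\<close>

locale bounded_face =
  fixes k :: nat and S :: "'a::euclidean_space set set" and x :: 'a
  assumes k: "k \<in> {1..DIM('a)}" and S: "S \<in> hyperplane_configs" and gp: "gen_pos S"
    and dim_flat: "aff_dim (flat_at S x) = int k" and bnd: "bounded (cellat S x)"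
begin

definition I where "I = {H \<in> S. lev H x = 0}"
definition L where "L = orth_fam I nrm"
definition m where "m H = norm (orth_proj L (nrm H))"
definition \<sigma> where "\<sigma> H = sgn (lev H x)"

lemma Sh: "S \<subseteq> hyperplanes" using S by (rule hyperplane_configs_subset)

lemma finite_I: "finite I"
proof (rule finite_subset)
  show "I \<subseteq> S \<inter> hitting {x}"
    using Sh lev_eq_0_iff[of _ x] by (fastforce simp: I_def hitting_def)
  show "finite (S \<inter> hitting {x})" using S by (simp add: hyperplane_configs_def)
qed

lemma subspace_L: "subspace L" by (simp add: L_def subspace_orth_fam)

lemma in_flat: "y \<in> flat_at S x \<longleftrightarrow> y - x \<in> L"
proof -
  have "y \<in> flat_at S x \<longleftrightarrow> (\<forall>H\<in>I. lev H y - lev H x = 0)"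
    unfolding in_flat_at_iff[OF Sh] I_def by auto
  then show ?thesis by (simp add: lev_diff L_def orth_fam_def inner_commute)
qed

lemma dim_L: "dim L = k"
proof -
  have "flat_at S x = (+) x ` L"
  proof
    show "flat_at S x \<subseteq> (+) x ` L"
    by (force simp: in_flat)
    show "(+) x ` L \<subseteq> flat_at S x"
      by (rule image_subsetI) (simp add: in_flat)
  qed
  then have "aff_dim (flat_at S x) = aff_dim L" by (simp only: aff_dim_translation_eq)
  also have "\<dots> = int (dim L)" by (rule aff_dim_subspace[OF subspace_L])
  finally show ?thesis using dim_flat by simp
qed

text \<open>General position gives independence for at most d hyperplanes. If more than d passed
  through x, then d of them would already cut the direction space down to zero, against k >
  0.\<close>

lemma card_I: "card I + k = DIM('a)"
proof (cases "card I \<le> DIM('a)")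
  case True
  have "indep_fam I nrm" using True finite_I by (intro gen_posD[OF gp]) (auto simp: I_def)
  from dim_orth_fam[OF finite_I this] show ?thesis using dim_L by (simp add: L_def)
next
  case False
  then obtain J where J: "J \<subseteq> I" "card J = DIM('a)" "finite J"
    using obtain_subset_with_card_n[of "DIM('a)" I] by auto
  have "indep_fam J nrm" using J by (intro gen_posD[OF gp]) (auto simp: I_def)
  from dim_orth_fam[OF J(3) this] have "dim (orth_fam J nrm) = 0" using J(2) by simp
  moreover have "L \<subseteq> orth_fam J nrm" using J(1) by (auto simp: L_def orth_fam_def)
  ultimately have "dim L = 0" using dim_subset[of L "orth_fam J nrm"] by simp
  then show ?thesis using dim_L k by simp
qed

lemma indep_ext:
  assumes "J \<subseteq> S - I" "finite J" "card J \<le> k"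
  shows "indep_fam J (\<lambda>H. orth_proj L (nrm H))"
  unfolding L_def
proof (rule indep_fam_orth_proj[OF assms(2) finite_I])
  show "I \<inter> J = {}" using assms(1) by auto
  have "card (I \<union> J) \<le> DIM('a)"
    using card_Un_le[of I J] card_I assms(3) by linarith
  then show "indep_fam (I \<union> J) nrm"
    using assms finite_I by (intro gen_posD[OF gp]) (auto simp: I_def)
qed

lemma m_pos: "H \<in> S - I \<Longrightarrow> 0 < m H"
proof -
  assume H: "H \<in> S - I"
  have "indep_fam {H} (\<lambda>H. orth_proj L (nrm H))"
    using H k by (intro indep_ext) auto
  then have "orth_proj L (nrm H) \<noteq> 0"
    unfolding indep_fam_def by (auto dest: spec[of _ "\<lambda>_. 1"])
  then show ?thesis by (simp add: m_def)
qed

lemma m_le_1: "H \<in> S \<Longrightarrow> m H \<le> 1"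
  using norm_orth_proj_le[OF subspace_L, of "nrm H"] norm_nrm[of H] Sh by (auto simp: m_def)

lemma \<sigma>_cases: "H \<in> S - I \<Longrightarrow> \<sigma> H = 1 \<or> \<sigma> H = - 1"
  by (auto simp: \<sigma>_def I_def sgn_if)

lemma in_cellat: "y \<in> cellat S x \<longleftrightarrow> y - x \<in> L \<and> (\<forall>H\<in>S - I. 0 \<le> \<sigma> H * lev H y)"
proof -
  have "0 \<le> lev H x * lev H y \<longleftrightarrow> 0 \<le> \<sigma> H * lev H y" if "H \<in> S - I" for H
    using that by (auto simp: \<sigma>_def I_def sgn_if zero_le_mult_iff)
  then have "y \<in> cellat S x \<longleftrightarrow> y \<in> flat_at S x \<and> (\<forall>H\<in>S - I. 0 \<le> \<sigma> H * lev H y)"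
    unfolding in_flat_at_iff[OF Sh] cellat_def I_def by auto
  then show ?thesis by (simp only: in_flat)
qed

text \<open>Linear conditions on (c, \<rho>) saying that the ball of radius \<rho> about c within
  the flat of x lies in the face; \<open>m H\<close> converts a radius into a change of level.
  Finding an inball becomes the maximization of \<rho>.\<close>

definition ok :: "'a \<times> real \<Rightarrow> bool" where
  "ok q \<longleftrightarrow> fst q - x \<in> L \<and> 0 \<le> snd q \<and> (\<forall>H\<in>S - I. snd q * m H \<le> \<sigma> H * lev H (fst q))"

lemma inner_L: "w \<in> L \<Longrightarrow> \<bar>inner w (nrm H)\<bar> \<le> norm w * m H"
  using Cauchy_Schwarz_ineq2[of w "orth_proj L (nrm H)"] inner_orth_proj[OF subspace_L, of w "nrm H"]
  by (simp add: m_def inner_commute)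

lemma \<sigma>_lev_add_ge:
  assumes "H \<in> S - I" "w \<in> L"
  shows "\<sigma> H * lev H (c + w) \<ge> \<sigma> H * lev H c - norm w * m H"
  using \<sigma>_cases[OF assms(1)] inner_L[OF assms(2), of H] by (auto simp: lev_add)

lemma ok_cellat:
  assumes "ok (c, \<rho>)" "w \<in> L" "norm w \<le> \<rho>"
  shows "c + w \<in> cellat S x"
  unfolding in_cellat
proof (intro conjI ballI)
  have "(c - x) + w \<in> L" using assms subspace_add[OF subspace_L] by (auto simp: ok_def)
  then show "c + w - x \<in> L" by (simp add: algebra_simps)
  fix H assume H: "H \<in> S - I"
  have "norm w * m H \<le> \<rho> * m H" using assms(3) m_pos[OF H] by (intro mult_right_mono) auto
  also have "\<dots> \<le> \<sigma> H * lev H c" using assms(1) H by (simp add: ok_def)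
  finally show "0 \<le> \<sigma> H * lev H (c + w)" using \<sigma>_lev_add_ge[OF H assms(2), of c] by linarith
qed

text \<open>The admissible pairs form a closed set. It is bounded because k > 0 provides a unit
  vector w in L, and both c and \<open>c + \<rho> *\<^sub>R w\<close> lie in the bounded face. So
  the radius attains its maximum.\<close>

lemma ok_max:
  obtains z r where "ok (z, r)" "\<And>c \<rho>. ok (c, \<rho>) \<Longrightarrow> \<rho> \<le> r"
proof -
  have closed: "closed {q. ok q}"
  proof -
    have "{q. ok q} = {q. fst q - x \<in> L} \<inter> {q. 0 \<le> snd q} \<inter> (\<Inter>H\<in>S - I. {q. snd q * m H \<le> \<sigma> H * lev H (fst q)})"
      by (auto simp: ok_def)
    moreover have "closed {q :: 'a \<times> real. fst q - x \<in> L}"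
    proof -
      have "{q :: 'a \<times> real. fst q - x \<in> L} = (\<lambda>q. fst q - x) -` L" by auto
      then show ?thesis
        by (simp only:) (intro closed_vimage closed_subspace subspace_L continuous_intros)
    qed
    moreover have "closed {q :: 'a \<times> real. 0 \<le> snd q}" by (intro closed_Collect_le continuous_intros)
    moreover have "closed {q :: 'a \<times> real. snd q * m H \<le> \<sigma> H * lev H (fst q)}" for H
      unfolding lev_def by (intro closed_Collect_le continuous_intros)
    ultimately show ?thesis by (simp only:) (intro closed_Int closed_INT ballI)
  qed
  obtain B where B: "\<And>y. y \<in> cellat S x \<Longrightarrow> norm y \<le> B"
    using bnd unfolding bounded_iff by blast
  have "dim L \<noteq> 0" using dim_L k by simp
  then have "\<not> L \<subseteq> {0}" by (simp only: dim_eq_0 not_False_eq_True)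
  then obtain w0 where w0: "w0 \<in> L" "w0 \<noteq> 0" by blast
  define w where "w = (1 / norm w0) *\<^sub>R w0"
  have w: "w \<in> L" "norm w = 1" using w0 subspace_scale[OF subspace_L] by (auto simp: w_def)
  have sub: "{q. ok q} \<subseteq> cball 0 B \<times> {0..2 * B}"
  proof
    fix q assume "q \<in> {q. ok q}"
    then obtain c \<rho> where q: "q = (c, \<rho>)" "ok (c, \<rho>)" by (cases q) auto
    have \<rho>0: "0 \<le> \<rho>" using q(2) by (simp add: ok_def)
    have "c + 0 \<in> cellat S x" by (rule ok_cellat[OF q(2)]) (use \<rho>0 subspace_0[OF subspace_L] in auto)
    then have c: "norm c \<le> B" using B by simp
    have "c + \<rho> *\<^sub>R w \<in> cellat S x"
      by (rule ok_cellat[OF q(2)]) (use \<rho>0 w subspace_scale[OF subspace_L] in auto)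
    then have "norm (c + \<rho> *\<^sub>R w) \<le> B" by (rule B)
    moreover have "\<rho> = norm ((c + \<rho> *\<^sub>R w) - c)" using w \<rho>0 by simp
    ultimately have "\<rho> \<le> 2 * B" using c norm_triangle_ineq4[of "c + \<rho> *\<^sub>R w" c] by linarith
    then show "q \<in> cball 0 B \<times> {0..2 * B}" using q(1) c \<rho>0 by simp
  qed
  have comp: "compact {q. ok q}"
  proof -
    have "compact (cball (0::'a) B \<times> {0..2 * B})" by (intro compact_Times) auto
    then have "compact ((cball (0::'a) B \<times> {0..2 * B}) \<inter> {q. ok q})" using closed by (rule compact_Int_closed)
    then show ?thesis using sub by (simp add: Int_absorb1)
  qed
  have "ok (x, 0)"
    using subspace_0[OF subspace_L] by (auto simp: ok_def \<sigma>_def sgn_if)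
  then have "{q. ok q} \<noteq> {}" by blast
  moreover have "continuous_on {q. ok q} snd" by (intro continuous_intros)
  ultimately have "\<exists>q\<in>{q. ok q}. \<forall>q'\<in>{q. ok q}. snd q' \<le> snd q"
    by (rule continuous_attains_sup[OF comp])
  then obtain q where q: "ok q" "\<And>q'. ok q' \<Longrightarrow> snd q' \<le> snd q"
    by blast
  show ?thesis
  proof (rule that[of "fst q" "snd q"])
    show "ok (fst q, snd q)" using q(1) by simp
    fix c \<rho> assume "ok (c, \<rho>)"
    from q(2)[OF this] show "\<rho> \<le> snd q" by simp
  qed
qed

lemma ok_positive: "\<exists>e>0. ok (x, e)"
proof -
  obtain e where e: "0 < e" "\<And>H y. H \<in> S \<Longrightarrow> lev H x \<noteq> 0 \<Longrightarrow> dist x y < e \<Longrightarrow> 0 < lev H x * lev H y"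
    using config_local[OF S] by blast
  have "ok (x, e / 2)"
    unfolding ok_def fst_conv snd_conv
  proof (intro conjI ballI)
    show "x - x \<in> L" using subspace_0[OF subspace_L] by simp
    show "0 \<le> e / 2" using e(1) by simp
    fix H assume H: "H \<in> S - I"
    have nz: "lev H x \<noteq> 0" using H by (auto simp: I_def)
    have n1: "norm (nrm H) = 1" using H Sh by (intro norm_nrm) auto
    \<comment> \<open>Moving x straight towards H by e / 2 stays within distance e and so does not
      reach H. Hence the distance from x to H exceeds e / 2.\<close>
    let ?y = "x + (- (e / 2) * \<sigma> H) *\<^sub>R nrm H"
    have "dist x ?y < e" using n1 \<sigma>_cases[OF H] e(1) by (auto simp: dist_norm)
    then have "0 < lev H x * lev H ?y" using e(2) H nz by blast
    moreover have "lev H ?y = lev H x - e / 2 * \<sigma> H"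
    proof -
      have "inner (nrm H) (nrm H) = 1" using n1 by (simp add: dot_square_norm)
      then show ?thesis unfolding lev_add by simp
    qed
    ultimately have "e / 2 < \<sigma> H * lev H x"
      using nz by (auto simp: \<sigma>_def sgn_if zero_less_mult_iff split: if_splits)
    moreover have "e / 2 * m H \<le> e / 2 * 1"
      using m_le_1[of H] H e(1) by (intro mult_left_mono) auto
    ultimately show "e / 2 * m H \<le> \<sigma> H * lev H x" by linarith
  qed
  then show ?thesis using e(1) by (intro exI[of _ "e / 2"]) simp
qed

text \<open>The projected normal turned towards the side of x: moving along it leads away from H
  into the face.\<close>

definition V where "V H = \<sigma> H *\<^sub>R orth_proj L (nrm H)"

lemma V_in_L: "V H \<in> L"
  unfolding V_def by (intro subspace_scale orth_proj_in subspace_L)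

text \<open>If the touching normals did not surround the origin, the ball could be moved and enlarged.\<close>

lemma touching_surround:
  assumes ok: "ok (z, r)" and max: "\<And>c \<rho>. ok (c, \<rho>) \<Longrightarrow> \<rho> \<le> r"
  defines "J \<equiv> {H \<in> S - I. r * m H = \<sigma> H * lev H z}"
  shows "finite J" and "0 \<in> convex hull (V ` J)"
proof -
  have r0: "0 \<le> r" using ok by (simp add: ok_def)
  have abs_lev: "\<bar>lev H z\<bar> = \<sigma> H * lev H z" if "H \<in> S - I" for H
  proof -
    have "0 \<le> r * m H" using r0 m_pos[OF that] by simp
    also have "\<dots> \<le> \<sigma> H * lev H z" using ok that by (simp add: ok_def)
    finally show ?thesis using \<sigma>_cases[OF that] by auto
  qed
  show finJ: "finite J"
  proof (rule finite_subset)
    show "J \<subseteq> S \<inter> hitting (cball z r)"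
    proof
      fix H assume H: "H \<in> J"
      then have H': "H \<in> S - I" by (simp add: J_def)
      have "\<bar>lev H z\<bar> = r * m H" using H abs_lev[OF H'] by (simp add: J_def)
      also have "\<dots> \<le> r * 1" using m_le_1[of H] H' r0 by (intro mult_left_mono) auto
      finally have "H \<in> hitting (cball z r)" using H' Sh by (intro cball_meets_hyperplane) auto
      then show "H \<in> S \<inter> hitting (cball z r)" using H' by simp
    qed
    show "finite (S \<inter> hitting (cball z r))" using S by (simp add: hyperplane_configs_def)
  qed
  show "0 \<in> convex hull (V ` J)"
  proof (rule ccontr)
    assume "0 \<notin> convex hull (V ` J)"
    moreover have "closed (convex hull (V ` J))"
      using finJ by (intro compact_imp_closed finite_imp_compact_convex_hull) simp
    \<comment> \<open>A direction along which every touching hyperplane recedes at a rate greater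
      than b. Only its component in L matters, because all \<open>V H\<close> lie in L.\<close>
    ultimately obtain a b where ab: "0 < b" "\<And>v. v \<in> convex hull (V ` J) \<Longrightarrow> inner a v > b"
      using separating_hyperplane_closed_0[OF convex_convex_hull, of "V ` J"] by blast
    define w where "w = orth_proj L a"
    have wL: "w \<in> L" unfolding w_def by (rule orth_proj_in[OF subspace_L])
    have wV: "inner w (V H) = \<sigma> H * inner w (nrm H)" for H
      using inner_orth_proj[OF subspace_L wL, of "nrm H"] by (simp add: V_def inner_commute)
    have wJ: "inner w (V H) > b" if "H \<in> J" for H
    proof -
      have "inner w (V H) = inner a (V H)" unfolding w_def by (rule inner_orth_proj[OF subspace_L V_in_L])
      also have "\<dots> > b" using that by (intro ab(2) hull_inc) simp
      finally show ?thesis .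
    qed
    \<comment> \<open>The slack of H. Hyperplanes missing the ball of radius r + 1 have slack at
      least 1 because \<open>m H\<close> is at most 1; the finitely many remaining ones contribute
      their minimum to \<delta>0.\<close>
    define s where "s H = \<sigma> H * lev H z - r * m H" for H
    define F where "F = {H \<in> S - I - J. H \<in> hitting (cball z (r + 1))}"
    have finF: "finite F"
    proof (rule finite_subset)
      show "F \<subseteq> S \<inter> hitting (cball z (r + 1))" by (auto simp: F_def)
      show "finite (S \<inter> hitting (cball z (r + 1)))" using S by (simp add: hyperplane_configs_def)
    qed
    define \<delta>0 where "\<delta>0 = Min (insert 1 (s ` F))"
    have s_pos: "0 < s H" if "H \<in> S - I - J" for H
    proof -
      have "r * m H \<le> \<sigma> H * lev H z" using ok that by (auto simp: ok_def)
      moreover have "r * m H \<noteq> \<sigma> H * lev H z" using that by (auto simp: J_def)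
      ultimately show ?thesis by (simp add: s_def)
    qed
    have \<delta>0: "0 < \<delta>0"
      unfolding \<delta>0_def using finF s_pos by (subst Min_gr_iff) (auto simp: F_def)
    have s_ge: "\<delta>0 \<le> s H" if H: "H \<in> S - I - J" for H
    proof (cases "H \<in> hitting (cball z (r + 1))")
      case True
      then have "H \<in> F" using H by (simp add: F_def)
      then show ?thesis unfolding \<delta>0_def using finF by (intro Min_le) auto
    next
      case False
      then have "\<not> \<bar>lev H z\<bar> \<le> r + 1" using cball_meets_hyperplane[of H z "r + 1"] H Sh by auto
      moreover have "r * m H \<le> r * 1" using m_le_1[of H] H r0 by (intro mult_left_mono) auto
      ultimately have "1 \<le> s H" using abs_lev[of H] H by (simp add: s_def)
      moreover have "\<delta>0 \<le> 1" unfolding \<delta>0_def using finF by (intro Min_le) auto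
      ultimately show ?thesis by linarith
    qed
    \<comment> \<open>Moving the center by \<delta> w and enlarging the radius by \<delta> b uses up
      at most \<delta> (norm w + b) of any slack. The choice makes this equal to the least slack
      available.\<close>
    define \<delta> where "\<delta> = \<delta>0 / (norm w + b)"
    have nb: "0 < norm w + b" using ab(1) by (simp add: add_nonneg_pos)
    have \<delta>: "0 < \<delta>" "\<delta> * (norm w + b) = \<delta>0" using \<delta>0 nb by (auto simp: \<delta>_def)
    have "ok (z + \<delta> *\<^sub>R w, r + \<delta> * b)"
      unfolding ok_def fst_conv snd_conv
    proof (intro conjI ballI)
      have "(z - x) + \<delta> *\<^sub>R w \<in> L"
        using ok wL by (intro subspace_add subspace_scale subspace_L) (auto simp: ok_def)
      then show "z + \<delta> *\<^sub>R w - x \<in> L" by (simp add: algebra_simps)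
      show "0 \<le> r + \<delta> * b" using r0 \<delta>(1) ab(1) by simp
      fix H assume H: "H \<in> S - I"
      have e: "\<sigma> H * lev H (z + \<delta> *\<^sub>R w) = \<sigma> H * lev H z + \<delta> * inner w (V H)"
        by (simp add: lev_add wV algebra_simps)
      have m1: "0 < m H" "m H \<le> 1" using m_pos[OF H] m_le_1[of H] H by auto
      show "(r + \<delta> * b) * m H \<le> \<sigma> H * lev H (z + \<delta> *\<^sub>R w)"
      proof (cases "H \<in> J")
        case True
        have "b * m H \<le> b * 1" using m1 ab(1) by (intro mult_left_mono) auto
        then have "\<delta> * (b * m H) \<le> \<delta> * inner w (V H)"
          using wJ[OF True] \<delta>(1) by (intro mult_left_mono) auto
        moreover have "r * m H = \<sigma> H * lev H z" using True by (simp add: J_def)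
        ultimately show ?thesis unfolding e by (simp add: algebra_simps)
      next
        case False
        have "\<bar>inner w (nrm H)\<bar> \<le> norm w * 1"
          using inner_L[OF wL, of H] mult_left_mono[OF m1(2), of "norm w"] by simp
        then have "- norm w \<le> inner w (V H)"
          using \<sigma>_cases[OF H] by (auto simp: wV)
        moreover have "b * m H \<le> b * 1" using m1 ab(1) by (intro mult_left_mono) auto
        ultimately have "b * m H - inner w (V H) \<le> norm w + b" by linarith
        then have "\<delta> * (b * m H - inner w (V H)) \<le> \<delta> * (norm w + b)" using \<delta>(1) by (intro mult_left_mono) auto
        also have "\<dots> = \<delta>0" by (rule \<delta>(2))
        also have "\<dots> \<le> s H" using H False by (intro s_ge) simp
        finally show ?thesis unfolding e s_def by (simp add: algebra_simps)
      qed
    qed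
    from max[OF this] show False using \<delta>(1) ab(1) by (simp add: mult_le_0_iff)
  qed
qed

text \<open>Caratheodory's theorem in the k-dimensional space L gives a relation between at most k +
  1 vectors. In general position any k of the projected normals are independent, so a nontrivial
  relation involves at least k + 1.\<close>

lemma touching_simplex:
  assumes fin: "finite J" and J: "J \<subseteq> S - I" and hull: "0 \<in> convex hull (V ` J)"
  obtains J' a where "J' \<subseteq> J" "card J' = k + 1" "\<And>H. H \<in> J' \<Longrightarrow> 0 < (a H :: real)" "(\<Sum>H\<in>J'. a H *\<^sub>R V H) = 0"
proof -
  have VJ: "V ` J \<subseteq> L" using V_in_L by auto
  obtain T where T: "finite T" "T \<subseteq> V ` J" "int (card T) \<le> aff_dim (V ` J) + 1" "0 \<in> convex hull T"
    using hull unfolding caratheodory_aff_dim[of "V ` J"] by blast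
  have "aff_dim (V ` J) \<le> aff_dim L" using VJ by (rule aff_dim_subset)
  also have "\<dots> = int k" using aff_dim_subspace[OF subspace_L] dim_L by simp
  finally have cardT: "card T \<le> k + 1" using T(3) by simp
  obtain c where c: "\<And>v. v \<in> T \<Longrightarrow> 0 \<le> c v" "sum c T = (1::real)" "(\<Sum>v\<in>T. c v *\<^sub>R v) = 0"
    using T(4) unfolding convex_hull_finite[OF T(1)] by blast
  define T' where "T' = {v \<in> T. 0 < c v}"
  have finT': "finite T'" using T(1) by (simp add: T'_def)
  \<comment> \<open>One hyperplane is chosen for each vector in the relation, as V is not known to
    be injective on J.\<close>
  define g where "g = inv_into J V"
  have g: "g v \<in> J" "V (g v) = v" if "v \<in> T'" for v
  proof -
    have "v \<in> V ` J" using that T(2) by (auto simp: T'_def)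
    then show "g v \<in> J" "V (g v) = v" unfolding g_def by (auto intro: inv_into_into f_inv_into_f)
  qed
  have inj: "inj_on g T'" using g(2) by (metis inj_onI)
  have sumT': "(\<Sum>v\<in>T'. c v *\<^sub>R v) = 0"
  proof -
    have "(\<Sum>v\<in>T'. c v *\<^sub>R v) = (\<Sum>v\<in>T. c v *\<^sub>R v)"
    proof (rule sum.mono_neutral_left)
      show "\<forall>v\<in>T - T'. c v *\<^sub>R v = 0"
        using c(1) by (force simp: T'_def)
    qed (use T(1) in \<open>auto simp: T'_def\<close>)
    then show ?thesis by (simp only: c(3))
  qed
  have neT': "T' \<noteq> {}"
  proof
    assume "T' = {}"
    then have "\<And>v. v \<in> T \<Longrightarrow> c v = 0" using c(1) by (force simp: T'_def)
    then have "sum c T = 0" by simp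
    then show False using c(2) by simp
  qed
  have sum0: "(\<Sum>H\<in>g ` T'. c (V H) *\<^sub>R V H) = 0"
  by (smt (verit) sum.reindex inj comp_def g sum.cong sumT')
  have pos: "0 < c (V H)" if "H \<in> g ` T'" for H
    using that g(2) by (auto simp: T'_def)
  have gJ: "g ` T' \<subseteq> J" using g(1) by auto
  have "k + 1 \<le> card (g ` T')"
  proof (rule ccontr)
    assume "\<not> k + 1 \<le> card (g ` T')"
    then have "indep_fam (g ` T') (\<lambda>H. orth_proj L (nrm H))"
      using gJ J finT' by (intro indep_ext) auto
    moreover have "(\<Sum>H\<in>g ` T'. (c (V H) * \<sigma> H) *\<^sub>R orth_proj L (nrm H)) = 0"
      using sum0 by (simp add: V_def)
    ultimately have z: "\<forall>H\<in>g ` T'. c (V H) * \<sigma> H = 0"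
      unfolding indep_fam_def by (elim allE[of _ "\<lambda>H. c (V H) * \<sigma> H"]) simp
    obtain v where v: "v \<in> T'" using neT' by blast
    then have "c (V (g v)) * \<sigma> (g v) = 0" using z by blast
    moreover have "g v \<in> S - I" using v gJ J by blast
    ultimately show False using pos[of "g v"] v \<sigma>_cases[of "g v"] by auto
  qed
  moreover have "card (g ` T') \<le> k + 1"
  proof -
    have "card (g ` T') = card T'" by (rule card_image[OF inj])
    also have "\<dots> \<le> card T" using T(1) by (intro card_mono) (auto simp: T'_def)
    finally show ?thesis using cardT by simp
  qed
  ultimately have "card (g ` T') = k + 1" by simp
  from that[OF gJ this pos sum0] show ?thesis .
qed

end

context bounded_face
begin

lemma exists_good_tuple: "\<exists>p z r. good_tuple k S p z r \<and> cellat S z = cellat S x"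
proof -
  obtain z r where ok: "ok (z, r)" and max: "\<And>c \<rho>. ok (c, \<rho>) \<Longrightarrow> \<rho> \<le> r"
    by (rule ok_max) blast
  obtain e where e: "0 < e" "ok (x, e)" using ok_positive by blast
  have r: "0 < r" using max[OF e(2)] e(1) by linarith
  define J where "J = {H \<in> S - I. r * m H = \<sigma> H * lev H z}"
  have finJ: "finite J"
    unfolding J_def by (rule touching_surround(1)[OF ok]) (erule max)
  have hull: "0 \<in> convex hull (V ` J)"
    unfolding J_def by (rule touching_surround(2)[OF ok]) (erule max)
  have "J \<subseteq> S - I" by (auto simp: J_def)
  from touching_simplex[OF finJ this hull]
  obtain J' a where J': "J' \<subseteq> J" "card J' = k + 1" and a: "\<And>H. H \<in> J' \<Longrightarrow> 0 < (a H :: real)"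
    and sum0: "(\<Sum>H\<in>J'. a H *\<^sub>R V H) = 0" by blast
  have J'S: "J' \<subseteq> S - I" using J'(1) by (auto simp: J_def)
  have finJ': "finite J'" using J'(1) finJ by (rule finite_subset)
  have IS: "I \<subseteq> S" by (auto simp: I_def)
  let ?N1 = "{1..k + 1}" and ?N2 = "{k + 2..DIM('a) + 1}"
  obtain f1 where f1: "bij_betw f1 ?N1 J'"
    using finite_same_card_bij[of ?N1 J'] finJ' J'(2) by auto
  have "card ?N2 = card I" using card_I by simp
  then obtain f2 where f2: "bij_betw f2 ?N2 I"
    using finite_same_card_bij[of ?N2 I] finite_I by blast
  have f1_in: "f1 i \<in> J'" if "i \<in> ?N1" for i using f1 that by (rule bij_betw_apply)
  have f2_in: "f2 i \<in> I" if "i \<in> ?N2" for i using f2 that by (rule bij_betw_apply)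
  define f where "f i = (if i \<le> k + 1 then f1 i else f2 i)" for i
  \<comment> \<open>The sign - \<sigma> turns the normals of the touching hyperplanes outward, which
    \<open>tuple_ball\<close> with positive radius demands. For hyperplanes through the face both
    signs are admissible, and \<open>sec\<close> supplies one.\<close>
  define p where "p = (\<lambda>i\<in>{1..DIM('a) + 1}. if i \<le> k + 1 then (- \<sigma> (f1 i)) *\<^sub>R sec (f1 i) else sec (f2 i))"
  have split: "i \<in> ?N1 \<or> i \<in> ?N2" if "i \<in> {1..DIM('a) + 1}" for i using that by auto
  have N1N: "i \<in> {1..DIM('a) + 1}" if "i \<in> ?N1" for i using that k by auto
  have N2N: "i \<in> {1..DIM('a) + 1}" if "i \<in> ?N2" for i using that by auto
  have p1: "p i = (- \<sigma> (f1 i)) *\<^sub>R sec (f1 i)" if "i \<in> ?N1" for i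
    using that N1N[OF that] by (simp add: p_def)
  have p2: "p i = sec (f2 i)" if "i \<in> ?N2" for i
    using that N2N[OF that] by (simp add: p_def)
  have \<sigma>1: "\<sigma> (f1 i) = 1 \<or> \<sigma> (f1 i) = - 1" if "i \<in> ?N1" for i
    using f1_in[OF that] J'S by (intro \<sigma>_cases) auto
  have hyp1: "hyp (p i) = f1 i" and norm1: "norm (fst (p i)) = 1" if i: "i \<in> ?N1" for i
  proof -
    have H: "f1 i \<in> hyperplanes" using f1_in[OF i] J'S Sh by auto
    have "p i = sec (f1 i) \<or> p i = - sec (f1 i)"
      using \<sigma>1[OF i] p1[OF i] by (elim disjE) (simp_all only: minus_minus scaleR_one scaleR_minus1_left simp_thms)
    then show "hyp (p i) = f1 i" "norm (fst (p i)) = 1"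
      using sec[OF H] hyp_uminus[of "sec (f1 i)"] fst_uminus[of "sec (f1 i)"] norm_minus_cancel[of "fst (sec (f1 i))"]
      by metis+
  qed
  have hyp2: "hyp (p i) = f2 i" and norm2: "norm (fst (p i)) = 1" if i: "i \<in> ?N2" for i
  proof -
    have H: "f2 i \<in> hyperplanes" using f2_in[OF i] IS Sh by auto
    show "hyp (p i) = f2 i" "norm (fst (p i)) = 1" unfolding p2[OF i] by (rule sec[OF H])+
  qed
  have inj: "inj_on (\<lambda>i. hyp (p i)) {1..DIM('a) + 1}"
  proof (rule inj_onI)
    fix i j assume i: "i \<in> {1..DIM('a) + 1}" and j: "j \<in> {1..DIM('a) + 1}" and eq: "hyp (p i) = hyp (p j)"
    have disj: "f1 i' \<noteq> f2 j'" if "i' \<in> ?N1" "j' \<in> ?N2" for i' j'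
      using f1_in[OF that(1)] f2_in[OF that(2)] J'S by auto
    from split[OF i] split[OF j] show "i = j"
    by (metis eq hyp1 f1 bij_betw_imp_inj_on inj_onD hyp2 f2 disj)
  qed
  have p_reps: "p i \<in> reps S" if i: "i \<in> {1..DIM('a) + 1}" for i
    using split[OF i]
  proof
    assume i: "i \<in> ?N1"
    show ?thesis using hyp1[OF i] norm1[OF i] f1_in[OF i] J'S by (auto simp: reps_def)
  next
    assume i: "i \<in> ?N2"
    show ?thesis using hyp2[OF i] norm2[OF i] f2_in[OF i] IS by (auto simp: reps_def)
  qed
  have ptup: "p \<in> tuples (DIM('a) + 1) S"
    unfolding tuples_def using inj p_reps by (auto simp: p_def)
  let ?u = "normals p"
  have u1: "?u i = (- \<sigma> (f1 i)) *\<^sub>R nrm (f1 i)" if i: "i \<in> ?N1" for i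
    using N1N[OF i] by (simp add: normals_apply p1[OF i] nrm_def)
  have u2: "?u i = nrm (f2 i)" if i: "i \<in> ?N2" for i
    using N2N[OF i] by (simp add: normals_apply p2[OF i] nrm_def)
  have L_eq: "L_space k ?u = L"
  proof (rule Set.set_eqI)
    fix w
    have "w \<in> L_space k ?u \<longleftrightarrow> (\<forall>i\<in>?N2. inner (nrm (f2 i)) w = 0)"
      unfolding in_L_space_iff using u2 by auto
    also have "\<dots> \<longleftrightarrow> (\<forall>H\<in>f2 ` ?N2. inner (nrm H) w = 0)" by blast
    also have "f2 ` ?N2 = I" using f2 by (simp add: bij_betw_def)
    finally show "w \<in> L_space k ?u \<longleftrightarrow> w \<in> L" by (simp add: L_def orth_fam_def)
  qed
  have proj1: "orth_proj L (?u i) = - V (f1 i)" if i: "i \<in> ?N1" for i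
    unfolding u1[OF i] orth_proj_scaleR[OF subspace_L] by (simp add: V_def)
  have mrad1: "mrad k ?u i = m (f1 i)" if i: "i \<in> ?N1" for i
    using i \<sigma>1[OF i] by (auto simp: mrad_def L_eq proj1[OF i] V_def m_def)
  have uP: "?u \<in> P_set k"
    unfolding P_set_iff[OF k]
  proof (intro conjI exI[of _ "\<lambda>i. a (f1 i)"])
    show "?u \<in> {1..DIM('a) + 1} \<rightarrow>\<^sub>E sphere 0 1"
      using p_reps by (auto simp: normals_def reps_def)
    show "general_position ?u" by (rule general_position_normals[OF gp ptup])
    show "\<forall>j\<in>?N1. 0 < a (f1 j)" using a f1_in by blast
    have "(\<Sum>j = 1..k + 1. a (f1 j) *\<^sub>R orth_proj (L_space k ?u) (?u j)) = (\<Sum>j = 1..k + 1. - (a (f1 j) *\<^sub>R V (f1 j)))"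
      unfolding L_eq using proj1 by (intro sum.cong) auto
    also have "\<dots> = - (\<Sum>j\<in>?N1. a (f1 j) *\<^sub>R V (f1 j))" by (simp only: sum_negf)
    also have "(\<Sum>j\<in>?N1. a (f1 j) *\<^sub>R V (f1 j)) = (\<Sum>H\<in>J'. a H *\<^sub>R V H)"
      by (rule sum.reindex_bij_betw[OF f1])
    finally show "(\<Sum>j = 1..k + 1. a (f1 j) *\<^sub>R orth_proj (L_space k ?u) (?u j)) = 0"
      by (simp only: sum0 minus_zero)
  qed
  have zL: "z - x \<in> L" using ok by (simp add: ok_def)
  have lev_I: "lev H z = 0" if "H \<in> I" for H
    using zL that lev_diff[of H z x] by (auto simp: L_def orth_fam_def I_def inner_commute)
  have tb: "tuple_ball k ?u (\<lambda>i. snd (p i)) z r"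
    unfolding tuple_ball_def
  proof
    fix i assume i: "i \<in> {1..DIM('a) + 1}"
    show "inner (?u i) z + r * mrad k ?u i = snd (p i)"
      using split[OF i]
    proof
      assume i: "i \<in> ?N1"
      have "r * m (f1 i) = \<sigma> (f1 i) * lev (f1 i) z" using f1_in[OF i] J'(1) by (auto simp: J_def)
      then show ?thesis
        unfolding mrad1[OF i] u1[OF i] p1[OF i]
        by (simp add: lev_def inner_commute algebra_simps)
    next
      assume i: "i \<in> ?N2"
      have "lev (f2 i) z = 0" by (rule lev_I[OF f2_in[OF i]])
      moreover have "mrad k ?u i = 0" using i by (simp add: mrad_def)
      ultimately show ?thesis unfolding u2[OF i] p2[OF i] by (simp add: lev_def inner_commute)
    qed
  qed
  have "good_tuple k S p z r"
    unfolding good_tuple_def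
  proof (intro conjI ballI impI ptup uP r tb)
    fix H w assume H: "H \<in> S - hyps (DIM('a) + 1) p" and w: "w \<in> L_space k ?u" "norm w < r"
    have wL: "w \<in> L" using w(1) by (simp only: L_eq)
    have "H \<notin> I"
    proof
      assume "H \<in> I"
      then have "H \<in> f2 ` ?N2" using f2 by (simp add: bij_betw_def)
      then obtain i where "i \<in> ?N2" "H = f2 i" by blast
      then have "H = hyp (p i)" "i \<in> {1..DIM('a) + 1}" using hyp2 N2N by auto
      then have "H \<in> hyps (DIM('a) + 1) p" by (auto simp: hyps_def)
      then show False using H by simp
    qed
    then have H': "H \<in> S - I" using H by simp
    have "norm w * m H < r * m H" using w(2) m_pos[OF H'] by simp
    also have "\<dots> \<le> \<sigma> H * lev H z" using ok H' by (auto simp: ok_def)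
    finally have "0 < \<sigma> H * lev H (z + w)" using \<sigma>_lev_add_ge[OF H' wL, of z] by linarith
    then have "lev H (z + w) \<noteq> 0" by auto
    then show "z + w \<notin> H" using lev_eq_0_iff[of H "z + w"] H Sh by auto
  qed
  \<comment> \<open>Since r > 0, the center z lies strictly on the side of x for every hyperplane
    not containing the face, so the two points have the same sign pattern.\<close>
  moreover have "cellat S z = cellat S x"
  proof (rule cellat_cong_sgn)
    fix H assume H: "H \<in> S"
    show "sgn (lev H z) = sgn (lev H x)"
    proof (cases "H \<in> I")
      case True
      then show ?thesis using lev_I by (simp add: I_def)
    next
      case False
      then have H': "H \<in> S - I" using H by simp
      have "0 < r * m H" using r m_pos[OF H'] by simp
      also have "\<dots> \<le> \<sigma> H * lev H z" using ok H' by (auto simp: ok_def)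
      finally show ?thesis using False H by (auto simp: \<sigma>_def sgn_if I_def split: if_splits)
    qed
  qed
  ultimately show ?thesis by blast
qed

end

section \<open>The number of tuples describing a face\<close>

lemma card_split_tuples:
  fixes h :: "'b \<Rightarrow> 'c"
  assumes fin: "finite N1" "finite N2" and disj: "N1 \<inter> N2 = {}"
  shows "card {p \<in> (\<Pi>\<^sub>E i\<in>N1 \<union> N2. if i \<in> N1 then R1 else R2). inj_on (\<lambda>i. h (p i)) N1 \<and> inj_on (\<lambda>i. h (p i)) N2} =
    card {p \<in> N1 \<rightarrow>\<^sub>E R1. inj_on (\<lambda>i. h (p i)) N1} * card {p \<in> N2 \<rightarrow>\<^sub>E R2. inj_on (\<lambda>i. h (p i)) N2}"
proof -
  let ?A = "{p \<in> (\<Pi>\<^sub>E i\<in>N1 \<union> N2. if i \<in> N1 then R1 else R2). inj_on (\<lambda>i. h (p i)) N1 \<and> inj_on (\<lambda>i. h (p i)) N2}"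
  let ?B1 = "{p \<in> N1 \<rightarrow>\<^sub>E R1. inj_on (\<lambda>i. h (p i)) N1}" and ?B2 = "{p \<in> N2 \<rightarrow>\<^sub>E R2. inj_on (\<lambda>i. h (p i)) N2}"
  have cong: "inj_on (\<lambda>i. h (p i)) N \<longleftrightarrow> inj_on (\<lambda>i. h (q i)) N" if "\<And>i. i \<in> N \<Longrightarrow> p i = q i" for p q :: "'d \<Rightarrow> 'b" and N
    using that by (intro inj_on_cong) auto
  have "bij_betw (\<lambda>p. (restrict p N1, restrict p N2)) ?A (?B1 \<times> ?B2)"
  proof (rule bij_betwI[where g="\<lambda>(q1, q2). \<lambda>i\<in>N1 \<union> N2. if i \<in> N1 then q1 i else q2 i"])
    show "(\<lambda>p. (restrict p N1, restrict p N2)) \<in> ?A \<rightarrow> ?B1 \<times> ?B2"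
    proof (rule funcsetI)
      fix p assume p: "p \<in> ?A"
      have 1: "p i \<in> R1" if "i \<in> N1" for i using p that by (auto dest!: PiE_mem[of p _ _ i])
      have 2: "p i \<in> R2" if "i \<in> N2" for i
      proof -
        have "i \<notin> N1" using that disj by auto
        then show ?thesis using p that by (auto dest!: PiE_mem[of p _ _ i])
      qed
      have "inj_on (\<lambda>i. h (restrict p N1 i)) N1" "inj_on (\<lambda>i. h (restrict p N2 i)) N2"
        using p cong[of N1 "restrict p N1" p] cong[of N2 "restrict p N2" p] by auto
      then show "(restrict p N1, restrict p N2) \<in> ?B1 \<times> ?B2" using 1 2 by auto
    qed
    show "(\<lambda>(q1, q2). \<lambda>i\<in>N1 \<union> N2. if i \<in> N1 then q1 i else q2 i) \<in> ?B1 \<times> ?B2 \<rightarrow> ?A"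
    proof (rule funcsetI)
      fix y assume "y \<in> ?B1 \<times> ?B2"
      then obtain q1 q2 where y: "y = (q1, q2)" "q1 \<in> ?B1" "q2 \<in> ?B2" by blast
      let ?p = "\<lambda>i\<in>N1 \<union> N2. if i \<in> N1 then q1 i else q2 i"
      have e1: "?p i = q1 i" if "i \<in> N1" for i using that by simp
      have e2: "?p i = q2 i" if "i \<in> N2" for i using that disj by auto
      have "inj_on (\<lambda>i. h (?p i)) N1" "inj_on (\<lambda>i. h (?p i)) N2"
        using y(2,3) cong[of N1 ?p q1, OF e1] cong[of N2 ?p q2, OF e2] by simp_all
      moreover have "?p \<in> (\<Pi>\<^sub>E i\<in>N1 \<union> N2. if i \<in> N1 then R1 else R2)"
        using y(2,3) by (auto simp: PiE_iff)
      ultimately show "(\<lambda>(q1, q2). \<lambda>i\<in>N1 \<union> N2. if i \<in> N1 then q1 i else q2 i) y \<in> ?A"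
        unfolding y(1) by simp
    qed
    show "(\<lambda>(q1, q2). \<lambda>i\<in>N1 \<union> N2. if i \<in> N1 then q1 i else q2 i) ((\<lambda>p. (restrict p N1, restrict p N2)) p) = p"
      if "p \<in> ?A" for p
      using that by (auto simp: fun_eq_iff PiE_iff extensional_def)
    show "(\<lambda>p. (restrict p N1, restrict p N2)) ((\<lambda>(q1, q2). \<lambda>i\<in>N1 \<union> N2. if i \<in> N1 then q1 i else q2 i) y) = y"
      if "y \<in> ?B1 \<times> ?B2" for y
      using that disj by (auto simp: fun_eq_iff PiE_iff extensional_def restrict_def)
  qed
  from bij_betw_same_card[OF this] show ?thesis by (simp add: card_cartesian_product)
qed

lemma card_reps_fibre:
  assumes "H \<in> hyperplanes" "H \<in> I"
  shows "card {q \<in> reps I. hyp q = H} = 2"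
proof -
  have "{q \<in> reps I. hyp q = H} = {sec H, - sec H}"
  proof
    show "{q \<in> reps I. hyp q = H} \<subseteq> {sec H, - sec H}"
    proof
      fix q assume "q \<in> {q \<in> reps I. hyp q = H}"
      then have q: "norm (fst q) = 1" "hyp q = H" by (auto simp: reps_def)
      then have "hyp q = hyp (sec H)" using sec[OF assms(1)] by simp
      then have "sec H = q \<or> sec H = - q" using hyp_eq_iff[OF q(1) sec(1)[OF assms(1)]] by simp
      then show "q \<in> {sec H, - sec H}" by auto
    qed
    show "{sec H, - sec H} \<subseteq> {q \<in> reps I. hyp q = H}"
      using sec[OF assms(1)] assms(2) by (auto simp: reps_def hyp_uminus)
  qed
  then show ?thesis using sec_neq_uminus_sec[OF assms(1) assms(1)] by simp
qed

text \<open>The condition \<open>no_extra\<close> says that no further hyperplane touches the ball.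
  Such a hyperplane could replace one of the k + 1 touching ones and give the face additional
  tuples.\<close>

locale good_tuple_face_gp = good_tuple_face +
  assumes gp: "gen_pos S"
    and no_extra: "\<And>H. H \<in> S - hyps (DIM('a) + 1) p \<Longrightarrow> \<bar>lev H z\<bar> \<noteq> r * norm (orth_proj (L_space k (normals p)) (nrm H))"
begin

definition J0 where "J0 = (\<lambda>i. hyp (p i)) ` {1..k + 1}"
definition I0 where "I0 = (\<lambda>i. hyp (p i)) ` {k + 2..DIM('a) + 1}"
text \<open>The outward representatives of the touching hyperplanes. As z lies off such a
  hyperplane, exactly one of its two pairs has z strictly below its level.\<close>

definition R1 where "R1 = {q. norm (fst q) = 1 \<and> hyp q \<in> J0 \<and> inner (fst q) z < snd q}"

lemma inj_p: "inj_on (\<lambda>i. hyp (p i)) {1..DIM('a) + 1}"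
  using p by (simp add: tuples_def)

lemma N_union: "{1..DIM('a) + 1} = {1..k + 1} \<union> {k + 2..DIM('a) + 1}"
  using k by auto

lemma inj_p1: "inj_on (\<lambda>i. hyp (p i)) {1..k + 1}" and inj_p2: "inj_on (\<lambda>i. hyp (p i)) {k + 2..DIM('a) + 1}"
  using inj_p unfolding N_union by (auto intro: inj_on_subset)

lemma card_J0: "card J0 = k + 1" and card_I0: "card I0 = DIM('a) - k"
  unfolding J0_def I0_def using card_image[OF inj_p1] card_image[OF inj_p2] by auto

lemma J0_I0: "J0 \<inter> I0 = {}"
proof (rule ccontr)
  assume "J0 \<inter> I0 \<noteq> {}"
  then obtain i j where ij: "i \<in> {1..k + 1}" "j \<in> {k + 2..DIM('a) + 1}" "hyp (p i) = hyp (p j)"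
    unfolding J0_def I0_def by blast
  then have "i = j" by (intro inj_onD[OF inj_p]) (use index_split in auto)
  then show False using ij by simp
qed

lemma hyps_eq: "hyps (DIM('a) + 1) p = J0 \<union> I0"
  unfolding hyps_def N_union J0_def I0_def by (rule image_Un)

lemma J0_S: "J0 \<subseteq> S" and I0_S: "I0 \<subseteq> S"
  unfolding J0_def I0_def using p_hyp index_split by auto

lemma fin_J0: "finite J0" and fin_I0: "finite I0" by (auto simp: J0_def I0_def)

lemma L_iff: "w \<in> L_space k (normals p) \<longleftrightarrow> (\<forall>H\<in>I0. inner (nrm H) w = 0)"
proof -
  have "w \<in> L_space k (normals p) \<longleftrightarrow> z + w \<in> flat_at S z" by (simp add: in_flat_iff)
  also have "\<dots> \<longleftrightarrow> (\<forall>H\<in>{H \<in> S. lev H z = 0}. lev H (z + w) = 0)" using in_flat_at_iff[OF Sh] by auto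
  also have "\<dots> \<longleftrightarrow> (\<forall>H\<in>I0. inner (nrm H) w = 0)"
    unfolding through_eq I0_def[symmetric]
  proof (intro ball_cong refl)
    fix H assume "H \<in> I0"
    then have "lev H z = 0" using through_eq unfolding I0_def by blast
    then show "lev H (z + w) = 0 \<longleftrightarrow> inner (nrm H) w = 0" by (simp add: lev_add inner_commute)
  qed
  finally show ?thesis .
qed

lemma R1_unique: "q \<in> R1 \<Longrightarrow> q' \<in> R1 \<Longrightarrow> hyp q = hyp q' \<Longrightarrow> q = q'"
  by (auto simp: hyp_eq_iff R1_def)

lemma p_in_R1: "i \<in> {1..k + 1} \<Longrightarrow> p i \<in> R1"
  using p_norm[OF index_split(1), of i] outer_level[of i] normals_apply[OF index_split(1), of i p]
  by (auto simp: R1_def J0_def simp del: atLeastAtMost_iff)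

lemma card_R1_fibre:
  assumes "H \<in> J0" shows "card {q \<in> R1. hyp q = H} = 1"
proof -
  obtain i where i: "i \<in> {1..k + 1}" "H = hyp (p i)" using assms unfolding J0_def by blast
  have "{q \<in> R1. hyp q = H} = {p i}" using R1_unique[OF _ p_in_R1[OF i(1)]] p_in_R1[OF i(1)] i(2) by auto
  then show ?thesis by simp
qed

text \<open>Center, radius and flat are intrinsic to the face: they are the incenter, the largest
  inscribed radius and the affine hull. A touching hyperplane of the second tuple therefore touches
  the same ball, and \<open>no_extra\<close> places it among those of p.\<close>

lemma same_face_tuple:
  assumes g: "good_tuple k S p' z' r'" and c: "cellat S z' = cellat S z"
  shows "z' = z" "r' = r" "i \<in> {1..k + 1} \<Longrightarrow> p' i \<in> R1" "i \<in> {k + 2..DIM('a) + 1} \<Longrightarrow> p' i \<in> reps I0"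
proof -
  interpret G: good_tuple_face k S p' z' r' by (rule good_tuple_face.intro[OF k S g])
  have "z' = incenter (cellat S z')" by (rule G.incenter_cellat[symmetric])
  also have "\<dots> = z" unfolding c by (rule incenter_cellat)
  finally show z: "z' = z" .
  have "r \<le> r'" using G.inscribed_le(1)[of z r] inscribed_center c by simp
  moreover have "r' \<le> r" using inscribed_le(1)[of z' r'] G.inscribed_center c by simp
  ultimately show r: "r' = r" by simp
  have I0: "(\<lambda>i. hyp (p' i)) ` {k + 2..DIM('a) + 1} = I0"
    using G.through_eq through_eq unfolding z I0_def by simp
  then show "p' i \<in> reps I0" if "i \<in> {k + 2..DIM('a) + 1}" for i
    using that G.p_norm[OF G.index_split(2)[OF that]] by (auto simp: reps_def simp del: atLeastAtMost_iff)
  have Leq: "L_space k (normals p') = L_space k (normals p)"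
  proof (rule Set.set_eqI)
    fix w
    have "w \<in> L_space k (normals p') \<longleftrightarrow> z + w \<in> flat_at S z" using G.in_flat_iff[of "z + w"] z by simp
    also have "\<dots> \<longleftrightarrow> w \<in> L_space k (normals p)" using in_flat_iff[of "z + w"] by simp
    finally show "w \<in> L_space k (normals p') \<longleftrightarrow> w \<in> L_space k (normals p)" .
  qed
  show "p' i \<in> R1" if i: "i \<in> {1..k + 1}" for i
  proof -
    have iN: "i \<in> {1..DIM('a) + 1}" by (rule index_split(1)[OF i])
    let ?H = "hyp (p' i)"
    obtain s where s: "(s = 1 \<or> s = -1) \<and> (\<forall>y. inner (fst (p' i)) y - snd (p' i) = s * lev ?H y)
      \<and> fst (p' i) = s *\<^sub>R nrm ?H"
      using rep_lev[OF G.p_norm[OF iN]] ..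
    have lvl: "inner (fst (p' i)) z < snd (p' i)"
      using G.outer_level[OF i] unfolding normals_apply[OF iN] z .
    have HS: "?H \<in> S" by (rule G.p_hyp[OF iN])
    have "inner (fst (p' i)) z - snd (p' i) = - (r * mrad k (normals p') i)"
      using G.p_level[OF iN] unfolding normals_apply[OF iN] z r .
    moreover have "inner (fst (p' i)) z - snd (p' i) = s * lev ?H z" using s by blast
    moreover have "mrad k (normals p') i = norm (orth_proj (L_space k (normals p)) (s *\<^sub>R nrm ?H))"
    proof -
      have "mrad k (normals p') i = norm (orth_proj (L_space k (normals p)) (fst (p' i)))"
        using i normals_apply[OF iN, of p'] by (simp add: mrad_def Leq)
      moreover have "fst (p' i) = s *\<^sub>R nrm ?H" using s by blast
      ultimately show ?thesis by (simp only:)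
    qed
    ultimately have "s * lev ?H z = - (r * norm (orth_proj (L_space k (normals p)) (s *\<^sub>R nrm ?H)))"
      by simp
    then have "\<bar>lev ?H z\<bar> = r * norm (orth_proj (L_space k (normals p)) (nrm ?H))"
      using conjunct1[OF s] good by (auto simp: orth_proj_scaleR[OF subspace_L_space] orth_proj_uminus[OF subspace_L_space] good_tuple_def abs_mult)
    then have "?H \<in> hyps (DIM('a) + 1) p" using no_extra[of ?H] HS by blast
    moreover have "?H \<notin> I0"
    proof
      assume "?H \<in> I0"
      then have "lev ?H z = 0" using through_eq unfolding I0_def by blast
      moreover have "inner (fst (p' i)) z - snd (p' i) = s * lev ?H z" using s by blast
      ultimately show False using lvl by simp
    qed
    ultimately have "?H \<in> J0" unfolding hyps_eq by blast
    then show ?thesis using lvl G.p_norm[OF iN] by (simp add: R1_def)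
  qed
qed

text \<open>Reordering the touching hyperplanes, and reordering or changing the sign of those
  through the face, preserves the flat, the levels at z and the positive relation, whose
  coefficients are permuted along.\<close>

lemma tuple_from_parts:
  assumes p': "p' \<in> {1..DIM('a) + 1} \<rightarrow>\<^sub>E UNIV"
    and 1: "\<And>i. i \<in> {1..k + 1} \<Longrightarrow> p' i \<in> R1" "inj_on (\<lambda>i. hyp (p' i)) {1..k + 1}"
    and 2: "\<And>i. i \<in> {k + 2..DIM('a) + 1} \<Longrightarrow> p' i \<in> reps I0" "inj_on (\<lambda>i. hyp (p' i)) {k + 2..DIM('a) + 1}"
  shows "good_tuple k S p' z r"
proof -
  have img1: "(\<lambda>i. hyp (p' i)) ` {1..k + 1} = J0"
    using 1 fin_J0 card_image[OF 1(2)] card_J0 by (intro card_subset_eq) (auto simp: R1_def)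
  have img2: "(\<lambda>i. hyp (p' i)) ` {k + 2..DIM('a) + 1} = I0"
    using 2 fin_I0 card_image[OF 2(2)] card_I0 by (intro card_subset_eq) (auto simp: reps_def)
  have hyps': "hyps (DIM('a) + 1) p' = hyps (DIM('a) + 1) p"
    unfolding hyps_eq unfolding hyps_def N_union image_Un img1 img2 ..
  have nrm1: "norm (fst (p' i)) = 1" if "i \<in> {1..DIM('a) + 1}" for i
    using that 1(1)[of i] 2(1)[of i] unfolding N_union by (auto simp: R1_def reps_def)
  have hypS: "hyp (p' i) \<in> S" if "i \<in> {1..DIM('a) + 1}" for i
  proof -
    from that have "i \<in> {1..k + 1} \<or> i \<in> {k + 2..DIM('a) + 1}" unfolding N_union by (rule UnE) simp_all
    then show ?thesis
    proof
      assume "i \<in> {1..k + 1}"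
      from 1(1)[OF this] show ?thesis using J0_S by (auto simp: R1_def)
    next
      assume "i \<in> {k + 2..DIM('a) + 1}"
      from 2(1)[OF this] show ?thesis using I0_S by (auto simp: reps_def)
    qed
  qed
  have inj: "inj_on (\<lambda>i. hyp (p' i)) {1..DIM('a) + 1}"
    unfolding N_union inj_on_Un
  proof (intro conjI 1(2) 2(2))
    have "(\<lambda>i. hyp (p' i)) ` ({1..k + 1} - {k + 2..DIM('a) + 1}) \<subseteq> J0"
      unfolding img1[symmetric] by (rule image_mono) (rule Diff_subset)
    moreover have "(\<lambda>i. hyp (p' i)) ` ({k + 2..DIM('a) + 1} - {1..k + 1}) \<subseteq> I0"
      unfolding img2[symmetric] by (rule image_mono) (rule Diff_subset)
    ultimately show "(\<lambda>i. hyp (p' i)) ` ({1..k + 1} - {k + 2..DIM('a) + 1}) \<inter>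
      (\<lambda>i. hyp (p' i)) ` ({k + 2..DIM('a) + 1} - {1..k + 1}) = {}"
      using J0_I0 by (meson disjoint_iff subsetD)
  qed
  have tup: "p' \<in> tuples (DIM('a) + 1) S"
    using p' nrm1 hypS inj by (auto simp: tuples_def reps_def PiE_iff)
  let ?u = "normals p'" and ?L = "L_space k (normals p)"
  have L_eq: "L_space k ?u = ?L"
  proof (rule Set.set_eqI)
    fix w
    have "inner (?u i) w = 0 \<longleftrightarrow> inner (nrm (hyp (p' i))) w = 0" if i: "i \<in> {k + 2..DIM('a) + 1}" for i
    proof -
      obtain s where "(s = 1 \<or> s = -1) \<and> (\<forall>y. inner (fst (p' i)) y - snd (p' i) = s * lev (hyp (p' i)) y)
        \<and> fst (p' i) = s *\<^sub>R nrm (hyp (p' i))"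
        using rep_lev[OF nrm1[OF index_split(2)[OF i]]] ..
      then show ?thesis unfolding normals_apply[OF index_split(2)[OF i]] by auto
    qed
    then have "w \<in> L_space k ?u \<longleftrightarrow> (\<forall>i\<in>{k + 2..DIM('a) + 1}. inner (nrm (hyp (p' i))) w = 0)"
      unfolding in_L_space_iff by (intro ball_cong refl)
    also have "\<dots> \<longleftrightarrow> (\<forall>H\<in>I0. inner (nrm H) w = 0)" unfolding img2[symmetric] by blast
    finally show "w \<in> L_space k ?u \<longleftrightarrow> w \<in> ?L" by (simp only: L_iff)
  qed
  \<comment> \<open>The permutation taking an index of p' to the index at which p uses the same
    hyperplane. As the outward pair is unique, the pairs agree as well.\<close>
  define \<pi> where "\<pi> i = the_inv_into {1..k + 1} (\<lambda>i. hyp (p i)) (hyp (p' i))" for i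
  have bij\<pi>: "bij_betw \<pi> {1..k + 1} {1..k + 1}"
  proof -
    have "bij_betw (\<lambda>i. hyp (p' i)) {1..k + 1} J0" using 1(2) img1 by (simp add: bij_betw_def)
    moreover have "bij_betw (the_inv_into {1..k + 1} (\<lambda>i. hyp (p i))) J0 {1..k + 1}"
      by (rule bij_betw_the_inv_into) (unfold bij_betw_def J0_def, rule conjI[OF inj_p1 refl])
    ultimately have "bij_betw (the_inv_into {1..k + 1} (\<lambda>i. hyp (p i)) \<circ> (\<lambda>i. hyp (p' i))) {1..k + 1} {1..k + 1}"
      by (rule bij_betw_trans)
    then show ?thesis unfolding \<pi>_def comp_def .
  qed
  have p'_eq: "p' i = p (\<pi> i)" if i: "i \<in> {1..k + 1}" for i
  proof (rule R1_unique[OF 1(1)[OF i]])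
    have \<pi>i: "\<pi> i \<in> {1..k + 1}" using bij\<pi> i by (rule bij_betw_apply)
    show "p (\<pi> i) \<in> R1" by (rule p_in_R1[OF \<pi>i])
    have "hyp (p' i) \<in> (\<lambda>i. hyp (p i)) ` {1..k + 1}" using 1(1)[OF i] by (simp add: R1_def J0_def)
    then show "hyp (p' i) = hyp (p (\<pi> i))"
      unfolding \<pi>_def using f_the_inv_into_f[OF inj_p1] by simp
  qed
  have u_eq: "?u i = normals p (\<pi> i)" if i: "i \<in> {1..k + 1}" for i
  proof -
    have \<pi>i: "\<pi> i \<in> {1..k + 1}" using bij\<pi> i by (rule bij_betw_apply)
    show ?thesis
      unfolding normals_apply[OF index_split(1)[OF i]] normals_apply[OF index_split(1)[OF \<pi>i]] by (simp only: p'_eq[OF i])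
  qed
  have uP: "?u \<in> P_set k"
  proof -
    obtain a where a: "\<forall>j\<in>{1..k + 1}. 0 < a j" "(\<Sum>j = 1..k + 1. a j *\<^sub>R orth_proj ?L (normals p j)) = 0"
      using uP unfolding P_set_iff[OF k] by blast
    show ?thesis
      unfolding P_set_iff[OF k]
    proof (intro conjI exI[of _ "\<lambda>i. a (\<pi> i)"])
      show "?u \<in> {1..DIM('a) + 1} \<rightarrow>\<^sub>E sphere 0 1" using nrm1 by (auto simp: normals_def)
      show "general_position ?u" by (rule general_position_normals[OF gp tup])
      show "\<forall>j\<in>{1..k + 1}. 0 < a (\<pi> j)" using a(1) bij_betw_apply[OF bij\<pi>] by blast
      have "(\<Sum>j = 1..k + 1. a (\<pi> j) *\<^sub>R orth_proj (L_space k ?u) (?u j)) = (\<Sum>j\<in>{1..k + 1}. a (\<pi> j) *\<^sub>R orth_proj ?L (normals p (\<pi> j)))"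
        unfolding L_eq using u_eq by (intro sum.cong) auto
      also have "\<dots> = (\<Sum>j\<in>{1..k + 1}. a j *\<^sub>R orth_proj ?L (normals p j))"
        by (rule sum.reindex_bij_betw[OF bij\<pi>])
      finally show "(\<Sum>j = 1..k + 1. a (\<pi> j) *\<^sub>R orth_proj (L_space k ?u) (?u j)) = 0" by (simp only: a(2))
    qed
  qed
  have tb: "tuple_ball k ?u (\<lambda>i. snd (p' i)) z r"
    unfolding tuple_ball_def
  proof
    fix i assume i: "i \<in> {1..DIM('a) + 1}"
    then have "i \<in> {1..k + 1} \<or> i \<in> {k + 2..DIM('a) + 1}" using N_union by blast
    then show "inner (?u i) z + r * mrad k ?u i = snd (p' i)"
    proof
      assume i: "i \<in> {1..k + 1}"
      have \<pi>i: "\<pi> i \<in> {1..k + 1}" using bij\<pi> i by (rule bij_betw_apply)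
      have "mrad k ?u i = mrad k (normals p) (\<pi> i)"
        using i \<pi>i u_eq[OF i] by (simp add: mrad_def L_eq)
      then show ?thesis
        using ball_eq[OF index_split(1)[OF \<pi>i]] by (simp only: u_eq[OF i] p'_eq[OF i])
    next
      assume i: "i \<in> {k + 2..DIM('a) + 1}"
      then have "hyp (p' i) \<in> I0" using img2 by blast
      then have l0: "lev (hyp (p' i)) z = 0" using through_eq unfolding I0_def by blast
      obtain s where s: "(s = 1 \<or> s = -1) \<and> (\<forall>y. inner (fst (p' i)) y - snd (p' i) = s * lev (hyp (p' i)) y)
        \<and> fst (p' i) = s *\<^sub>R nrm (hyp (p' i))"
        using rep_lev[OF nrm1[OF index_split(2)[OF i]]] ..
      have "inner (fst (p' i)) z - snd (p' i) = s * lev (hyp (p' i)) z" using s by blast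
      then have "inner (fst (p' i)) z - snd (p' i) = 0" unfolding l0 by simp
      moreover have "mrad k ?u i = 0" using i by (simp add: mrad_def)
      ultimately show ?thesis unfolding normals_apply[OF index_split(2)[OF i]] by simp
    qed
  qed
  show ?thesis
    unfolding good_tuple_def hyps' L_eq
    using tup uP r tb nohit by blast
qed

text \<open>The normals of the \<open>k + 1\<close> touching hyperplanes must point outwards, while each hyperplane through
  the face may be represented by either of its two normals.\<close>

theorem card_tuples_of_face:
  "card {p'. \<exists>z' r'. good_tuple k S p' z' r' \<and> cellat S z' = cellat S z} =
    fact (k + 1) * (2 ^ (DIM('a) - k) * fact (DIM('a) - k))"
proof -
  let ?N1 = "{1..k + 1}" and ?N2 = "{k + 2..DIM('a) + 1}"
  have "{p'. \<exists>z' r'. good_tuple k S p' z' r' \<and> cellat S z' = cellat S z} =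
    {p' \<in> (\<Pi>\<^sub>E i\<in>?N1 \<union> ?N2. if i \<in> ?N1 then R1 else reps I0).
      inj_on (\<lambda>i. hyp (p' i)) ?N1 \<and> inj_on (\<lambda>i. hyp (p' i)) ?N2}" (is "?A = ?B")
  proof
    show "?A \<subseteq> ?B"
    proof
      fix p' assume "p' \<in> ?A"
      then obtain z' r' where g: "good_tuple k S p' z' r'" "cellat S z' = cellat S z" by blast
      have tup: "p' \<in> tuples (DIM('a) + 1) S" using g(1) by (simp add: good_tuple_def)
      have "inj_on (\<lambda>i. hyp (p' i)) ({1..k + 1} \<union> {k + 2..DIM('a) + 1})"
        unfolding N_union[symmetric] using tup by (simp add: tuples_def)
      then have inj: "inj_on (\<lambda>i. hyp (p' i)) ?N1" "inj_on (\<lambda>i. hyp (p' i)) ?N2"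
        by (auto intro: inj_on_subset)
      have ext: "p' \<in> extensional (?N1 \<union> ?N2)"
        unfolding N_union[symmetric] using tup by (simp add: tuples_def PiE_def)
      have "p' i \<in> (if i \<in> ?N1 then R1 else reps I0)" if "i \<in> ?N1 \<union> ?N2" for i
        using that same_face_tuple(3,4)[OF g, of i] by auto
      then show "p' \<in> ?B" using inj ext by (auto simp: PiE_iff simp del: atLeastAtMost_iff Un_iff)
    qed
    show "?B \<subseteq> ?A"
    proof
      fix p' assume p': "p' \<in> ?B"
      have m: "p' i \<in> (if i \<in> ?N1 then R1 else reps I0)" if "i \<in> ?N1 \<union> ?N2" for i
        using p' that by (auto dest!: PiE_mem[of p' _ _ i] simp del: atLeastAtMost_iff Un_iff)
      have "good_tuple k S p' z r"
      proof (rule tuple_from_parts)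
        have "p' \<in> extensional (?N1 \<union> ?N2)" using p' by (simp add: PiE_def del: atLeastAtMost_iff)
        then show "p' \<in> {1..DIM('a) + 1} \<rightarrow>\<^sub>E UNIV" unfolding N_union[symmetric] by (simp add: PiE_def)
        show "p' i \<in> R1" if "i \<in> ?N1" for i using m[of i] that by simp
        show "p' i \<in> reps I0" if "i \<in> ?N2" for i using m[of i] that by auto
      qed (use p' in auto)
      then show "p' \<in> ?A" by blast
    qed
  qed
  then have "card ?A = card {q \<in> ?N1 \<rightarrow>\<^sub>E R1. inj_on (\<lambda>i. hyp (q i)) ?N1} * card {q \<in> ?N2 \<rightarrow>\<^sub>E reps I0. inj_on (\<lambda>i. hyp (q i)) ?N2}"
    by (simp only:) (rule card_split_tuples, auto)
  also have "card {q \<in> ?N1 \<rightarrow>\<^sub>E R1. inj_on (\<lambda>i. hyp (q i)) ?N1} = 1 ^ card ?N1 * fact (card ?N1)"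
  proof (rule card_tuples_of_fibres[where I=J0])
    have "R1 \<subseteq> p ` ?N1"
    using R1_def J0_def R1_unique p_in_R1 by blast
    then show "finite R1" by (rule finite_subset) simp
    show "card ?N1 = card J0" by (simp add: card_J0)
    show "hyp q \<in> J0" if "q \<in> R1" for q using that by (simp add: R1_def)
  qed (auto simp: fin_J0 card_R1_fibre)
  also have "card {q \<in> ?N2 \<rightarrow>\<^sub>E reps I0. inj_on (\<lambda>i. hyp (q i)) ?N2} = 2 ^ card ?N2 * fact (card ?N2)"
  proof (rule card_tuples_of_fibres[where I=I0])
    have Ih: "I0 \<subseteq> hyperplanes" using I0_S Sh by blast
    show "finite (reps I0)" unfolding reps_eq[OF Ih] using fin_I0 by simp
    show "card ?N2 = card I0" by (simp add: card_I0)
    show "hyp q \<in> I0" if "q \<in> reps I0" for q using that by (simp add: reps_def)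
    show "card {q \<in> reps I0. hyp q = H} = 2" if "H \<in> I0" for H
      using card_reps_fibre[of H I0] that Ih by blast
  qed (auto simp: fin_I0)
  finally show ?thesis by simp
qed

end

section \<open>Measurability of maps into the space of convex bodies\<close>

lemma convex_infdist_le:
  fixes K :: "'a::euclidean_space set"
  assumes K: "K \<in> convex_bodies"
  shows "convex {y. infdist y K \<le> q}"
  unfolding convex_def
proof (intro ballI allI impI)
  fix y z and a b :: real
  assume y: "y \<in> {y. infdist y K \<le> q}" and z: "z \<in> {y. infdist y K \<le> q}" and ab: "0 \<le> a" "0 \<le> b" "a + b = 1"
  have cl: "closed K" "K \<noteq> {}" "convex K" using K by (auto simp: convex_bodies_def compact_imp_closed)
  obtain y' where y': "y' \<in> K" "infdist y K = dist y y'" using infdist_attains_inf[OF cl(1,2)] by metis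
  obtain z' where z': "z' \<in> K" "infdist z K = dist z z'" using infdist_attains_inf[OF cl(1,2)] by metis
  have in_K: "a *\<^sub>R y' + b *\<^sub>R z' \<in> K" using cl(3) y'(1) z'(1) ab by (rule convexD)
  have "infdist (a *\<^sub>R y + b *\<^sub>R z) K \<le> dist (a *\<^sub>R y + b *\<^sub>R z) (a *\<^sub>R y' + b *\<^sub>R z')"
    by (rule infdist_le[OF in_K])
  also have "\<dots> = norm (a *\<^sub>R (y - y') + b *\<^sub>R (z - z'))"
    by (simp add: dist_norm algebra_simps)
  also have "\<dots> \<le> a * dist y y' + b * dist z z'"
    using norm_triangle_ineq[of "a *\<^sub>R (y - y')" "b *\<^sub>R (z - z')"] ab by (simp add: dist_norm)
  also have "\<dots> \<le> a * q + b * q"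
    using y z y' z' ab by (intro add_mono mult_left_mono) auto
  also have "\<dots> = q" using ab(3) by (metis distrib_right mult_1)
  finally show "a *\<^sub>R y + b *\<^sub>R z \<in> {y. infdist y K \<le> q}" by simp
qed

text \<open>The distance to a convex body is a convex function, so on the polytope it need only be
  checked at the points of F. A closed Hausdorff ball around a polytope is thereby described by one
  open set that is not hit and finitely many distances.\<close>

lemma hausdorff_dist_hull_le_iff:
  fixes K :: "'a::euclidean_space set"
  assumes K: "K \<in> convex_bodies" and F: "finite F" "F \<noteq> {}"
  shows "hausdorff_dist K (convex hull F) \<le> q \<longleftrightarrow>
    K \<inter> {y. q < infdist y (convex hull F)} = {} \<and> (\<forall>f\<in>F. infdist f K \<le> q)"
proof -
  have H: "convex hull F \<in> convex_bodies"
    using F by (auto simp: convex_bodies_def finite_imp_compact_convex_hull convex_convex_hull)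
  show ?thesis
  proof
    assume h: "hausdorff_dist K (convex hull F) \<le> q"
    have "infdist y (convex hull F) \<le> q" if "y \<in> K" for y
      using infdist_le_hausdorff_dist[OF K H that] h by simp
    moreover have "infdist f K \<le> q" if "f \<in> F" for f
      using infdist_le_hausdorff_dist[OF H K hull_inc[OF that]] h by (simp add: hausdorff_dist_commute)
    ultimately show "K \<inter> {y. q < infdist y (convex hull F)} = {} \<and> (\<forall>f\<in>F. infdist f K \<le> q)"
      by fastforce
  next
    assume a: "K \<inter> {y. q < infdist y (convex hull F)} = {} \<and> (\<forall>f\<in>F. infdist f K \<le> q)"
    have "convex hull F \<subseteq> {y. infdist y K \<le> q}"
      using a by (intro hull_minimal convex_infdist_le K) auto
    then show "hausdorff_dist K (convex hull F) \<le> q"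
      using a by (intro hausdorff_dist_le K H) (force, blast)
  qed
qed

text \<open>Take a finite q / 2 net of K and move each of its points by less than q / 2 into the
  dense set. This provides countably many polytopes as centers for Hausdorff balls.\<close>

lemma hausdorff_dist_dense:
  fixes K :: "'a::euclidean_space set"
  assumes K: "K \<in> convex_bodies" and D: "\<And>X. open X \<Longrightarrow> X \<noteq> {} \<Longrightarrow> \<exists>d\<in>D. d \<in> X" and q: "0 < q"
  shows "\<exists>F. finite F \<and> F \<noteq> {} \<and> F \<subseteq> D \<and> hausdorff_dist K (convex hull F) \<le> q"
proof -
  have cK: "compact K" "K \<noteq> {}" using K by (auto simp: convex_bodies_def)
  obtain C where C: "finite C" "C \<subseteq> K" "K \<subseteq> (\<Union>x\<in>C. ball x (q / 2))"
    using compactE_image[OF cK(1), of K "\<lambda>x. ball x (q / 2)"] q by (metis UN_I centre_in_ball half_gt_zero open_ball subsetI)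
  have "\<forall>c. \<exists>d\<in>D. d \<in> ball c (q / 2)" using D[of "ball _ (q / 2)"] q by auto
  then obtain d where d: "\<And>c. d c \<in> D" "\<And>c. dist c (d c) < q / 2" by (metis mem_ball)
  have "C \<noteq> {}" using C(3) cK(2) by auto
  have 1: "infdist y (convex hull (d ` C)) \<le> q" if y: "y \<in> K" for y
  proof -
    obtain c where c: "c \<in> C" "dist c y < q / 2" using C(3) y by auto
    have "d c \<in> convex hull (d ` C)" using c(1) by (intro hull_inc) simp
    then have "infdist y (convex hull (d ` C)) \<le> dist y (d c)" by (rule infdist_le)
    also have "\<dots> \<le> dist y c + dist c (d c)" by (rule dist_triangle)
    also have "\<dots> \<le> q" using c(2) d(2)[of c] by (simp add: dist_commute)
    finally show ?thesis .
  qed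
  have 2: "infdist f K \<le> q" if f: "f \<in> d ` C" for f
  proof -
    obtain c where c: "c \<in> C" "f = d c" using f by blast
    then have "infdist f K \<le> dist f c" using C(2) by (intro infdist_le) auto
    then show ?thesis using d(2)[of c] c(2) q by (simp add: dist_commute)
  qed
  have "hausdorff_dist K (convex hull (d ` C)) \<le> q"
    using C(1) \<open>C \<noteq> {}\<close> 1 2
    by (subst hausdorff_dist_hull_le_iff[OF K]) (simp, simp, simp add: disjoint_iff not_less)
  then show ?thesis using C(1) \<open>C \<noteq> {}\<close> d(1) by (intro exI[of _ "d ` C"]) auto
qed

text \<open>Open sets in the Hausdorff metric are countable unions of closed balls with rational
  radii around hulls of finite subsets of a countable dense set.
  \<open>hausdorff_dist_hull_le_iff\<close> reduces membership in such a ball to hitting open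
  sets.\<close>

lemma measurable_bodyI:
  fixes \<psi> :: "'x \<Rightarrow> 'a::euclidean_space set"
  assumes bodies: "\<And>x. x \<in> space N \<Longrightarrow> \<psi> x \<in> convex_bodies"
    and hits: "\<And>G. open G \<Longrightarrow> {x \<in> space N. \<psi> x \<inter> G \<noteq> {}} \<in> sets N"
  shows "\<psi> \<in> N \<rightarrow>\<^sub>M body_borel"
proof -
  interpret ms: Metric_space "convex_bodies :: 'a set set" hausdorff_dist by (rule Metric_space_hausdorff_dist)
  obtain D :: "'a set" where D: "countable D" "\<And>X. open X \<Longrightarrow> X \<noteq> {} \<Longrightarrow> \<exists>d\<in>D. d \<in> X"
    using countable_dense_exists by metis
  define \<F> where "\<F> = {F. finite F \<and> F \<subseteq> D \<and> F \<noteq> {}}"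
  have "countable {F. finite F \<and> F \<subseteq> D}" using countable_Collect_finite_subset[OF D(1)] .
  then have c\<F>: "countable \<F>" by (rule countable_subset[rotated]) (auto simp: \<F>_def)
  have H: "convex hull F \<in> convex_bodies" if "F \<in> \<F>" for F
    using that by (auto simp: \<F>_def convex_bodies_def finite_imp_compact_convex_hull convex_convex_hull)
  define B where "B F q = {K \<in> convex_bodies. hausdorff_dist K (convex hull F) \<le> q}" for F :: "'a set" and q :: real
  have near: "{x \<in> space N. infdist f (\<psi> x) \<le> q} \<in> sets N" for f q
  proof -
    \<comment> \<open>A distance is expressed through hit open balls; the margins 1 / (n + 1) make
      up for their openness.\<close>
    have "infdist f (\<psi> x) \<le> q \<longleftrightarrow> (\<forall>n::nat. \<psi> x \<inter> ball f (q + 1 / (real n + 1)) \<noteq> {})" if x: "x \<in> space N" for x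
    proof -
      have cl: "closed (\<psi> x)" "\<psi> x \<noteq> {}" using bodies[OF x] by (auto simp: convex_bodies_def compact_imp_closed)
      obtain y where y: "y \<in> \<psi> x" "infdist f (\<psi> x) = dist f y" using infdist_attains_inf[OF cl] by metis
      show ?thesis
      proof
        assume le: "infdist f (\<psi> x) \<le> q"
        show "\<forall>n::nat. \<psi> x \<inter> ball f (q + 1 / (real n + 1)) \<noteq> {}"
        proof
          fix n :: nat
          have "0 < 1 / (real n + 1)" by simp
          then have "dist f y < q + 1 / (real n + 1)" using le y(2) by linarith
          then have "y \<in> \<psi> x \<inter> ball f (q + 1 / (real n + 1))" using y(1) by simp
          then show "\<psi> x \<inter> ball f (q + 1 / (real n + 1)) \<noteq> {}" by blast
        qed
      next
        assume a: "\<forall>n::nat. \<psi> x \<inter> ball f (q + 1 / (real n + 1)) \<noteq> {}"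
        show "infdist f (\<psi> x) \<le> q"
        proof (rule field_le_epsilon)
          fix e :: real assume "0 < e"
          then obtain n where n: "inverse (real (Suc n)) < e" using reals_Archimedean by blast
          obtain w where w: "w \<in> \<psi> x" "dist f w < q + 1 / (real n + 1)" using a by (metis IntE disjoint_iff mem_ball)
          have "infdist f (\<psi> x) \<le> dist f w" by (rule infdist_le[OF w(1)])
          then show "infdist f (\<psi> x) \<le> q + e" using w(2) n by (simp add: inverse_eq_divide add.commute)
        qed
      qed
    qed
    then have "{x \<in> space N. infdist f (\<psi> x) \<le> q} = {x \<in> space N. \<forall>n::nat. \<psi> x \<inter> ball f (q + 1 / (real n + 1)) \<noteq> {}}"
      by (intro Collect_cong conj_cong refl)
    also have "\<dots> \<in> sets N"
      using hits[of "ball f _"] by (intro sets.sets_Collect_countable_All) simp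
    finally show ?thesis .
  qed
  have pre: "\<psi> -` B F q \<inter> space N \<in> sets N" if F: "F \<in> \<F>" for F q
  proof -
    have FF: "finite F" "F \<noteq> {}" using F by (auto simp: \<F>_def)
    have "\<psi> -` B F q \<inter> space N = {x \<in> space N. \<not> (\<psi> x \<inter> {y. q < infdist y (convex hull F)} \<noteq> {})} \<inter>
        (\<Inter>f\<in>F. {x \<in> space N. infdist f (\<psi> x) \<le> q})"
    proof (rule Set.set_eqI)
      fix x
      show "x \<in> \<psi> -` B F q \<inter> space N \<longleftrightarrow> x \<in> {x \<in> space N. \<not> (\<psi> x \<inter> {y. q < infdist y (convex hull F)} \<noteq> {})} \<inter>
        (\<Inter>f\<in>F. {x \<in> space N. infdist f (\<psi> x) \<le> q})"
      by (auto simp: hausdorff_dist_hull_le_iff bodies FF B_def)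
    qed
    also have "\<dots> \<in> sets N"
    proof (intro sets.Int sets.finite_INT FF near)
      have "open {y. q < infdist y (convex hull F)}"
        by (intro open_Collect_less continuous_intros)
      from sets.Diff[OF sets.top hits[OF this]]
      show "{x \<in> space N. \<not> (\<psi> x \<inter> {y. q < infdist y (convex hull F)} \<noteq> {})} \<in> sets N"
        by (rule back_subst[of "\<lambda>A. A \<in> sets N"]) auto
    qed
    finally show ?thesis .
  qed
  show ?thesis
    unfolding body_borel_def borel_algebra_def
  proof (rule measurable_measure_of)
    show "{U. openin ms.mtopology U} \<subseteq> Pow (topspace ms.mtopology)"
      using openin_subset[of ms.mtopology] unfolding subset_iff Pow_iff mem_Collect_eq by blast
    show "\<psi> \<in> space N \<rightarrow> topspace ms.mtopology" using bodies by auto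
    fix U assume "U \<in> {U. openin ms.mtopology U}"
    then have U: "U \<subseteq> convex_bodies" "\<And>K. K \<in> U \<Longrightarrow> \<exists>e>0. ms.mball K e \<subseteq> U"
      unfolding mem_Collect_eq ms.openin_mtopology by auto
    let ?I = "{(F, q). F \<in> \<F> \<and> q \<in> \<rat> \<and> B F q \<subseteq> U}"
    have U_eq: "U = (\<Union>(F, q)\<in>?I. B F q)"
    proof
      show "U \<subseteq> (\<Union>(F, q)\<in>?I. B F q)"
      proof
        fix K assume K: "K \<in> U"
        obtain e where e: "0 < e" "ms.mball K e \<subseteq> U" using U(2)[OF K] by blast
        have Kb: "K \<in> convex_bodies" using K U(1) by blast
        \<comment> \<open>With q < e / 2, the q-ball around a polytope within q of K stays inside
          the e-ball around K.\<close>
        obtain q where q: "q \<in> \<rat>" "0 < q" "q < e / 2" using Rats_dense_in_real[of 0 "e / 2"] e(1) by auto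
        obtain F where F: "finite F" "F \<noteq> {}" "F \<subseteq> D" "hausdorff_dist K (convex hull F) \<le> q"
          using hausdorff_dist_dense[OF Kb D(2) q(2)] by blast
        have F\<F>: "F \<in> \<F>" using F by (simp add: \<F>_def)
        have "B F q \<subseteq> U"
        proof
          fix K' assume "K' \<in> B F q"
          then have K': "K' \<in> convex_bodies" "hausdorff_dist K' (convex hull F) \<le> q" by (auto simp: B_def)
          have "hausdorff_dist K K' \<le> hausdorff_dist K (convex hull F) + hausdorff_dist (convex hull F) K'"
            by (rule ms.triangle[OF Kb H[OF F\<F>] K'(1)])
          also have "\<dots> < e" using F(4) K'(2) q(3) by (simp add: hausdorff_dist_commute[of "convex hull F"])
          finally have "K' \<in> ms.mball K e" using Kb K'(1) by simp
          then show "K' \<in> U" using e(2) by blast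
        qed
        then have "(F, q) \<in> ?I" using F\<F> q(1) by simp
        moreover have "K \<in> B F q" using Kb F(4) by (simp add: B_def)
        ultimately show "K \<in> (\<Union>(F, q)\<in>?I. B F q)" by blast
      qed
    qed auto
    have preU: "\<psi> -` U \<inter> space N = (\<Union>(F, q)\<in>?I. \<psi> -` B F q \<inter> space N)"
      by (rule trans[OF arg_cong[OF U_eq, of "\<lambda>U. \<psi> -` U \<inter> space N"]]) blast
    have "(\<Union>(F, q)\<in>?I. \<psi> -` B F q \<inter> space N) \<in> sets N"
    proof (rule sets.countable_UN')
      have "countable (\<F> \<times> \<rat>)" using c\<F> countable_rat by (rule countable_SIGMA)
      then show "countable ?I" by (rule countable_subset[rotated]) auto
      show "(\<lambda>(F, q). \<psi> -` B F q \<inter> space N) ` ?I \<subseteq> sets N"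
        using pre by auto
    qed
    then show "\<psi> -` U \<inter> space N \<in> sets N" by (rule ssubst[OF preU, of "\<lambda>W. W \<in> sets N"])
  qed
qed

section \<open>Measurable dependence of projections on the normal vectors\<close>

lemma orth_proj_orth_fam_witness:
  assumes "finite I"
  shows "\<exists>b. orth_proj (orth_fam I u) x = x - (\<Sum>i\<in>I. b i *\<^sub>R u i)"
proof -
  let ?L = "orth_fam I u"
  have "orth_proj ?L (x - orth_proj ?L x) = 0"
    by (simp add: orth_proj_diff[OF subspace_orth_fam] orth_proj_self[OF subspace_orth_fam orth_proj_in[OF subspace_orth_fam]])
  then have "x - orth_proj ?L x \<in> span (u ` I)" by (simp only: orth_proj_orth_fam_eq_0_iff)
  then obtain b where "x - orth_proj ?L x = (\<Sum>i\<in>I. b i *\<^sub>R u i)"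
    using span_image_sum[OF assms] by blast
  then show ?thesis by (intro exI[of _ b]) (simp add: algebra_simps)
qed

text \<open>The norm of the projection is the distance from x to the span of the \<open>u i\<close>,
  and rational coefficients approximate this distance. The condition becomes countable, also for
  dependent vectors.\<close>

lemma norm_orth_proj_less_iff:
  fixes u :: "nat \<Rightarrow> 'a::euclidean_space"
  assumes fin: "finite I"
  shows "norm (orth_proj (orth_fam I u) x) < c \<longleftrightarrow> (\<exists>b\<in>I \<rightarrow>\<^sub>E \<rat>. norm (x - (\<Sum>i\<in>I. b i *\<^sub>R u i)) < c)"
proof
  let ?L = "orth_fam I u"
  assume lt: "norm (orth_proj ?L x) < c"
  obtain b where b: "orth_proj ?L x = x - (\<Sum>i\<in>I. b i *\<^sub>R u i)"
    using orth_proj_orth_fam_witness[OF fin] by blast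
  define U where "U = 1 + (\<Sum>i\<in>I. norm (u i))"
  have U: "0 < U" unfolding U_def by (intro add_pos_nonneg sum_nonneg) auto
  define \<delta> where "\<delta> = (c - norm (orth_proj ?L x)) / U"
  have \<delta>: "0 < \<delta>" using lt U by (simp add: \<delta>_def)
  have "\<forall>i. \<exists>q\<in>\<rat>. b i < q \<and> q < b i + \<delta>"
    using Rats_dense_in_real \<delta> by (metis less_add_same_cancel1)
  then obtain q where q: "\<And>i. q i \<in> \<rat>" "\<And>i. b i < q i" "\<And>i. q i < b i + \<delta>" by metis
  have "norm (x - (\<Sum>i\<in>I. q i *\<^sub>R u i)) = norm (orth_proj ?L x - (\<Sum>i\<in>I. (q i - b i) *\<^sub>R u i))"
    unfolding b by (simp add: scaleR_diff_left sum_subtractf)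
  also have "\<dots> \<le> norm (orth_proj ?L x) + norm (\<Sum>i\<in>I. (q i - b i) *\<^sub>R u i)" by (rule norm_triangle_ineq4)
  also have "norm (\<Sum>i\<in>I. (q i - b i) *\<^sub>R u i) \<le> (\<Sum>i\<in>I. \<delta> * norm (u i))"
  proof (rule sum_norm_le)
    fix i assume "i \<in> I"
    have "\<bar>q i - b i\<bar> \<le> \<delta>" using q(2,3)[of i] by simp
    then show "norm ((q i - b i) *\<^sub>R u i) \<le> \<delta> * norm (u i)"
      by (simp add: mult_right_mono)
  qed
  also have "\<dots> = \<delta> * (\<Sum>i\<in>I. norm (u i))" by (simp only: sum_distrib_left)
  also have "\<dots> < \<delta> * U" using \<delta> by (simp add: U_def)
  also have "\<delta> * U = c - norm (orth_proj ?L x)" using U by (simp add: \<delta>_def)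
  finally have "norm (x - (\<Sum>i\<in>I. q i *\<^sub>R u i)) < c" by simp
  moreover have "(\<Sum>i\<in>I. restrict q I i *\<^sub>R u i) = (\<Sum>i\<in>I. q i *\<^sub>R u i)" by (intro sum.cong) auto
  ultimately show "\<exists>b\<in>I \<rightarrow>\<^sub>E \<rat>. norm (x - (\<Sum>i\<in>I. b i *\<^sub>R u i)) < c"
    using q(1) by (intro bexI[of _ "restrict q I"]) auto
next
  let ?L = "orth_fam I u"
  assume "\<exists>b\<in>I \<rightarrow>\<^sub>E \<rat>. norm (x - (\<Sum>i\<in>I. b i *\<^sub>R u i)) < c"
  then obtain b where b: "norm (x - (\<Sum>i\<in>I. b i *\<^sub>R u i)) < c" by blast
  have "(\<Sum>i\<in>I. b i *\<^sub>R u i) \<in> span (u ` I)" by (intro span_sum span_scale span_base) auto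
  then have "orth_proj ?L (\<Sum>i\<in>I. b i *\<^sub>R u i) = 0" by (simp only: orth_proj_orth_fam_eq_0_iff)
  then have "orth_proj ?L x = orth_proj ?L (x - (\<Sum>i\<in>I. b i *\<^sub>R u i))"
    by (simp only: orth_proj_diff[OF subspace_orth_fam] diff_zero)
  then have "norm (orth_proj ?L x) \<le> norm (x - (\<Sum>i\<in>I. b i *\<^sub>R u i))"
    using norm_orth_proj_le[OF subspace_orth_fam, of I u "x - (\<Sum>i\<in>I. b i *\<^sub>R u i)"] by (simp only:)
  then show "norm (orth_proj ?L x) < c" using b by linarith
qed

lemma measurable_norm_orth_proj:
  fixes u :: "'x \<Rightarrow> nat \<Rightarrow> 'a::euclidean_space"
  assumes fin: "finite I" and u: "\<And>i. i \<in> I \<Longrightarrow> (\<lambda>x. u x i) \<in> borel_measurable N" and f: "f \<in> borel_measurable N"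
  shows "(\<lambda>x. norm (orth_proj (orth_fam I (u x)) (f x))) \<in> borel_measurable N"
proof (subst borel_measurable_iff_less, rule allI)
  fix c
  have cnt: "countable (I \<rightarrow>\<^sub>E (\<rat> :: real set))" using fin countable_rat by (intro countable_PiE) auto
  have "{x \<in> space N. norm (f x - (\<Sum>i\<in>I. b i *\<^sub>R u x i)) < c} \<in> sets N" for b :: "nat \<Rightarrow> real"
  using u f by simp
  then have "(\<Union>b\<in>I \<rightarrow>\<^sub>E \<rat>. {x \<in> space N. norm (f x - (\<Sum>i\<in>I. b i *\<^sub>R u x i)) < c}) \<in> sets N"
    using cnt by (intro sets.countable_UN') auto
  also have "(\<Union>b\<in>I \<rightarrow>\<^sub>E \<rat>. {x \<in> space N. norm (f x - (\<Sum>i\<in>I. b i *\<^sub>R u x i)) < c}) =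
      {x \<in> space N. norm (orth_proj (orth_fam I (u x)) (f x)) < c}"
    unfolding norm_orth_proj_less_iff[OF fin] by blast
  finally show "{x \<in> space N. norm (orth_proj (orth_fam I (u x)) (f x)) < c} \<in> sets N" .
qed

lemma measurable_orth_proj:
  fixes u :: "'x \<Rightarrow> nat \<Rightarrow> 'a::euclidean_space"
  assumes fin: "finite I" and u: "\<And>i. i \<in> I \<Longrightarrow> (\<lambda>x. u x i) \<in> borel_measurable N" and f: "f \<in> borel_measurable N"
  shows "(\<lambda>x. orth_proj (orth_fam I (u x)) (f x)) \<in> borel_measurable N"
proof (rule borel_measurable_euclidean_space[THEN iffD2], rule ballI)
  fix b :: 'a
  let ?P = "\<lambda>x. orth_proj (orth_fam I (u x))"
  \<comment> \<open>Polarization: the projection is symmetric and idempotent, so its coordinates are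
    recovered from norms of projections.\<close>
  have e: "inner (?P x (f x)) b = ((norm (?P x (f x + b)))\<^sup>2 - (norm (?P x (f x - b)))\<^sup>2) / 4" for x
  by (simp add: inner_commute inner_orth_proj orth_proj_in subspace_orth_fam orth_proj_add orth_proj_diff power2_norm_eq_inner inner_add_right inner_diff_right)
  have "(\<lambda>x. ((norm (?P x (f x + b)))\<^sup>2 - (norm (?P x (f x - b)))\<^sup>2) / 4) \<in> borel_measurable N"
  proof -
    note [measurable] = f
    have [measurable]: "(\<lambda>x. norm (?P x (f x + b))) \<in> borel_measurable N"
      by (intro measurable_norm_orth_proj[OF fin u]) measurable
    have [measurable]: "(\<lambda>x. norm (?P x (f x - b))) \<in> borel_measurable N"
      by (intro measurable_norm_orth_proj[OF fin u]) measurable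
    show ?thesis by measurable
  qed
  then show "(\<lambda>x. inner (?P x (f x)) b) \<in> borel_measurable N" by (simp only: e)
qed

lemma indep_fam_iff_span:
  assumes "finite I"
  shows "indep_fam I u \<longleftrightarrow> (\<forall>j\<in>I. u j \<notin> span (u ` (I - {j})))"
proof
  assume i: "indep_fam I u"
  show "\<forall>j\<in>I. u j \<notin> span (u ` (I - {j}))"
  proof (rule ballI, rule notI)
    fix j assume j: "j \<in> I" and sp: "u j \<in> span (u ` (I - {j}))"
    obtain b where b: "u j = (\<Sum>i\<in>I - {j}. b i *\<^sub>R u i)"
      using span_image_sum[OF _ sp] assms by blast
    let ?c = "\<lambda>i. if i = j then - 1 else b i"
    have "(\<Sum>i\<in>I. ?c i *\<^sub>R u i) = ?c j *\<^sub>R u j + (\<Sum>i\<in>I - {j}. ?c i *\<^sub>R u i)"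
      using assms j by (rule sum.remove)
    also have "(\<Sum>i\<in>I - {j}. ?c i *\<^sub>R u i) = (\<Sum>i\<in>I - {j}. b i *\<^sub>R u i)" by (intro sum.cong) auto
    also have "\<dots> = u j" by (rule b[symmetric])
    finally have "(\<Sum>i\<in>I. ?c i *\<^sub>R u i) = 0" by simp
    then have "\<forall>i\<in>I. ?c i = 0" using i unfolding indep_fam_def by (elim allE[of _ ?c]) simp
    then have "?c j = 0" using j by (rule bspec)
    then show False by simp
  qed
next
  assume a: "\<forall>j\<in>I. u j \<notin> span (u ` (I - {j}))"
  show "indep_fam I u"
    unfolding indep_fam_def
  proof (intro allI impI ballI, rule ccontr)
    fix c j assume c: "(\<Sum>i\<in>I. c i *\<^sub>R u i) = 0" and j: "j \<in> I" and nz: "c j \<noteq> 0"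
    have "c j *\<^sub>R u j + (\<Sum>i\<in>I - {j}. c i *\<^sub>R u i) = 0"
      using sum.remove[OF assms j, of "\<lambda>i. c i *\<^sub>R u i"] c by simp
    then have "c j *\<^sub>R u j = - (\<Sum>i\<in>I - {j}. c i *\<^sub>R u i)" by (rule eq_neg_iff_add_eq_0[THEN iffD2])
    also have "\<dots> \<in> span (u ` (I - {j}))" by (intro span_neg span_sum span_scale span_base) auto
    finally have "(1 / c j) *\<^sub>R (c j *\<^sub>R u j) \<in> span (u ` (I - {j}))" by (rule span_scale)
    then show False using a j nz by simp
  qed
qed

lemma sets_indep_fam:
  fixes u :: "'x \<Rightarrow> nat \<Rightarrow> 'a::euclidean_space"
  assumes fin: "finite I" and u: "\<And>i. i \<in> I \<Longrightarrow> (\<lambda>x. u x i) \<in> borel_measurable N"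
  shows "{x \<in> space N. indep_fam I (u x)} \<in> sets N"
proof -
  have "{x \<in> space N. norm (orth_proj (orth_fam (I - {j}) (u x)) (u x j)) \<noteq> 0} \<in> sets N" if "j \<in> I" for j
  proof -
    have [measurable]: "(\<lambda>x. norm (orth_proj (orth_fam (I - {j}) (u x)) (u x j))) \<in> borel_measurable N"
      using fin u that by (intro measurable_norm_orth_proj) auto
    show ?thesis by measurable
  qed
  then have "{x \<in> space N. \<forall>j\<in>I. norm (orth_proj (orth_fam (I - {j}) (u x)) (u x j)) \<noteq> 0} \<in> sets N"
    by (intro sets.sets_Collect_finite_All fin)
  then show ?thesis
    unfolding indep_fam_iff_span[OF fin] orth_proj_orth_fam_eq_0_iff[symmetric] by simp
qed

text \<open>The positive spanning condition is a sign condition on the coefficients of \<open>u (k + 1)\<close>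
  in the basis formed by the other vectors.\<close>

lemma pos_dependency_iff:
  fixes u :: "nat \<Rightarrow> 'a::euclidean_space"
  assumes k: "k \<in> {1..DIM('a)}" and gp: "general_position u"
  shows "(\<exists>a. (\<forall>j\<in>{1..k + 1}. 0 < a j) \<and> (\<Sum>j = 1..k + 1. a j *\<^sub>R orth_proj (L_space k u) (u j)) = 0) \<longleftrightarrow>
    (\<forall>j\<in>{1..k}. inner (u (k + 1)) (orth_proj (orth_fam ({1..DIM('a) + 1} - {j, k + 1}) u) (u j)) < 0)"
proof -
  let ?N = "{1..DIM('a) + 1}" and ?L = "L_space k u" and ?N2 = "{k + 2..DIM('a) + 1}"
  \<comment> \<open>The vector \<open>?q j\<close> is orthogonal to all \<open>u i\<close> except
    possibly \<open>u j\<close> and \<open>u (k + 1)\<close>. Pairing a relation with it isolates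
    the coefficient of \<open>u j\<close> against that of \<open>u (k + 1)\<close>.\<close>
  let ?q = "\<lambda>j. orth_proj (orth_fam (?N - {j, k + 1}) u) (u j)"
  have ind: "indep_fam (?N - {k + 1}) u"
    using k by (intro general_position_indep_fam[OF gp]) auto
  have q_orth: "inner (u i) (?q j) = 0" if "i \<in> ?N" "i \<noteq> j" "i \<noteq> k + 1" for i j
    using orth_proj_in[OF subspace_orth_fam, of "?N - {j, k + 1}" u "u j"] that by (auto simp: orth_fam_def)
  have q_self: "inner (u j) (?q j) = norm (?q j) ^ 2" for j
    by (rule inner_orth_proj_self[OF subspace_orth_fam])
  have q_pos: "0 < norm (?q j) ^ 2" if j: "j \<in> {1..k}" for j
  proof -
    have "u j \<notin> span (u ` (?N - {k + 1} - {j}))"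
      using ind j k unfolding indep_fam_iff_span[OF finite_Diff[OF finite_atLeastAtMost]] by auto
    moreover have "?N - {k + 1} - {j} = ?N - {j, k + 1}" by auto
    ultimately have "?q j \<noteq> 0" by (simp only: orth_proj_orth_fam_eq_0_iff not_False_eq_True)
    then show ?thesis by simp
  qed
  show ?thesis
  proof
    assume "\<exists>a. (\<forall>j\<in>{1..k + 1}. 0 < a j) \<and> (\<Sum>j = 1..k + 1. a j *\<^sub>R orth_proj ?L (u j)) = 0"
    then obtain a where a: "\<forall>j\<in>{1..k + 1}. 0 < a j" "(\<Sum>j = 1..k + 1. a j *\<^sub>R orth_proj ?L (u j)) = 0" by blast
    have "orth_proj ?L (\<Sum>j = 1..k + 1. a j *\<^sub>R u j) = 0"
      unfolding orth_proj_sum[OF subspace_L_space] orth_proj_scaleR[OF subspace_L_space] by (rule a(2))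
    then have "(\<Sum>j = 1..k + 1. a j *\<^sub>R u j) \<in> span (u ` ?N2)"
      unfolding L_space_eq by (simp only: orth_proj_orth_fam_eq_0_iff)
    then obtain b where b: "(\<Sum>j = 1..k + 1. a j *\<^sub>R u j) = (\<Sum>i\<in>?N2. b i *\<^sub>R u i)"
      using span_image_sum[of ?N2] by blast
    show "\<forall>j\<in>{1..k}. inner (u (k + 1)) (?q j) < 0"
    proof
      fix j assume j: "j \<in> {1..k}"
      have "inner (\<Sum>i\<in>?N2. b i *\<^sub>R u i) (?q j) = (\<Sum>i\<in>?N2. b i * inner (u i) (?q j))"
        by (simp only: inner_sum_left inner_scaleR_left)
      also have "\<dots> = 0" using q_orth[of _ j] j by (intro sum.neutral) auto
      finally have "0 = inner (\<Sum>i = 1..k + 1. a i *\<^sub>R u i) (?q j)" by (simp only: b)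
      also have "\<dots> = (\<Sum>i = 1..k + 1. a i * inner (u i) (?q j))"
        by (simp only: inner_sum_left inner_scaleR_left)
      also have "\<dots> = (\<Sum>i = 1..k. a i * inner (u i) (?q j)) + a (k + 1) * inner (u (k + 1)) (?q j)" by simp
      also have "(\<Sum>i = 1..k. a i * inner (u i) (?q j)) = (\<Sum>i\<in>{1..k}. if i = j then a j * norm (?q j) ^ 2 else 0)"
        using q_orth[of _ j] q_self[of j] k by (intro sum.cong) auto
      also have "\<dots> = a j * norm (?q j) ^ 2" using j by simp
      finally have e: "a (k + 1) * inner (u (k + 1)) (?q j) = - (a j * norm (?q j) ^ 2)" by linarith
      have "0 < a j * norm (?q j) ^ 2" using a(1) j q_pos[OF j] by (intro mult_pos_pos) auto
      then have "a (k + 1) * inner (u (k + 1)) (?q j) < 0" using e by linarith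
      moreover have "0 < a (k + 1)" using a(1) by simp
      ultimately show "inner (u (k + 1)) (?q j) < 0" by (simp add: mult_less_0_iff)
    qed
  next
    assume neg: "\<forall>j\<in>{1..k}. inner (u (k + 1)) (?q j) < 0"
    have "independent (u ` (?N - {k + 1}))" "card (u ` (?N - {k + 1})) = DIM('a)"
      using ind k indep_fam_iff[of "?N - {k + 1}" u] by (auto simp: card_image)
    then have "UNIV \<subseteq> span (u ` (?N - {k + 1}))"
      by (intro card_ge_dim_independent) auto
    then obtain b where b: "u (k + 1) = (\<Sum>i\<in>?N - {k + 1}. b i *\<^sub>R u i)"
      using span_image_sum[of "?N - {k + 1}" "u (k + 1)" u] by blast
    have bneg: "b j < 0" if j: "j \<in> {1..k}" for j
    proof -
      have "inner (u (k + 1)) (?q j) = (\<Sum>i\<in>?N - {k + 1}. b i * inner (u i) (?q j))"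
        by (subst b) (simp only: inner_sum_left inner_scaleR_left)
      also have "\<dots> = (\<Sum>i\<in>?N - {k + 1}. if i = j then b j * norm (?q j) ^ 2 else 0)"
        using q_orth[of _ j] q_self[of j] by (intro sum.cong) auto
      also have "\<dots> = b j * norm (?q j) ^ 2" using j k by simp
      finally have "inner (u (k + 1)) (?q j) = b j * norm (?q j) ^ 2" .
      then have "b j * norm (?q j) ^ 2 < 0" using bspec[OF neg j] by linarith
      then show ?thesis using q_pos[OF j] by (simp add: mult_less_0_iff)
    qed
    let ?a = "\<lambda>j. if j = k + 1 then 1 else - b j"
    have "(\<Sum>j = 1..k + 1. ?a j *\<^sub>R orth_proj ?L (u j)) = orth_proj ?L (\<Sum>j = 1..k + 1. ?a j *\<^sub>R u j)"
      by (simp only: orth_proj_sum[OF subspace_L_space] orth_proj_scaleR[OF subspace_L_space])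
    also have "(\<Sum>j = 1..k + 1. ?a j *\<^sub>R u j) = (\<Sum>j = 1..k. ?a j *\<^sub>R u j) + u (k + 1)" by simp
    also have "(\<Sum>j = 1..k. ?a j *\<^sub>R u j) = - (\<Sum>j = 1..k. b j *\<^sub>R u j)"
      unfolding sum_negf[symmetric] by (intro sum.cong) auto
    also have "- (\<Sum>j = 1..k. b j *\<^sub>R u j) + u (k + 1) = (\<Sum>i\<in>?N2. b i *\<^sub>R u i)"
    proof -
      have "?N - {k + 1} = {1..k} \<union> ?N2" using k by auto
      then have "u (k + 1) = (\<Sum>j\<in>{1..k} \<union> ?N2. b j *\<^sub>R u j)" using b by simp
      also have "\<dots> = (\<Sum>j = 1..k. b j *\<^sub>R u j) + (\<Sum>i\<in>?N2. b i *\<^sub>R u i)"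
        by (rule sum.union_disjoint) auto
      finally show ?thesis by simp
    qed
    also have "orth_proj ?L (\<Sum>i\<in>?N2. b i *\<^sub>R u i) = 0"
    proof -
      have "(\<Sum>i\<in>?N2. b i *\<^sub>R u i) \<in> span (u ` ?N2)" by (intro span_sum span_scale span_base) auto
      then show ?thesis unfolding L_space_eq by (simp only: orth_proj_orth_fam_eq_0_iff)
    qed
    finally have "(\<Sum>j = 1..k + 1. ?a j *\<^sub>R orth_proj ?L (u j)) = 0" .
    moreover have "\<forall>j\<in>{1..k + 1}. 0 < ?a j" using bneg by auto
    ultimately show "\<exists>a. (\<forall>j\<in>{1..k + 1}. 0 < a j) \<and> (\<Sum>j = 1..k + 1. a j *\<^sub>R orth_proj ?L (u j)) = 0"
      by (intro exI[of _ ?a] conjI)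
  qed
qed

lemma sets_P_set:
  fixes u :: "'x \<Rightarrow> nat \<Rightarrow> 'a::euclidean_space"
  assumes k: "k \<in> {1..DIM('a)}" and u: "\<And>i. i \<in> {1..DIM('a) + 1} \<Longrightarrow> (\<lambda>x. u x i) \<in> borel_measurable N"
    and ext: "\<And>x. x \<in> space N \<Longrightarrow> u x \<in> extensional {1..DIM('a) + 1}"
  shows "{x \<in> space N. u x \<in> P_set k} \<in> sets N"
proof -
  let ?N = "{1..DIM('a) + 1}"
  let ?neg = "\<lambda>u j. inner (u (k + 1)) (orth_proj (orth_fam (?N - {j, k + 1}) u) (u j)) < 0"
  have 1: "{x \<in> space N. \<forall>i\<in>?N. norm (u x i) = 1} \<in> sets N"
  using u by simp
  have 2: "{x \<in> space N. \<forall>I\<in>{I \<in> Pow ?N. card I = DIM('a)}. indep_fam I (u x)} \<in> sets N"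
  proof (rule sets.sets_Collect_finite_All')
    fix I assume I: "I \<in> {I \<in> Pow ?N. card I = DIM('a)}"
    then have "finite I" by (intro finite_subset[of I ?N]) (auto simp del: atLeastAtMost_iff)
    then show "{x \<in> space N. indep_fam I (u x)} \<in> sets N"
      using u I by (intro sets_indep_fam) auto
  qed (use k in \<open>auto intro!: exI[of _ "{1..DIM('a)}"]\<close>)
  have 3: "{x \<in> space N. \<forall>j\<in>{1..k}. ?neg (u x) j} \<in> sets N"
  proof (rule sets.sets_Collect_finite_All')
    fix j assume j: "j \<in> {1..k}"
    have [measurable]: "(\<lambda>x. orth_proj (orth_fam (?N - {j, k + 1}) (u x)) (u x j)) \<in> borel_measurable N"
      using u j k by (intro measurable_orth_proj) auto
    have "k + 1 \<in> ?N" using k by simp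
    note [measurable] = u[OF this]
    show "{x \<in> space N. ?neg (u x) j} \<in> sets N" by measurable
  qed (use k in auto)
  have "{x \<in> space N. u x \<in> P_set k} = {x \<in> space N. \<forall>i\<in>?N. norm (u x i) = 1} \<inter>
     {x \<in> space N. \<forall>I\<in>{I \<in> Pow ?N. card I = DIM('a)}. indep_fam I (u x)} \<inter> {x \<in> space N. \<forall>j\<in>{1..k}. ?neg (u x) j}"
  proof (rule Set.set_eqI)
    fix x
    have "u x \<in> P_set k \<longleftrightarrow> (\<forall>i\<in>?N. norm (u x i) = 1) \<and> general_position (u x) \<and> (\<forall>j\<in>{1..k}. ?neg (u x) j)"
      if x: "x \<in> space N"
    proof -
      have "u x \<in> ?N \<rightarrow>\<^sub>E sphere 0 1 \<longleftrightarrow> (\<forall>i\<in>?N. norm (u x i) = 1)"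
        using ext[OF x] by (simp add: PiE_iff del: atLeastAtMost_iff)
      then show ?thesis unfolding P_set_iff[OF k] using pos_dependency_iff[OF k, of "u x"] by blast
    qed
    moreover have "general_position (u x) \<longleftrightarrow> (\<forall>I\<in>{I \<in> Pow ?N. card I = DIM('a)}. indep_fam I (u x))"
      unfolding general_position_iff by blast
    ultimately show "x \<in> {x \<in> space N. u x \<in> P_set k} \<longleftrightarrow> x \<in> {x \<in> space N. \<forall>i\<in>?N. norm (u x i) = 1} \<inter>
     {x \<in> space N. \<forall>I\<in>{I \<in> Pow ?N. card I = DIM('a)}. indep_fam I (u x)} \<inter> {x \<in> space N. \<forall>j\<in>{1..k}. ?neg (u x) j}"
      by blast
  qed
  then show ?thesis using 1 2 3 by simp
qed

lemma measurable_mrad: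
  fixes u :: "'x \<Rightarrow> nat \<Rightarrow> 'a::euclidean_space"
  assumes u: "\<And>i. i \<in> {1..DIM('a) + 1} \<Longrightarrow> (\<lambda>x. u x i) \<in> borel_measurable N" and i: "i \<in> {1..DIM('a) + 1}"
  shows "(\<lambda>x. mrad k (u x) i) \<in> borel_measurable N"
proof (cases "i \<le> k + 1")
  case True
  have "(\<lambda>x. norm (orth_proj (L_space k (u x)) (u x i))) \<in> borel_measurable N"
    unfolding L_space_eq using u i by (intro measurable_norm_orth_proj) auto
  then show ?thesis using True by (simp add: mrad_def)
qed (simp add: mrad_def)

section \<open>Center and radius of the ball inscribed by a tuple\<close>

definition tuple_solution :: "nat \<Rightarrow> (nat \<Rightarrow> 'a::euclidean_space \<times> real) \<Rightarrow> nat \<Rightarrow> real" where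
  "tuple_solution k p = cramer_solve (DIM('a) + 1) (center_radius_mat (normals p) (mrad k (normals p))) (\<lambda>i. snd (p (i + 1)))"

definition tuple_center :: "nat \<Rightarrow> (nat \<Rightarrow> 'a::euclidean_space \<times> real) \<Rightarrow> 'a" where
  "tuple_center k p = (\<Sum>j<DIM('a). tuple_solution k p j *\<^sub>R from_nat_into Basis j)"

definition tuple_radius :: "nat \<Rightarrow> (nat \<Rightarrow> 'a::euclidean_space \<times> real) \<Rightarrow> real" where
  "tuple_radius k p = tuple_solution k p DIM('a)"

lemma sum_from_nat_into_Basis: "(\<Sum>j<DIM('a). f (from_nat_into Basis j)) = (\<Sum>b\<in>Basis. f b)"
  for f :: "'a::euclidean_space \<Rightarrow> 'b::comm_monoid_add"
  using sum.reindex_bij_betw[OF bij_betw_from_nat_into_finite[OF finite_Basis], of f] by simp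

lemma tuple_center_radius_eq:
  fixes p :: "nat \<Rightarrow> 'a::euclidean_space \<times> real"
  assumes k: "k \<in> {1..DIM('a)}" and u: "normals p \<in> P_set k"
    and tb: "tuple_ball k (normals p) (\<lambda>i. snd (p i)) z r"
  shows "tuple_center k p = z" "tuple_radius k p = r"
proof -
  let ?A = "center_radius_mat (normals p) (mrad k (normals p))" and ?n = "DIM('a) + 1"
  define x where "x j = (if j < DIM('a) then inner z (from_nat_into Basis j) else r)" for j
  have row: "snd (p (i + 1)) = (\<Sum>j<?n. ?A $$ (i, j) * x j)" if i: "i < ?n" for i
  proof -
    have "(\<Sum>j<?n. ?A $$ (i, j) * x j) = (\<Sum>j<DIM('a). ?A $$ (i, j) * x j) + ?A $$ (i, DIM('a)) * x DIM('a)" by simp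
    also have "?A $$ (i, DIM('a)) * x DIM('a) = r * mrad k (normals p) (i + 1)"
      using i by (simp add: center_radius_mat_def x_def)
    also have "(\<Sum>j<DIM('a). ?A $$ (i, j) * x j) =
        (\<Sum>j<DIM('a). inner (normals p (i + 1)) (from_nat_into Basis j) * inner z (from_nat_into Basis j))"
      using i by (intro sum.cong refl) (simp add: center_radius_mat_def x_def)
    also have "\<dots> = inner (normals p (i + 1)) z"
      unfolding sum_from_nat_into_Basis[of "\<lambda>b. inner (normals p (i + 1)) b * inner z b"]
      by (rule euclidean_inner[symmetric])
    also have "inner (normals p (i + 1)) z + r * mrad k (normals p) (i + 1) = snd (p (i + 1))"
      using tb i unfolding tuple_ball_def by (elim ballE[of _ _ "i + 1"]) auto
    finally show ?thesis by (rule sym)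
  qed
  have sol: "tuple_solution k p j = x j" if "j < ?n" for j
  proof -
    have "tuple_solution k p j = cramer_solve ?n ?A (\<lambda>i. \<Sum>j<?n. ?A $$ (i, j) * x j) j"
      unfolding tuple_solution_def cramer_solve_def by (intro arg_cong2[where f="(/)"] sum.cong refl) (simp only: lessThan_iff row)
    also have "\<dots> = x j"
      by (rule cramer_solve[OF center_radius_mat_carrier det_center_radius_neq_0[OF k u] that])
    finally show ?thesis .
  qed
  have "tuple_center k p = (\<Sum>j<DIM('a). inner z (from_nat_into Basis j) *\<^sub>R from_nat_into Basis j)"
    unfolding tuple_center_def by (intro sum.cong refl) (simp add: sol x_def)
  also have "\<dots> = z"
    unfolding sum_from_nat_into_Basis[of "\<lambda>b. inner z b *\<^sub>R b"] by (rule euclidean_representation)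
  finally show "tuple_center k p = z" .
  show "tuple_radius k p = r" unfolding tuple_radius_def by (simp add: sol x_def)
qed

context
  fixes p :: "'x \<Rightarrow> nat \<Rightarrow> 'a::euclidean_space \<times> real" and N :: "'x measure"
  assumes p: "\<And>i. i \<in> {1..DIM('a) + 1} \<Longrightarrow> (\<lambda>x. p x i) \<in> borel_measurable N"
begin

lemma measurable_normals: "i \<in> {1..DIM('a) + 1} \<Longrightarrow> (\<lambda>x. normals (p x) i) \<in> borel_measurable N"
  unfolding normals_apply by (rule measurable_compose[OF p measurable_fst_borel])

lemma measurable_tuple_solution:
  assumes "j < DIM('a) + 1"
  shows "(\<lambda>x. tuple_solution k (p x) j) \<in> borel_measurable N"
  unfolding tuple_solution_def center_radius_mat_def
proof (rule measurable_cramer_solve[OF _ _ assms])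
  fix i j assume i: "i < DIM('a) + 1"
  then have i': "i + 1 \<in> {1..DIM('a) + 1}" by simp
  note [measurable] = measurable_normals[OF i'] measurable_mrad[OF measurable_normals i', where k=k]
  show "(\<lambda>x. if j < DIM('a) then inner (normals (p x) (i + 1)) (from_nat_into Basis j)
      else mrad k (normals (p x)) (i + 1)) \<in> borel_measurable N"
    by measurable
next
  fix i assume i: "i < DIM('a) + 1"
  then have i': "i + 1 \<in> {1..DIM('a) + 1}" by simp
  show "(\<lambda>x. snd (p x (i + 1))) \<in> borel_measurable N"
    by (rule measurable_compose[OF p[OF i'] measurable_snd_borel])
qed

lemma measurable_tuple_radius: "(\<lambda>x. tuple_radius k (p x)) \<in> borel_measurable N"
  unfolding tuple_radius_def by (rule measurable_tuple_solution) simp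

lemma measurable_tuple_center: "(\<lambda>x. tuple_center k (p x)) \<in> borel_measurable N"
  unfolding tuple_center_def
  by (intro borel_measurable_sum borel_measurable_scaleR borel_measurable_const measurable_tuple_solution) simp

lemma sets_tuple_ball: "{x \<in> space N. tuple_ball k (normals (p x)) (\<lambda>i. snd (p x i)) (tuple_center k (p x)) (tuple_radius k (p x))} \<in> sets N"
  unfolding tuple_ball_def
proof (rule sets.sets_Collect_finite_All)
  fix i assume i: "i \<in> {1..DIM('a) + 1}"
  note [measurable] = measurable_normals[OF i] measurable_mrad[OF measurable_normals i, where k=k]
    measurable_tuple_radius[of k] measurable_tuple_center[of k] measurable_compose[OF p[OF i] measurable_snd_borel]
  show "{x \<in> space N. inner (normals (p x) i) (tuple_center k (p x)) + tuple_radius k (p x) * mrad k (normals (p x)) i =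
      snd (p x i)} \<in> sets N"
    by measurable
qed simp

lemma sets_normals_P_set: "k \<in> {1..DIM('a)} \<Longrightarrow> {x \<in> space N. normals (p x) \<in> P_set k} \<in> sets N"
  by (rule sets_P_set) (assumption, erule measurable_normals, simp add: normals_def)

end

section \<open>Translations\<close>

definition shift :: "'a::euclidean_space \<Rightarrow> 'a set set \<Rightarrow> 'a set set" where
  "shift z S = (\<lambda>H. (+) z ` H) ` S"

lemma in_shift_iff: "y \<in> (+) z ` H \<longleftrightarrow> y - z \<in> H" for y z :: "'a::euclidean_space"
proof
  assume "y - z \<in> H"
  then have "z + (y - z) \<in> (+) z ` H" by (rule imageI)
  then show "y \<in> (+) z ` H" by simp
qed auto

lemma shift_hyp:
  assumes "norm (fst p) = 1"
  shows "(+) z ` hyp p = hyp (fst p, snd p + inner (fst p) z)"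
proof -
  have "(+) z ` hyperplane (fst p) (snd p) = hyperplane (fst p) (snd p + inner (fst p) z)"
  proof (rule Set.set_eqI)
    fix y
    show "y \<in> (+) z ` hyperplane (fst p) (snd p) \<longleftrightarrow> y \<in> hyperplane (fst p) (snd p + inner (fst p) z)"
      unfolding in_shift_iff hyperplane_def mem_Collect_eq inner_diff_left diff_eq_eq
      by (simp only: inner_commute)
  qed
  then show ?thesis using assms by (simp add: hyp_def)
qed

lemma shift_hyperplane:
  assumes H: "H \<in> hyperplanes"
  shows "(+) z ` H \<in> hyperplanes"
  using shift_hyp[OF sec(1)[OF H], of z] hyp_in_hyperplanes by (simp add: sec(2)[OF H])

lemma shift_shift: "(+) (- z) ` (+) z ` H = H" "(+) z ` (+) (- z) ` H = H" for z :: "'a::euclidean_space"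
  by (auto simp: image_image)

text \<open>The signed distances agree up to one sign depending on the representatives, and this
  sign cancels in the product of two values.\<close>

lemma lev_shift:
  assumes H: "H \<in> hyperplanes"
  shows "lev ((+) z ` H) y * lev ((+) z ` H) y' = lev H (y - z) * lev H (y' - z)"
proof -
  let ?q = "(fst (sec H), snd (sec H) + inner (fst (sec H)) z)"
  have n: "norm (fst ?q) = 1" using sec(1)[OF H] by simp
  have e: "hyp ?q = (+) z ` H" using shift_hyp[OF sec(1)[OF H], of z] by (simp add: sec(2)[OF H])
  obtain s where s: "s = 1 \<or> s = - 1" "\<And>y. inner (fst ?q) y - snd ?q = s * lev ((+) z ` H) y"
    using rep_lev[OF n] unfolding e by blast
  have l: "lev H (y - z) = s * lev ((+) z ` H) y" for y
    using s(2)[of y] by (simp add: lev_def nrm_def inner_commute algebra_simps)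
  show ?thesis unfolding l using s(1) by auto
qed

lemma shift_config:
  assumes S: "S \<in> hyperplane_configs"
  shows "shift z S \<in> hyperplane_configs"
  unfolding hyperplane_configs_def
proof (intro CollectI conjI allI impI)
  show "shift z S \<subseteq> hyperplanes"
    using hyperplane_configs_subset[OF S] shift_hyperplane by (auto simp: shift_def)
  fix C :: "'a set" assume C: "compact C"
  have "compact ((+) (- z) ` C)" using C by (rule compact_translation)
  then have fin: "finite (S \<inter> hitting ((+) (- z) ` C))" using S by (simp add: hyperplane_configs_def)
  have "shift z S \<inter> hitting C \<subseteq> (\<lambda>H. (+) z ` H) ` (S \<inter> hitting ((+) (- z) ` C))"
  proof
    fix H' assume "H' \<in> shift z S \<inter> hitting C"
    then obtain H x where H: "H \<in> S" "H' = (+) z ` H" and x: "x \<in> H'" "x \<in> C"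
      by (auto simp: shift_def hitting_def)
    have "x - z \<in> H" using x(1) H(2) by (simp add: in_shift_iff)
    moreover have "x - z \<in> (+) (- z) ` C" using x(2) by (auto simp: image_iff)
    ultimately have "H \<in> hitting ((+) (- z) ` C)"
      using hyperplane_configs_subset[OF S] H(1) by (auto simp: hitting_def)
    then show "H' \<in> (\<lambda>H. (+) z ` H) ` (S \<inter> hitting ((+) (- z) ` C))" using H by blast
  qed
  then show "finite (shift z S \<inter> hitting C)" using fin finite_surj by blast
qed

lemma measurable_shift_hyperplane:
  "(\<lambda>(z, H). (+) z ` H) \<in> (borel :: 'a::euclidean_space measure) \<Otimes>\<^sub>M hyperplane_borel \<rightarrow>\<^sub>M hyperplane_borel"
proof (rule measurable_via_sec)
  let ?b = "SOME b. b \<in> (Basis :: 'a set)"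
  have b: "norm ?b = 1" by (rule norm_Basis) (rule some_in_eq[THEN iffD2, OF nonempty_Basis])
  have eq: "(+) z ` hyp p = hyp (if norm (fst p) = 1 then (fst p, snd p + inner (fst p) z) else (?b, inner ?b z))" for z and p :: "'a \<times> real"
  proof (cases "norm (fst p) = 1")
    case False
    then have "hyp p = hyp (?b, 0)" using b by (simp add: hyp_def)
    then show ?thesis using shift_hyp[of "(?b, 0)" z] b False by simp
  qed (simp add: shift_hyp)
  have "(\<lambda>x::'a \<times> 'a \<times> real. if norm (fst (snd x)) = 1 then (fst (snd x), snd (snd x) + inner (fst (snd x)) (fst x))
      else (?b, inner ?b (fst x))) \<in> borel \<Otimes>\<^sub>M borel \<rightarrow>\<^sub>M borel"
    by measurable
  from measurable_compose[OF this measurable_hyp]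
  show "(\<lambda>(z::'a, p). (+) z ` hyp p) \<in> borel \<Otimes>\<^sub>M borel \<rightarrow>\<^sub>M hyperplane_borel"
    unfolding eq by (simp only: split_beta')
qed

lemma measurable_shift:
  fixes z :: "'x \<Rightarrow> 'a::euclidean_space"
  assumes z: "z \<in> borel_measurable N" and S: "S \<in> N \<rightarrow>\<^sub>M config_space"
  shows "(\<lambda>x. shift (z x) (S x)) \<in> N \<rightarrow>\<^sub>M config_space"
proof (rule measurable_configI)
  show "shift (z x) (S x) \<in> hyperplane_configs" if "x \<in> space N" for x
    by (rule shift_config[OF config_space_spaceD[OF S that]])
next
  fix B :: "'a set set" assume B: "B \<in> sets hyperplane_borel"
  have "(\<lambda>(x, H). (z x, H)) \<in> N \<Otimes>\<^sub>M hyperplane_borel \<rightarrow>\<^sub>M borel \<Otimes>\<^sub>M hyperplane_borel"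
    unfolding split_beta' by (intro measurable_Pair measurable_compose[OF measurable_fst z] measurable_snd)
  from measurable_compose[OF this measurable_shift_hyperplane]
  have m: "(\<lambda>(x, H). (+) (z x) ` H) \<in> N \<Otimes>\<^sub>M hyperplane_borel \<rightarrow>\<^sub>M hyperplane_borel"
    by (simp add: split_beta')
  let ?A = "(\<lambda>(x, H). (+) (z x) ` H) -` B \<inter> space (N \<Otimes>\<^sub>M hyperplane_borel)"
  have "(\<lambda>x. num_in (S x) {H. (x, H) \<in> ?A}) \<in> borel_measurable N"
    by (rule measurable_num_in_section[OF S measurable_sets[OF m B]])
  moreover have "num_in (shift (z x) (S x)) B = num_in (S x) {H. (x, H) \<in> ?A}" if x: "x \<in> space N" for x
  proof -
    have Sx: "S x \<subseteq> hyperplanes" using config_space_spaceD[OF S x] by (rule hyperplane_configs_subset)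
    have inj: "inj_on (\<lambda>H. (+) (z x) ` H) T" for T :: "'a set set"
      by (rule inj_on_inverseI[of _ "\<lambda>H. (+) (- z x) ` H"]) (rule shift_shift)
    have "shift (z x) (S x) \<inter> B = (\<lambda>H. (+) (z x) ` H) ` (S x \<inter> {H. (x, H) \<in> ?A})"
      using Sx x by (auto simp: shift_def space_pair_measure space_hyperplane_borel)
    then show ?thesis
      unfolding num_in_def using inj[of "S x \<inter> {H. (x, H) \<in> ?A}"]
      by (simp add: emeasure_count_space finite_image_iff card_image)
  qed
  ultimately show "(\<lambda>x. num_in (shift (z x) (S x)) B) \<in> borel_measurable N"
    by (simp cong: measurable_cong)
qed

lemma (in hyperplane_process) nn_integral_shift:
  assumes f: "f \<in> borel_measurable config_space"
  shows "(\<integral>\<^sup>+\<omega>. f (shift z (X \<omega>)) \<partial>M) = (\<integral>\<^sup>+\<omega>. f (X \<omega>) \<partial>M)"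
proof -
  have m: "(\<lambda>\<omega>. shift z (X \<omega>)) \<in> M \<rightarrow>\<^sub>M config_space"
    by (rule measurable_shift) (simp_all add: measurable_X)
  have "distr M config_space (\<lambda>\<omega>. shift z (X \<omega>)) = distr M config_space X"
    using stationary unfolding stationary_process_def shift_def by blast
  then show ?thesis
    using nn_integral_distr[OF m, of f] nn_integral_distr[OF measurable_X, of f] f by simp
qed

section \<open>The random body inside a simplex\<close>

definition face_body :: "nat \<Rightarrow> (nat \<Rightarrow> 'a::euclidean_space) \<Rightarrow> real \<Rightarrow> 'a set set \<Rightarrow> 'a set" where
  "face_body k u r S = (\<Inter>H \<in> S - hitting (rel_open_ball (L_space k u) r). halfspace_at H 0) \<inter> (*\<^sub>R) r ` T_simplex k u"

lemma scaled_simplex_eq: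
  fixes u :: "nat \<Rightarrow> 'a::euclidean_space"
  assumes r: "0 < r"
  shows "(*\<^sub>R) r ` T_simplex k u = {w \<in> L_space k u. \<forall>j\<in>{1..k + 1}. inner (u j) w \<le> r * mrad k u j}" (is "?l = ?R")
proof (rule Set.set_eqI)
  fix w
  have "w \<in> ?l \<longleftrightarrow> (1 / r) *\<^sub>R w \<in> T_simplex k u"
  proof
    assume "w \<in> ?l"
    then show "(1 / r) *\<^sub>R w \<in> T_simplex k u" using r by auto
  next
    assume a: "(1 / r) *\<^sub>R w \<in> T_simplex k u"
    have "w = r *\<^sub>R ((1 / r) *\<^sub>R w)" using r by simp
    then show "w \<in> ?l" using a by (rule image_eqI)
  qed
  also have "\<dots> \<longleftrightarrow> (1 / r) *\<^sub>R w \<in> L_space k u \<and> (\<forall>j\<in>{1..k + 1}. inner (u j) ((1 / r) *\<^sub>R w) \<le> mrad k u j)"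
    by (auto simp: T_simplex_def halfspace_def mrad_def inner_commute)
  also have "(1 / r) *\<^sub>R w \<in> L_space k u \<longleftrightarrow> w \<in> L_space k u"
    using r by (simp add: in_L_space_iff)
  also have "(\<forall>j\<in>{1..k + 1}. inner (u j) ((1 / r) *\<^sub>R w) \<le> mrad k u j) \<longleftrightarrow> (\<forall>j\<in>{1..k + 1}. inner (u j) w \<le> r * mrad k u j)"
    using r by (simp add: field_simps)
  finally show "w \<in> ?l \<longleftrightarrow> w \<in> ?R" by simp
qed

text \<open>By Cauchy-Schwarz in L, the level at the origin must be smaller than r times the length
  of the projected normal. The second alternative covers hyperplanes containing L, whose projected
  normal is zero although they hit the ball.\<close>

lemma hitting_rel_open_ball_iff:
  fixes L :: "'a::euclidean_space set"
  assumes L: "subspace L" and r: "0 < r" and H: "H \<in> hyperplanes"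
  shows "H \<in> hitting (rel_open_ball L r) \<longleftrightarrow> \<bar>lev H 0\<bar> < r * norm (orth_proj L (nrm H)) \<or> lev H 0 = 0"
proof -
  let ?v = "orth_proj L (nrm H)"
  have lev: "lev H w = lev H 0 + inner w (nrm H)" for w using lev_add[of H 0 w] by simp
  have self: "inner ?v (nrm H) = (norm ?v)\<^sup>2" using inner_orth_proj_self[OF L, of "nrm H"] by (simp add: inner_commute)
  have "H \<in> hitting (rel_open_ball L r) \<longleftrightarrow> (\<exists>w\<in>L. norm w < r \<and> lev H w = 0)"
    using H unfolding hitting_def rel_open_ball_eq[OF L r] by (auto simp: lev_eq_0_iff)
  also have "\<dots> \<longleftrightarrow> \<bar>lev H 0\<bar> < r * norm ?v \<or> lev H 0 = 0"
  proof
    assume "\<exists>w\<in>L. norm w < r \<and> lev H w = 0"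
    then obtain w where w: "w \<in> L" "norm w < r" "lev H w = 0" by blast
    have "inner w ?v = inner w (nrm H)" using inner_orth_proj[OF L w(1), of "nrm H"] by (simp add: inner_commute)
    then have "\<bar>lev H 0\<bar> = \<bar>inner w ?v\<bar>" using lev[of w] w(3) by linarith
    also have "\<dots> \<le> norm w * norm ?v" by (rule Cauchy_Schwarz_ineq2)
    finally have le: "\<bar>lev H 0\<bar> \<le> norm w * norm ?v" .
    show "\<bar>lev H 0\<bar> < r * norm ?v \<or> lev H 0 = 0"
    proof (cases "?v = 0")
      case True
      then show ?thesis using le by simp
    next
      case False
      then have "norm w * norm ?v < r * norm ?v" using w(2) by (intro mult_strict_right_mono) auto
      then show ?thesis using le by linarith
    qed
  next
    assume a: "\<bar>lev H 0\<bar> < r * norm ?v \<or> lev H 0 = 0"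
    show "\<exists>w\<in>L. norm w < r \<and> lev H w = 0"
    proof (cases "lev H 0 = 0")
      case True
      then show ?thesis using r L by (intro bexI[of _ 0]) (auto simp: subspace_0)
    next
      case False
      then have lt: "\<bar>lev H 0\<bar> < r * norm ?v" using a by blast
      then have v: "norm ?v \<noteq> 0" by (metis abs_ge_zero mult_zero_right not_le)
      \<comment> \<open>The foot of the perpendicular from the origin to H, taken within L.\<close>
      let ?w = "(- lev H 0 / (norm ?v)\<^sup>2) *\<^sub>R ?v"
      have "lev H ?w = 0" using lev[of ?w] v by (simp add: self)
      moreover have "norm ?w < r" using lt v by (simp add: power2_eq_square divide_simps)
      moreover have "?w \<in> L" using L by (intro subspace_scale orth_proj_in)
      ultimately show ?thesis by blast
    qed
  qed
  finally show ?thesis .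
qed

section \<open>The body cut out by a fixed configuration\<close>

context
  fixes k :: nat and u :: "nat \<Rightarrow> 'a::euclidean_space" and r :: real and S :: "'a set set"
  assumes k: "k \<in> {1..DIM('a)}" and u: "u \<in> P_set k" and r: "0 < r" and S: "S \<subseteq> hyperplanes"
begin

lemma not_hitting_lev:
  assumes "H \<in> S - hitting (rel_open_ball (L_space k u) r)"
  shows "lev H 0 \<noteq> 0"
  using assms S hitting_rel_open_ball_iff[OF subspace_L_space r, of H k u] by blast

lemma halfspace_at_0_eq:
  assumes "H \<in> S - hitting (rel_open_ball (L_space k u) r)"
  shows "halfspace_at H 0 = {y. 0 \<le> lev H 0 * lev H y}"
  using assms S not_hitting_lev[OF assms] by (intro halfspace_at_eq) (auto simp: lev_eq_0_iff[symmetric])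

lemma in_face_body_iff:
  "y \<in> face_body k u r S \<longleftrightarrow> y \<in> L_space k u \<and> (\<forall>j\<in>{1..k + 1}. inner (u j) y \<le> r * mrad k u j) \<and>
    (\<forall>H\<in>S - hitting (rel_open_ball (L_space k u) r). 0 \<le> lev H 0 * lev H y)"
proof -
  have "y \<in> (\<Inter>H \<in> S - hitting (rel_open_ball (L_space k u) r). halfspace_at H 0) \<longleftrightarrow>
    (\<forall>H\<in>S - hitting (rel_open_ball (L_space k u) r). 0 \<le> lev H 0 * lev H y)"
    unfolding INT_iff by (intro ball_cong refl) (simp only: halfspace_at_0_eq mem_Collect_eq)
  then show ?thesis unfolding face_body_def scaled_simplex_eq[OF r] by blast
qed

lemma ball_subset_face_body:
  assumes w: "w \<in> L_space k u" "norm w < r"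
  shows "w \<in> face_body k u r S"
  unfolding in_face_body_iff
proof (intro conjI ballI w(1))
  fix j assume j: "j \<in> {1..k + 1}"
  have m: "mrad k u j = norm (orth_proj (L_space k u) (u j))" using j by (simp add: mrad_def)
  have "inner (u j) w = inner (orth_proj (L_space k u) (u j)) w" by (rule inner_orth_proj[OF subspace_L_space w(1), symmetric])
  also have "\<dots> \<le> norm (orth_proj (L_space k u) (u j)) * norm w" by (rule norm_cauchy_schwarz)
  also have "\<dots> \<le> norm (orth_proj (L_space k u) (u j)) * r" using w(2) by (intro mult_left_mono) auto
  finally show "inner (u j) w \<le> r * mrad k u j" unfolding m by (simp only: mult.commute)
next
  fix H assume H: "H \<in> S - hitting (rel_open_ball (L_space k u) r)"
  then have Hh: "H \<in> hyperplanes" using S by blast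
  have "\<not> (\<bar>lev H 0\<bar> < r * norm (orth_proj (L_space k u) (nrm H)))"
    using H hitting_rel_open_ball_iff[OF subspace_L_space r Hh, of k u] by blast
  then have ge: "r * norm (orth_proj (L_space k u) (nrm H)) \<le> \<bar>lev H 0\<bar>" by simp
  have "\<bar>inner w (nrm H)\<bar> = \<bar>inner (orth_proj (L_space k u) (nrm H)) w\<bar>"
    unfolding inner_orth_proj[OF subspace_L_space w(1)] by (simp only: inner_commute)
  also have "\<dots> \<le> norm (orth_proj (L_space k u) (nrm H)) * norm w" by (rule Cauchy_Schwarz_ineq2)
  also have "\<dots> \<le> norm (orth_proj (L_space k u) (nrm H)) * r" using w(2) by (intro mult_left_mono) auto
  finally have "\<bar>inner w (nrm H)\<bar> \<le> \<bar>lev H 0\<bar>" using ge by (simp add: mult.commute)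
  moreover have "lev H w = lev H 0 + inner w (nrm H)" using lev_add[of H 0 w] by simp
  ultimately show "0 \<le> lev H 0 * lev H w" by (auto simp: zero_le_mult_iff)
qed

lemma convex_face_body: "convex (face_body k u r S)"
  unfolding convex_def
proof (intro ballI allI impI)
  fix x y and a b :: real
  assume x: "x \<in> face_body k u r S" and y: "y \<in> face_body k u r S" and ab: "0 \<le> a" "0 \<le> b" "a + b = 1"
  show "a *\<^sub>R x + b *\<^sub>R y \<in> face_body k u r S"
    unfolding in_face_body_iff
  proof (intro conjI ballI)
    show "a *\<^sub>R x + b *\<^sub>R y \<in> L_space k u"
      using x y unfolding in_face_body_iff by (intro subspace_add subspace_scale subspace_L_space) blast+
  next
    fix j assume j: "j \<in> {1..k + 1}"
    have "a * inner (u j) x \<le> a * (r * mrad k u j)" "b * inner (u j) y \<le> b * (r * mrad k u j)"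
      using x y j ab unfolding in_face_body_iff by (blast intro: mult_left_mono)+
    then have "inner (u j) (a *\<^sub>R x + b *\<^sub>R y) \<le> (a + b) * (r * mrad k u j)"
      unfolding inner_add_right inner_scaleR_right distrib_right by (rule add_mono)
    then show "inner (u j) (a *\<^sub>R x + b *\<^sub>R y) \<le> r * mrad k u j" by (simp only: ab(3) mult_1)
  next
    fix H assume H: "H \<in> S - hitting (rel_open_ball (L_space k u) r)"
    have "0 \<le> a * (lev H 0 * lev H x)" "0 \<le> b * (lev H 0 * lev H y)"
      using x y H ab unfolding in_face_body_iff by (blast intro: mult_nonneg_nonneg)+
    moreover have "lev H 0 * lev H (a *\<^sub>R x + b *\<^sub>R y) = a * (lev H 0 * lev H x) + b * (lev H 0 * lev H y)"
      by (simp add: lev_convex[OF ab(3)] algebra_simps)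
    ultimately show "0 \<le> lev H 0 * lev H (a *\<^sub>R x + b *\<^sub>R y)" by linarith
  qed
qed

lemma closed_face_body: "closed (face_body k u r S)"
proof -
  have "face_body k u r S = L_space k u \<inter> (\<Inter>j\<in>{1..k + 1}. {y. inner (u j) y \<le> r * mrad k u j}) \<inter>
      (\<Inter>H\<in>S - hitting (rel_open_ball (L_space k u) r). {y. 0 \<le> lev H 0 * lev H y})"
    using in_face_body_iff by blast
  moreover have "closed {y. 0 \<le> lev H 0 * lev H y}" for H :: "'a set"
    by (intro closed_Collect_le continuous_intros continuous_lev)
  ultimately show ?thesis
    by (simp add: closed_Int closed_INT closed_subspace subspace_L_space closed_halfspace_le)
qed

lemma face_body_convex_body: "face_body k u r S \<in> convex_bodies"
proof -
  have "bounded (face_body k u r S)"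
  proof (rule bounded_subset)
    show "bounded {y. y - 0 \<in> L_space k u \<and> (\<forall>j\<in>{1..k + 1}. inner (u j) y \<le> r * mrad k u j)}"
      by (rule P_set_simplex_bounded[OF k u])
    show "face_body k u r S \<subseteq> {y. y - 0 \<in> L_space k u \<and> (\<forall>j\<in>{1..k + 1}. inner (u j) y \<le> r * mrad k u j)}"
      unfolding diff_zero using in_face_body_iff by blast
  qed
  moreover have "0 \<in> face_body k u r S"
    using r by (intro ball_subset_face_body) (simp_all add: subspace_0 subspace_L_space)
  ultimately show ?thesis
    using convex_face_body closed_face_body unfolding convex_bodies_def compact_eq_bounded_closed by blast
qed

text \<open>The body has interior points relative to its plane, so a dense sequence of directions detects
  whether it meets an open set.\<close>

lemma face_body_meets_open_iff:
  assumes G: "open G" and D: "\<And>X. open X \<Longrightarrow> X \<noteq> {} \<Longrightarrow> \<exists>d\<in>D. d \<in> X"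
  shows "face_body k u r S \<inter> G \<noteq> {} \<longleftrightarrow>
    (\<exists>d\<in>D. orth_proj (L_space k u) d \<in> face_body k u r S \<and> orth_proj (L_space k u) d \<in> G)"
proof
  let ?L = "L_space k u" and ?K = "face_body k u r S"
  assume "?K \<inter> G \<noteq> {}"
  then obtain y where y: "y \<in> ?K" "y \<in> G" by blast
  then have yL: "y \<in> ?L" unfolding in_face_body_iff by blast
  obtain e where e: "0 < e" "ball y e \<subseteq> G" using G y(2) by (meson openE)
  \<comment> \<open>Shrinking y towards the origin by the factor 1 - s leaves room: by convexity the
    relative ball of radius s r around the shrunk point lies in the body. The bound on s keeps the
    displacement of y at most e / 2.\<close>
  define s where "s = min (1 / 2) (e / (2 * (norm y + 1)))"
  have s: "0 < s" "s < 1" unfolding s_def using e(1) by (auto simp: add_nonneg_pos intro!: divide_pos_pos mult_pos_pos)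
  have sy: "s * norm y \<le> e / 2"
  proof -
    have "s * norm y \<le> (e / (2 * (norm y + 1))) * (norm y + 1)"
      unfolding s_def using e(1) by (intro mult_mono) auto
    also have "\<dots> = e / 2" by (simp add: add_nonneg_eq_0_iff field_simps)
    finally show ?thesis .
  qed
  define y' where "y' = (1 - s) *\<^sub>R y"
  have y'L: "y' \<in> ?L" unfolding y'_def by (intro subspace_scale subspace_L_space yL)
  define \<delta> where "\<delta> = min (s * r) (e / 2)"
  have \<delta>: "0 < \<delta>" unfolding \<delta>_def using s r e by simp
  obtain d where d: "d \<in> D" "d \<in> ball y' \<delta>" using D[of "ball y' \<delta>"] \<delta> by auto
  let ?w = "orth_proj ?L d"
  have wL: "?w \<in> ?L" by (rule orth_proj_in[OF subspace_L_space])
  have "norm (?w - y') = norm (orth_proj ?L (d - y'))"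
    unfolding orth_proj_diff[OF subspace_L_space] orth_proj_self[OF subspace_L_space y'L] by (rule refl)
  also have "\<dots> \<le> norm (d - y')" by (rule norm_orth_proj_le[OF subspace_L_space])
  also have "\<dots> < \<delta>" using d(2) by (simp add: dist_norm norm_minus_commute)
  finally have near: "norm (?w - y') < \<delta>" .
  have "?w \<in> ?K"
  proof -
    let ?v = "(1 / s) *\<^sub>R (?w - y')"
    have "?v \<in> ?K"
    proof (rule ball_subset_face_body)
      show "?v \<in> ?L" by (intro subspace_scale subspace_diff subspace_L_space wL y'L)
      have "norm (?w - y') < s * r" using near by (simp add: \<delta>_def)
      then have "\<bar>1 / s\<bar> * norm (?w - y') < r" using s(1) by (simp add: field_simps)
      then show "norm ?v < r" by (simp only: norm_scaleR)
    qed
    then have "(1 - s) *\<^sub>R y + s *\<^sub>R ?v \<in> ?K"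
      using s by (intro convexD[OF convex_face_body y(1)]) auto
    moreover have "(1 - s) *\<^sub>R y + s *\<^sub>R ?v = ?w" using s(1) by (simp add: y'_def)
    ultimately show ?thesis by simp
  qed
  moreover have "?w \<in> G"
  proof -
    have "norm (y' - y) = s * norm y" unfolding y'_def using s(1) by (simp add: algebra_simps)
    then have "norm (?w - y) < e"
      using near sy norm_triangle_ineq[of "?w - y'" "y' - y"] by (simp add: \<delta>_def)
    then show ?thesis using e(2) by (auto simp: dist_norm norm_minus_commute)
  qed
  ultimately show "\<exists>d\<in>D. orth_proj ?L d \<in> ?K \<and> orth_proj ?L d \<in> G" using d(1) by blast
next
  assume "\<exists>d\<in>D. orth_proj (L_space k u) d \<in> face_body k u r S \<and> orth_proj (L_space k u) d \<in> G"
  then show "face_body k u r S \<inter> G \<noteq> {}" by blast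
qed

end

section \<open>Measurable dependence of the body on its data\<close>

context
  fixes k :: nat and N :: "'x measure" and u :: "'x \<Rightarrow> nat \<Rightarrow> 'a::euclidean_space" and r :: "'x \<Rightarrow> real" and S :: "'x \<Rightarrow> 'a set set"
  assumes k: "k \<in> {1..DIM('a)}"
    and u: "\<And>i. i \<in> {1..DIM('a) + 1} \<Longrightarrow> (\<lambda>x. u x i) \<in> borel_measurable N"
    and r: "r \<in> borel_measurable N" and S: "S \<in> N \<rightarrow>\<^sub>M config_space"
begin

lemma measurable_norm_orth_proj_nrm:
  "(\<lambda>(x, H). norm (orth_proj (L_space k (u x)) (nrm H))) \<in> borel_measurable (N \<Otimes>\<^sub>M hyperplane_borel)"
  unfolding L_space_eq split_beta' nrm_def
proof (rule measurable_norm_orth_proj)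
  show "finite {k + 2..DIM('a) + 1}" by simp
  fix i assume "i \<in> {k + 2..DIM('a) + 1}"
  then have "(\<lambda>x. u x i) \<in> borel_measurable N" by (intro u) auto
  then show "(\<lambda>x. u (fst x) i) \<in> borel_measurable (N \<Otimes>\<^sub>M hyperplane_borel)"
    by (rule measurable_compose[OF measurable_fst])
next
  have "(\<lambda>H. fst (sec H)) \<in> borel_measurable hyperplane_borel"
    by (rule measurable_compose[OF measurable_sec measurable_fst_borel])
  then show "(\<lambda>x. fst (sec (snd x))) \<in> borel_measurable (N \<Otimes>\<^sub>M hyperplane_borel)"
    by (rule measurable_compose[OF measurable_snd])
qed

lemma measurable_lev:
  assumes y: "y \<in> borel_measurable N"
  shows "(\<lambda>(x, H). lev H (y x)) \<in> borel_measurable (N \<Otimes>\<^sub>M (hyperplane_borel :: 'a set measure))"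
proof -
  have 1: "(\<lambda>H. fst (sec H)) \<in> borel_measurable (hyperplane_borel :: 'a set measure)" "(\<lambda>H. snd (sec H)) \<in> borel_measurable (hyperplane_borel :: 'a set measure)"
    by (rule measurable_compose[OF measurable_sec measurable_fst_borel] measurable_compose[OF measurable_sec measurable_snd_borel])+
  note [measurable] = measurable_compose[OF measurable_snd 1(1)] measurable_compose[OF measurable_snd 1(2)] measurable_compose[OF measurable_fst y]
  show ?thesis unfolding lev_def nrm_def split_beta' by measurable
qed

text \<open>The criterion of \<open>hitting_rel_open_ball_iff\<close> in place of the geometric
  relation, since it involves measurable functions of x and H only.\<close>

definition hit_pairs :: "('x \<times> 'a set) set" where
  "hit_pairs = {x \<in> space (N \<Otimes>\<^sub>M hyperplane_borel). \<bar>lev (snd x) 0\<bar> < r (fst x) * norm (orth_proj (L_space k (u (fst x))) (nrm (snd x))) \<or> lev (snd x) 0 = 0}"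

lemma sets_hit_pairs: "hit_pairs \<in> sets (N \<Otimes>\<^sub>M hyperplane_borel)"
proof -
  note [measurable] = measurable_norm_orth_proj_nrm[unfolded split_beta'] measurable_lev[OF borel_measurable_const, of 0, unfolded split_beta']
    measurable_compose[OF measurable_fst r]
  show ?thesis unfolding hit_pairs_def by measurable
qed

lemma hit_pairs_iff:
  assumes "x \<in> space N" "0 < r x"
  shows "{H. (x, H) \<in> hit_pairs} = hitting (rel_open_ball (L_space k (u x)) (r x))"
proof (rule Set.set_eqI)
  fix H :: "'a set"
  show "H \<in> {H. (x, H) \<in> hit_pairs} \<longleftrightarrow> H \<in> hitting (rel_open_ball (L_space k (u x)) (r x))"
  proof (cases "H \<in> hyperplanes")
    case True
    then show ?thesis
      using assms hitting_rel_open_ball_iff[OF subspace_L_space assms(2) True, of k "u x"]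
      by (simp add: hit_pairs_def space_pair_measure space_hyperplane_borel)
  qed (simp add: hit_pairs_def space_pair_measure space_hyperplane_borel hitting_def)
qed

lemma sets_no_hit:
  assumes "\<And>x. x \<in> space N \<Longrightarrow> 0 < r x"
  shows "{x \<in> space N. S x \<inter> hitting (rel_open_ball (L_space k (u x)) (r x)) = {}} \<in> sets N"
proof -
  have [measurable]: "(\<lambda>x. num_in (S x) {H. (x, H) \<in> hit_pairs}) \<in> borel_measurable N"
    by (rule measurable_num_in_section[OF S sets_hit_pairs])
  have "{x \<in> space N. num_in (S x) {H. (x, H) \<in> hit_pairs} = 0} \<in> sets N" by measurable
  also have "{x \<in> space N. num_in (S x) {H. (x, H) \<in> hit_pairs} = 0} =
      {x \<in> space N. S x \<inter> hitting (rel_open_ball (L_space k (u x)) (r x)) = {}}"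
    unfolding num_in_eq_0_iff using assms by (intro Collect_cong conj_cong refl) (simp only: hit_pairs_iff)
  finally show ?thesis .
qed

lemma measurable_face_body:
  assumes uP: "\<And>x. x \<in> space N \<Longrightarrow> u x \<in> P_set k" and rp: "\<And>x. x \<in> space N \<Longrightarrow> 0 < r x"
  shows "(\<lambda>x. face_body k (u x) (r x) (S x)) \<in> N \<rightarrow>\<^sub>M body_borel"
proof (rule measurable_bodyI)
  have Sh: "S x \<subseteq> hyperplanes" if "x \<in> space N" for x
    using config_space_spaceD[OF S that] by (rule hyperplane_configs_subset)
  show "face_body k (u x) (r x) (S x) \<in> convex_bodies" if "x \<in> space N" for x
    by (rule face_body_convex_body[OF k uP[OF that] rp[OF that] Sh[OF that]])
  fix G :: "'a set" assume G: "open G"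
  obtain D :: "'a set" where D: "countable D" "\<And>X. open X \<Longrightarrow> X \<noteq> {} \<Longrightarrow> \<exists>d\<in>D. d \<in> X"
    using countable_dense_exists by metis
  let ?y = "\<lambda>d x. orth_proj (L_space k (u x)) d"
  have y: "(\<lambda>x. ?y d x) \<in> borel_measurable N" for d
    unfolding L_space_eq by (rule measurable_orth_proj) (auto intro!: u)
  have one: "{x \<in> space N. ?y d x \<in> face_body k (u x) (r x) (S x) \<and> ?y d x \<in> G} \<in> sets N" for d
  proof -
    \<comment> \<open>The pairs in which H misses the ball but separates the projected test point
      from the origin. The test point satisfies all halfspace conditions exactly when the
      configuration contains no such H.\<close>
    let ?T = "{x \<in> space (N \<Otimes>\<^sub>M hyperplane_borel). lev (snd x) 0 * lev (snd x) (?y d (fst x)) < 0} - hit_pairs"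
    note [measurable] = measurable_lev[OF borel_measurable_const, of 0, unfolded split_beta'] measurable_lev[OF y, of d, unfolded split_beta']
    have "{x \<in> space (N \<Otimes>\<^sub>M hyperplane_borel). lev (snd x) 0 * lev (snd x) (?y d (fst x)) < 0} \<in> sets (N \<Otimes>\<^sub>M hyperplane_borel)"
      by measurable
    then have "?T \<in> sets (N \<Otimes>\<^sub>M hyperplane_borel)" using sets_hit_pairs by (rule sets.Diff)
    then have [measurable]: "(\<lambda>x. num_in (S x) {H. (x, H) \<in> ?T}) \<in> borel_measurable N"
      by (rule measurable_num_in_section[OF S])
    have 1: "{x \<in> space N. num_in (S x) {H. (x, H) \<in> ?T} = 0} \<in> sets N" by measurable
    have 2: "{x \<in> space N. \<forall>j\<in>{1..k + 1}. inner (u x j) (?y d x) \<le> r x * mrad k (u x) j} \<in> sets N"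
    proof (rule sets.sets_Collect_finite_All)
      fix j assume "j \<in> {1..k + 1}"
      then have j: "j \<in> {1..DIM('a) + 1}" using k by auto
      note [measurable] = y[of d] r u[OF j] measurable_mrad[OF u j, where k=k]
      show "{x \<in> space N. inner (u x j) (?y d x) \<le> r x * mrad k (u x) j} \<in> sets N" by measurable
    qed simp
    have 3: "{x \<in> space N. ?y d x \<in> G} \<in> sets N"
      using measurable_sets[OF y[of d], of G] G by (simp add: vimage_def Int_def conj_commute)
    have iff: "?y d x \<in> face_body k (u x) (r x) (S x) \<longleftrightarrow>
        (\<forall>j\<in>{1..k + 1}. inner (u x j) (?y d x) \<le> r x * mrad k (u x) j) \<and> num_in (S x) {H. (x, H) \<in> ?T} = 0"
      if x: "x \<in> space N" for x
    proof -
      have "num_in (S x) {H. (x, H) \<in> ?T} = 0 \<longleftrightarrow>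
          (\<forall>H\<in>S x - hitting (rel_open_ball (L_space k (u x)) (r x)). 0 \<le> lev H 0 * lev H (?y d x))"
        unfolding num_in_eq_0_iff hit_pairs_iff[OF x rp[OF x], symmetric]
        using Sh[OF x] x by (auto simp: space_pair_measure space_hyperplane_borel not_less disjoint_iff)
      then show ?thesis
        unfolding in_face_body_iff[OF k uP[OF x] rp[OF x] Sh[OF x]] using orth_proj_in[OF subspace_L_space] by blast
    qed
    have "{x \<in> space N. ?y d x \<in> face_body k (u x) (r x) (S x) \<and> ?y d x \<in> G} =
        {x \<in> space N. \<forall>j\<in>{1..k + 1}. inner (u x j) (?y d x) \<le> r x * mrad k (u x) j} \<inter>
        {x \<in> space N. num_in (S x) {H. (x, H) \<in> ?T} = 0} \<inter> {x \<in> space N. ?y d x \<in> G}"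
      using iff by blast
    then show ?thesis using 1 2 3 by simp
  qed
  have "{x \<in> space N. face_body k (u x) (r x) (S x) \<inter> G \<noteq> {}} =
      (\<Union>d\<in>D. {x \<in> space N. ?y d x \<in> face_body k (u x) (r x) (S x) \<and> ?y d x \<in> G})"
  proof (rule Set.set_eqI)
    fix x
    show "x \<in> {x \<in> space N. face_body k (u x) (r x) (S x) \<inter> G \<noteq> {}} \<longleftrightarrow>
      x \<in> (\<Union>d\<in>D. {x \<in> space N. ?y d x \<in> face_body k (u x) (r x) (S x) \<and> ?y d x \<in> G})"
    proof (cases "x \<in> space N")
      case True
      show ?thesis
        using face_body_meets_open_iff[OF k uP[OF True] rp[OF True] Sh[OF True] G D(2)] True by blast
    qed blast
  qed
  also have "\<dots> \<in> sets N"
    by (rule sets.countable_UN'[OF D(1)]) (use one in blast)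
  finally show "{x \<in> space N. face_body k (u x) (r x) (S x) \<inter> G \<noteq> {}} \<in> sets N" .
qed

end

section \<open>Void probabilities and independence\<close>

lemma measurable_config_Diff:
  assumes S: "S \<in> N \<rightarrow>\<^sub>M config_space" and W: "W \<in> sets hyperplane_borel"
  shows "(\<lambda>x. S x - W) \<in> N \<rightarrow>\<^sub>M config_space"
proof (rule measurable_cong[THEN iffD1])
  have "space N \<times> (hyperplanes - W) \<in> sets (N \<Otimes>\<^sub>M hyperplane_borel)"
    using W sets.compl_sets[OF W] by (simp add: space_hyperplane_borel)
  then show "(\<lambda>x. S x \<inter> {H. (x, H) \<in> space N \<times> (hyperplanes - W)}) \<in> N \<rightarrow>\<^sub>M config_space"
    by (rule measurable_config_Int[OF S])
  fix x assume "x \<in> space N"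
  then show "S x \<inter> {H. (x, H) \<in> space N \<times> (hyperplanes - W)} = S x - W"
    using hyperplane_configs_subset[OF config_space_spaceD[OF S]] by auto
qed

lemma continuous_orth_proj:
  fixes L :: "'a::euclidean_space set"
  assumes L: "subspace L"
  shows "continuous_on A (orth_proj L)"
  by (metis linearI orth_proj_add L orth_proj_scaleR linear_continuous_on linear_conv_bounded_linear)

lemma support_function_cball_Int:
  fixes L :: "'a::euclidean_space set"
  assumes L: "subspace L"
  shows "support_function (cball 0 1 \<inter> L) u = norm (orth_proj L u)"
  unfolding support_function_def
proof (rule cSup_eq_maximum)
  let ?v = "orth_proj L u"
  have v: "?v \<in> L" by (rule orth_proj_in[OF L])
  \<comment> \<open>The maximizer is the normalized projection. If the projection is zero, division
    by zero makes the chosen point the origin, which attains the value 0.\<close>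
  have "inner ((1 / norm ?v) *\<^sub>R ?v) u = norm ?v"
    using inner_orth_proj_self[OF L, of u] by (simp add: inner_commute power2_eq_square)
  moreover have "(1 / norm ?v) *\<^sub>R ?v \<in> cball 0 1 \<inter> L"
    using L v by (auto intro: subspace_scale)
  ultimately show "norm ?v \<in> (\<lambda>x. inner x u) ` (cball 0 1 \<inter> L)" by (metis image_eqI)
  fix y assume "y \<in> (\<lambda>x. inner x u) ` (cball 0 1 \<inter> L)"
  then obtain x where x: "x \<in> L" "norm x \<le> 1" "y = inner x u" by auto
  have "y = inner ?v x" using inner_orth_proj[OF L x(1), of u] x(3) by (simp add: inner_commute)
  also have "\<dots> \<le> norm ?v * norm x" by (rule norm_cauchy_schwarz)
  also have "\<dots> \<le> norm ?v * 1" using x(2) by (intro mult_left_mono) auto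
  finally show "y \<le> norm ?v" by simp
qed

lemma sets_hitting_rel_open_ball:
  fixes L :: "'a::euclidean_space set"
  assumes L: "subspace L" and r: "0 < r"
  shows "hitting (rel_open_ball L r) \<in> sets hyperplane_borel"
proof -
  have "orth_proj L \<in> borel_measurable borel"
    by (intro borel_measurable_continuous_onI continuous_orth_proj L)
  note [measurable] = measurable_compose[OF measurable_compose[OF measurable_sec measurable_fst_borel] this]
    measurable_compose[OF measurable_sec measurable_snd_borel]
  have "{H \<in> space hyperplane_borel. \<bar>- snd (sec H)\<bar> < r * norm (orth_proj L (fst (sec H))) \<or> - snd (sec H) = 0} \<in> sets hyperplane_borel"
    by measurable
  also have "{H \<in> space hyperplane_borel. \<bar>- snd (sec H)\<bar> < r * norm (orth_proj L (fst (sec H))) \<or> - snd (sec H) = 0} =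
      hitting (rel_open_ball L r)"
  proof (rule Set.set_eqI)
    fix H :: "'a set"
    show "H \<in> {H \<in> space hyperplane_borel. \<bar>- snd (sec H)\<bar> < r * norm (orth_proj L (fst (sec H))) \<or> - snd (sec H) = 0} \<longleftrightarrow>
        H \<in> hitting (rel_open_ball L r)"
    proof (cases "H \<in> hyperplanes")
      case True
      then show ?thesis
        using hitting_rel_open_ball_iff[OF L r True] by (simp add: lev_def nrm_def space_hyperplane_borel)
    qed (simp add: space_hyperplane_borel hitting_def)
  qed
  finally show ?thesis .
qed

lemma hyperplane_hits_rel_open_ball_iff:
  fixes L :: "'a::euclidean_space set"
  assumes L: "subspace L" and r: "0 < r" and v: "norm v = 1"
  shows "hyperplane v t \<in> hitting (rel_open_ball L r) \<longleftrightarrow> \<bar>t\<bar> < r * norm (orth_proj L v) \<or> t = 0"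
proof -
  obtain s where s: "s = 1 \<or> s = - 1" "\<And>y. inner v y - t = s * lev (hyp (v, t)) y" "v = s *\<^sub>R nrm (hyp (v, t))"
    using rep_lev[of "(v, t)"] v by auto
  have H: "hyp (v, t) = hyperplane v t" using v by (simp add: hyp_def)
  have "norm (orth_proj L v) = norm (orth_proj L (nrm (hyp (v, t))))"
    by (subst s(3)) (use s(1) in \<open>auto simp: orth_proj_scaleR[OF L]\<close>)
  moreover have "\<bar>t\<bar> = \<bar>lev (hyp (v, t)) 0\<bar>" using s(1) s(2)[of 0] by auto
  ultimately show ?thesis
    using hitting_rel_open_ball_iff[OF L r hyp_in_hyperplanes, of "(v, t)"] unfolding H by (metis abs_eq_0)
qed

lemma emeasure_lborel_abs_less:
  assumes "0 \<le> c"
  shows "emeasure lborel {t::real. \<bar>t\<bar> < c \<or> t = 0} = ennreal (2 * c)"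
proof (cases "c = 0")
  case True
  then have "{t::real. \<bar>t\<bar> < c \<or> t = 0} = {0}" by auto
  then show ?thesis using True by simp
next
  case False
  then have "{t::real. \<bar>t\<bar> < c \<or> t = 0} = {- c<..<c}" using assms by auto
  then show ?thesis using assms by simp
qed

section \<open>Avoiding the ball and its independence of the rest\<close>

context hyperplane_process
begin

lemma nn_integral_intensity:
  assumes "f \<in> borel_measurable hyperplane_borel"
  shows "(\<integral>\<^sup>+H. f H \<partial>\<Theta>) = ennreal \<gamma> * (\<integral>\<^sup>+u. (\<integral>\<^sup>+t. f (hyperplane u t) \<partial>lborel) \<partial>\<phi>)"
  using intensity assms unfolding has_intensity_and_directional_distribution_def by blast

lemma hitting_functional_nonneg:
  assumes L: "subspace L" shows "0 \<le> hitting_functional \<phi> (cball 0 1 \<inter> L)"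
  unfolding hitting_functional_def support_function_cball_Int[OF L] by simp

lemma nn_integral_norm_orth_proj:
  assumes L: "subspace L"
  shows "(\<integral>\<^sup>+u. ennreal (norm (orth_proj L u)) \<partial>\<phi>) = ennreal (hitting_functional \<phi> (cball 0 1 \<inter> L))"
  unfolding hitting_functional_def support_function_cball_Int[OF L]
proof (rule nn_integral_eq_integral)
  interpret \<phi>: prob_space \<phi> by (rule prob_space_phi)
  have "orth_proj L \<in> borel_measurable borel"
    by (intro borel_measurable_continuous_onI continuous_orth_proj L)
  note [measurable] = measurable_compose[OF measurable_id_phi this]
  show "integrable \<phi> (\<lambda>u. norm (orth_proj L u))"
  proof (rule \<phi>.integrable_const_bound[where B=1])
    show "AE u in \<phi>. norm (norm (orth_proj L u)) \<le> 1"
    proof (rule AE_I2)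
      fix u assume "u \<in> space \<phi>"
      then show "norm (norm (orth_proj L u)) \<le> 1"
        using norm_orth_proj_le[OF L, of u] by (simp add: space_phi)
    qed
  qed measurable
qed simp

text \<open>For a fixed normal u the hitting levels have total length 2 r
  \<open>norm (orth_proj L u)\<close>. This norm is the support function of the unit ball of L, so
  integration over u produces the hitting functional.\<close>

lemma emeasure_hitting_rel_open_ball:
  assumes L: "subspace L" and r: "0 < r"
  shows "emeasure \<Theta> (hitting (rel_open_ball L r)) = ennreal (2 * \<gamma> * r * hitting_functional \<phi> (cball 0 1 \<inter> L))"
proof -
  let ?W = "hitting (rel_open_ball L r)"
  have W: "?W \<in> sets hyperplane_borel" by (rule sets_hitting_rel_open_ball[OF L r])
  have "orth_proj L \<in> borel_measurable borel"
    by (intro borel_measurable_continuous_onI continuous_orth_proj L)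
  note [measurable] = measurable_compose[OF measurable_id_phi this]
  have "emeasure \<Theta> ?W = (\<integral>\<^sup>+H. indicator ?W H \<partial>\<Theta>)" using W by simp
  also have "\<dots> = ennreal \<gamma> * (\<integral>\<^sup>+u. (\<integral>\<^sup>+t. indicator ?W (hyperplane u t) \<partial>lborel) \<partial>\<phi>)"
    using W by (intro nn_integral_intensity) simp
  also have "(\<integral>\<^sup>+u. (\<integral>\<^sup>+t. indicator ?W (hyperplane u t) \<partial>lborel) \<partial>\<phi>) = (\<integral>\<^sup>+u. ennreal (2 * r) * ennreal (norm (orth_proj L u)) \<partial>\<phi>)"
  proof (rule nn_integral_cong)
    fix u assume "u \<in> space \<phi>"
    then have u: "norm u = 1" by (simp add: space_phi)
    have "(\<integral>\<^sup>+t. indicator ?W (hyperplane u t) \<partial>lborel) = (\<integral>\<^sup>+t. indicator {t. \<bar>t\<bar> < r * norm (orth_proj L u) \<or> t = 0} t \<partial>lborel)"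
      by (intro nn_integral_cong) (simp add: indicator_def hyperplane_hits_rel_open_ball_iff[OF L r u])
    also have "\<dots> = emeasure lborel {t. \<bar>t\<bar> < r * norm (orth_proj L u) \<or> t = 0}"
      by (rule nn_integral_indicator) measurable
    also have "\<dots> = ennreal (2 * (r * norm (orth_proj L u)))"
      using r by (intro emeasure_lborel_abs_less) simp
    also have "\<dots> = ennreal (2 * r) * ennreal (norm (orth_proj L u))"
      using r by (subst ennreal_mult[symmetric]) (auto simp: mult.assoc)
    finally show "(\<integral>\<^sup>+t. indicator ?W (hyperplane u t) \<partial>lborel) = ennreal (2 * r) * ennreal (norm (orth_proj L u))" .
  qed
  also have "\<dots> = ennreal (2 * r) * ennreal (hitting_functional \<phi> (cball 0 1 \<inter> L))"
    by (subst nn_integral_cmult) (simp_all add: nn_integral_norm_orth_proj[OF L])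
  also have "ennreal \<gamma> * (ennreal (2 * r) * ennreal (hitting_functional \<phi> (cball 0 1 \<inter> L))) =
      ennreal (2 * \<gamma> * r * hitting_functional \<phi> (cball 0 1 \<inter> L))"
    using gamma_pos r hitting_functional_nonneg[OF L] by (simp add: ennreal_mult[symmetric] mult_ac)
  finally show ?thesis .
qed

lemma void_probability:
  assumes L: "subspace L" and r: "0 < r"
  shows "(\<integral>\<^sup>+\<omega>. indicator {0} (num_in (X \<omega>) (hitting (rel_open_ball L r))) \<partial>M) =
    ennreal (exp (- 2 * \<gamma> * r * hitting_functional \<phi> (cball 0 1 \<inter> L)))"
proof -
  have "0 \<le> 2 * \<gamma> * r * hitting_functional \<phi> (cball 0 1 \<inter> L)"
    using gamma_pos r hitting_functional_nonneg[OF L] by simp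
  then have "measure \<Theta> (hitting (rel_open_ball L r)) = 2 * \<gamma> * r * hitting_functional \<phi> (cball 0 1 \<inter> L)"
    unfolding measure_def emeasure_hitting_rel_open_ball[OF L r] by simp
  then show ?thesis
    using prob_num_in[OF sets_hitting_rel_open_ball[OF L r], of 0] emeasure_hitting_rel_open_ball[OF L r] by simp
qed

text \<open>Both sides are finite measures as functions of V, so they can be compared on void
  events. There the part of the process outside W avoids C exactly when the whole process has no
  point in \<open>C - W\<close>, a set disjoint from W.\<close>

lemma void_indep:
  assumes W: "W \<in> sets hyperplane_borel" and V: "V \<in> sets config_space"
  shows "(\<integral>\<^sup>+\<omega>. indicator {0} (num_in (X \<omega>) W) * indicator V (X \<omega> - W) \<partial>M) =
    (\<integral>\<^sup>+\<omega>. indicator {0} (num_in (X \<omega>) W) \<partial>M) * (\<integral>\<^sup>+\<omega>. indicator V (X \<omega> - W) \<partial>M)"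
proof -
  let ?f = "\<lambda>\<omega>. indicator {0} (num_in (X \<omega>) W) :: ennreal"
  have f[measurable]: "?f \<in> borel_measurable M" using W by measurable
  have D[measurable]: "(\<lambda>\<omega>. X \<omega> - W) \<in> M \<rightarrow>\<^sub>M config_space" by (rule measurable_config_Diff[OF measurable_X W])
  define c where "c = (\<integral>\<^sup>+\<omega>. ?f \<omega> \<partial>M)"
  define \<mu> where "\<mu> = distr (density M ?f) config_space (\<lambda>\<omega>. X \<omega> - W)"
  define \<nu> where "\<nu> = density (distr M config_space (\<lambda>\<omega>. X \<omega> - W)) (\<lambda>_. c)"
  have \<mu>: "emeasure \<mu> V = (\<integral>\<^sup>+\<omega>. ?f \<omega> * indicator V (X \<omega> - W) \<partial>M)" if V: "V \<in> sets config_space" for V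
  proof -
    have "emeasure \<mu> V = emeasure (density M ?f) ((\<lambda>\<omega>. X \<omega> - W) -` V \<inter> space M)"
      unfolding \<mu>_def using V D by (subst emeasure_distr) auto
    also have "\<dots> = (\<integral>\<^sup>+\<omega>. ?f \<omega> * indicator ((\<lambda>\<omega>. X \<omega> - W) -` V \<inter> space M) \<omega> \<partial>M)"
      by (rule emeasure_density[OF f measurable_sets[OF D V]])
    also have "\<dots> = (\<integral>\<^sup>+\<omega>. ?f \<omega> * indicator V (X \<omega> - W) \<partial>M)"
      by (intro nn_integral_cong) (simp add: indicator_def)
    finally show ?thesis .
  qed
  have \<nu>: "emeasure \<nu> V = c * (\<integral>\<^sup>+\<omega>. indicator V (X \<omega> - W) \<partial>M)" if V: "V \<in> sets config_space" for V
  proof -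
    have "emeasure \<nu> V = (\<integral>\<^sup>+S. c * indicator V S \<partial>distr M config_space (\<lambda>\<omega>. X \<omega> - W))"
      unfolding \<nu>_def using V by (intro emeasure_density) auto
    also have "\<dots> = (\<integral>\<^sup>+\<omega>. c * indicator V (X \<omega> - W) \<partial>M)"
      using V D by (subst nn_integral_distr) auto
    also have "\<dots> = c * (\<integral>\<^sup>+\<omega>. indicator V (X \<omega> - W) \<partial>M)"
      using measurable_compose[OF D borel_measurable_indicator[OF V]] by (rule nn_integral_cmult)
    finally show ?thesis .
  qed
  have "\<mu> = \<nu>"
  proof (rule measure_eqI_generator_eq[where A="\<lambda>_. hyperplane_configs"])
    show "Int_stable (void_events :: 'a set set set set)" by (rule Int_stable_void_events)
    show "void_events \<subseteq> Pow (hyperplane_configs :: 'a set set set)" by (auto simp: void_events_def void_event_def)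
    show "sets \<mu> = sigma_sets hyperplane_configs void_events" by (simp add: \<mu>_def sets_config_space_void)
    show "sets \<nu> = sigma_sets hyperplane_configs void_events" by (simp add: \<nu>_def sets_config_space_void)
    show "range (\<lambda>_::nat. hyperplane_configs) \<subseteq> (void_events :: 'a set set set set)" using space_in_void_events by auto
    show "(\<Union>i::nat. hyperplane_configs) = (hyperplane_configs :: 'a set set set)" by simp
    have hc: "hyperplane_configs \<in> sets (config_space :: 'a set set measure)"
      using sets.top[of config_space] by (simp add: space_config_space)
    have "emeasure \<mu> hyperplane_configs \<le> (\<integral>\<^sup>+\<omega>. 1 \<partial>M)"
      unfolding \<mu>[OF hc] by (intro nn_integral_mono) (auto simp: indicator_def)
    then show "emeasure \<mu> hyperplane_configs \<noteq> \<infinity>" by (simp add: emeasure_space_1 top_unique) (metis ennreal_one_neq_top neq_top_trans)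
    fix Y :: "'a set set set" assume "Y \<in> void_events"
    then obtain C where C: "Y = void_event C" "C \<in> sets hyperplane_borel" unfolding void_events_def by blast
    have Y: "Y \<in> sets config_space" unfolding C(1) by (rule sets_void_event[OF C(2)])
    have e: "indicator Y (X \<omega> - W) = (indicator {0} (num_in (X \<omega>) (C - W)) :: ennreal)" if "\<omega> \<in> space M" for \<omega>
      using config_space_spaceD[OF D that] by (auto simp: C(1) indicator_def void_event_def num_in_eq_0_iff)
    have "emeasure \<mu> Y = (\<integral>\<^sup>+\<omega>. ?f \<omega> * indicator {0} (num_in (X \<omega>) (C - W)) \<partial>M)"
      unfolding \<mu>[OF Y] by (intro nn_integral_cong) (simp only: e)
    also have "\<dots> = c * (\<integral>\<^sup>+\<omega>. indicator {0} (num_in (X \<omega>) (C - W)) \<partial>M)"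
      unfolding c_def using W C(2) by (intro nn_integral_num_in_indep) auto
    also have "(\<integral>\<^sup>+\<omega>. indicator {0} (num_in (X \<omega>) (C - W)) \<partial>M) = (\<integral>\<^sup>+\<omega>. indicator Y (X \<omega> - W) \<partial>M)"
      by (intro nn_integral_cong) (simp only: e)
    finally show "emeasure \<mu> Y = emeasure \<nu> Y" unfolding \<nu>[OF Y] .
  qed
  then show ?thesis using \<mu>[OF V] \<nu>[OF V] unfolding c_def by simp
qed

text \<open>The body depends only on the hyperplanes that miss the ball, so it is unchanged when the
  others are deleted. \<open>void_indep\<close> therefore splits off the probability that the ball
  is not hit.\<close>

lemma expectation_face_body:
  fixes u :: "nat \<Rightarrow> 'a"
  assumes k: "k \<in> {1..DIM('a)}" and u: "u \<in> P_set k" and r: "0 < r" and A: "A \<in> sets body_borel"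
  shows "(\<integral>\<^sup>+\<omega>. indicator {S. S \<inter> hitting (rel_open_ball (L_space k u) r) = {}} (X \<omega>) * indicator A (face_body k u r (X \<omega>)) \<partial>M) =
    ennreal (exp (- 2 * \<gamma> * r * hitting_functional \<phi> (cball 0 1 \<inter> L_space k u)) * \<P>(\<omega> in M. face_body k u r (X \<omega>) \<in> A))"
proof -
  let ?W = "hitting (rel_open_ball (L_space k u) r)"
  let ?e = "exp (- 2 * \<gamma> * r * hitting_functional \<phi> (cball 0 1 \<inter> L_space k u))"
  have W: "?W \<in> sets hyperplane_borel" by (rule sets_hitting_rel_open_ball[OF subspace_L_space r])
  have m: "(\<lambda>S. face_body k u r S) \<in> config_space \<rightarrow>\<^sub>M body_borel"
    using k u r by (intro measurable_face_body[where u="\<lambda>_. u" and r="\<lambda>_. r" and S="\<lambda>S. S"]) auto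
  define V where "V = (\<lambda>S. face_body k u r S) -` A \<inter> space config_space"
  have V: "V \<in> sets config_space" unfolding V_def by (rule measurable_sets[OF m A])
  have D: "(\<lambda>\<omega>. X \<omega> - ?W) \<in> M \<rightarrow>\<^sub>M config_space" by (rule measurable_config_Diff[OF measurable_X W])
  have cut: "face_body k u r (S - ?W) = face_body k u r S" for S
    unfolding face_body_def by (simp add: Diff_idemp)
  have ind: "indicator V (X \<omega> - ?W) = (indicator A (face_body k u r (X \<omega>)) :: ennreal)" if "\<omega> \<in> space M" for \<omega>
    using config_space_spaceD[OF D that] unfolding V_def by (simp add: indicator_def cut space_config_space)
  have "(\<integral>\<^sup>+\<omega>. indicator {S. S \<inter> ?W = {}} (X \<omega>) * indicator A (face_body k u r (X \<omega>)) \<partial>M) =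
      (\<integral>\<^sup>+\<omega>. indicator {0} (num_in (X \<omega>) ?W) * indicator V (X \<omega> - ?W) \<partial>M)"
    by (intro nn_integral_cong arg_cong2[where f=times]) (simp add: indicator_def num_in_eq_0_iff, simp only: ind)
  also have "\<dots> = ennreal ?e * (\<integral>\<^sup>+\<omega>. indicator V (X \<omega> - ?W) \<partial>M)"
    unfolding void_indep[OF W V] void_probability[OF subspace_L_space r] by (rule refl)
  also have "(\<integral>\<^sup>+\<omega>. indicator V (X \<omega> - ?W) \<partial>M) = (\<integral>\<^sup>+\<omega>. indicator {\<omega> \<in> space M. face_body k u r (X \<omega>) \<in> A} \<omega> \<partial>M)"
    by (intro nn_integral_cong) (simp only: ind, simp add: indicator_def)
  also have "\<dots> = emeasure M {\<omega> \<in> space M. face_body k u r (X \<omega>) \<in> A}"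
    using measurable_sets[OF measurable_compose[OF measurable_X m] A]
    by (intro nn_integral_indicator) (simp add: vimage_def Int_def conj_commute)
  also have "\<dots> = ennreal (\<P>(\<omega> in M. face_body k u r (X \<omega>) \<in> A))" by (rule emeasure_eq_measure)
  finally show ?thesis by (simp add: ennreal_mult')
qed

end

section \<open>The weight of a tuple and its expectation\<close>

text \<open>The second argument stands for the configuration without the hyperplanes of the tuple;
  the Mecke formula turns it into the full process. Shifting the center to the origin allows
  stationarity to remove the dependence on the center later.\<close>

definition face_weight :: "nat \<Rightarrow> 'a::euclidean_space set set \<Rightarrow> 'a set \<Rightarrow> (nat \<Rightarrow> 'a \<times> real) \<times> 'a set set \<Rightarrow> ennreal" where
  "face_weight k A B = (\<lambda>(p, S).
     indicator {p. normals p \<in> P_set k \<and> 0 < tuple_radius k p \<and>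
       tuple_ball k (normals p) (\<lambda>i. snd (p i)) (tuple_center k p) (tuple_radius k p)} p *
     indicator B (tuple_center k p) *
     (indicator {S. S \<inter> hitting (rel_open_ball (L_space k (normals p)) (tuple_radius k p)) = {}} (shift (- tuple_center k p) S) *
      indicator A (face_body k (normals p) (tuple_radius k p) (shift (- tuple_center k p) S))))"

lemma measurable_face_weight:
  fixes A :: "'a::euclidean_space set set"
  assumes k: "k \<in> {1..DIM('a)}" and A: "A \<in> sets body_borel" and B: "B \<in> sets borel"
  shows "face_weight k A B \<in> borel_measurable (PiM {1..DIM('a) + 1} (\<lambda>_. borel) \<Otimes>\<^sub>M config_space)"
proof -
  let ?N = "PiM {1..DIM('a) + 1} (\<lambda>_. borel) \<Otimes>\<^sub>M config_space :: ((nat \<Rightarrow> 'a \<times> real) \<times> 'a set set) measure"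
  have p: "(\<lambda>x. fst x i) \<in> borel_measurable ?N" if "i \<in> {1..DIM('a) + 1}" for i
    by (rule measurable_compose[OF measurable_fst measurable_component_singleton[OF that]])
  note c = measurable_tuple_center[OF p, where k=k] and rad = measurable_tuple_radius[OF p, where k=k]
  let ?c = "\<lambda>x::(nat \<Rightarrow> 'a \<times> real) \<times> 'a set set. tuple_center k (fst x)"
  let ?r = "\<lambda>x::(nat \<Rightarrow> 'a \<times> real) \<times> 'a set set. tuple_radius k (fst x)"
  let ?T = "\<lambda>x. shift (- ?c x) (snd x)"
  have T: "?T \<in> ?N \<rightarrow>\<^sub>M config_space"
    by (rule measurable_shift[OF borel_measurable_uminus[OF c] measurable_snd])
  let ?good = "\<lambda>p. normals p \<in> P_set k \<and> 0 < tuple_radius k p \<and>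
       tuple_ball k (normals p) (\<lambda>i. snd (p i)) (tuple_center k p) (tuple_radius k p)"
  define D where "D = {x \<in> space ?N. normals (fst x) \<in> P_set k} \<inter> {x \<in> space ?N. 0 < ?r x} \<inter>
    {x \<in> space ?N. tuple_ball k (normals (fst x)) (\<lambda>i. snd (fst x i)) (?c x) (?r x)}"
  have D: "D \<in> sets ?N"
  proof -
    note [measurable] = rad
    have "{x \<in> space ?N. 0 < ?r x} \<in> sets ?N" by measurable
    then show ?thesis
      unfolding D_def by (intro sets.Int sets_normals_P_set[OF p k] sets_tuple_ball[OF p])
  qed
  have D_iff: "x \<in> D \<longleftrightarrow> ?good (fst x)" if "x \<in> space ?N" for x using that unfolding D_def by blast
  \<comment> \<open>\<open>measurable_face_body\<close> needs admissible normals and a positive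
    radius throughout, so measurability is shown on the set of such tuples and then transferred
    back.\<close>
  let ?R = "restrict_space ?N D"
  have spR: "space ?R = D" using D sets.sets_into_space[OF D] by (auto simp: space_restrict_space)
  have DN: "D \<inter> space ?N \<in> sets ?N" using D by auto
  have RD: "normals (fst x) \<in> P_set k" "0 < ?r x" if "x \<in> space ?R" for x
    using that spR unfolding D_def by blast+
  note R = measurable_restrict_space1
  have uR: "(\<lambda>x. normals (fst x) i) \<in> borel_measurable ?R" if "i \<in> {1..DIM('a) + 1}" for i
    by (rule R[OF measurable_normals[OF p that]])
  have n: "{x \<in> space ?R. ?T x \<inter> hitting (rel_open_ball (L_space k (normals (fst x))) (?r x)) = {}} \<in> sets ?R"
    by (rule sets_no_hit[OF k uR R[OF rad] R[OF T] RD(2)])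
  have f: "(\<lambda>x. face_body k (normals (fst x)) (?r x) (?T x)) \<in> ?R \<rightarrow>\<^sub>M body_borel"
    by (rule measurable_face_body[OF k uR R[OF rad] R[OF T] RD])
  define E where "E = {x \<in> space ?R. ?T x \<inter> hitting (rel_open_ball (L_space k (normals (fst x))) (?r x)) = {}} \<inter>
     ((\<lambda>x. face_body k (normals (fst x)) (?r x) (?T x)) -` A \<inter> space ?R)"
  have "E \<in> sets ?R" unfolding E_def by (rule sets.Int[OF n measurable_sets[OF f A]])
  then have E: "E \<in> sets ?N" using sets_restrict_space_iff[OF DN] by blast
  have w: "face_weight k A B x = indicator E x * indicator B (?c x)" if x: "x \<in> space ?N" for x
    using D_iff[OF x] unfolding face_weight_def E_def spR by (cases x) (auto simp: indicator_def)
  note [measurable] = E c B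
  have "(\<lambda>x. indicator E x * indicator B (?c x) :: ennreal) \<in> borel_measurable ?N" by measurable
  then show ?thesis by (rule measurable_cong[THEN iffD2, rotated]) (rule w)
qed

lemma D_fun_eq: "D_fun k u = \<bar>Determinant.det (center_radius_mat u (mrad k u))\<bar>" for u :: "nat \<Rightarrow> 'a::euclidean_space"
proof -
  have "mat (DIM('a) + 1) (DIM('a) + 1) (\<lambda>(i, j).
     if j < DIM('a) then inner (u (i + 1)) (from_nat_into Basis j)
     else if i < k + 1 then norm (orth_proj (L_space k u) (u (i + 1))) else 0) = center_radius_mat u (mrad k u)"
    unfolding center_radius_mat_def by (rule cong_mat) (auto simp: mrad_def)
  then show ?thesis unfolding D_fun_def by simp
qed

context hyperplane_process
begin

lemma expectation_face_weight:
  fixes u :: "nat \<Rightarrow> 'a"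
  assumes k: "k \<in> {1..DIM('a)}" and u: "u \<in> P_set k" and A: "A \<in> sets body_borel"
  shows "(\<integral>\<^sup>+\<omega>. face_weight k A B (\<lambda>i\<in>{1..DIM('a) + 1}. (u i, inner (u i) z + r * mrad k u i), X \<omega>) \<partial>M) =
    indicator B z * (indicator {0<..} r *
      ennreal (exp (- 2 * \<gamma> * r * hitting_functional \<phi> (cball 0 1 \<inter> L_space k u)) * \<P>(\<omega> in M. face_body k u r (X \<omega>) \<in> A)))"
proof -
  define p where "p = (\<lambda>i\<in>{1..DIM('a) + 1}. (u i, inner (u i) z + r * mrad k u i))"
  have "u \<in> extensional {1..DIM('a) + 1}" using u by (auto simp: P_set_def PiE_def)
  then have n: "normals p = u" by (auto simp: p_def normals_def extensional_def fun_eq_iff)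
  have tb: "tuple_ball k (normals p) (\<lambda>i. snd (p i)) z r"
    unfolding n tuple_ball_def by (simp add: p_def)
  note cr = tuple_center_radius_eq[OF k _ tb, unfolded n, OF u]
  have w: "face_weight k A B (p, S) = indicator B z * (indicator {0<..} r *
      (indicator {S. S \<inter> hitting (rel_open_ball (L_space k u) r) = {}} (shift (- z) S) * indicator A (face_body k u r (shift (- z) S))))" for S
    using u tb unfolding n by (simp add: face_weight_def n cr indicator_def)
  have "(\<integral>\<^sup>+\<omega>. face_weight k A B (p, X \<omega>) \<partial>M) = indicator B z * (indicator {0<..} r *
      ennreal (exp (- 2 * \<gamma> * r * hitting_functional \<phi> (cball 0 1 \<inter> L_space k u)) * \<P>(\<omega> in M. face_body k u r (X \<omega>) \<in> A)))"
  proof (cases "0 < r")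
    case False
    then show ?thesis by (simp add: w)
  next
    case True
    let ?g = "\<lambda>S. indicator {S. S \<inter> hitting (rel_open_ball (L_space k u) r) = {}} S * indicator A (face_body k u r S) :: ennreal"
    have g: "?g \<in> borel_measurable config_space"
    proof (rule borel_measurable_times_ennreal)
      have W: "hitting (rel_open_ball (L_space k u) r) \<in> sets hyperplane_borel"
        by (rule sets_hitting_rel_open_ball[OF subspace_L_space True])
      have "indicator (void_event (hitting (rel_open_ball (L_space k u) r))) \<in> borel_measurable config_space"
        by (rule borel_measurable_indicator[OF sets_void_event[OF W]])
      then show "(\<lambda>S. indicator {S. S \<inter> hitting (rel_open_ball (L_space k u) r) = {}} S :: ennreal) \<in> borel_measurable config_space"
        by (rule measurable_cong[THEN iffD1, rotated]) (auto simp: indicator_def void_event_def space_config_space)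
      have "(\<lambda>S. face_body k u r S) \<in> config_space \<rightarrow>\<^sub>M body_borel"
        using k u True by (intro measurable_face_body[where u="\<lambda>_. u" and r="\<lambda>_. r" and S="\<lambda>S. S"]) auto
      from measurable_compose[OF this borel_measurable_indicator[OF A]]
      show "(\<lambda>S. indicator A (face_body k u r S) :: ennreal) \<in> borel_measurable config_space" .
    qed
    have "(\<integral>\<^sup>+\<omega>. face_weight k A B (p, X \<omega>) \<partial>M) = (\<integral>\<^sup>+\<omega>. indicator B z * ?g (shift (- z) (X \<omega>)) \<partial>M)"
      using True by (simp add: w)
    also have "\<dots> = indicator B z * (\<integral>\<^sup>+\<omega>. ?g (shift (- z) (X \<omega>)) \<partial>M)"
      by (cases "z \<in> B") simp_all
    also have "(\<integral>\<^sup>+\<omega>. ?g (shift (- z) (X \<omega>)) \<partial>M) = (\<integral>\<^sup>+\<omega>. ?g (X \<omega>) \<partial>M)"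
      by (rule nn_integral_shift[OF g])
    also have "(\<integral>\<^sup>+\<omega>. ?g (X \<omega>) \<partial>M) =
      ennreal (exp (- 2 * \<gamma> * r * hitting_functional \<phi> (cball 0 1 \<inter> L_space k u)) * \<P>(\<omega> in M. face_body k u r (X \<omega>) \<in> A))"
      by (rule expectation_face_body[OF k u True A])
    finally show ?thesis using True by simp
  qed
  then show ?thesis unfolding p_def .
qed

lemma measurable_pair_tuple_lborel:
  "(\<lambda>t. \<lambda>i\<in>I. (u i, t i)) \<in> PiM I (\<lambda>_. lborel :: real measure) \<rightarrow>\<^sub>M PiM I (\<lambda>_. borel :: ('a \<times> real) measure)"
  by simp

text \<open>For fixed normals the levels are replaced by (z, r), with Jacobian
  \<open>D_fun k u\<close>. By stationarity z then enters only through the indicator of B, whose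
  integral is 1.\<close>

theorem integral_face_weight:
  assumes k: "k \<in> {1..DIM('a)}" and A: "A \<in> sets body_borel" and B: "B \<in> sets borel" "emeasure lborel B = 1"
  shows "(\<integral>\<^sup>+q. \<integral>\<^sup>+\<omega>. face_weight k A B (q, X \<omega>) \<partial>M \<partial>PiM {1..DIM('a) + 1} (\<lambda>_. \<Psi>)) =
    (\<integral>\<^sup>+u\<in>P_set k. (\<integral>\<^sup>+r\<in>{0<..}. ennreal (exp (- 2 * \<gamma> * r * hitting_functional \<phi> (cball 0 1 \<inter> L_space k u)) *
        \<P>(\<omega> in M. face_body k u r (X \<omega>) \<in> A)) \<partial>lborel) * ennreal (D_fun k u) \<partial>PiM {1..DIM('a) + 1} (\<lambda>_. \<phi>))"
proof -
  let ?I = "{1..DIM('a) + 1}"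
  let ?E = "\<lambda>q. \<integral>\<^sup>+\<omega>. face_weight k A B (q, X \<omega>) \<partial>M"
  let ?G = "\<lambda>u r. ennreal (exp (- 2 * \<gamma> * r * hitting_functional \<phi> (cball 0 1 \<inter> L_space k u)) * \<P>(\<omega> in M. face_body k u r (X \<omega>) \<in> A))"
  have mE: "?E \<in> borel_measurable (PiM ?I (\<lambda>_. borel))"
    by (rule measurable_expectation[OF measurable_face_weight[OF k A B(1)]])
  interpret \<phi>: prob_space \<phi> by (rule prob_space_phi)
  have "(\<integral>\<^sup>+q. ?E q \<partial>PiM ?I (\<lambda>_. \<Psi>)) = (\<integral>\<^sup>+u. \<integral>\<^sup>+t. ?E (\<lambda>i\<in>?I. (u i, t i)) \<partial>PiM ?I (\<lambda>_. lborel) \<partial>PiM ?I (\<lambda>_. \<phi>))"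
    using measurable_compose[OF measurable_id_PiM_Psi mE] unfolding \<Psi>_def
    by (intro nn_integral_PiM_pair \<phi>.sigma_finite_measure_axioms lborel.sigma_finite_measure_axioms) simp_all
  also have "\<dots> = (\<integral>\<^sup>+u. (\<integral>\<^sup>+r\<in>{0<..}. ?G u r \<partial>lborel) * ennreal (D_fun k u) * indicator (P_set k) u \<partial>PiM ?I (\<lambda>_. \<phi>))"
  proof (rule nn_integral_cong)
    fix u assume "u \<in> space (PiM ?I (\<lambda>_. \<phi>))"
    then have ext: "u \<in> extensional ?I" by (simp add: space_PiM PiE_def)
    show "(\<integral>\<^sup>+t. ?E (\<lambda>i\<in>?I. (u i, t i)) \<partial>PiM ?I (\<lambda>_. lborel)) =
       (\<integral>\<^sup>+r\<in>{0<..}. ?G u r \<partial>lborel) * ennreal (D_fun k u) * indicator (P_set k) u"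
    proof (cases "u \<in> P_set k")
      case False
      have "normals (\<lambda>i\<in>?I. (u i, t i)) = u" for t
        using ext by (auto simp: normals_def extensional_def fun_eq_iff)
      then have "face_weight k A B (\<lambda>i\<in>?I. (u i, t i), S) = 0" for t S
        using False by (simp add: face_weight_def)
      then show ?thesis using False by simp
    next
      case True
      have "(\<integral>\<^sup>+t. ?E (\<lambda>i\<in>?I. (u i, t i)) \<partial>PiM ?I (\<lambda>_. lborel)) =
        ennreal \<bar>Determinant.det (center_radius_mat u (mrad k u))\<bar> *
        (\<integral>\<^sup>+z. \<integral>\<^sup>+r. ?E (\<lambda>i\<in>?I. (u i, (\<lambda>i\<in>?I. inner (u i) z + r * mrad k u i) i)) \<partial>lborel \<partial>lborel)"
        by (rule nn_integral_center_radius[OF det_center_radius_neq_0[OF k True] measurable_compose[OF measurable_pair_tuple_lborel mE]])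
      also have "\<bar>Determinant.det (center_radius_mat u (mrad k u))\<bar> = D_fun k u" by (rule D_fun_eq[symmetric])
      also have "(\<integral>\<^sup>+z. \<integral>\<^sup>+r. ?E (\<lambda>i\<in>?I. (u i, (\<lambda>i\<in>?I. inner (u i) z + r * mrad k u i) i)) \<partial>lborel \<partial>lborel) =
        (\<integral>\<^sup>+z. \<integral>\<^sup>+r. indicator B z * (indicator {0<..} r * ?G u r) \<partial>lborel \<partial>lborel)"
      proof (intro nn_integral_cong)
        fix z r
        have "(\<lambda>i\<in>?I. (u i, (\<lambda>i\<in>?I. inner (u i) z + r * mrad k u i) i)) = (\<lambda>i\<in>?I. (u i, inner (u i) z + r * mrad k u i))"
          by (simp add: restrict_def fun_eq_iff)
        then show "?E (\<lambda>i\<in>?I. (u i, (\<lambda>i\<in>?I. inner (u i) z + r * mrad k u i) i)) = indicator B z * (indicator {0<..} r * ?G u r)"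
          by (simp only: expectation_face_weight[OF k True A])
      qed
      also have "\<dots> = (\<integral>\<^sup>+z. indicator B z * (\<integral>\<^sup>+r. indicator {0<..} r * ?G u r \<partial>lborel) \<partial>lborel)"
        by (intro nn_integral_cong) (simp add: indicator_def)
      also have "\<dots> = emeasure lborel B * (\<integral>\<^sup>+r. indicator {0<..} r * ?G u r \<partial>lborel)"
        using B(1) by (subst nn_integral_multc) auto
      also have "\<dots> = (\<integral>\<^sup>+r\<in>{0<..}. ?G u r \<partial>lborel)"
        unfolding B(2) by (simp only: mult_1 mult.commute)
      finally have e: "(\<integral>\<^sup>+t. ?E (\<lambda>i\<in>?I. (u i, t i)) \<partial>PiM ?I (\<lambda>_. lborel)) =
        ennreal (D_fun k u) * (\<integral>\<^sup>+r\<in>{0<..}. ?G u r \<partial>lborel)" .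
      have i1: "indicator (P_set k) u = (1 :: ennreal)" using True by simp
      show ?thesis unfolding e i1 mult_1_right by (rule mult.commute)
    qed
  qed
  finally show ?thesis .
qed

end

section \<open>General position holds almost surely\<close>

lemma nn_integral_count_space_eq_0_D:
  assumes "(\<integral>\<^sup>+x. f x \<partial>count_space A) = 0" "x \<in> A"
  shows "f x = 0"
  using assms nn_integral_0_iff_AE[of f "count_space A"] by (simp add: AE_count_space)

text \<open>A family is independent if no member lies in the span of the others. Enumerating J with
  the chosen member last turns this into a condition on tuples, to which the Mecke formula
  applies.\<close>

lemma gen_posI:
  fixes S :: "'a::euclidean_space set set"
  assumes S: "S \<subseteq> hyperplanes"
    and span: "\<And>m q. m < DIM('a) \<Longrightarrow> q \<in> tuples (Suc m) S \<Longrightarrow> fst (q (Suc m)) \<notin> span ((\<lambda>i. fst (q i)) ` {1..m})"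
  shows "gen_pos S"
  unfolding gen_pos_def
proof (intro allI impI)
  fix J assume J: "J \<subseteq> S" "finite J" "card J \<le> DIM('a)"
  show "indep_fam J nrm"
    unfolding indep_fam_iff_span[OF J(2)]
  proof
    fix j assume j: "j \<in> J"
    define m where "m = card (J - {j})"
    have m: "m < DIM('a)" using J j card_Diff1_less[OF J(2) j] unfolding m_def by simp
    obtain e where e: "bij_betw e {1..m} (J - {j})"
      using ex_bij_betw_nat_finite_1[of "J - {j}"] J(2) unfolding m_def by auto
    define g where "g i = (if i = Suc m then j else e i)" for i
    have gS: "g i \<in> S" if "i \<in> {1..Suc m}" for i
    proof (cases "i = Suc m")
      case True
      then show ?thesis using j J(1) by (auto simp: g_def)
    next
      case False
      then have "e i \<in> J - {j}" using that by (intro bij_betwE[OF e, rule_format]) auto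
      then show ?thesis using False J(1) by (auto simp: g_def)
    qed
    have gh: "g i \<in> hyperplanes" if "i \<in> {1..Suc m}" for i using gS[OF that] S by blast
    define q where "q = (\<lambda>i\<in>{1..Suc m}. sec (g i))"
    have hyp_q: "hyp (q i) = g i" if "i \<in> {1..Suc m}" for i
      using that sec(2)[OF gh[OF that]] by (simp add: q_def)
    have inj: "inj_on g {1..Suc m}"
    proof (rule inj_onI)
      fix a b assume ab: "a \<in> {1..Suc m}" "b \<in> {1..Suc m}" "g a = g b"
      have ne: "e i \<noteq> j" if "i \<in> {1..m}" for i using bij_betwE[OF e] that by blast
      show "a = b"
      proof (cases "a = Suc m \<or> b = Suc m")
        case True
        then show ?thesis using ab ne[of a] ne[of b] by (auto simp: g_def split: if_splits)
      next
        case False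
        then have "e a = e b" "a \<in> {1..m}" "b \<in> {1..m}" using ab by (auto simp: g_def)
        then show ?thesis using bij_betw_imp_inj_on[OF e] by (simp only: inj_on_eq_iff)
      qed
    qed
    have "q \<in> tuples (Suc m) S"
      unfolding tuples_def
    proof (intro CollectI conjI PiE_I)
      fix i assume i: "i \<in> {1..Suc m}"
      have "q i = sec (g i)" using i by (simp add: q_def)
      then show "q i \<in> reps S"
        using sec[OF gh[OF i]] gS[OF i] unfolding reps_def by simp
    next
      show "inj_on (\<lambda>i. hyp (q i)) {1..Suc m}"
      by (smt (verit) inj_onI hyp_q inj_onD inj)
    qed (auto simp: q_def)
    from span[OF m this] have "fst (q (Suc m)) \<notin> span ((\<lambda>i. fst (q i)) ` {1..m})" .
    moreover have "fst (q (Suc m)) = nrm j" by (simp add: q_def g_def nrm_def)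
    moreover have "(\<lambda>i. fst (q i)) ` {1..m} = nrm ` (J - {j})"
      unfolding bij_betw_imp_surj_on[OF e, symmetric] image_image
      by (intro image_cong refl) (simp add: q_def g_def nrm_def)
    ultimately show "nrm j \<notin> span (nrm ` (J - {j}))" by simp
  qed
qed

definition touching :: "'a::euclidean_space set \<Rightarrow> 'a \<Rightarrow> real \<Rightarrow> 'a set set" where
  "touching L z r = {H \<in> hyperplanes. \<bar>lev H z\<bar> = r * norm (orth_proj L (nrm H))}"

context hyperplane_process
begin

text \<open>By the Mecke formula the sum of F over all tuples has expectation zero, so almost surely
  each of its nonnegative terms vanishes. Null statements for fixed tuples and an unconditioned
  process thus carry over to tuples of the process itself.\<close>

lemma AE_tuplesI:
  fixes F :: "(nat \<Rightarrow> 'a \<times> real) \<times> 'a set set \<Rightarrow> ennreal"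
  assumes F: "F \<in> borel_measurable (PiM {1..n} (\<lambda>_. borel) \<Otimes>\<^sub>M config_space)"
    and 0: "(\<integral>\<^sup>+q. \<integral>\<^sup>+\<omega>. F (q, X \<omega>) \<partial>M \<partial>PiM {1..n} (\<lambda>_. \<Psi>)) = 0"
  shows "AE \<omega> in M. \<forall>q\<in>tuples n (X \<omega>). F (q, X \<omega> - hyps n q) = 0"
proof -
  have "(\<integral>\<^sup>+\<omega>. \<integral>\<^sup>+q. F (q, X \<omega> - hyps n q) \<partial>count_space (tuples n (X \<omega>)) \<partial>M) = 0"
    unfolding mecke_tuples[OF F] 0 by simp
  then have "AE \<omega> in M. (\<integral>\<^sup>+q. F (q, X \<omega> - hyps n q) \<partial>count_space (tuples n (X \<omega>))) = 0"
    using measurable_compose[OF measurable_X measurable_sum_tuples[OF F]] by (subst (asm) nn_integral_0_iff_AE)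
  then show ?thesis by eventually_elim (blast dest: nn_integral_count_space_eq_0_D)
qed

text \<open>Fewer than d vectors are orthogonal to a common nonzero vector, so the unit vectors in
  their span lie in a great subsphere, which is a null set of \<phi>.\<close>

lemma AE_not_in_span:
  assumes sf: "subspace_free \<phi>" and fin: "finite V" and card: "card V < DIM('a)"
  shows "AE v in \<phi>. v \<notin> span V"
proof -
  have "dim V < DIM('a)" using dim_le_card'[OF fin] card by linarith
  then obtain a where a: "a \<noteq> 0" "\<And>y. y \<in> span V \<Longrightarrow> real_inner_class.orthogonal a y"
    using orthogonal_to_subspace_exists by blast
  let ?G = "sphere 0 1 \<inter> {x. inner a x = 0}"
  have "?G \<in> great_subspheres"
    unfolding great_subspheres_def
    by (intro CollectI exI[of _ "{x. inner a x = 0}"] conjI refl subspace_hyperplane dim_hyperplane a(1))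
  then have "emeasure \<phi> ?G = 0" using sf unfolding subspace_free_def by blast
  moreover have "?G \<in> sets \<phi>"
  by (simp add: sets_phi sets_restrict_space)
  ultimately have "?G \<in> null_sets \<phi>" by (intro null_setsI)
  then show ?thesis
  proof (rule AE_I', intro subsetI)
    fix v assume "v \<in> {v \<in> space \<phi>. \<not> v \<notin> span V}"
    then have "norm v = 1" "v \<in> span V" by (simp_all add: space_phi)
    then show "v \<in> ?G" using a(2)[of v] by (simp add: real_inner_class.orthogonal_def)
  qed
qed

text \<open>For m < d and any first m normals, the next normal almost surely avoids their span.
  \<open>AE_tuplesI\<close> turns this into a statement about all distinct hyperplanes of the
  process, and only finitely many m have to be combined.\<close>

lemma AE_gen_pos:
  assumes sf: "subspace_free \<phi>"
  shows "AE \<omega> in M. gen_pos (X \<omega>)"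
proof -
  have "AE \<omega> in M. \<forall>q\<in>tuples (Suc m) (X \<omega>). fst (q (Suc m)) \<notin> span ((\<lambda>i. fst (q i)) ` {1..m})" if m: "m < DIM('a)" for m
  proof -
    let ?N = "PiM {1..Suc m} (\<lambda>_. borel) :: (nat \<Rightarrow> 'a \<times> real) measure"
    define E where "E = {q \<in> space ?N. fst (q (Suc m)) \<in> span ((\<lambda>i. fst (q i)) ` {1..m})}"
    have comp: "(\<lambda>q. fst (q i)) \<in> borel_measurable ?N" if "i \<in> {1..Suc m}" for i
      by (rule measurable_compose[OF measurable_component_singleton[OF that] measurable_fst_borel])
    have E: "E \<in> sets ?N"
    proof -
      have [measurable]: "(\<lambda>q. norm (orth_proj (orth_fam {1..m} (\<lambda>i. fst (q i))) (fst (q (Suc m))))) \<in> borel_measurable ?N"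
        by (rule measurable_norm_orth_proj) (auto intro!: comp)
      have "E = {q \<in> space ?N. norm (orth_proj (orth_fam {1..m} (\<lambda>i. fst (q i))) (fst (q (Suc m)))) = 0}"
        unfolding E_def norm_eq_zero orth_proj_orth_fam_eq_0_iff by (rule refl)
      also have "\<dots> \<in> sets ?N" by measurable
      finally show ?thesis .
    qed
    let ?F = "\<lambda>x. indicator E (fst x) :: ennreal"
    have F: "?F \<in> borel_measurable (?N \<Otimes>\<^sub>M config_space)"
      by (rule measurable_compose[OF measurable_fst borel_measurable_indicator[OF E]])
    interpret \<Psi>: sigma_finite_measure \<Psi> by (rule sigma_finite_Psi)
    interpret product_sigma_finite "\<lambda>_::nat. \<Psi>" ..
    have ins: "{1..Suc m} = insert (Suc m) {1..m}" by auto
    have "(\<integral>\<^sup>+q. \<integral>\<^sup>+\<omega>. ?F (q, X \<omega>) \<partial>M \<partial>PiM {1..Suc m} (\<lambda>_. \<Psi>)) = (\<integral>\<^sup>+q. indicator E q \<partial>PiM {1..Suc m} (\<lambda>_. \<Psi>))"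
      by (simp add: emeasure_space_1)
    also have "\<dots> = (\<integral>\<^sup>+q. \<integral>\<^sup>+p. indicator E (q(Suc m := p)) \<partial>\<Psi> \<partial>PiM {1..m} (\<lambda>_. \<Psi>))"
      unfolding ins using measurable_compose[OF measurable_id_PiM_Psi borel_measurable_indicator[OF E], unfolded ins]
      by (intro product_nn_integral_insert) auto
    also have "\<dots> = (\<integral>\<^sup>+q. 0 \<partial>PiM {1..m} (\<lambda>_. \<Psi>))"
    proof (rule nn_integral_cong)
      fix q :: "nat \<Rightarrow> 'a \<times> real"
      let ?V = "(\<lambda>i. fst (q i)) ` {1..m}"
      have "(\<integral>\<^sup>+p. indicator E (q(Suc m := p)) \<partial>\<Psi>) \<le> (\<integral>\<^sup>+p. indicator (span ?V) (fst p) \<partial>\<Psi>)"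
      proof (intro nn_integral_mono)
        fix p
        have "(\<lambda>i. fst ((q(Suc m := p)) i)) ` {1..m} = ?V" by (intro image_cong refl) simp
        then show "indicator E (q(Suc m := p)) \<le> (indicator (span ?V) (fst p) :: ennreal)"
          by (simp add: E_def indicator_def)
      qed
      also have "\<dots> = (\<integral>\<^sup>+v. (\<integral>\<^sup>+t. indicator (span ?V) v \<partial>(lborel :: real measure)) \<partial>\<phi>)"
      proof (subst nn_integral_Psi)
        have "span ?V \<in> sets borel" by (intro borel_closed closed_span)
        then show "(\<lambda>p::'a \<times> real. indicator (span ?V) (fst p) :: ennreal) \<in> borel_measurable borel"
          by (intro measurable_compose[OF measurable_fst_borel borel_measurable_indicator])
      qed simp
      also have "\<dots> = (\<integral>\<^sup>+v. 0 \<partial>\<phi>)"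
      proof (rule nn_integral_cong_AE)
        have "card ?V < DIM('a)" using card_image_le[of "{1..m}" "\<lambda>i. fst (q i)"] m by simp
        then have "AE v in \<phi>. v \<notin> span ?V" by (intro AE_not_in_span[OF sf]) simp_all
        then show "AE v in \<phi>. (\<integral>\<^sup>+t. indicator (span ?V) v \<partial>(lborel :: real measure)) = (0::ennreal)"
          by eventually_elim simp
      qed
      finally show "(\<integral>\<^sup>+p. indicator E (q(Suc m := p)) \<partial>\<Psi>) = 0" by simp
    qed
    finally have "(\<integral>\<^sup>+q. \<integral>\<^sup>+\<omega>. ?F (q, X \<omega>) \<partial>M \<partial>PiM {1..Suc m} (\<lambda>_. \<Psi>)) = 0" by simp
    from AE_tuplesI[OF F this]
    have "AE \<omega> in M. \<forall>q\<in>tuples (Suc m) (X \<omega>). indicator E q = (0::ennreal)" by simp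
    then show ?thesis
    proof eventually_elim
      case (elim \<omega>)
      show ?case
      proof
        fix q assume q: "q \<in> tuples (Suc m) (X \<omega>)"
        then have "q \<in> space ?N" by (auto simp: tuples_def space_PiM PiE_def)
        moreover have "q \<notin> E" using elim q by (metis indicator_eq_0_iff)
        ultimately show "fst (q (Suc m)) \<notin> span ((\<lambda>i. fst (q i)) ` {1..m})" by (simp add: E_def)
      qed
    qed
  qed
  then have "AE \<omega> in M. \<forall>m\<in>{..<DIM('a)}. \<forall>q\<in>tuples (Suc m) (X \<omega>). fst (q (Suc m)) \<notin> span ((\<lambda>i. fst (q i)) ` {1..m})"
    by (intro AE_finite_allI) auto
  then show ?thesis
    using AE_space
  proof eventually_elim
    case (elim \<omega>)
    then show ?case
      by (intro gen_posI hyperplane_configs_subset config_space_spaceD[OF measurable_X]) auto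
  qed
qed

text \<open>For each normal there are at most two levels at which a hyperplane touches a given ball,
  and two points are a Lebesgue null set.\<close>

lemma touching_null:
  assumes L: "subspace L"
  shows "touching L z r \<in> sets hyperplane_borel" "emeasure \<Theta> (touching L z r) = 0"
proof -
  have "orth_proj L \<in> borel_measurable borel"
    by (intro borel_measurable_continuous_onI continuous_orth_proj L)
  note [measurable] = measurable_compose[OF measurable_compose[OF measurable_sec measurable_fst_borel] this]
    measurable_compose[OF measurable_sec measurable_snd_borel] measurable_compose[OF measurable_sec measurable_fst_borel]
  have "{H \<in> space hyperplane_borel. \<bar>inner z (fst (sec H)) - snd (sec H)\<bar> = r * norm (orth_proj L (fst (sec H)))} \<in> sets hyperplane_borel"
    by measurable
  then show W: "touching L z r \<in> sets hyperplane_borel"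
    unfolding touching_def lev_def nrm_def space_hyperplane_borel .
  have "emeasure \<Theta> (touching L z r) = (\<integral>\<^sup>+H. indicator (touching L z r) H \<partial>\<Theta>)" using W by simp
  also have "\<dots> = ennreal \<gamma> * (\<integral>\<^sup>+u. (\<integral>\<^sup>+t. indicator (touching L z r) (hyperplane u t) \<partial>lborel) \<partial>\<phi>)"
    using W by (intro nn_integral_intensity) simp
  also have "(\<integral>\<^sup>+u. (\<integral>\<^sup>+t. indicator (touching L z r) (hyperplane u t) \<partial>lborel) \<partial>\<phi>) = (\<integral>\<^sup>+u. 0 \<partial>\<phi>)"
  proof (rule nn_integral_cong)
    fix u assume "u \<in> space \<phi>"
    then have u: "norm u = 1" by (simp add: space_phi)
    let ?c = "r * norm (orth_proj L u)"
    have sub: "t \<in> {inner u z - ?c, inner u z + ?c}" if "hyperplane u t \<in> touching L z r" for t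
    proof -
      obtain s where s: "s = 1 \<or> s = - 1" "\<And>y. inner u y - t = s * lev (hyp (u, t)) y" "u = s *\<^sub>R nrm (hyp (u, t))"
        using rep_lev[of "(u, t)"] u by auto
      have H: "hyp (u, t) = hyperplane u t" using u by (simp add: hyp_def)
      have "norm (orth_proj L u) = norm (orth_proj L (nrm (hyp (u, t))))"
        by (subst s(3)) (use s(1) in \<open>auto simp: orth_proj_scaleR[OF L]\<close>)
      moreover have "\<bar>inner u z - t\<bar> = \<bar>lev (hyp (u, t)) z\<bar>" unfolding s(2) using s(1) by auto
      ultimately have "\<bar>inner u z - t\<bar> = ?c" using that unfolding touching_def H by simp
      then show ?thesis by auto
    qed
    have "(\<integral>\<^sup>+t. indicator (touching L z r) (hyperplane u t) \<partial>lborel) \<le> (\<integral>\<^sup>+t. indicator {inner u z - ?c, inner u z + ?c} t \<partial>lborel)"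
      using sub by (intro nn_integral_mono) (simp add: indicator_def)
    also have "\<dots> = emeasure lborel {inner u z - ?c, inner u z + ?c}" by (rule nn_integral_indicator) simp
    also have "\<dots> = 0" by (intro emeasure_lborel_countable) simp
    finally show "(\<integral>\<^sup>+t. indicator (touching L z r) (hyperplane u t) \<partial>lborel) = 0" by simp
  qed
  finally show "emeasure \<Theta> (touching L z r) = 0" by simp
qed

text \<open>After the Mecke formula the tuple is deterministic and the rest of the configuration is
  again the full process. The expected number of hyperplanes touching the ball of the tuple is then
  zero by \<open>touching_null\<close>.\<close>

lemma AE_no_touching:
  assumes k: "k \<in> {1..DIM('a)}"
  shows "AE \<omega> in M. \<forall>q\<in>tuples (DIM('a) + 1) (X \<omega>).
    (X \<omega> - hyps (DIM('a) + 1) q) \<inter> touching (L_space k (normals q)) (tuple_center k q) (tuple_radius k q) = {}"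
proof -
  let ?N = "PiM {1..DIM('a) + 1} (\<lambda>_. borel) \<Otimes>\<^sub>M config_space :: ((nat \<Rightarrow> 'a \<times> real) \<times> 'a set set) measure"
  let ?W = "\<lambda>q. touching (L_space k (normals q)) (tuple_center k q) (tuple_radius k q)"
  let ?F = "\<lambda>x. num_in (snd x) (?W (fst x))"
  have p: "(\<lambda>x. fst x i) \<in> borel_measurable ?N" if "i \<in> {1..DIM('a) + 1}" for i
    by (rule measurable_compose[OF measurable_fst measurable_component_singleton[OF that]])
  note c = measurable_tuple_center[OF p, where k=k] and rad = measurable_tuple_radius[OF p, where k=k]
  have F: "?F \<in> borel_measurable ?N"
  proof -
    let ?T = "{x \<in> space (?N \<Otimes>\<^sub>M hyperplane_borel). \<bar>lev (snd x) (tuple_center k (fst (fst x)))\<bar> =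
        tuple_radius k (fst (fst x)) * norm (orth_proj (L_space k (normals (fst (fst x)))) (nrm (snd x)))}"
    note [measurable] = measurable_norm_orth_proj_nrm[OF k measurable_normals[OF p] rad measurable_snd, unfolded split_beta']
      measurable_lev[OF k measurable_normals[OF p] rad measurable_snd c, unfolded split_beta'] measurable_compose[OF measurable_fst rad]
    have T: "?T \<in> sets (?N \<Otimes>\<^sub>M hyperplane_borel)" by measurable
    have "num_in (snd x) {H. (x, H) \<in> ?T} = ?F x" if x: "x \<in> space ?N" for x
      using x by (simp add: touching_def space_pair_measure space_hyperplane_borel)
    then show ?thesis
      using measurable_num_in_section[OF measurable_snd T] by (rule measurable_cong[THEN iffD1])
  qed
  have "(\<integral>\<^sup>+\<omega>. ?F (q, X \<omega>) \<partial>M) = 0" for q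
    using nn_integral_num_in[OF touching_null(1)[OF subspace_L_space]] touching_null(2)[OF subspace_L_space] by simp
  then have "(\<integral>\<^sup>+q. \<integral>\<^sup>+\<omega>. ?F (q, X \<omega>) \<partial>M \<partial>PiM {1..DIM('a) + 1} (\<lambda>_. \<Psi>)) = 0" by simp
  from AE_tuplesI[OF F this] show ?thesis unfolding fst_conv snd_conv num_in_eq_0_iff .
qed

end

section \<open>Summing over faces and over tuples\<close>

lemma good_tuple_iff:
  fixes S :: "'a::euclidean_space set set"
  assumes k: "k \<in> {1..DIM('a)}" and S: "S \<in> hyperplane_configs"
  shows "good_tuple k S p z r \<longleftrightarrow> p \<in> tuples (DIM('a) + 1) S \<and> normals p \<in> P_set k \<and> 0 < r \<and>
     tuple_ball k (normals p) (\<lambda>i. snd (p i)) z r \<and>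
     shift (- z) (S - hyps (DIM('a) + 1) p) \<inter> hitting (rel_open_ball (L_space k (normals p)) r) = {}"
proof -
  have "(\<forall>H\<in>S - hyps (DIM('a) + 1) p. \<forall>w\<in>L_space k (normals p). norm w < r \<longrightarrow> z + w \<notin> H) \<longleftrightarrow>
     shift (- z) (S - hyps (DIM('a) + 1) p) \<inter> hitting (rel_open_ball (L_space k (normals p)) r) = {}" if r: "0 < r"
  proof -
    have Hh: "(+) (- z) ` H \<in> hyperplanes" if "H \<in> S - hyps (DIM('a) + 1) p" for H
      using that hyperplane_configs_subset[OF S] by (intro shift_hyperplane) blast
    have "(+) (- z) ` H \<notin> hitting (rel_open_ball (L_space k (normals p)) r) \<longleftrightarrow>
        (\<forall>w\<in>L_space k (normals p). norm w < r \<longrightarrow> z + w \<notin> H)" if "H \<in> S - hyps (DIM('a) + 1) p" for H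
    proof -
      have "(+) (- z) ` H \<in> hitting (rel_open_ball (L_space k (normals p)) r) \<longleftrightarrow>
          (\<exists>w. w \<in> (+) (- z) ` H \<and> w \<in> L_space k (normals p) \<and> norm w < r)"
        unfolding hitting_def rel_open_ball_eq[OF subspace_L_space r] using Hh[OF that] by blast
      also have "\<dots> \<longleftrightarrow> (\<exists>w. z + w \<in> H \<and> w \<in> L_space k (normals p) \<and> norm w < r)"
        unfolding in_shift_iff by (simp only: diff_minus_eq_add add.commute)
      finally show ?thesis by blast
    qed
    then show ?thesis unfolding shift_def by blast
  qed
  then show ?thesis unfolding good_tuple_def by blast
qed

text \<open>As no other hyperplane meets the open ball of a good tuple, none is discarded in
  \<open>face_body\<close>, and its inequalities are those of
  \<open>translate_cellat\<close>.\<close>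

lemma (in good_tuple_face) face_body_eq: "face_body k u r (shift (- z) (S - hyps (DIM('a) + 1) p)) = (\<lambda>x. x - z) ` cellat S z"
proof -
  let ?S' = "shift (- z) (S - hyps (DIM('a) + 1) p)"
  have S': "?S' \<subseteq> hyperplanes"
    unfolding shift_def by (intro image_subsetI shift_hyperplane) (use Sh in blast)
  have nh: "?S' - hitting (rel_open_ball L r) = ?S'"
    using good good_tuple_iff[OF k S, of p z r] by blast
  have "w \<in> face_body k u r ?S' \<longleftrightarrow> w \<in> (\<lambda>x. x - z) ` cellat S z" for w
  proof -
    have "(\<forall>H\<in>?S'. 0 \<le> lev H 0 * lev H w) \<longleftrightarrow> (\<forall>H\<in>S - hyps (DIM('a) + 1) p. 0 \<le> lev H z * lev H (z + w))"
      unfolding shift_def Set.ball_simps(9)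
    proof (rule ball_cong[OF refl])
      fix H assume "H \<in> S - hyps (DIM('a) + 1) p"
      then have H: "H \<in> hyperplanes" using Sh by blast
      show "0 \<le> lev ((+) (- z) ` H) 0 * lev ((+) (- z) ` H) w \<longleftrightarrow> 0 \<le> lev H z * lev H (z + w)"
        unfolding lev_shift[OF H] by (simp add: add.commute)
    qed
    then show ?thesis
      unfolding in_face_body_iff[OF k uP r S'] nh translate_cellat by blast
  qed
  then show ?thesis by (rule Set.set_eqI)
qed

text \<open>Grouping the sum by the value of c gives each K the weight of its fibre. The fibre size
  is prescribed only where g is nonzero, which leaves out faces of zero weight, in particular
  unbounded ones.\<close>

lemma nn_integral_count_space_fibres:
  fixes g :: "'c \<Rightarrow> ennreal"
  assumes c: "\<And>q. q \<in> G \<Longrightarrow> c q \<in> F"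
    and fib: "\<And>K. K \<in> F \<Longrightarrow> g K \<noteq> 0 \<Longrightarrow> card {q \<in> G. c q = K} = n" and n: "n \<noteq> 0"
  shows "(\<integral>\<^sup>+q. g (c q) \<partial>count_space G) = of_nat n * (\<integral>\<^sup>+K. g K \<partial>count_space F)"
proof -
  let ?\<Sigma> = "SIGMA K:F. {q \<in> G. c q = K}"
  have bij: "bij_betw (\<lambda>q. (c q, q)) G ?\<Sigma>"
    by (rule bij_betwI[of _ _ _ snd]) (use c in auto)
  have "(\<integral>\<^sup>+q. g (c q) \<partial>count_space G) = (\<integral>\<^sup>+z. g (fst z) \<partial>count_space ?\<Sigma>)"
    using nn_integral_bij_count_space[OF bij, of "\<lambda>z. g (fst z)"] by simp
  also have "\<dots> = (\<integral>\<^sup>+K. \<integral>\<^sup>+q. g K \<partial>count_space {q \<in> G. c q = K} \<partial>count_space F)"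
    by (simp add: nn_integral_count_space_Sigma)
  also have "\<dots> = (\<integral>\<^sup>+K. of_nat n * g K \<partial>count_space F)"
  proof (rule nn_integral_cong)
    fix K assume "K \<in> space (count_space F)"
    then have K: "K \<in> F" by simp
    show "(\<integral>\<^sup>+q. g K \<partial>count_space {q \<in> G. c q = K}) = of_nat n * g K"
    proof (cases "g K = 0")
      case False
      then have cd: "card {q \<in> G. c q = K} = n" by (rule fib[OF K])
      then have "finite {q \<in> G. c q = K}" using n by (intro card_ge_0_finite) simp
      then show ?thesis using cd by (simp add: emeasure_count_space mult.commute)
    qed simp
  qed
  also have "\<dots> = of_nat n * (\<integral>\<^sup>+K. g K \<partial>count_space F)" by (rule nn_integral_cmult) simp
  finally show ?thesis .
qed

definition face_mark :: "'a::euclidean_space set set \<Rightarrow> 'a set \<Rightarrow> 'a set \<Rightarrow> ennreal" where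
  "face_mark A B K = indicator A ((\<lambda>x. x - incenter K) ` K) * indicator B (incenter K)"

text \<open>The weight of a tuple is the mark of its face if the tuple is good and zero otherwise. A
  face with nonzero mark is bounded, hence has a good tuple, and \<open>card_tuples_of_face\<close>
  gives the common number of its tuples.\<close>

lemma sum_face_weight:
  fixes S :: "'a::euclidean_space set set"
  assumes k: "k \<in> {1..DIM('a)}" and S: "S \<in> hyperplane_configs" and gp: "gen_pos S" and A: "A \<subseteq> convex_bodies"
    and no_touch: "\<And>q. q \<in> tuples (DIM('a) + 1) S \<Longrightarrow>
      (S - hyps (DIM('a) + 1) q) \<inter> touching (L_space k (normals q)) (tuple_center k q) (tuple_radius k q) = {}"
  shows "(\<integral>\<^sup>+q. face_weight k A B (q, S - hyps (DIM('a) + 1) q) \<partial>count_space (tuples (DIM('a) + 1) S)) =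
    of_nat (fact (k + 1) * (2 ^ (DIM('a) - k) * fact (DIM('a) - k))) * (\<integral>\<^sup>+K. face_mark A B K \<partial>count_space (faces k S))"
proof -
  let ?T = "tuples (DIM('a) + 1) S"
  define G where "G = {q. good_tuple k S q (tuple_center k q) (tuple_radius k q)}"
  let ?c = "\<lambda>q. cellat S (tuple_center k q)"
  have cr: "tuple_center k q = z" "tuple_radius k q = r" if "good_tuple k S q z r" for q z r
    using that tuple_center_radius_eq[OF k, of q z r] unfolding good_tuple_def by blast+
  have weight: "face_weight k A B (q, S - hyps (DIM('a) + 1) q) = (if q \<in> G then face_mark A B (?c q) else 0)" if q: "q \<in> ?T" for q
  proof (cases "q \<in> G")
    case True
    then have g: "good_tuple k S q (tuple_center k q) (tuple_radius k q)" by (simp add: G_def)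
    interpret good_tuple_face k S q "tuple_center k q" "tuple_radius k q"
      by standard (rule k S g)+
    define S1 where "S1 = S - hyps (DIM('a) + 1) q"
    show ?thesis
      using True g face_body_eq unfolding good_tuple_iff[OF k S] face_mark_def incenter_cellat S1_def[symmetric]
      by (simp add: face_weight_def mult.commute)
  next
    case False
    then have "\<not> good_tuple k S q (tuple_center k q) (tuple_radius k q)" by (simp add: G_def)
    then show ?thesis
      using False q unfolding good_tuple_iff[OF k S] by (auto simp: face_weight_def indicator_def)
  qed
  have GT: "G \<subseteq> ?T" unfolding G_def good_tuple_def by blast
  have "(\<integral>\<^sup>+q. face_weight k A B (q, S - hyps (DIM('a) + 1) q) \<partial>count_space ?T) = (\<integral>\<^sup>+q. (if q \<in> G then face_mark A B (?c q) else 0) \<partial>count_space ?T)"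
    by (intro nn_integral_cong) (simp only: space_count_space weight)
  also have "\<dots> = (\<integral>\<^sup>+q. (if q \<in> G then face_mark A B (?c q) else 0) \<partial>count_space G)"
    using GT by (intro nn_integral_count_space_eq) auto
  also have "\<dots> = (\<integral>\<^sup>+q. face_mark A B (?c q) \<partial>count_space G)"
    by (intro nn_integral_cong) simp
  also have "\<dots> = of_nat (fact (k + 1) * (2 ^ (DIM('a) - k) * fact (DIM('a) - k))) * (\<integral>\<^sup>+K. face_mark A B K \<partial>count_space (faces k S))"
  proof (rule nn_integral_count_space_fibres)
    fix q assume "q \<in> G"
    then interpret good_tuple_face k S q "tuple_center k q" "tuple_radius k q"
      by unfold_locales (use k S in \<open>simp_all add: G_def\<close>)
    show "?c q \<in> faces k S" by (rule cellat_in_faces)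
  next
    fix K assume K: "K \<in> faces k S" and nz: "face_mark A B K \<noteq> 0"
    obtain x where x: "K = cellat S x" "aff_dim (flat_at S x) = int k"
      using K unfolding faces_eq[OF S] by blast
    \<comment> \<open>A nonzero mark puts a translate of K into A and hence among the convex bodies.
      This gives boundedness before anything is known about the incenter.\<close>
    have "(\<lambda>x. x - incenter K) ` K \<in> convex_bodies"
      using nz A unfolding face_mark_def by (auto simp: indicator_def split: if_splits)
    then have "bounded ((\<lambda>x. x - incenter K) ` K)" by (auto simp: convex_bodies_def compact_imp_bounded)
    from bounded_translation_minus[OF this, of "- incenter K"]
    have bnd: "bounded K" by (simp add: image_image)
    have "bounded_face k S x"
      by standard (use k S gp x bnd in simp_all)
    then obtain p z r where g: "good_tuple k S p z r" and pz: "cellat S z = cellat S x"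
      using bounded_face.exists_good_tuple by blast
    note pcr = cr[OF g]
    have pT: "p \<in> ?T" using g unfolding good_tuple_def by blast
    interpret good_tuple_face_gp k S p z r
    proof
      show "k \<in> {1..DIM('a)}" "S \<in> hyperplane_configs" "good_tuple k S p z r" "gen_pos S" by (rule k S g gp)+
      fix H assume H: "H \<in> S - hyps (DIM('a) + 1) p"
      have "H \<notin> touching (L_space k (normals p)) z r" using no_touch[OF pT] H unfolding pcr by blast
      moreover have "H \<in> hyperplanes" using H hyperplane_configs_subset[OF S] by blast
      ultimately show "\<bar>lev H z\<bar> \<noteq> r * norm (orth_proj (L_space k (normals p)) (nrm H))"
        unfolding touching_def by blast
    qed
    have "{q \<in> G. ?c q = K} = {p'. \<exists>z' r'. good_tuple k S p' z' r' \<and> cellat S z' = cellat S z}"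
      unfolding G_def x(1) pz using cr by blast
    then show "card {q \<in> G. ?c q = K} = fact (k + 1) * (2 ^ (DIM('a) - k) * fact (DIM('a) - k))"
      by (simp only: card_tuples_of_face)
  qed simp
  finally show ?thesis .
qed

theorem theorem1:
  fixes M :: "'w measure" and X :: "'w \<Rightarrow> 'a::euclidean_space set set"
    and \<phi> :: "'a measure" and Q :: "'a set measure"
    and \<gamma> \<gamma>k :: real and k :: nat and A :: "'a set set"
  assumes "DIM('a) \<ge> 2"
    and "prob_space M"
    and "poisson_hyperplane_process M X"
    and "stationary_process M X"
    and "has_intensity_and_directional_distribution M X \<gamma> \<phi>"
    and "non_degenerate \<phi>"
    and "subspace_free \<phi>"
    and "k \<in> {1..DIM('a)}"
    and "is_typical_face_distribution M X k \<gamma>k Q"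
    and "A \<in> sets body_borel"
  shows "emeasure Q A =
    ennreal (2 ^ (k + 1) / (fact (k + 1) * fact (DIM('a) - k)) * (\<gamma> ^ (DIM('a) + 1) / \<gamma>k)) *
    (\<integral>\<^sup>+u\<in>P_set k.
       (\<integral>\<^sup>+r\<in>{0<..}.
          ennreal (exp (- 2 * \<gamma> * r * hitting_functional \<phi> (cball 0 1 \<inter> L_space k u)) *
            \<P>(\<omega> in M. (\<Inter>H \<in> X \<omega> - hitting (rel_open_ball (L_space k u) r). halfspace_at H 0)
                      \<inter> (*\<^sub>R) r ` T_simplex k u \<in> A))
        \<partial>lborel) * ennreal (D_fun k u)
     \<partial>PiM {1..DIM('a) + 1} (\<lambda>_. \<phi>))"
proof -
  note k = assms(8) and A = assms(10)
  interpret hyperplane_process M X \<gamma> \<phi>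
    using assms(2-5) by (simp add: hyperplane_process_def hyperplane_process_axioms_def)
  let ?d = "DIM('a)"
  let ?B = "cbox 0 One :: 'a set"
  let ?C = "fact (k + 1) * (2 ^ (?d - k) * fact (?d - k)) :: nat"
  define J where "J = (\<integral>\<^sup>+u\<in>P_set k. (\<integral>\<^sup>+r\<in>{0<..}. ennreal (exp (- 2 * \<gamma> * r * hitting_functional \<phi> (cball 0 1 \<inter> L_space k u)) *
        \<P>(\<omega> in M. face_body k u r (X \<omega>) \<in> A)) \<partial>lborel) * ennreal (D_fun k u) \<partial>PiM {1..?d + 1} (\<lambda>_. \<phi>))"
  let ?W = "\<lambda>\<omega>. \<integral>\<^sup>+q. face_weight k A ?B (q, X \<omega> - hyps (?d + 1) q) \<partial>count_space (tuples (?d + 1) (X \<omega>))"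
  have B: "?B \<in> sets borel" "emeasure lborel ?B = 1"
    by (simp_all add: emeasure_lborel_cbox_eq)
  have F: "face_weight k A ?B \<in> borel_measurable (PiM {1..?d + 1} (\<lambda>_. borel) \<Otimes>\<^sub>M config_space)"
    by (rule measurable_face_weight[OF k A B(1)])
  have mW: "?W \<in> borel_measurable M"
    by (rule measurable_compose[OF measurable_X measurable_sum_tuples[OF F]])
  have intW: "(\<integral>\<^sup>+\<omega>. ?W \<omega> \<partial>M) = ennreal ((2 * \<gamma>) ^ (?d + 1)) * J"
    unfolding mecke_tuples[OF F] integral_face_weight[OF k A B] J_def by (rule refl)
  have Asub: "A \<subseteq> convex_bodies" using sets.sets_into_space[OF A] by (simp add: space_body_borel)
  define n where "n = ?C"
  have "0 < n" unfolding n_def by (intro mult_pos_pos fact_gt_zero zero_less_power) simp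
  have n: "ennreal (1 / real n) * of_nat n = 1"
  proof -
    have "ennreal (1 / real n) * ennreal (real n) = ennreal (1 / real n * real n)" by (rule ennreal_mult[symmetric]) simp_all
    also have "1 / real n * real n = 1" using \<open>0 < n\<close> by simp
    finally show ?thesis by (simp add: ennreal_of_nat_eq_real_of_nat)
  qed
  have "AE \<omega> in M. (\<integral>\<^sup>+K. face_mark A ?B K \<partial>count_space (faces k (X \<omega>))) = ennreal (1 / real n) * ?W \<omega>"
    using AE_gen_pos[OF assms(7)] AE_no_touching[OF k] AE_space
  proof eventually_elim
    case (elim \<omega>)
    have W: "?W \<omega> = of_nat n * (\<integral>\<^sup>+K. face_mark A ?B K \<partial>count_space (faces k (X \<omega>)))"
      unfolding n_def
      by (rule sum_face_weight[OF k config_space_spaceD[OF measurable_X elim(3)] elim(1) Asub]) (use elim(2) in blast)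
    show ?case unfolding W mult.assoc[symmetric] n by simp
  qed
  then have "(\<integral>\<^sup>+\<omega>. \<integral>\<^sup>+K. face_mark A ?B K \<partial>count_space (faces k (X \<omega>)) \<partial>M) = (\<integral>\<^sup>+\<omega>. ennreal (1 / real n) * ?W \<omega> \<partial>M)"
    by (rule nn_integral_cong_AE)
  also have "\<dots> = ennreal (1 / real n) * (ennreal ((2 * \<gamma>) ^ (?d + 1)) * J)"
    unfolding intW[symmetric] by (rule nn_integral_cmult[OF mW])
  finally have sum: "(\<integral>\<^sup>+\<omega>. \<integral>\<^sup>+K. face_mark A ?B K \<partial>count_space (faces k (X \<omega>)) \<partial>M) =
      ennreal (1 / real n) * (ennreal ((2 * \<gamma>) ^ (?d + 1)) * J)" .
  have \<gamma>k: "0 < \<gamma>k" using assms(9) by (simp add: is_typical_face_distribution_def)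
  have "ennreal \<gamma>k * emeasure Q A = (\<integral>\<^sup>+\<omega>. \<integral>\<^sup>+K. face_mark A ?B K \<partial>count_space (faces k (X \<omega>)) \<partial>M)"
    using assms(9) A B unfolding is_typical_face_distribution_def face_mark_def by simp
  then have e: "ennreal \<gamma>k * emeasure Q A = ennreal (1 / real n) * (ennreal ((2 * \<gamma>) ^ (?d + 1)) * J)"
    unfolding sum .
  have "emeasure Q A = ennreal (1 / \<gamma>k) * (ennreal \<gamma>k * emeasure Q A)"
    using \<gamma>k by (simp add: mult.assoc[symmetric] ennreal_mult[symmetric])
  also have "\<dots> = ennreal (1 / \<gamma>k * (1 / real n * (2 * \<gamma>) ^ (?d + 1))) * J"
  proof -
    have "0 \<le> (2 * \<gamma>) ^ (?d + 1)" using gamma_pos by simp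
    then have "ennreal (1 / \<gamma>k * (1 / real n * (2 * \<gamma>) ^ (?d + 1))) = ennreal (1 / \<gamma>k) * (ennreal (1 / real n) * ennreal ((2 * \<gamma>) ^ (?d + 1)))"
      using \<gamma>k by (subst ennreal_mult, simp, simp, subst ennreal_mult) simp_all
    then show ?thesis unfolding e by (simp only: mult.assoc)
  qed
  also have "1 / \<gamma>k * (1 / real n * (2 * \<gamma>) ^ (?d + 1)) =
      2 ^ (k + 1) / (fact (k + 1) * fact (?d - k)) * (\<gamma> ^ (?d + 1) / \<gamma>k)"
  proof -
    have "k + 1 + (?d - k) = ?d + 1" using k by simp
    \<comment> \<open>The signed representatives contribute 2^(d+1) and the number of tuples per
      face contains 2^(d-k); the quotient 2^(k+1) is the power in the formula.\<close>
    then have p: "(2::real) ^ (?d + 1) = 2 ^ (k + 1) * 2 ^ (?d - k)" by (metis power_add)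
    have c: "real n = fact (k + 1) * (2 ^ (?d - k) * fact (?d - k))"
      unfolding n_def by (simp only: of_nat_mult of_nat_fact of_nat_power of_nat_numeral)
    have alg: "1 / y * (1 / (a * (q * b)) * (p * q * g)) = p / (a * b) * (g / y)" if "q \<noteq> 0" for y a b p q g :: real
      using that by simp
    show ?thesis unfolding c power_mult_distrib p by (rule alg) simp
  qed
  finally show ?thesis unfolding J_def face_body_def .
qed

end
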